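(* Let $\nu>0$ and $\mu>0$. Then for all $n\ge 0$ and $x,y\in\mathbb{B}^d$, writing $x=\|x\|x'$ with $x'\in\mathbb{S}^{d-1}$, $$ P_n(W_{\kappa,\mu,\nu};x,y)=a_{\kappa,\mu,\nu}\int_{-1}^1\int_0^1\int_{-1}^1 V_\kappa\Big[Z_n^{\lambda_{\kappa,\mu,\nu}}\big(\zeta(\cdot;\|x\|,y,u,v,t)\big)\Big](x')\,(1-t^2)^{\mu-1}\,dt\;u^{\nu-1}(1-u)^{\gamma_\kappa+\frac{d-2}{2}}\,du\;(1-v^2)^{\nu-\frac12}\,dv, $$ where $a_{\kappa,\mu,\nu}$ is the constant such that the right-hand side equals $1$ when $n=0$, and, for $z\in\mathbb{R}^d$ and $0\le r\le 1$, $$ \zeta(z;r,y,u,v,t)=r\,\|y\|\,uv+r\,\langle z,y\rangle(1-u)+\sqrt{1-r^2}\sqrt{1-\|y\|^2}\;t . $$ Furthermore, if $\mu=0$ (and $\nu>0$), the formula holds under the limit $\mu\to0+$, that is, with the normalized measure $c_\mu(1-t^2)^{\mu-1}dt$ on $[-1,1]$ replaced by its limit, according to $$\lim_{a\to0+}c_a\int_{-1}^1 f(t)(1-t^2)^{a-1}dt=\tfrac12[f(1)+f(-1)],\qquad c_a=\frac{\Gamma(a+1/2)}{\sqrt{\pi}\,\Gamma(a)}.$$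
   Context: Let $d\ge2$, $\mathbb{B}^d=\{x\in\mathbb{R}^d:\|x\|\le1\}$. Let $G$ be a finite reflection group on $\mathbb{R}^d$ with a fixed positive root system $R_+$; for $v\in R_+$ let $x\sigma_v=x-2\langle x,v\rangle v/\|v\|^2$. Let $\kappa:R_+\to[0,\infty)$ be a $G$-invariant multiplicity function. Put $h_\kappa(x)=\prod_{v\in R_+}|\langle x,v\rangle|^{\kappa(v)}$ and $\gamma_\kappa=\sum_{v\in R_+}\kappa(v)$. The weight function on the ball is $W_{\kappa,\mu,\nu}(x)=h_\kappa^2(x)\|x\|^{2\nu}(1-\|x\|^2)^{\mu-1/2}$, with inner product $\langle f,g\rangle_{\kappa,\mu,\nu}=b_{\kappa,\mu,\nu}\int_{\mathbb{B}^d}f(x)g(x)W_{\kappa,\mu,\nu}(x)\,dx$, where $b_{\kappa,\mu,\nu}$ is such that $\langle1,1\rangle_{\kappa,\mu,\nu}=1$. $\mathcal{V}_n^d(W_{\kappa,\mu,\nu})$ is the space of polynomials of degree $n$ in $d$ variables that are orthogonal, for this inner product, to all polynomials of degree at most $n-1$ (together with $0$). $P_n(W_{\kappa,\mu,\nu};\cdot,\cdot)$ is the reproducing kernel of $\mathcal{V}_n^d(W_{\kappa,\mu,\nu})$: $P_n(W_{\kappa,\mu,\nu};x,y)=\sum_k Q_k(x)Q_k(y)$ for any orthonormal basis $\{Q_k\}$ of $\mathcal{V}_n^d(W_{\kappa,\mu,\nu})$. Dunkl operators: $\mathcal{D}_if(x)=\partial_if(x)+\sum_{v\in R_+}\kappa(v)\frac{f(x)-f(x\sigma_v)}{\langle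 x,v\rangle}v_i$, $1\le i\le d$. The intertwining operator $V_\kappa$ is the linear operator on polynomials uniquely determined by $V_\kappa1=1$, $V_\kappa\mathcal{P}_n^d=\mathcal{P}_n^d$ and $\mathcal{D}_iV_\kappa=V_\kappa\partial_i$ for $1\le i\le d$, where $\mathcal{P}_n^d$ is the space of homogeneous polynomials of degree $n$ in $d$ variables. In the formula $V_\kappa$ acts on the variable denoted by a dot and the result is evaluated at $x'$ (if $x=0$, $x'$ is any unit vector). $Z_n^\lambda(t)=\frac{n+\lambda}{\lambda}C_n^\lambda(t)$ for $\lambda>0$, where $C_n^\lambda$ is the Gegenbauer polynomial, and $\lambda_{\kappa,\mu,\nu}=\nu+\mu+\gamma_\kappa+\frac{d-1}{2}$. *)

theory Defs
  imports "HOL-Analysis.Analysis"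
begin

definition reflection :: "real ^ 'n \<Rightarrow> real ^ 'n \<Rightarrow> real ^ 'n" where
  "reflection v x = x - (2 * (x \<bullet> v) / (norm v)\<^sup>2) *\<^sub>R v"

inductive_set reflection_group :: "(real ^ 'n) set \<Rightarrow> (real ^ 'n \<Rightarrow> real ^ 'n) set"
  for R :: "(real ^ 'n) set" where
  id: "id \<in> reflection_group R"
| step: "v \<in> R \<Longrightarrow> g \<in> reflection_group R \<Longrightarrow> reflection v \<circ> g \<in> reflection_group R"

text \<open>Root systems are reduced, but neither spanning nor crystallographic in general; the empty
  root system (trivial group) is allowed.\<close>

definition root_system :: "(real ^ 'n) set \<Rightarrow> bool" where
  "root_system R \<longleftrightarrow> finite R \<and> 0 \<notin> R \<and>
     (\<forall>v\<in>R. reflection v ` R = R) \<and>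
     (\<forall>v\<in>R. \<forall>c::real. c *\<^sub>R v \<in> R \<longrightarrow> c = 1 \<or> c = -1)"

definition positive_root_system ::
    "(real ^ 'n \<Rightarrow> real ^ 'n) set \<Rightarrow> (real ^ 'n) set \<Rightarrow> bool" where
  "positive_root_system G Rp \<longleftrightarrow>
     (\<exists>R w. root_system R \<and> G = reflection_group R \<and>
            (\<forall>v\<in>R. v \<bullet> w \<noteq> 0) \<and> Rp = {v \<in> R. v \<bullet> w > 0})"

text \<open>A multiplicity function lives on the positive roots and is extended to all roots by
  \<open>\<kappa> (- v) = \<kappa> v\<close>; invariance refers to this extension.\<close>

definition multiplicity_function ::
    "(real ^ 'n \<Rightarrow> real ^ 'n) set \<Rightarrow> (real ^ 'n) set \<Rightarrow> (real ^ 'n \<Rightarrow> real) \<Rightarrow> bool" where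
  "multiplicity_function G Rp \<kappa> \<longleftrightarrow>
     (\<forall>v\<in>Rp. \<kappa> v \<ge> 0) \<and>
     (\<forall>g\<in>G. \<forall>v\<in>Rp. \<forall>w\<in>Rp. g v = w \<or> g v = - w \<longrightarrow> \<kappa> v = \<kappa> w)"

definition gamma_kappa :: "(real ^ 'n) set \<Rightarrow> (real ^ 'n \<Rightarrow> real) \<Rightarrow> real" where
  "gamma_kappa Rp \<kappa> = (\<Sum>v\<in>Rp. \<kappa> v)"

text \<open>Since \<open>0 powr 0 = 0\<close>, this is off by a null set from the usual \<open>h\<^sub>\<kappa>\<close> when some \<open>\<kappa> v\<close> is zero;
  it is only used inside integrals.\<close>

definition h_kappa :: "(real ^ 'n) set \<Rightarrow> (real ^ 'n \<Rightarrow> real) \<Rightarrow> real ^ 'n \<Rightarrow> real" where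
  "h_kappa Rp \<kappa> x = (\<Prod>v\<in>Rp. \<bar>x \<bullet> v\<bar> powr \<kappa> v)"

definition monomial_fun :: "('n \<Rightarrow> nat) \<Rightarrow> real ^ 'n \<Rightarrow> real" where
  "monomial_fun \<alpha> x = (\<Prod>i\<in>UNIV. x $ i ^ \<alpha> i)"

definition homogeneous_polys :: "nat \<Rightarrow> (real ^ 'n \<Rightarrow> real) set" where
  "homogeneous_polys n =
     {\<lambda>x. \<Sum>\<alpha> | sum \<alpha> UNIV = n. c \<alpha> * monomial_fun \<alpha> x | c :: ('n \<Rightarrow> nat) \<Rightarrow> real. True}"

definition polys_le :: "nat \<Rightarrow> (real ^ 'n \<Rightarrow> real) set" where
  "polys_le n =
     {\<lambda>x. \<Sum>\<alpha> | sum \<alpha> UNIV \<le> n. c \<alpha> * monomial_fun \<alpha> x | c :: ('n \<Rightarrow> nat) \<Rightarrow> real. True}"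

definition polys_of_degree :: "nat \<Rightarrow> (real ^ 'n \<Rightarrow> real) set" where
  "polys_of_degree n = {p \<in> polys_le n. \<forall>m<n. p \<notin> polys_le m}"

definition weight ::
    "(real ^ 'n) set \<Rightarrow> (real ^ 'n \<Rightarrow> real) \<Rightarrow> real \<Rightarrow> real \<Rightarrow> real ^ 'n \<Rightarrow> real" where
  "weight Rp \<kappa> \<mu> \<nu> x =
     (h_kappa Rp \<kappa> x)\<^sup>2 * norm x powr (2 * \<nu>) * (1 - (norm x)\<^sup>2) powr (\<mu> - 1 / 2)"

definition b_const :: "(real ^ 'n) set \<Rightarrow> (real ^ 'n \<Rightarrow> real) \<Rightarrow> real \<Rightarrow> real \<Rightarrow> real" where
  "b_const Rp \<kappa> \<mu> \<nu> = 1 / (LINT x:cball 0 1|lborel. weight Rp \<kappa> \<mu> \<nu> x)"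

definition ball_inner ::
    "(real ^ 'n) set \<Rightarrow> (real ^ 'n \<Rightarrow> real) \<Rightarrow> real \<Rightarrow> real \<Rightarrow>
     (real ^ 'n \<Rightarrow> real) \<Rightarrow> (real ^ 'n \<Rightarrow> real) \<Rightarrow> real" where
  "ball_inner Rp \<kappa> \<mu> \<nu> f g =
     b_const Rp \<kappa> \<mu> \<nu> * (LINT x:cball 0 1|lborel. f x * g x * weight Rp \<kappa> \<mu> \<nu> x)"

definition orth_polys ::
    "(real ^ 'n) set \<Rightarrow> (real ^ 'n \<Rightarrow> real) \<Rightarrow> real \<Rightarrow> real \<Rightarrow> nat \<Rightarrow> (real ^ 'n \<Rightarrow> real) set" where
  "orth_polys Rp \<kappa> \<mu> \<nu> n =
     {p. (p \<in> polys_of_degree n \<or> p = (\<lambda>x. 0)) \<and>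
         (\<forall>m<n. \<forall>q\<in>polys_le m. ball_inner Rp \<kappa> \<mu> \<nu> p q = 0)}"

definition orthonormal_basis ::
    "((real ^ 'n \<Rightarrow> real) \<Rightarrow> (real ^ 'n \<Rightarrow> real) \<Rightarrow> real) \<Rightarrow>
     (real ^ 'n \<Rightarrow> real) set \<Rightarrow> (real ^ 'n \<Rightarrow> real) set \<Rightarrow> bool" where
  "orthonormal_basis ip U B \<longleftrightarrow>
     finite B \<and> B \<subseteq> U \<and>
     (\<forall>p\<in>B. \<forall>q\<in>B. ip p q = (if p = q then 1 else 0)) \<and>
     (\<forall>p\<in>U. \<exists>c. p = (\<lambda>x. \<Sum>q\<in>B. c q * q x))"

definition reproducing_kernel ::
    "(real ^ 'n) set \<Rightarrow> (real ^ 'n \<Rightarrow> real) \<Rightarrow> real \<Rightarrow> real \<Rightarrow> nat \<Rightarrow>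
     real ^ 'n \<Rightarrow> real ^ 'n \<Rightarrow> real" where
  "reproducing_kernel Rp \<kappa> \<mu> \<nu> n =
     (THE K. \<forall>B. orthonormal_basis (ball_inner Rp \<kappa> \<mu> \<nu>) (orth_polys Rp \<kappa> \<mu> \<nu> n) B \<longrightarrow>
               K = (\<lambda>x y. \<Sum>q\<in>B. q x * q y))"

definition partial_deriv :: "'n \<Rightarrow> (real ^ 'n \<Rightarrow> real) \<Rightarrow> real ^ 'n \<Rightarrow> real" where
  "partial_deriv i f x = frechet_derivative f (at x) (axis i 1)"

text \<open>For polynomial \<open>f\<close> the difference quotient is again a polynomial. Pointwise division would
  give 0 on the hyperplane orthogonal to \<open>v\<close>, so its value there is taken by continuity.\<close>

definition diff_quotient :: "real ^ 'n \<Rightarrow> (real ^ 'n \<Rightarrow> real) \<Rightarrow> real ^ 'n \<Rightarrow> real" where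
  "diff_quotient v f x =
     (if x \<bullet> v \<noteq> 0 then (f x - f (reflection v x)) / (x \<bullet> v)
      else Lim (at x within {z. z \<bullet> v \<noteq> 0}) (\<lambda>z. (f z - f (reflection v z)) / (z \<bullet> v)))"

definition dunkl_operator ::
    "(real ^ 'n) set \<Rightarrow> (real ^ 'n \<Rightarrow> real) \<Rightarrow> 'n \<Rightarrow>
     (real ^ 'n \<Rightarrow> real) \<Rightarrow> real ^ 'n \<Rightarrow> real" where
  "dunkl_operator Rp \<kappa> i f x =
     partial_deriv i f x + (\<Sum>v\<in>Rp. \<kappa> v * diff_quotient v f x * v $ i)"

text \<open>Only the values of \<open>V\<close> on polynomials are constrained.\<close>

definition intertwining_operator ::
    "(real ^ 'n) set \<Rightarrow> (real ^ 'n \<Rightarrow> real) \<Rightarrow>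
     ((real ^ 'n \<Rightarrow> real) \<Rightarrow> (real ^ 'n \<Rightarrow> real)) \<Rightarrow> bool" where
  "intertwining_operator Rp \<kappa> V \<longleftrightarrow>
     (\<forall>p q. real_polynomial_function p \<longrightarrow> real_polynomial_function q \<longrightarrow>
            V (\<lambda>x. p x + q x) = (\<lambda>x. V p x + V q x)) \<and>
     (\<forall>p a. real_polynomial_function p \<longrightarrow> V (\<lambda>x. a * p x) = (\<lambda>x. a * V p x)) \<and>
     V (\<lambda>x. 1) = (\<lambda>x. 1) \<and>
     (\<forall>n. V ` homogeneous_polys n = homogeneous_polys n) \<and>
     (\<forall>i p. real_polynomial_function p \<longrightarrow>
            dunkl_operator Rp \<kappa> i (V p) = V (partial_deriv i p))"

definition gegenbauer :: "nat \<Rightarrow> real \<Rightarrow> real \<Rightarrow> real" where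
  "gegenbauer n l t =
     (\<Sum>k\<in>{..n div 2}. (- 1) ^ k * pochhammer l (n - k) / (fact k * fact (n - 2 * k))
                    * (2 * t) ^ (n - 2 * k))"

definition Z_poly :: "nat \<Rightarrow> real \<Rightarrow> real \<Rightarrow> real" where
  "Z_poly n l t = (real n + l) / l * gegenbauer n l t"

definition lambda_const ::
    "(real ^ 'n) set \<Rightarrow> (real ^ 'n \<Rightarrow> real) \<Rightarrow> real \<Rightarrow> real \<Rightarrow> real" where
  "lambda_const Rp \<kappa> \<mu> \<nu> = \<nu> + \<mu> + gamma_kappa Rp \<kappa> + (real CARD('n) - 1) / 2"

definition zeta ::
    "real ^ 'n \<Rightarrow> real \<Rightarrow> real ^ 'n \<Rightarrow> real \<Rightarrow> real \<Rightarrow> real \<Rightarrow> real" where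
  "zeta z r y u v t =
     r * norm y * u * v + r * (z \<bullet> y) * (1 - u) + sqrt (1 - r\<^sup>2) * sqrt (1 - (norm y)\<^sup>2) * t"

definition triple_integral ::
    "(real ^ 'n) set \<Rightarrow> (real ^ 'n \<Rightarrow> real) \<Rightarrow> real \<Rightarrow> real \<Rightarrow>
     (real \<Rightarrow> real \<Rightarrow> real \<Rightarrow> real) \<Rightarrow> real" where
  "triple_integral Rp \<kappa> \<mu> \<nu> F =
     (LINT v:{-1..1}|lborel.
        (LINT u:{0..1}|lborel.
           (LINT t:{-1..1}|lborel. F u v t * (1 - t\<^sup>2) powr (\<mu> - 1))
           * (u powr (\<nu> - 1) * (1 - u) powr (gamma_kappa Rp \<kappa> + (real CARD('n) - 2) / 2)))
        * (1 - v\<^sup>2) powr (\<nu> - 1 / 2))"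

text \<open>The same integral with the normalized measure in \<open>t\<close> replaced by its limit for \<open>\<mu>\<close> tending
  to 0, the mean of the point masses at \<open>1\<close> and \<open>-1\<close>.\<close>

definition limit_integral ::
    "(real ^ 'n) set \<Rightarrow> (real ^ 'n \<Rightarrow> real) \<Rightarrow> real \<Rightarrow>
     (real \<Rightarrow> real \<Rightarrow> real \<Rightarrow> real) \<Rightarrow> real" where
  "limit_integral Rp \<kappa> \<nu> F =
     (LINT v:{-1..1}|lborel.
        (LINT u:{0..1}|lborel.
           ((F u v 1 + F u v (-1)) / 2)
           * (u powr (\<nu> - 1) * (1 - u) powr (gamma_kappa Rp \<kappa> + (real CARD('n) - 2) / 2)))
        * (1 - v\<^sup>2) powr (\<nu> - 1 / 2))"

text \<open>For \<open>n = 0\<close> the integrand \<open>V Z\<^sub>0\<close> is the constant 1, so the constants normalizing the formula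
  are the reciprocals of the total masses.\<close>

definition a_const :: "(real ^ 'n) set \<Rightarrow> (real ^ 'n \<Rightarrow> real) \<Rightarrow> real \<Rightarrow> real \<Rightarrow> real" where
  "a_const Rp \<kappa> \<mu> \<nu> = 1 / triple_integral Rp \<kappa> \<mu> \<nu> (\<lambda>u v t. 1)"

definition a_const_limit :: "(real ^ 'n) set \<Rightarrow> (real ^ 'n \<Rightarrow> real) \<Rightarrow> real \<Rightarrow> real" where
  "a_const_limit Rp \<kappa> \<nu> = 1 / limit_integral Rp \<kappa> \<nu> (\<lambda>u v t. 1)"

definition c_const :: "real \<Rightarrow> real" where
  "c_const a = Gamma (a + 1 / 2) / (sqrt pi * Gamma a)"

end

(*
The kernel on the right-hand side is evaluated term by term on monomials of Z_n and shown to
reproduce the orthogonal polynomials of degree n.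

Commutativity of the Dunkl operators and the fact that they map polynomials to polynomials come
for free from the intertwining operator; with the commutator of D_i and x_j they give the
decomposition of x_i Y, for an h-harmonic Y, into harmonics, hence the Fischer decomposition.
Integration by parts against h^2, regularized by ((x.v)^2 + eps)^kappa, and scaling in the radius
replace integration over the sphere. Applying D_i in x to the spherical mean of V[<.,y>^N](x) Y(y)
and using that only constants are annihilated by all D_i yields the Funk-Hecke formula, whose
coefficients are moments of Gegenbauer polynomials. The integrals over u and v shift the
Gegenbauer parameter by nu, which is the Hagen-Rothe identity with z = 2; the integral over t
gives an operator that acts on polynomials of degree m modulo lower degree as the scalar 1 if
m = n and 0 otherwise. This operator is symmetric, so it vanishes on degree less than n and is the
identity on the orthogonal polynomials of degree n, and its kernel is the reproducing kernel.
*)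
theory Submission
  imports Defs
begin

section \<open>Homogeneous polynomials\<close>

text \<open>The hypotheses on \<open>V\<close> give the intertwining relation and linearity on
  polynomials, but no integral representation and no positivity. Hence \<open>V\<close> is evaluated
  only on powers of an inner product, and each exchange of \<open>V\<close> with an integral is
  linearity on finite sums. The kernel is tested on |y|^(2j) Y with Y h-harmonic, which span each
  degree. The number \<open>fhc l N m\<close> is the N-th moment of C_m^l / C_m^l(1) (a limit if l =
  0) for the normalized Gegenbauer weight of index l, and the coefficients of Z_n^l are dual to
  these moments by orthogonality: this is the source of the scalar 1 or 0. The index l moves from
  \<gamma> + (d-2)/2 on the sphere to \<nu> + \<gamma> + (d-2)/2 after the integrals in u and v, and
  to \<nu> + \<mu> + \<gamma> + (d-1)/2 after the one in t, the index in the formula. Every mean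
  that occurs is a ratio of Pochhammer symbols that stays meaningful at \<mu> = 0, so the limiting
  formula is the same algebra at \<mu> = 0; the convergence of the measures is proved
  separately.\<close>

inductive hom :: "nat \<Rightarrow> (real ^ 'n \<Rightarrow> real) \<Rightarrow> bool" where
  const: "hom 0 (\<lambda>x. c)"
| coord: "hom n p \<Longrightarrow> hom (Suc n) (\<lambda>x. x $ i * p x)"
| add: "hom n p \<Longrightarrow> hom n q \<Longrightarrow> hom n (\<lambda>x. p x + q x)"

lemma hom_cmul: "hom n p \<Longrightarrow> hom n (\<lambda>x. c * p x)"
proof (induction rule: hom.induct)
  case (coord n p i)
  from hom.coord[OF coord.IH, of i] show ?case by (simp add: mult_ac)
qed (auto simp: distrib_left intro: hom.intros)

lemma hom_zero: "hom n (\<lambda>x. 0)"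
proof (induction n)
  case (Suc n)
  from hom.coord[OF this] show ?case by simp
qed (rule hom.const)

lemma hom_if: "(P \<Longrightarrow> hom n p) \<Longrightarrow> hom n (\<lambda>x. if P then p x else 0)"
  by (cases P) (simp_all add: hom_zero)

lemma hom_minus: "hom n p \<Longrightarrow> hom n (\<lambda>x. - p x)"
  using hom_cmul[of n p "-1"] by simp

lemma hom_diff: "hom n p \<Longrightarrow> hom n q \<Longrightarrow> hom n (\<lambda>x. p x - q x)"
  using hom.add[of n p "\<lambda>x. - q x"] hom_minus[of n q] by simp

lemma hom_sum: "(\<And>i. i \<in> A \<Longrightarrow> hom n (f i)) \<Longrightarrow> hom n (\<lambda>x. \<Sum>i\<in>A. f i x)"
  by (induction A rule: infinite_finite_induct) (auto intro: hom_zero hom.add)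

lemma hom_mult_inner: "hom n p \<Longrightarrow> hom (Suc n) (\<lambda>x. (x \<bullet> a) * p x)"
proof -
  assume "hom n p"
  then have "hom (Suc n) (\<lambda>x. \<Sum>i\<in>UNIV. a $ i * (x $ i * p x))"
    by (intro hom_sum hom_cmul hom.coord)
  then show ?thesis by (simp add: inner_vec_def sum_distrib_left mult_ac)
qed

lemma hom_mult: "hom m p \<Longrightarrow> hom n q \<Longrightarrow> hom (m + n) (\<lambda>x. p x * q x)"
proof (induction rule: hom.induct)
  case (const c)
  then show ?case by (simp add: hom_cmul)
next
  case (coord m p i)
  from hom.coord[OF coord.IH[OF coord.prems], of i] show ?case by (simp add: mult_ac)
next
  case (add m p r)
  then show ?case by (simp add: distrib_right hom.add)
qed

lemma hom_norm_mult: "hom n p \<Longrightarrow> hom (n + 2) (\<lambda>x. (norm x)\<^sup>2 * p x)"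
proof -
  assume "hom n p"
  then have "hom (Suc (Suc n)) (\<lambda>x. \<Sum>i\<in>UNIV. x $ i * (x $ i * p x))"
    by (intro hom_sum hom.coord)
  then show ?thesis
    by (simp add: power2_norm_eq_inner inner_vec_def sum_distrib_left mult_ac)
qed

lemma hom_norm_power_mult: "hom n p \<Longrightarrow> hom (n + 2 * j) (\<lambda>x. (norm x) ^ (2 * j) * p x)"
proof (induction j)
  case (Suc j)
  from hom_norm_mult[OF Suc.IH[OF Suc.prems]]
  show ?case by (simp add: power_add power2_eq_square mult_ac)
qed simp

lemma hom_compose_linear:
  fixes A :: "real ^ 'n \<Rightarrow> real ^ 'n"
  assumes "hom n p" "linear A"
  shows "hom n (\<lambda>x. p (A x))"
  using assms(1)
proof (induction rule: hom.induct)
  case (coord n p i)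
  have "A x $ i = x \<bullet> adjoint A (axis i 1)" for x
    using adjoint_works[OF assms(2)] by (metis cart_eq_inner_axis)
  with hom_mult_inner[OF coord.IH] show ?case by simp
qed (auto intro: hom.intros)

lemma hom_scale: "hom n p \<Longrightarrow> p (c *\<^sub>R x) = c ^ n * p x"
  by (induction rule: hom.induct) (auto simp: algebra_simps)

lemma hom_0D: "hom n p \<Longrightarrow> n = 0 \<Longrightarrow> \<exists>c. p = (\<lambda>x. c)"
  by (induction rule: hom.induct) auto

text \<open>The factors \<open>q i\<close> are not unique. The induction on degree in
  \<open>S_orthogonal\<close> only needs that some coordinate can be split off each summand.\<close>

lemma hom_SucD:
  "hom N p \<Longrightarrow> N = Suc n \<Longrightarrow> \<exists>q. (\<forall>i. hom n (q i)) \<and> p = (\<lambda>x. \<Sum>i\<in>UNIV. x $ i * q i x)"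
proof (induction rule: hom.induct)
  case (coord m p i)
  then have "(\<lambda>x. x $ i * p x) = (\<lambda>x. \<Sum>j\<in>UNIV. x $ j * (if j = i then p x else 0))"
    by (auto simp: if_distrib[of "(*) _"] cong: if_cong)
  with coord show ?case
    by (intro exI[of _ "\<lambda>j x. if j = i then p x else 0"]) (auto intro: hom_if)
next
  case (add m p q)
  then obtain f g where "\<forall>i. hom n (f i)" "p = (\<lambda>x. \<Sum>i\<in>UNIV. x $ i * f i x)"
    "\<forall>i. hom n (g i)" "q = (\<lambda>x. \<Sum>i\<in>UNIV. x $ i * g i x)" by blast
  then show ?case
    by (intro exI[of _ "\<lambda>i x. f i x + g i x"]) (auto simp: distrib_left sum.distrib intro: hom.add)
qed auto

lemma hom_real_polynomial: "hom n p \<Longrightarrow> real_polynomial_function p"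
proof (induction rule: hom.induct)
  case (coord n p i)
  have "real_polynomial_function (\<lambda>x::real^'a. x $ i)"
    by (intro real_polynomial_function.intros(1) bounded_linear_vec_nth)
  with coord show ?case by auto
qed auto

lemma hom_continuous: "hom n p \<Longrightarrow> continuous_on S p"
  by (induction rule: hom.induct) (auto intro!: continuous_intros)

lemma hom_measurable: "hom n p \<Longrightarrow> p \<in> borel_measurable borel"
  by (intro borel_measurable_continuous_onI hom_continuous)

lemma coord_differentiable: "(\<lambda>x::real^'n. x $ i) differentiable F"
  using bounded_linear_imp_differentiable[OF bounded_linear_vec_nth] .

lemma hom_differentiable: "hom n p \<Longrightarrow> p differentiable (at x)"
  by (induction rule: hom.induct)
     (auto intro!: differentiable_const differentiable_add differentiable_mult coord_differentiable)

lemma partial_deriv_const: "partial_deriv i (\<lambda>x. c) = (\<lambda>x. 0)"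
  by (simp add: partial_deriv_def fun_eq_iff)

lemma partial_deriv_eqI: "(f has_derivative f') (at x) \<Longrightarrow> partial_deriv i f x = f' (axis i 1)"
  unfolding partial_deriv_def using frechet_derivative_at by metis

lemma partial_deriv_add:
  assumes "p differentiable (at x)" "q differentiable (at x)"
  shows "partial_deriv i (\<lambda>x. p x + q x) x = partial_deriv i p x + partial_deriv i q x"
  using partial_deriv_eqI[OF has_derivative_add] assms
  unfolding frechet_derivative_works partial_deriv_def by blast

lemma partial_deriv_mult:
  assumes "p differentiable (at x)" "q differentiable (at x)"
  shows "partial_deriv i (\<lambda>x. p x * q x) x = p x * partial_deriv i q x + partial_deriv i p x * q x"
  using partial_deriv_eqI[OF has_derivative_mult] assms
  unfolding frechet_derivative_works partial_deriv_def by blast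

lemma partial_deriv_coord: "partial_deriv i (\<lambda>x. x $ j) x = (if i = j then 1 else 0)"
  by (subst partial_deriv_eqI[of _ "\<lambda>x. x $ j"])
     (auto intro: bounded_linear_imp_has_derivative bounded_linear_vec_nth simp: axis_def)

lemma partial_deriv_coord_mult:
  "hom n p \<Longrightarrow> partial_deriv i (\<lambda>x. x $ j * p x) x = (if i = j then p x else 0) + x $ j * partial_deriv i p x"
  by (subst partial_deriv_mult)
     (auto simp: partial_deriv_coord hom_differentiable coord_differentiable)

lemma partial_deriv_hom_0: "hom 0 p \<Longrightarrow> partial_deriv i p = (\<lambda>x. 0)"
  using hom_0D[of 0 p] partial_deriv_const by auto

lemma partial_deriv_hom: "hom N p \<Longrightarrow> N = Suc n \<Longrightarrow> hom n (partial_deriv i p)"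
proof (induction arbitrary: n rule: hom.induct)
  case (coord m p j)
  then have [simp]: "m = n" by simp
  have "partial_deriv i (\<lambda>x. x $ j * p x) = (\<lambda>x. (if i = j then p x else 0) + x $ j * partial_deriv i p x)"
    using coord partial_deriv_coord_mult by blast
  moreover have "hom n (\<lambda>x. x $ j * partial_deriv i p x)"
  proof (cases n)
    case 0
    then show ?thesis using coord partial_deriv_hom_0[of p i] by (simp add: hom_zero)
  qed (use coord hom.coord in auto)
  moreover have "hom n (\<lambda>x. if i = j then p x else 0)"
    using coord by (auto intro: hom_if)
  ultimately show ?case by (simp add: hom.add)
next
  case (add m p q)
  then have "partial_deriv i (\<lambda>x. p x + q x) = (\<lambda>x. partial_deriv i p x + partial_deriv i q x)"
    by (intro ext partial_deriv_add hom_differentiable)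
  with add show ?case by (auto intro: hom.add)
qed auto

lemma partial_deriv_cmul:
  "hom n p \<Longrightarrow> partial_deriv i (\<lambda>x. c * p x) x = c * partial_deriv i p x"
  using partial_deriv_mult[of "\<lambda>_. c" x p i] by (simp add: hom_differentiable partial_deriv_const)

text \<open>Truncated subtraction covers n = 0: the derivative is then 0, which is homogeneous of
  every degree.\<close>

lemma partial_deriv_pred: "hom n p \<Longrightarrow> hom (n - 1) (partial_deriv i p)"
  using partial_deriv_hom[of n p "n - 1" i] partial_deriv_hom_0[of p i] hom_zero
  by (cases n) auto

text \<open>For a product with a coordinate both mixed derivatives are given by \<open>*\<close>,
  whose terms are permuted when i and j are exchanged. Through \<open>V\<close> this becomes the
  commutation of the Dunkl operators.\<close>

lemma partial_deriv_commute:
  "hom n p \<Longrightarrow> partial_deriv i (partial_deriv j p) = partial_deriv j (partial_deriv i p)"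
proof (induction rule: hom.induct)
  case (coord n p k)
  have *: "partial_deriv i (partial_deriv j (\<lambda>x. x $ k * p x)) =
      (\<lambda>x. (if j = k then partial_deriv i p x else 0) + (if i = k then partial_deriv j p x else 0)
         + x $ k * partial_deriv i (partial_deriv j p) x)" for i j
  proof -
    have e1: "partial_deriv j (\<lambda>x. x $ k * p x) = (\<lambda>x. (if j = k then p x else 0) + x $ k * partial_deriv j p x)"
      using coord partial_deriv_coord_mult by blast
    have e2: "partial_deriv i \<dots> x = partial_deriv i (\<lambda>x. if j = k then p x else 0) x
       + partial_deriv i (\<lambda>x. x $ k * partial_deriv j p x) x" for x
      using hom.coord[OF partial_deriv_pred[OF coord.hyps(1), of j], of k] coord.hyps(1)
      by (intro partial_deriv_add) (auto intro: hom_differentiable hom_if)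
    have e3: "partial_deriv i (\<lambda>x. if j = k then p x else 0) x = (if j = k then partial_deriv i p x else 0)" for x
      by (simp add: partial_deriv_const)
    show ?thesis
      by (rule ext) (simp only: e1 e2 e3 partial_deriv_coord_mult[OF partial_deriv_pred[OF coord.hyps(1)]] add.assoc)
  qed
  show ?case unfolding * using coord by (auto simp: fun_eq_iff)
next
  case (add n p q)
  have *: "partial_deriv i (partial_deriv j (\<lambda>x. p x + q x)) =
      (\<lambda>x. partial_deriv i (partial_deriv j p) x + partial_deriv i (partial_deriv j q) x)" for i j
  proof -
    have e: "partial_deriv j (\<lambda>x. p x + q x) = (\<lambda>x. partial_deriv j p x + partial_deriv j q x)"
      using add by (intro ext partial_deriv_add hom_differentiable)
    show ?thesis
    proof
      fix x
      have "partial_deriv j p differentiable at x" "partial_deriv j q differentiable at x"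
        using add.hyps partial_deriv_pred hom_differentiable by blast+
      then show "partial_deriv i (partial_deriv j (\<lambda>x. p x + q x)) x =
          partial_deriv i (partial_deriv j p) x + partial_deriv i (partial_deriv j q) x"
        unfolding e by (rule partial_deriv_add)
    qed
  qed
  show ?case unfolding * using add by simp
qed (simp add: partial_deriv_const)

lemma euler_hom: "hom n p \<Longrightarrow> (\<Sum>i\<in>UNIV. x $ i * partial_deriv i p x) = real n * p x"
proof (induction rule: hom.induct)
  case (coord n p k)
  have "(\<Sum>i\<in>UNIV. x $ i * partial_deriv i (\<lambda>x. x $ k * p x) x) =
     (\<Sum>i\<in>UNIV. x $ i * (if i = k then p x else 0)) + x $ k * (\<Sum>i\<in>UNIV. x $ i * partial_deriv i p x)"
    unfolding partial_deriv_coord_mult[OF coord.hyps] sum_distrib_left sum.distrib[symmetric]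
    by (intro sum.cong) (simp_all add: algebra_simps)
  with coord show ?case by (simp add: algebra_simps if_distrib cong: if_cong)
next
  case (add n p q)
  then show ?case by (simp add: partial_deriv_add hom_differentiable distrib_left sum.distrib)
qed (simp add: partial_deriv_const)

lemma has_derivative_along:
  assumes "hom n p"
  shows "((\<lambda>t. p (x + t *\<^sub>R axis i 1)) has_real_derivative partial_deriv i p x) (at 0)"
proof -
  have "(p has_derivative frechet_derivative p (at x)) (at (x + 0 *\<^sub>R axis i 1))"
    using frechet_derivative_works hom_differentiable[OF assms] by fastforce
  moreover have "((\<lambda>t. x + t *\<^sub>R axis i 1) has_derivative (\<lambda>t. t *\<^sub>R axis i 1)) (at (0::real))"
    by (auto intro!: derivative_eq_intros)
  ultimately have "((\<lambda>t. p (x + t *\<^sub>R axis i 1)) has_derivative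
      (\<lambda>t. frechet_derivative p (at x) (t *\<^sub>R axis i 1))) (at 0)"
    by (rule has_derivative_compose[rotated])
  moreover have "linear (frechet_derivative p (at x))"
    using assms hom_differentiable linear_frechet_derivative by blast
  then have "frechet_derivative p (at x) (t *\<^sub>R axis i 1) = partial_deriv i p x * t" for t
    by (simp add: linear_scale partial_deriv_def)
  ultimately show ?thesis
    unfolding has_field_derivative_def by simp
qed

section \<open>Comparison with polynomials given by coefficients\<close>

lemma finite_multiindex: "finite {\<alpha> :: 'n::finite \<Rightarrow> nat. sum \<alpha> UNIV \<le> n}"
proof (rule finite_subset)
  show "{\<alpha> :: 'n \<Rightarrow> nat. sum \<alpha> UNIV \<le> n} \<subseteq> (UNIV :: 'n set) \<rightarrow>\<^sub>E {..n}"
  proof (clarsimp simp: PiE_def)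
    fix \<alpha> :: "'n \<Rightarrow> nat" and i assume "sum \<alpha> UNIV \<le> n"
    then show "\<alpha> i \<le> n" using member_le_sum[of i UNIV \<alpha>] by simp
  qed
qed (auto intro: finite_PiE)

lemma finite_multiindex_eq: "finite {\<alpha> :: 'n::finite \<Rightarrow> nat. sum \<alpha> UNIV = n}"
  by (rule finite_subset[OF _ finite_multiindex[of n]]) auto

lemma hom_monomial: "sum \<alpha> UNIV = n \<Longrightarrow> hom n (monomial_fun \<alpha>)"
proof (induction n arbitrary: \<alpha>)
  case 0
  then show ?case using hom.const[of 1] by (simp add: monomial_fun_def[abs_def])
next
  case (Suc n)
  then obtain i where i: "\<alpha> i \<noteq> 0" by (metis nat.distinct(1) sum.neutral)
  define \<beta> where "\<beta> = \<alpha>(i := \<alpha> i - 1)"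
  have "sum \<alpha> UNIV = \<alpha> i + sum \<alpha> (UNIV - {i})" "sum \<beta> UNIV = \<beta> i + sum \<beta> (UNIV - {i})"
    by (simp_all add: sum.remove)
  moreover have "sum \<beta> (UNIV - {i}) = sum \<alpha> (UNIV - {i})" by (intro sum.cong) (auto simp: \<beta>_def)
  ultimately have "sum \<beta> UNIV = n" using Suc.prems i by (simp add: \<beta>_def)
  then have "hom (Suc n) (\<lambda>x. x $ i * monomial_fun \<beta> x)" using Suc.IH hom.coord by blast
  moreover have "monomial_fun \<alpha> = (\<lambda>x. x $ i * monomial_fun \<beta> x)"
  proof
    fix x :: "real ^ 'a"
    have "monomial_fun \<alpha> x = x $ i ^ \<alpha> i * (\<Prod>j\<in>UNIV - {i}. x $ j ^ \<alpha> j)"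
      "monomial_fun \<beta> x = x $ i ^ \<beta> i * (\<Prod>j\<in>UNIV - {i}. x $ j ^ \<beta> j)"
      by (simp_all add: monomial_fun_def prod.remove)
    moreover have "(\<Prod>j\<in>UNIV - {i}. x $ j ^ \<beta> j) = (\<Prod>j\<in>UNIV - {i}. x $ j ^ \<alpha> j)"
      by (intro prod.cong) (auto simp: \<beta>_def)
    ultimately show "monomial_fun \<alpha> x = x $ i * monomial_fun \<beta> x"
      using i by (cases "\<alpha> i") (auto simp: \<beta>_def)
  qed
  ultimately show ?case by simp
qed

text \<open>The theorem speaks of polynomials given by coefficients over multi-indices, while
  \<open>hom\<close> provides an induction with only constants, multiplication by one coordinate and
  sums. This equivalence lets the induction be used throughout.\<close>

lemma homogeneous_polys_hom: "p \<in> homogeneous_polys n \<longleftrightarrow> hom n p"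
proof
  assume "p \<in> homogeneous_polys n"
  then show "hom n p" unfolding homogeneous_polys_def
    by (auto intro!: hom_sum hom_cmul hom_monomial)
next
  show "hom n p \<Longrightarrow> p \<in> homogeneous_polys n"
  proof (induction rule: hom.induct)
    case (const c)
    have "{\<alpha> :: 'a \<Rightarrow> nat. sum \<alpha> UNIV = 0} = {\<lambda>_. 0}" by auto
    then show ?case unfolding homogeneous_polys_def
      by (auto simp: monomial_fun_def intro!: exI[of _ "\<lambda>_. c"])
  next
    case (coord n p i)
    then obtain c where p: "p = (\<lambda>x. \<Sum>\<alpha> | sum \<alpha> UNIV = n. c \<alpha> * monomial_fun \<alpha> x)"
      unfolding homogeneous_polys_def by auto
    \<comment> \<open>Multiplication by \<open>x $ i\<close> raises the i-th exponent, so the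
      coefficient at \<alpha> comes from the lowered multi-index; it is 0 if the monomial does not
      contain the i-th coordinate.\<close>
    define c' where "c' \<alpha> = (if \<alpha> i = 0 then 0 else c (\<alpha>(i := \<alpha> i - 1)))" for \<alpha>
    have "x $ i * p x = (\<Sum>\<alpha> | sum \<alpha> UNIV = Suc n. c' \<alpha> * monomial_fun \<alpha> x)" for x
    proof -
      have sum_upd: "sum (\<alpha>(i := k)) UNIV + \<alpha> i = sum \<alpha> UNIV + k" for \<alpha> :: "'a \<Rightarrow> nat" and k
      proof -
        have "sum (\<alpha>(i := k)) (UNIV - {i}) = sum \<alpha> (UNIV - {i})" by (intro sum.cong) auto
        then show ?thesis by (simp add: sum.remove[of UNIV i])
      qed
      have mono: "monomial_fun (\<alpha>(i := Suc (\<alpha> i))) x = x $ i * monomial_fun \<alpha> x" for \<alpha>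
      proof -
        have "(\<Prod>j\<in>UNIV - {i}. x $ j ^ (\<alpha>(i := Suc (\<alpha> i))) j) = (\<Prod>j\<in>UNIV - {i}. x $ j ^ \<alpha> j)"
          by (intro prod.cong) auto
        then show ?thesis by (simp add: monomial_fun_def prod.remove[of UNIV i])
      qed
      have "x $ i * p x = (\<Sum>\<alpha> | sum \<alpha> UNIV = n. c \<alpha> * monomial_fun (\<alpha>(i := Suc (\<alpha> i))) x)"
        unfolding p mono by (simp add: sum_distrib_left mult_ac)
      also have "\<dots> = (\<Sum>\<alpha> | sum \<alpha> UNIV = Suc n \<and> \<alpha> i \<noteq> 0. c' \<alpha> * monomial_fun \<alpha> x)"
      proof (rule sum.reindex_bij_witness[where i="\<lambda>\<alpha>. \<alpha>(i := \<alpha> i - 1)" and j="\<lambda>\<alpha>. \<alpha>(i := Suc (\<alpha> i))"])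
        fix \<alpha> :: "'a \<Rightarrow> nat" assume "\<alpha> \<in> {\<alpha>. sum \<alpha> UNIV = Suc n \<and> \<alpha> i \<noteq> 0}"
        then show "\<alpha>(i := \<alpha> i - 1) \<in> {\<alpha>. sum \<alpha> UNIV = n}" "(\<alpha>(i := \<alpha> i - 1))(i := Suc ((\<alpha>(i := \<alpha> i - 1)) i)) = \<alpha>"
          using sum_upd[of \<alpha> "\<alpha> i - 1"] by (auto simp: fun_eq_iff)
      next
        fix \<alpha> :: "'a \<Rightarrow> nat" assume "\<alpha> \<in> {\<alpha>. sum \<alpha> UNIV = n}"
        then show "\<alpha>(i := Suc (\<alpha> i)) \<in> {\<alpha>. sum \<alpha> UNIV = Suc n \<and> \<alpha> i \<noteq> 0}"
          using sum_upd[of \<alpha> "Suc (\<alpha> i)"] by auto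
      qed (auto simp: c'_def)
      also have "\<dots> = (\<Sum>\<alpha> | sum \<alpha> UNIV = Suc n. c' \<alpha> * monomial_fun \<alpha> x)"
        by (intro sum.mono_neutral_left finite_multiindex_eq) (auto simp: c'_def)
      finally show ?thesis .
    qed
    then show ?case unfolding homogeneous_polys_def by auto
  next
    case (add n p q)
    then obtain c d where "p = (\<lambda>x. \<Sum>\<alpha> | sum \<alpha> UNIV = n. c \<alpha> * monomial_fun \<alpha> x)"
      "q = (\<lambda>x. \<Sum>\<alpha> | sum \<alpha> UNIV = n. d \<alpha> * monomial_fun \<alpha> x)"
      unfolding homogeneous_polys_def by auto
    then show ?case unfolding homogeneous_polys_def
      by (auto simp: sum.distrib[symmetric] distrib_right intro!: exI[of _ "\<lambda>\<alpha>. c \<alpha> + d \<alpha>"])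
  qed
qed

section \<open>The filtration by degree\<close>

text \<open>Polynomials of degree strictly less than \<open>n\<close>, so that \<open>polys_lt 0\<close> is the zero space.\<close>

definition polys_lt :: "nat \<Rightarrow> (real ^ 'n \<Rightarrow> real) set" where
  "polys_lt n = {\<lambda>x. \<Sum>k<n. q k x | q. \<forall>k. hom k (q k)}"

lemma polys_le_eq_polys_lt: "polys_le n = polys_lt (Suc n)"
proof (intro equalityI subsetI)
  fix p :: "real ^ 'n \<Rightarrow> real" assume "p \<in> polys_le n"
  then obtain c where p: "p = (\<lambda>x. \<Sum>\<alpha> | sum \<alpha> UNIV \<le> n. c \<alpha> * monomial_fun \<alpha> x)"
    unfolding polys_le_def by auto
  have "p x = (\<Sum>k<Suc n. \<Sum>\<alpha> | sum \<alpha> UNIV = k. c \<alpha> * monomial_fun \<alpha> x)" for x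
  proof -
    have "{\<alpha> :: 'n \<Rightarrow> nat. sum \<alpha> UNIV \<le> n \<and> sum \<alpha> UNIV = k} = {\<alpha>. sum \<alpha> UNIV = k}"
      if "k < Suc n" for k using that by auto
    then show ?thesis unfolding p
      by (subst sum.group[symmetric, where T="{..<Suc n}" and g="\<lambda>\<alpha>. sum \<alpha> UNIV"])
         (auto simp: finite_multiindex intro!: sum.cong)
  qed
  then show "p \<in> polys_lt (Suc n)" unfolding polys_lt_def
    by (auto simp: intro!: exI[of _ "\<lambda>k x. \<Sum>\<alpha> | sum \<alpha> UNIV = k. c \<alpha> * monomial_fun \<alpha> x"]
        hom_sum hom_cmul hom_monomial)
next
  fix p :: "real ^ 'n \<Rightarrow> real" assume "p \<in> polys_lt (Suc n)"
  then obtain q where q: "\<forall>k. hom k (q k)" and p: "p = (\<lambda>x. \<Sum>k<Suc n. q k x)"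
    unfolding polys_lt_def by auto
  have "\<exists>c. \<forall>x. q k x = (\<Sum>\<alpha> | sum \<alpha> UNIV = k. c \<alpha> * monomial_fun \<alpha> x)" for k
    using q unfolding homogeneous_polys_hom[symmetric] homogeneous_polys_def by (fastforce simp: fun_eq_iff)
  then obtain c where c: "\<And>k x. q k x = (\<Sum>\<alpha> | sum \<alpha> UNIV = k. c k \<alpha> * monomial_fun \<alpha> x)" by metis
  have "p x = (\<Sum>\<alpha> | sum \<alpha> UNIV \<le> n. c (sum \<alpha> UNIV) \<alpha> * monomial_fun \<alpha> x)" for x
  proof -
    have "{\<alpha> :: 'n \<Rightarrow> nat. sum \<alpha> UNIV \<le> n \<and> sum \<alpha> UNIV = k} = {\<alpha>. sum \<alpha> UNIV = k}"
      if "k < Suc n" for k using that by auto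
    then show ?thesis unfolding p c
      by (subst sum.group[symmetric, where T="{..<Suc n}" and g="\<lambda>\<alpha>. sum \<alpha> UNIV"])
         (auto simp: finite_multiindex intro!: sum.cong)
  qed
  then show "p \<in> polys_le n" unfolding polys_le_def by (auto intro!: exI[of _ "\<lambda>\<alpha>. c (sum \<alpha> UNIV) \<alpha>"])
qed

lemma polys_ltI: "(\<And>k. hom k (q k)) \<Longrightarrow> (\<lambda>x. \<Sum>k<n. q k x) \<in> polys_lt n"
  unfolding polys_lt_def by blast

lemma polys_lt_add:
  assumes "p \<in> polys_lt n" "q \<in> polys_lt n" shows "(\<lambda>x. p x + q x) \<in> polys_lt n"
proof -
  from assms obtain f g where "\<forall>k. hom k (f k)" "p = (\<lambda>x. \<Sum>k<n. f k x)"
    "\<forall>k. hom k (g k)" "q = (\<lambda>x. \<Sum>k<n. g k x)" unfolding polys_lt_def by auto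
  then show ?thesis using polys_ltI[of "\<lambda>k x. f k x + g k x" n]
    by (auto simp: sum.distrib intro: hom.add)
qed

lemma polys_lt_cmul:
  assumes "p \<in> polys_lt n" shows "(\<lambda>x. c * p x) \<in> polys_lt n"
proof -
  from assms obtain f where "\<forall>k. hom k (f k)" "p = (\<lambda>x. \<Sum>k<n. f k x)" unfolding polys_lt_def by auto
  then show ?thesis using polys_ltI[of "\<lambda>k x. c * f k x" n]
    by (auto simp: sum_distrib_left intro: hom_cmul)
qed

lemma polys_lt_zero: "(\<lambda>x. 0) \<in> polys_lt n"
  using polys_ltI[of "\<lambda>k x. 0" n] by (simp add: hom_zero)

lemma polys_lt_diff:
  "p \<in> polys_lt n \<Longrightarrow> q \<in> polys_lt n \<Longrightarrow> (\<lambda>x. p x - q x) \<in> polys_lt n"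
  using polys_lt_add[of p n "\<lambda>x. (-1) * q x"] polys_lt_cmul[of q n "-1"] by simp

lemma polys_lt_sum:
  "(\<And>i. i \<in> A \<Longrightarrow> f i \<in> polys_lt n) \<Longrightarrow> (\<lambda>x. \<Sum>i\<in>A. f i x) \<in> polys_lt n"
  by (induction A rule: infinite_finite_induct) (auto intro: polys_lt_zero polys_lt_add)

lemma hom_polys_lt: "hom k p \<Longrightarrow> k < n \<Longrightarrow> p \<in> polys_lt n"
proof -
  assume "hom k p" "k < n"
  moreover from this have "p = (\<lambda>x. \<Sum>j<n. (if j = k then p x else 0))" by simp
  moreover have "hom j (\<lambda>x. if j = k then p x else 0)" for j
    using \<open>hom k p\<close> by (auto intro: hom_if)
  ultimately show ?thesis using polys_ltI[of "\<lambda>j x. if j = k then p x else 0" n] by simp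
qed

lemma polys_lt_mono: "m \<le> n \<Longrightarrow> p \<in> polys_lt m \<Longrightarrow> p \<in> polys_lt n"
proof -
  assume "m \<le> n" "p \<in> polys_lt m"
  then obtain f where "\<forall>k. hom k (f k)" "p = (\<lambda>x. \<Sum>k<m. f k x)" unfolding polys_lt_def by auto
  with \<open>m \<le> n\<close> show ?thesis by (auto intro!: polys_lt_sum hom_polys_lt)
qed

lemma polys_lt_0: "p \<in> polys_lt 0 \<Longrightarrow> p = (\<lambda>x. 0)"
  unfolding polys_lt_def by auto

lemma polys_lt_SucE:
  assumes "p \<in> polys_lt (Suc n)"
  obtains q r where "q \<in> polys_lt n" "hom n r" "p = (\<lambda>x. q x + r x)"
proof -
  from assms obtain f where "\<forall>k. hom k (f k)" "p = (\<lambda>x. \<Sum>k<Suc n. f k x)" unfolding polys_lt_def by auto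
  then show ?thesis using that[of "\<lambda>x. \<Sum>k<n. f k x" "f n"] polys_ltI[of f n] by auto
qed

lemma polys_lt_mult_hom:
  assumes "p \<in> polys_lt n" "hom m r"
  shows "(\<lambda>x. r x * p x) \<in> polys_lt (m + n)"
proof -
  from assms obtain f where f: "\<forall>k. hom k (f k)" "p = (\<lambda>x. \<Sum>k<n. f k x)" unfolding polys_lt_def by auto
  have "(\<lambda>x. \<Sum>k<n. r x * f k x) \<in> polys_lt (m + n)"
    using hom_mult[OF assms(2)] f by (intro polys_lt_sum hom_polys_lt[of "m + k" for k]) auto
  then show ?thesis by (simp add: f sum_distrib_left)
qed

lemma polys_lt_continuous: "p \<in> polys_lt n \<Longrightarrow> continuous_on S p"
  unfolding polys_lt_def by (auto intro!: continuous_on_sum intro: hom_continuous)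

text \<open>On the ray through x the homogeneous components of \<open>p\<close> are the coefficients
  of a polynomial in the scale \<open>s\<close>, which has infinitely many roots if \<open>p\<close>
  vanishes on the open ball. This makes the inner product on the ball definite on
  polynomials.\<close>

lemma polys_lt_zero_on_ball:
  assumes p: "p \<in> polys_lt n" and z: "\<And>x. norm x < 1 \<Longrightarrow> p x = 0"
  shows "p = (\<lambda>x. 0)"
proof
  fix x
  from p obtain f where f: "\<forall>k. hom k (f k)" "p = (\<lambda>x. \<Sum>k<n. f k x)" unfolding polys_lt_def by auto
  \<comment> \<open>The bound 1/(|x| + 1) keeps s x in the open unit ball and is defined for x = 0
    too.\<close>
  have *: "(\<Sum>k<n. f k x * s ^ k) = 0" if "0 < s" "s < inverse (norm x + 1)" for s
  proof -
    have "s * norm x < 1"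
    proof -
      have "s * norm x \<le> s * (norm x + 1)" using that by simp
      also have "\<dots> < inverse (norm x + 1) * (norm x + 1)"
        using that norm_ge_zero[of x] by (intro mult_strict_right_mono) linarith+
      also have "\<dots> = 1" using norm_ge_zero[of x] by (intro left_inverse) linarith
      finally show ?thesis .
    qed
    then have "p (s *\<^sub>R x) = 0" using that by (intro z) simp
    then show ?thesis using f by (simp add: hom_scale[OF f(1)[rule_format]] mult.commute)
  qed
  \<comment> \<open>\<open>polyfun_finite_roots\<close> expects an inclusive upper index; padding
    with 0 covers n = 0, where n - 1 is truncated.\<close>
  have c0: "\<forall>k\<le>n - 1. (if k < n then f k x else 0) = 0"
  proof (rule ccontr)
    assume "\<not> ?thesis"
    then have "finite {s. (\<Sum>k\<le>n - 1. (if k < n then f k x else 0) * s ^ k) = 0}"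
      using polyfun_finite_roots[of "\<lambda>k. if k < n then f k x else 0" "n - 1"] by blast
    moreover have "{0<..<inverse (norm x + 1)} \<subseteq> {s. (\<Sum>k\<le>n - 1. (if k < n then f k x else 0) * s ^ k) = 0}"
    proof
      fix s assume "s \<in> {0<..<inverse (norm x + 1)}"
      moreover have "(\<Sum>k\<le>n - 1. (if k < n then f k x else 0) * s ^ k) = (\<Sum>k<n. f k x * s ^ k)"
        by (cases n) (auto simp: lessThan_Suc_atMost intro!: sum.cong)
      ultimately show "s \<in> {s. (\<Sum>k\<le>n - 1. (if k < n then f k x else 0) * s ^ k) = 0}" using * by simp
    qed
    ultimately have "finite {0<..<inverse (norm x + 1)}" using finite_subset by blast
    then show False using infinite_Ioo[of 0 "inverse (norm x + 1)"]
      by (metis add_nonneg_pos inverse_positive_iff_positive norm_ge_zero zero_less_one)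
  qed
  have "f k x = 0" if "k < n" for k
  proof -
    have "k \<le> n - 1" using that by simp
    then have "(if k < n then f k x else 0) = 0" using c0 by blast
    then show ?thesis using that by simp
  qed
  then have "(\<Sum>k<n. f k x) = 0" by (intro sum.neutral) auto
  then show "p x = 0" using f(2) by simp
qed

section \<open>Reflections and Dunkl operators\<close>

lemma reflection_linear: "linear (reflection v)"
  unfolding reflection_def
  by (rule linearI) (simp_all add: inner_add_left algebra_simps add_divide_distrib)

lemma reflection_inner:
  assumes "v \<noteq> 0" shows "reflection v x \<bullet> v = - (x \<bullet> v)"
  using assms by (simp add: reflection_def inner_diff_left power2_norm_eq_inner field_simps)

lemma reflection_involution [simp]: "reflection v (reflection v x) = x"
proof (cases "v = 0")
  case False
  have "reflection v (reflection v x) = reflection v x - (2 * (reflection v x \<bullet> v) / (norm v)\<^sup>2) *\<^sub>R v"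
    by (subst reflection_def) simp
  also have "\<dots> = x" unfolding reflection_inner[OF False] by (simp add: reflection_def)
  finally show ?thesis .
qed (simp add: reflection_def)

lemma reflection_inner_commute: "reflection v x \<bullet> y = x \<bullet> reflection v y"
  by (simp add: reflection_def inner_diff_left inner_diff_right inner_commute)

lemma reflection_norm [simp]: "norm (reflection v x) = norm x"
  by (simp add: norm_eq_sqrt_inner reflection_inner_commute)

lemma hom_reflection: "hom n p \<Longrightarrow> hom n (\<lambda>x. p (reflection v x))"
  by (rule hom_compose_linear[OF _ reflection_linear])

lemma sum_reflection_axis: "(\<Sum>i\<in>UNIV. x $ i * v $ i) = x \<bullet> v"
  by (simp add: inner_vec_def)

text \<open>A finite union of hyperplanes is negligible and so contains no nonempty open
  set.\<close>

lemma closure_regular: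
  fixes Rp :: "(real ^ 'n) set"
  assumes "finite Rp" "0 \<notin> Rp"
  shows "closure {x :: real ^ 'n. \<forall>v\<in>Rp. x \<bullet> v \<noteq> 0} = UNIV"
proof -
  have neg: "negligible (\<Union>v\<in>Rp. {x :: real ^ 'n. v \<bullet> x = 0})"
    using assms by (intro negligible_Union_nat negligible_Union) (auto intro!: negligible_hyperplane)
  have "interior (\<Union>v\<in>Rp. {x :: real ^ 'n. v \<bullet> x = 0}) = {}"
    using negligible_subset[OF neg interior_subset] open_not_negligible[OF open_interior] by blast
  moreover have "{x. \<forall>v\<in>Rp. x \<bullet> v \<noteq> 0} = - (\<Union>v\<in>Rp. {x. v \<bullet> x = 0})"
    by (auto simp: inner_commute)
  ultimately show ?thesis by (simp only: closure_complement) simp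
qed

lemma eq_on_regular:
  fixes Rp :: "(real ^ 'n) set"
  assumes "finite Rp" "0 \<notin> Rp" "continuous_on UNIV f" "continuous_on UNIV g"
    and "\<And>x. \<forall>v\<in>Rp. x \<bullet> v \<noteq> 0 \<Longrightarrow> f x = (g x :: real)"
  shows "f x = g x"
  using continuous_constant_on_closure[of "{x. \<forall>v\<in>Rp. x \<bullet> v \<noteq> 0}" "\<lambda>x. f x - g x" 0 x]
    closure_regular[OF assms(1,2)] assms(3-) by (auto intro: continuous_intros)

section \<open>Positive roots under a reflection\<close>

locale dunkl_setting =
  fixes G :: "(real ^ 'n \<Rightarrow> real ^ 'n) set"
    and Rp :: "(real ^ 'n) set"
    and \<kappa> :: "real ^ 'n \<Rightarrow> real"
    and V :: "(real ^ 'n \<Rightarrow> real) \<Rightarrow> (real ^ 'n \<Rightarrow> real)"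
  assumes dim: "CARD('n) \<ge> 2"
    and roots: "positive_root_system G Rp"
    and mult: "multiplicity_function G Rp \<kappa>"
    and V: "intertwining_operator Rp \<kappa> V"
begin

abbreviation "gam \<equiv> gamma_kappa Rp \<kappa>"

text \<open>The Gegenbauer index of the sphere with weight h^2, usually written \<lambda>_\<kappa>.
  It is 0 if d = 2 and all multiplicities vanish, so a denominator \<open>real m + lk\<close>
  requires m > 0 or a vanishing numerator.\<close>

definition lk :: real where "lk = gam + (real CARD('n) - 2) / 2"

abbreviation D :: "'n \<Rightarrow> (real ^ 'n \<Rightarrow> real) \<Rightarrow> real ^ 'n \<Rightarrow> real"
  where "D \<equiv> dunkl_operator Rp \<kappa>"

definition regular :: "real ^ 'n \<Rightarrow> bool" where "regular x \<longleftrightarrow> (\<forall>v\<in>Rp. x \<bullet> v \<noteq> 0)"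

lemma finite_Rp [simp]: "finite Rp"
  using roots unfolding positive_root_system_def root_system_def by auto

lemma zero_notin_Rp [simp]: "0 \<notin> Rp"
  using roots unfolding positive_root_system_def root_system_def by auto

lemma Rp_nonzero: "v \<in> Rp \<Longrightarrow> v \<noteq> 0" by auto

lemma kappa_nonneg: "v \<in> Rp \<Longrightarrow> \<kappa> v \<ge> 0"
  using mult unfolding multiplicity_function_def by auto

lemma gam_nonneg: "gam \<ge> 0"
  unfolding gamma_kappa_def by (intro sum_nonneg kappa_nonneg)

lemma lk_nonneg: "lk \<ge> 0"
  using gam_nonneg dim by (simp add: lk_def)

text \<open>The reflected root is a root again, so it or its negative lies on the positive side of
  the hyperplane that defines \<open>Rp\<close>. Invariance of \<kappa> is formulated up to sign for
  exactly this ambiguity.\<close>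

lemma reflect_Rp:
  assumes "u \<in> Rp" "w \<in> Rp"
  obtains w' where "w' \<in> Rp" "reflection u w = w' \<or> reflection u w = - w'" "\<kappa> w' = \<kappa> w"
proof -
  from roots obtain R z where R: "root_system R" "G = reflection_group R" "\<forall>v\<in>R. v \<bullet> z \<noteq> 0"
    "Rp = {v \<in> R. v \<bullet> z > 0}" unfolding positive_root_system_def by auto
  have uR: "u \<in> R" "w \<in> R" using assms R by auto
  have refl: "reflection v v = - v" if "v \<noteq> 0" for v :: "real ^ 'n"
    using that by (simp add: reflection_def power2_norm_eq_inner scaleR_2[symmetric] algebra_simps)
  have img: "reflection v x \<in> R" if "v \<in> R" "x \<in> R" for v x
    using R(1) that unfolding root_system_def by blast
  have neg: "- x \<in> R" if "x \<in> R" for x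
    using img[OF that that] refl[of x] R(1) that unfolding root_system_def by (metis (full_types))
  have g: "reflection u \<in> G"
    using reflection_group.step[OF uR(1) reflection_group.id] R(2) by simp
  have inv: "\<kappa> w = \<kappa> w'" if "w' \<in> Rp" "reflection u w = w' \<or> reflection u w = - w'" for w'
    using mult g assms that unfolding multiplicity_function_def by blast
  show ?thesis
  proof (cases "reflection u w \<bullet> z > 0")
    case True
    then have "reflection u w \<in> Rp" using R img uR by auto
    with inv[of "reflection u w"] show ?thesis by (intro that) auto
  next
    case False
    then have "- reflection u w \<in> Rp" using R img[OF uR] neg[OF img[OF uR]]
      by (auto simp: inner_minus_left less_le)
    with inv[of "- reflection u w"] show ?thesis by (intro that[of "- reflection u w"]) auto
  qed
qed

lemma not_both_Rp: "w \<in> Rp \<Longrightarrow> - w \<notin> Rp"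
  using roots unfolding positive_root_system_def by auto

text \<open>Reflecting and then correcting the sign permutes the positive roots and preserves
  \<kappa>. Functions even in the inner products with the roots, such as those in \<open>h2\<close>
  and \<open>hreg\<close>, see a plain permutation.\<close>

lemma root_permutation:
  assumes u: "u \<in> Rp"
  obtains f where "bij_betw f Rp Rp" "\<And>w. w \<in> Rp \<Longrightarrow> \<kappa> (f w) = \<kappa> w"
    "\<And>x w. reflection u x \<bullet> w = x \<bullet> f w \<or> reflection u x \<bullet> w = - (x \<bullet> f w)"
proof -
  define f where "f w = (if reflection u w \<in> Rp then reflection u w else - reflection u w)" for w
  have f: "f w \<in> Rp \<and> \<kappa> (f w) = \<kappa> w" if "w \<in> Rp" for w
  proof -
    from reflect_Rp[OF u that] obtain w' where w': "w' \<in> Rp"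
      "reflection u w = w' \<or> reflection u w = - w'" "\<kappa> w' = \<kappa> w" .
    then show ?thesis using not_both_Rp[of w'] by (auto simp: f_def)
  qed
  have ff: "f (f w) = w" if "w \<in> Rp" for w
  proof -
    have "reflection u (- reflection u w) = - w"
      by (simp add: linear_neg[OF reflection_linear])
    then show ?thesis using that not_both_Rp[of w] by (auto simp: f_def)
  qed
  show ?thesis
  proof (rule that[of f])
    show "bij_betw f Rp Rp" using f ff by (intro bij_betwI[where g=f]) auto
    show "reflection u x \<bullet> w = x \<bullet> f w \<or> reflection u x \<bullet> w = - (x \<bullet> f w)" for x w
      by (auto simp: f_def reflection_inner_commute)
  qed (use f in auto)
qed

lemma sum_roots_reflection:
  fixes \<psi> :: "real \<Rightarrow> real \<Rightarrow> real"
  assumes u: "u \<in> Rp" and even: "\<And>s k. \<psi> (- s) k = \<psi> s k"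
  shows "(\<Sum>w\<in>Rp. \<psi> (reflection u x \<bullet> w) (\<kappa> w)) = (\<Sum>w\<in>Rp. \<psi> (x \<bullet> w) (\<kappa> w))"
proof -
  from root_permutation[OF u] obtain f where f: "bij_betw f Rp Rp" "\<And>w. w \<in> Rp \<Longrightarrow> \<kappa> (f w) = \<kappa> w"
    "\<And>x w. reflection u x \<bullet> w = x \<bullet> f w \<or> reflection u x \<bullet> w = - (x \<bullet> f w)" by blast
  have "\<psi> (reflection u x \<bullet> w) (\<kappa> w) = \<psi> (x \<bullet> f w) (\<kappa> (f w))" if "w \<in> Rp" for w
    using f(2)[OF that] f(3)[of x w] even by auto
  then show ?thesis using sum.reindex_bij_betw[OF f(1), of "\<lambda>w. \<psi> (x \<bullet> w) (\<kappa> w)"] by simp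
qed

lemma prod_roots_reflection:
  fixes \<psi> :: "real \<Rightarrow> real \<Rightarrow> real"
  assumes u: "u \<in> Rp" and even: "\<And>s k. \<psi> (- s) k = \<psi> s k"
  shows "(\<Prod>w\<in>Rp. \<psi> (reflection u x \<bullet> w) (\<kappa> w)) = (\<Prod>w\<in>Rp. \<psi> (x \<bullet> w) (\<kappa> w))"
proof -
  from root_permutation[OF u] obtain f where f: "bij_betw f Rp Rp" "\<And>w. w \<in> Rp \<Longrightarrow> \<kappa> (f w) = \<kappa> w"
    "\<And>x w. reflection u x \<bullet> w = x \<bullet> f w \<or> reflection u x \<bullet> w = - (x \<bullet> f w)" by blast
  have "\<psi> (reflection u x \<bullet> w) (\<kappa> w) = \<psi> (x \<bullet> f w) (\<kappa> (f w))" if "w \<in> Rp" for w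
    using f(2)[OF that] f(3)[of x w] even by auto
  then show ?thesis using prod.reindex_bij_betw[OF f(1), of "\<lambda>w. \<psi> (x \<bullet> w) (\<kappa> w)"] by simp
qed

section \<open>The intertwining operator and the algebra of the Dunkl operators\<close>

lemmas V_facts = V[unfolded intertwining_operator_def]

lemma V_add_poly:
  "real_polynomial_function p \<Longrightarrow> real_polynomial_function q \<Longrightarrow> V (\<lambda>x. p x + q x) = (\<lambda>x. V p x + V q x)"
  by (rule V_facts[THEN conjunct1, rule_format])

lemma V_cmul_poly: "real_polynomial_function p \<Longrightarrow> V (\<lambda>x. c * p x) = (\<lambda>x. c * V p x)"
  by (rule V_facts[THEN conjunct2, THEN conjunct1, rule_format])

lemma V_add: "hom m p \<Longrightarrow> hom n q \<Longrightarrow> V (\<lambda>x. p x + q x) = (\<lambda>x. V p x + V q x)"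
  by (intro V_add_poly hom_real_polynomial)

lemma V_cmul: "hom n p \<Longrightarrow> V (\<lambda>x. c * p x) = (\<lambda>x. c * V p x)"
  by (intro V_cmul_poly hom_real_polynomial)

lemma V_one: "V (\<lambda>x. 1) = (\<lambda>x. 1)"
  using V_facts by (elim conjE)

lemma V_zero: "V (\<lambda>x. 0) = (\<lambda>x. 0)"
  using V_cmul[OF hom.const, of 0 0] by simp

lemma V_image: "V ` homogeneous_polys n = homogeneous_polys n"
  by (rule V_facts[THEN conjunct2, THEN conjunct2, THEN conjunct2, THEN conjunct1, rule_format])

lemma V_hom: "hom n p \<Longrightarrow> hom n (V p)"
  using V_image[of n] homogeneous_polys_hom by blast

text \<open>Since \<open>q = V p\<close>, the relation
  \<open>D i (V p) = V (partial_deriv i p)\<close> transfers degree, linearity and commutation from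
  the partial derivatives to \<open>D i\<close>.\<close>

lemma V_surjE:
  assumes "hom n q" obtains p where "hom n p" "q = V p"
proof -
  have "q \<in> V ` homogeneous_polys n" by (simp only: V_image homogeneous_polys_hom assms)
  then show ?thesis using that homogeneous_polys_hom by (auto elim!: imageE)
qed

lemma V_D: "hom n p \<Longrightarrow> D i (V p) = V (partial_deriv i p)"
  by (intro V_facts[THEN conjunct2, THEN conjunct2, THEN conjunct2, THEN conjunct2, rule_format] hom_real_polynomial)

lemma V_sum_real_polynomial:
  assumes "\<And>i. i \<in> A \<Longrightarrow> real_polynomial_function (f i)"
  shows "V (\<lambda>x. \<Sum>i\<in>A. f i x) = (\<lambda>x. \<Sum>i\<in>A. V (f i) x)"
  using assms
proof (induction A rule: infinite_finite_induct)
  case (insert a A)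
  have "V (\<lambda>x. f a x + (\<Sum>i\<in>A. f i x)) = (\<lambda>x. V (f a) x + V (\<lambda>x. \<Sum>i\<in>A. f i x) x)"
    using insert.prems by (intro V_add_poly real_polynomial_function_sum insert.hyps) auto
  then show ?case using insert by simp
qed (simp_all add: V_zero)

lemma D_hom: "hom n q \<Longrightarrow> hom (n - 1) (D i q)"
proof -
  assume "hom n q"
  then obtain p where p: "hom n p" "q = V p" by (rule V_surjE)
  then show ?thesis using V_hom[OF partial_deriv_pred[OF p(1)]] by (simp add: V_D[OF p(1)])
qed

lemma D_hom_Suc: "hom (Suc n) q \<Longrightarrow> hom n (D i q)"
  using D_hom[of "Suc n"] by simp

lemma D_hom_0: "hom 0 q \<Longrightarrow> D i q = (\<lambda>x. 0)"
proof -
  assume "hom 0 q"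
  then obtain p where p: "hom 0 p" "q = V p" by (rule V_surjE)
  then show ?thesis by (simp add: V_D[OF p(1)] partial_deriv_hom_0 V_zero)
qed

lemma D_add:
  assumes "hom n p" "hom n q"
  shows "D i (\<lambda>x. p x + q x) = (\<lambda>x. D i p x + D i q x)"
proof -
  obtain f where f: "hom n f" "p = V f" using V_surjE[OF assms(1)] .
  obtain g where g: "hom n g" "q = V g" using V_surjE[OF assms(2)] .
  have "D i (\<lambda>x. p x + q x) = D i (V (\<lambda>x. f x + g x))" using V_add[OF f(1) g(1)] f g by simp
  also have "\<dots> = V (partial_deriv i (\<lambda>x. f x + g x))" using f g by (intro V_D hom.add)
  also have "partial_deriv i (\<lambda>x. f x + g x) = (\<lambda>x. partial_deriv i f x + partial_deriv i g x)"
    using f g by (intro ext partial_deriv_add hom_differentiable)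
  finally show ?thesis using V_add[OF partial_deriv_pred partial_deriv_pred, OF f(1) g(1)]
    V_D[OF f(1)] V_D[OF g(1)] f g by simp
qed

lemma D_cmul:
  assumes "hom n p"
  shows "D i (\<lambda>x. c * p x) = (\<lambda>x. c * D i p x)"
proof -
  obtain f where f: "hom n f" "p = V f" using V_surjE[OF assms] .
  have "D i (\<lambda>x. c * p x) = D i (V (\<lambda>x. c * f x))" using V_cmul[OF f(1)] f by simp
  also have "\<dots> = V (partial_deriv i (\<lambda>x. c * f x))" using f by (intro V_D hom_cmul)
  also have "partial_deriv i (\<lambda>x. c * f x) = (\<lambda>x. c * partial_deriv i f x)"
    using f by (intro ext partial_deriv_cmul)
  finally show ?thesis using V_cmul[OF partial_deriv_pred, OF f(1)] V_D[OF f(1)] f by simp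
qed

lemma D_zero: "D i (\<lambda>x. 0) = (\<lambda>x. 0)"
  using D_hom_0[OF hom.const] .

lemma D_diff:
  assumes "hom n p" "hom n q"
  shows "D i (\<lambda>x. p x - q x) = (\<lambda>x. D i p x - D i q x)"
  using D_add[OF assms(1) hom_cmul[OF assms(2), of "-1"]] D_cmul[OF assms(2), of i "-1"] by simp

lemma D_sum: "(\<And>a. a \<in> A \<Longrightarrow> hom n (f a)) \<Longrightarrow> D i (\<lambda>x. \<Sum>a\<in>A. f a x) = (\<lambda>x. \<Sum>a\<in>A. D i (f a) x)"
proof (induction A rule: infinite_finite_induct)
  case (insert a A)
  then show ?case using D_add[of n "f a" "\<lambda>x. \<Sum>a\<in>A. f a x"] by (simp add: hom_sum)
qed (simp_all add: D_zero)

lemma D_commute: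
  assumes "hom n p" shows "D i (D j p) = D j (D i p)"
proof -
  obtain f where f: "hom n f" "p = V f" using V_surjE[OF assms] .
  have "D i (D j p) = V (partial_deriv i (partial_deriv j f))" for i j
    using V_D[OF f(1)] V_D[OF partial_deriv_pred[OF f(1)]] f(2) by simp
  then show ?thesis using partial_deriv_commute[OF f(1)] by simp
qed

section \<open>Commutation relations with the coordinates\<close>

lemma D_regular:
  "regular x \<Longrightarrow> D i f x = partial_deriv i f x + (\<Sum>v\<in>Rp. \<kappa> v * ((f x - f (reflection v x)) / (x \<bullet> v)) * v $ i)"
  unfolding dunkl_operator_def diff_quotient_def regular_def by simp

text \<open>Off the root hyperplanes \<open>diff_quotient\<close> is an honest quotient and
  identities are plain algebra. The remaining points follow by continuity, which
  \<open>D_hom\<close> supplies for images of polynomials.\<close>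

lemma eqI_regular:
  assumes "continuous_on UNIV f" "continuous_on UNIV g" "\<And>x. regular x \<Longrightarrow> f x = (g x :: real)"
  shows "f x = g x"
  using eq_on_regular[OF finite_Rp zero_notin_Rp assms(1,2)] assms(3) unfolding regular_def by blast

text \<open>The commutator of \<open>D i\<close> with multiplication by x_j. It is symmetric in i
  and j, on which the computation of the Laplacian relies.\<close>

definition C :: "'n \<Rightarrow> 'n \<Rightarrow> (real ^ 'n \<Rightarrow> real) \<Rightarrow> real ^ 'n \<Rightarrow> real" where
  "C i j p x = (if i = j then p x else 0) + (\<Sum>v\<in>Rp. 2 * \<kappa> v * (v $ i * v $ j) / (norm v)\<^sup>2 * p (reflection v x))"

lemma C_sym: "C i j p = C j i p"
  by (auto simp: C_def fun_eq_iff mult_ac)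

lemma hom_C: "hom n p \<Longrightarrow> hom n (C i j p)"
  unfolding C_def[abs_def] by (intro hom.add hom_if hom_sum hom_cmul hom_reflection)

text \<open>In coordinate j the reflected vector differs from x by a multiple of
  \<open>x \<bullet> v\<close>. This cancels the denominator of the difference quotient and leaves
  values of \<open>p\<close> at reflected points.\<close>

lemma D_coord_mult:
  assumes p: "hom n p"
  shows "D i (\<lambda>x. x $ j * p x) x = x $ j * D i p x + C i j p x"
proof (rule eqI_regular)
  show "continuous_on UNIV (D i (\<lambda>x. x $ j * p x))"
    using D_hom_Suc[OF hom.coord[OF p]] by (rule hom_continuous)
  show "continuous_on UNIV (\<lambda>x. x $ j * D i p x + C i j p x)"
    by (intro continuous_intros hom_continuous[OF D_hom[OF p]] hom_continuous[OF hom_C[OF p]])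
  fix x assume x: "regular x"
  have "\<kappa> v * ((x $ j * p x - reflection v x $ j * p (reflection v x)) / (x \<bullet> v)) * v $ i
     = x $ j * (\<kappa> v * ((p x - p (reflection v x)) / (x \<bullet> v)) * v $ i)
      + 2 * \<kappa> v * (v $ i * v $ j) / (norm v)\<^sup>2 * p (reflection v x)" if "v \<in> Rp" for v
  proof -
    have "reflection v x $ j = x $ j - 2 * (x \<bullet> v) / (norm v)\<^sup>2 * v $ j" by (simp add: reflection_def)
    moreover have "x \<bullet> v \<noteq> 0" "(norm v)\<^sup>2 \<noteq> 0" using x that by (auto simp: regular_def)
    ultimately show ?thesis by (simp only:) (simp add: field_simps)
  qed
  then show "D i (\<lambda>x. x $ j * p x) x = x $ j * D i p x + C i j p x"
    using x by (simp add: D_regular C_def partial_deriv_coord_mult[OF p] distrib_left sum.distrib sum_distrib_left)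
qed

text \<open>The Euler operator with \<open>D i\<close> in place of the partial derivatives. In
  general it is not a scalar on homogeneous polynomials; \<open>E_eq\<close> exhibits the additional
  reflection terms.\<close>

definition E :: "(real ^ 'n \<Rightarrow> real) \<Rightarrow> real ^ 'n \<Rightarrow> real" where
  "E p x = (\<Sum>i\<in>UNIV. x $ i * D i p x)"

lemma hom_E: "hom n p \<Longrightarrow> hom n (E p)"
  unfolding E_def[abs_def] using D_hom_0 D_hom_Suc
  by (cases n) (auto intro!: hom_sum hom.coord hom_zero)

text \<open>Summing x_i v_i over i gives \<open>x \<bullet> v\<close>, so the difference quotients
  lose their denominators.\<close>

lemma E_eq:
  assumes p: "hom n p"
  shows "E p x = real n * p x + (\<Sum>v\<in>Rp. \<kappa> v * (p x - p (reflection v x)))"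
proof (rule eqI_regular)
  show "continuous_on UNIV (E p)" using hom_continuous[OF hom_E[OF p]] .
  show "continuous_on UNIV (\<lambda>x. real n * p x + (\<Sum>v\<in>Rp. \<kappa> v * (p x - p (reflection v x))))"
    by (intro continuous_intros hom_continuous[OF p] hom_continuous[OF hom_reflection[OF p]])
  fix x assume x: "regular x"
  have "E p x = (\<Sum>i\<in>UNIV. x $ i * partial_deriv i p x)
     + (\<Sum>i\<in>UNIV. \<Sum>v\<in>Rp. x $ i * (\<kappa> v * ((p x - p (reflection v x)) / (x \<bullet> v)) * v $ i))"
    using x by (simp add: E_def D_regular distrib_left sum.distrib sum_distrib_left)
  also have "(\<Sum>i\<in>UNIV. \<Sum>v\<in>Rp. x $ i * (\<kappa> v * ((p x - p (reflection v x)) / (x \<bullet> v)) * v $ i))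
     = (\<Sum>v\<in>Rp. \<kappa> v * ((p x - p (reflection v x)) / (x \<bullet> v)) * (\<Sum>i\<in>UNIV. x $ i * v $ i))"
    unfolding sum_distrib_left by (subst sum.swap) (intro sum.cong refl, simp)
  also have "\<dots> = (\<Sum>v\<in>Rp. \<kappa> v * (p x - p (reflection v x)))"
    using x by (intro sum.cong) (auto simp: sum_reflection_axis regular_def)
  finally show "E p x = real n * p x + (\<Sum>v\<in>Rp. \<kappa> v * (p x - p (reflection v x)))"
    using euler_hom[OF p] by simp
qed

definition Lap :: "(real ^ 'n \<Rightarrow> real) \<Rightarrow> real ^ 'n \<Rightarrow> real" where
  "Lap p x = (\<Sum>i\<in>UNIV. D i (D i p) x)"

text \<open>The reflections in twice \<open>E\<close> and in the trace of the commutators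
  \<open>C i i\<close> cancel, and all that remains of the roots is \<gamma>. The scalar equals 2n +
  d + 2\<gamma>.\<close>

lemma E_plus_adjoint:
  assumes p: "hom n p"
  shows "E p x + (\<Sum>i\<in>UNIV. D i (\<lambda>x. x $ i * p x) x) = 2 * (real n + lk + 1) * p x"
proof -
  have "(\<Sum>i\<in>UNIV. C i i p x) = real CARD('n) * p x
     + (\<Sum>i\<in>UNIV. \<Sum>v\<in>Rp. 2 * \<kappa> v * (v $ i * v $ i) / (norm v)\<^sup>2 * p (reflection v x))"
    by (simp add: C_def sum.distrib)
  also have "(\<Sum>i\<in>UNIV. \<Sum>v\<in>Rp. 2 * \<kappa> v * (v $ i * v $ i) / (norm v)\<^sup>2 * p (reflection v x))
     = (\<Sum>v\<in>Rp. 2 * \<kappa> v * (\<Sum>i\<in>UNIV. v $ i * v $ i) / (norm v)\<^sup>2 * p (reflection v x))"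
    by (subst sum.swap) (simp add: sum_distrib_left sum_distrib_right sum_divide_distrib)
  also have "\<dots> = (\<Sum>v\<in>Rp. 2 * \<kappa> v * p (reflection v x))"
    by (intro sum.cong) (auto simp: sum_reflection_axis power2_norm_eq_inner)
  finally have C: "(\<Sum>i\<in>UNIV. C i i p x) = real CARD('n) * p x + (\<Sum>v\<in>Rp. 2 * \<kappa> v * p (reflection v x))" .
  have "(\<Sum>i\<in>UNIV. D i (\<lambda>x. x $ i * p x) x) = E p x + (\<Sum>i\<in>UNIV. C i i p x)"
    by (simp add: D_coord_mult[OF p] E_def sum.distrib)
  then have "E p x + (\<Sum>i\<in>UNIV. D i (\<lambda>x. x $ i * p x) x) = 2 * E p x + (\<Sum>i\<in>UNIV. C i i p x)" by simp
  also have "\<dots> = 2 * real n * p x + real CARD('n) * p x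
      + (\<Sum>v\<in>Rp. 2 * \<kappa> v * (p x - p (reflection v x)) + 2 * \<kappa> v * p (reflection v x))"
    by (simp add: E_eq[OF p] C sum_distrib_left sum.distrib mult.assoc)
  also have "(\<Sum>v\<in>Rp. 2 * \<kappa> v * (p x - p (reflection v x)) + 2 * \<kappa> v * p (reflection v x)) = 2 * gam * p x"
    unfolding gamma_kappa_def sum_distrib_left sum_distrib_right by (intro sum.cong) (auto simp: algebra_simps)
  finally show ?thesis by (simp add: lk_def field_simps)
qed

text \<open>Expanding leaves a sum over j of \<open>C i j\<close> composed with \<open>D j\<close>
  on either side. Read as commutators, these terms become \<open>D i\<close> applied to the scalar
  of \<open>E_plus_adjoint\<close> in degree n, minus the same scalar in degree n - 1 applied to
  \<open>D i p\<close>; no double sum over roots has to be evaluated.\<close>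

lemma Lap_coord_mult:
  assumes p: "hom n p"
  shows "Lap (\<lambda>x. x $ i * p x) x = x $ i * Lap p x + 2 * D i p x"
proof -
  have pD: "hom (n - 1) (D j p)" for j using D_hom[OF p] .
  have 1: "D j (D j (\<lambda>x. x $ i * p x)) x = x $ i * D j (D j p) x + C i j (D j p) x + D j (C i j p) x" for j
  proof -
    have *: "D j (\<lambda>x. x $ i * p x) = (\<lambda>x. x $ i * D j p x + C i j p x)"
      using D_coord_mult[OF p] C_sym by auto
    show ?thesis
    proof (cases n)
      case 0
      then have "D j p = (\<lambda>x. 0)" using D_hom_0 p by auto
      then have "D j (\<lambda>x. x $ i * p x) = C i j p" using * by (simp add: fun_eq_iff)
      moreover have "C i j (D j p) x = 0" using \<open>D j p = _\<close> by (simp add: C_def)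
      ultimately
      show ?thesis using D_hom_0[OF hom_C[OF p[unfolded 0]]] \<open>D j p = _\<close> by (simp add: D_zero)
    next
      case (Suc m)
      then have "hom n (\<lambda>x. x $ i * D j p x)" using hom.coord[OF pD] by simp
      then show ?thesis unfolding * using D_add[of n _ "C i j p"] hom_C[OF p] D_coord_mult[OF pD, of j i j x] C_sym
        by simp
    qed
  qed
  \<comment> \<open>Here \<open>C i j\<close> is written as the commutator of \<open>D i\<close>
    with x_j and the Dunkl operators are commuted, so that \<open>D i\<close> stands outside the
    terms to be summed over j.\<close>
  have 2: "C i j (D j p) x = D i (\<lambda>x. x $ j * D j p x) x - x $ j * D j (D i p) x" for j
    using D_coord_mult[OF pD, of i j j x] D_commute[OF p, of i j] by simp
  have 3: "D j (C i j p) x = D i (D j (\<lambda>x. x $ j * p x)) x - D j (\<lambda>x. x $ j * D i p x) x" for j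
  proof (cases n)
    case 0
    then have "D i p = (\<lambda>x. 0)" using D_hom_0 p by auto
    moreover have "D j (\<lambda>x. x $ j * p x) = C j j p"
      using D_coord_mult[OF p] D_hom_0 p 0 by auto
    ultimately show ?thesis using D_hom_0[OF hom_C[OF p[unfolded 0]]] by (simp add: D_zero)
  next
    case (Suc m)
    have "C i j p = (\<lambda>x. D i (\<lambda>x. x $ j * p x) x - x $ j * D i p x)"
      using D_coord_mult[OF p] by auto
    moreover have "hom n (D i (\<lambda>x. x $ j * p x))" using D_hom_Suc[OF hom.coord[OF p]] .
    moreover have "hom n (\<lambda>x. x $ j * D i p x)" using hom.coord[OF pD] Suc by simp
    ultimately have "D j (C i j p) x = D j (D i (\<lambda>x. x $ j * p x)) x - D j (\<lambda>x. x $ j * D i p x) x"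
      using D_diff by simp
    then show ?thesis using D_commute[OF hom.coord[OF p], of i j j] by simp
  qed
  have hxD: "hom n (\<lambda>x. x $ j * D j p x)" for j
    using hom.coord[OF pD] D_hom_0 p by (cases n) (auto intro: hom_zero)
  have "Lap (\<lambda>x. x $ i * p x) x = x $ i * Lap p x + (\<Sum>j\<in>UNIV. C i j (D j p) x + D j (C i j p) x)"
    by (simp add: Lap_def 1 sum.distrib sum_distrib_left)
  also have "(\<Sum>j\<in>UNIV. C i j (D j p) x + D j (C i j p) x) =
      ((\<Sum>j\<in>UNIV. D i (\<lambda>x. x $ j * D j p x) x) + (\<Sum>j\<in>UNIV. D i (D j (\<lambda>x. x $ j * p x)) x))
     - (E (D i p) x + (\<Sum>j\<in>UNIV. D j (\<lambda>x. x $ j * D i p x) x))"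
    by (simp add: 2 3 E_def sum.distrib sum_subtractf)
  also have "(\<Sum>j\<in>UNIV. D i (\<lambda>x. x $ j * D j p x) x) + (\<Sum>j\<in>UNIV. D i (D j (\<lambda>x. x $ j * p x)) x)
     = D i (\<lambda>x. E p x + (\<Sum>j\<in>UNIV. D j (\<lambda>x. x $ j * p x) x)) x"
  proof -
    have "hom n (\<lambda>x. \<Sum>j\<in>UNIV. D j (\<lambda>x. x $ j * p x) x)"
      by (intro hom_sum D_hom_Suc hom.coord p)
    then have "D i (\<lambda>x. E p x + (\<Sum>j\<in>UNIV. D j (\<lambda>x. x $ j * p x) x)) x
       = D i (E p) x + D i (\<lambda>x. \<Sum>j\<in>UNIV. D j (\<lambda>x. x $ j * p x) x) x"
      using D_add[OF hom_E[OF p]] by simp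
    moreover have "D i (E p) x = (\<Sum>j\<in>UNIV. D i (\<lambda>x. x $ j * D j p x) x)"
      unfolding E_def[abs_def] using D_sum[of UNIV n "\<lambda>j x. x $ j * D j p x" i] hxD by simp
    moreover have "D i (\<lambda>x. \<Sum>j\<in>UNIV. D j (\<lambda>x. x $ j * p x) x) x = (\<Sum>j\<in>UNIV. D i (D j (\<lambda>x. x $ j * p x)) x)"
      using D_sum[of UNIV n "\<lambda>j. D j (\<lambda>x. x $ j * p x)" i] D_hom_Suc[OF hom.coord[OF p]] by simp
    ultimately show ?thesis by simp
  qed
  also have "\<dots> = D i (\<lambda>x. 2 * (real n + lk + 1) * p x) x"
    by (simp add: E_plus_adjoint[OF p])
  also have "\<dots> = 2 * (real n + lk + 1) * D i p x"
    using D_cmul[OF p] by simp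
  also have "E (D i p) x + (\<Sum>j\<in>UNIV. D j (\<lambda>x. x $ j * D i p x) x) = 2 * (real (n - 1) + lk + 1) * D i p x"
    using E_plus_adjoint[OF pD] .
  \<comment> \<open>The two scalars differ by 2 because the degrees differ by one; for n = 0, where
    n - 1 is truncated, \<open>D i p\<close> is 0.\<close>
  also have "2 * (real n + lk + 1) * D i p x - 2 * (real (n - 1) + lk + 1) * D i p x = 2 * D i p x"
    using D_hom_0[of p i] p by (cases n) (auto simp: algebra_simps)
  finally show ?thesis .
qed

lemma Lap_add: "hom n p \<Longrightarrow> hom n q \<Longrightarrow> Lap (\<lambda>x. p x + q x) x = Lap p x + Lap q x"
  using D_hom[of n p] D_hom[of n q]
  by (simp add: Lap_def D_add[of n] D_add[of "n - 1"] sum.distrib)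

lemma Lap_cmul: "hom n p \<Longrightarrow> Lap (\<lambda>x. c * p x) x = c * Lap p x"
  using D_hom[of n p] by (simp add: Lap_def D_cmul[of n] D_cmul[of "n - 1"] sum_distrib_left)

lemma Lap_sum: "(\<And>a. a \<in> A \<Longrightarrow> hom n (f a)) \<Longrightarrow> Lap (\<lambda>x. \<Sum>a\<in>A. f a x) x = (\<Sum>a\<in>A. Lap (f a) x)"
proof (induction A rule: infinite_finite_induct)
  case (insert a A)
  then show ?case using Lap_add[of n "f a" "\<lambda>x. \<Sum>a\<in>A. f a x"] by (simp add: hom_sum)
qed (simp_all add: Lap_def D_zero)

lemma norm_mult_eq: "(norm x)\<^sup>2 * p x = (\<Sum>j\<in>UNIV. x $ j * (x $ j * p x))"
  by (simp add: power2_norm_eq_inner inner_vec_def sum_distrib_right mult.assoc)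

text \<open>Two uses of \<open>Lap_coord_mult\<close> for each coordinate leave twice the operator
  of \<open>E_plus_adjoint\<close>, a scalar.\<close>

lemma Lap_norm_mult:
  assumes p: "hom n p"
  shows "Lap (\<lambda>x. (norm x)\<^sup>2 * p x) x = (norm x)\<^sup>2 * Lap p x + 4 * (real n + lk + 1) * p x"
proof -
  have "Lap (\<lambda>x. (norm x)\<^sup>2 * p x) x = (\<Sum>j\<in>UNIV. Lap (\<lambda>x. x $ j * (x $ j * p x)) x)"
    unfolding norm_mult_eq by (intro Lap_sum[where n="Suc (Suc n)"] hom.coord p)
  also have "\<dots> = (\<Sum>j\<in>UNIV. x $ j * (x $ j * Lap p x)) + 2 * (E p x + (\<Sum>j\<in>UNIV. D j (\<lambda>x. x $ j * p x) x))"
    by (simp add: Lap_coord_mult[OF hom.coord[OF p]] Lap_coord_mult[OF p] E_def sum.distrib sum_distrib_left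
        distrib_left mult.left_commute[of _ 2])
  also have "\<dots> = (norm x)\<^sup>2 * Lap p x + 4 * (real n + lk + 1) * p x"
    unfolding E_plus_adjoint[OF p] norm_mult_eq by simp
  finally show ?thesis .
qed

text \<open>Since |x|^2 is invariant under reflections, it obeys the Leibniz rule: the reflection
  terms combine to inner products of \<open>v\<close> with the sum of x and its reflection, which is
  orthogonal to \<open>v\<close>.\<close>

lemma D_norm_mult:
  assumes p: "hom n p"
  shows "D i (\<lambda>x. (norm x)\<^sup>2 * p x) x = (norm x)\<^sup>2 * D i p x + 2 * x $ i * p x"
proof -
  have "D i (\<lambda>x. (norm x)\<^sup>2 * p x) x = (\<Sum>j\<in>UNIV. D i (\<lambda>x. x $ j * (x $ j * p x)) x)"
    unfolding norm_mult_eq using D_sum[of UNIV "Suc (Suc n)" "\<lambda>j x. x $ j * (x $ j * p x)" i] hom.coord[OF hom.coord[OF p]]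
    by simp
  also have "\<dots> = (\<Sum>j\<in>UNIV. x $ j * (x $ j * D i p x)) + (\<Sum>j\<in>UNIV. x $ j * C i j p x + C i j (\<lambda>x. x $ j * p x) x)"
    by (simp only: D_coord_mult[OF hom.coord[OF p]] D_coord_mult[OF p] sum.distrib distrib_left add.assoc)
  also have "(\<Sum>j\<in>UNIV. x $ j * C i j p x + C i j (\<lambda>x. x $ j * p x) x) =
     (\<Sum>j\<in>UNIV. (if i = j then 2 * x $ j * p x else 0)) + (\<Sum>j\<in>UNIV. \<Sum>v\<in>Rp. 2 * \<kappa> v * (v $ i * v $ j) / (norm v)\<^sup>2 * p (reflection v x) * (x $ j + reflection v x $ j))"
    unfolding sum.distrib[symmetric] by (intro sum.cong) (auto simp: C_def sum_distrib_left sum.distrib[symmetric] algebra_simps add_divide_distrib)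
  also have "(\<Sum>j\<in>UNIV. \<Sum>v\<in>Rp. 2 * \<kappa> v * (v $ i * v $ j) / (norm v)\<^sup>2 * p (reflection v x) * (x $ j + reflection v x $ j))
    = (\<Sum>v\<in>Rp. 2 * \<kappa> v * v $ i / (norm v)\<^sup>2 * p (reflection v x) * (\<Sum>j\<in>UNIV. (x + reflection v x) $ j * v $ j))"
    unfolding sum_distrib_left by (subst sum.swap) (intro sum.cong refl, simp)
  also have "\<dots> = 0"
    unfolding sum_reflection_axis by (intro sum.neutral) (auto simp: inner_add_left reflection_inner Rp_nonzero)
  finally show ?thesis unfolding norm_mult_eq by simp
qed

section \<open>h-harmonics and the Fischer decomposition\<close>

definition harm :: "nat \<Rightarrow> (real ^ 'n \<Rightarrow> real) \<Rightarrow> bool" where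
  "harm m Y \<longleftrightarrow> hom m Y \<and> Lap Y = (\<lambda>x. 0)"

lemma harm_hom: "harm m Y \<Longrightarrow> hom m Y" by (simp add: harm_def)

lemma harm_const: "harm 0 (\<lambda>x. c)"
proof -
  have "D i (\<lambda>x. c) = (\<lambda>x. 0)" for i using D_hom_0[OF hom.const] .
  then show ?thesis by (simp add: harm_def Lap_def[abs_def] hom.const D_zero)
qed

lemma harm_D: "harm m Y \<Longrightarrow> harm (m - 1) (D i Y)"
proof -
  assume Y: "harm m Y"
  then have h: "hom m Y" by (simp add: harm_def)
  have "Lap (D i Y) x = D i (Lap Y) x" for x
  proof -
    have "D i (\<lambda>x. \<Sum>j\<in>UNIV. D j (D j Y) x) = (\<lambda>x. \<Sum>j\<in>UNIV. D i (D j (D j Y)) x)"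
      by (rule D_sum[of _ "m - 1 - 1"]) (intro D_hom h)
    then show ?thesis
      using D_commute[OF h, of i] D_commute[OF D_hom[OF h], of i] by (simp add: Lap_def[abs_def])
  qed
  moreover have "Lap Y = (\<lambda>x. 0)" using Y by (simp add: harm_def)
  ultimately show ?thesis using D_hom[OF h] by (auto simp: harm_def D_zero)
qed

text \<open>The harmonic part of x_i Y. As the Laplacian sends x_i Y to 2 D_i Y and |x|^2 D_i Y to 4
  (m + lk) D_i Y, the correction has the factor 1/(2 (m + lk)). For m = 0 the denominator may be 0,
  but then D_i Y = 0.\<close>

definition raise :: "nat \<Rightarrow> 'n \<Rightarrow> (real ^ 'n \<Rightarrow> real) \<Rightarrow> real ^ 'n \<Rightarrow> real" where
  "raise m i Y x = x $ i * Y x - (norm x)\<^sup>2 * D i Y x / (2 * (real m + lk))"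

lemma harm_raise:
  assumes Y: "harm m Y"
  shows "harm (Suc m) (raise m i Y)"
proof -
  have h: "hom m Y" and L: "\<And>x. Lap Y x = 0" using Y by (auto simp: harm_def)
  show ?thesis
  proof (cases m)
    case 0
    then have "D i Y = (\<lambda>x. 0)" using D_hom_0 h by auto
    then show ?thesis
      using hom.coord[OF h, of i] Lap_coord_mult[OF h, of i] L by (auto simp: harm_def raise_def[abs_def])
  next
    case (Suc k)
    define c where "c = - 1 / (2 * (real m + lk))"
    have pos: "real m + lk > 0" using Suc lk_nonneg by simp
    have eq: "raise m i Y = (\<lambda>x. x $ i * Y x + c * ((norm x)\<^sup>2 * D i Y x))"
      by (auto simp: raise_def[abs_def] c_def)
    have hD: "hom k (D i Y)" using D_hom[OF h, of i] Suc by simp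
    have h2: "hom (Suc m) (\<lambda>x. (norm x)\<^sup>2 * D i Y x)"
      using hom_norm_mult[OF hD] Suc by simp
    have LD: "Lap (D i Y) x = 0" for x using harm_D[OF Y] by (simp add: harm_def)
    have "Lap (raise m i Y) x = 0" for x
    proof -
      have "Lap (raise m i Y) x = 2 * D i Y x + c * (4 * (real k + lk + 1) * D i Y x)"
        unfolding eq Lap_add[OF hom.coord[OF h] hom_cmul[OF h2]] Lap_cmul[OF h2]
        by (simp add: Lap_coord_mult[OF h] Lap_norm_mult[OF hD] L LD)
      also have "\<dots> = 0" using pos Suc by (simp add: c_def field_simps)
      finally show ?thesis .
    qed
    moreover have "hom (Suc m) (raise m i Y)" unfolding eq by (intro hom.add hom.coord h hom_cmul h2)
    ultimately show ?thesis by (auto simp: harm_def)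
  qed
qed

lemma coord_mult_harm:
  "x $ i * Y x = raise m i Y x + (norm x)\<^sup>2 * D i Y x / (2 * (real m + lk))"
  by (simp add: raise_def)

text \<open>An inductive closure rather than a choice of components: a linear statement about
  homogeneous polynomials has to be checked only on |x|^(2j) Y and under sums.\<close>

inductive fischer :: "nat \<Rightarrow> (real ^ 'n \<Rightarrow> real) \<Rightarrow> bool" where
  harm: "harm m Y \<Longrightarrow> fischer (m + 2 * j) (\<lambda>x. norm x ^ (2 * j) * Y x)"
| add: "fischer n p \<Longrightarrow> fischer n q \<Longrightarrow> fischer n (\<lambda>x. p x + q x)"

lemma harm_cmul: "harm m Y \<Longrightarrow> harm m (\<lambda>x. c * Y x)"
  by (auto simp: harm_def hom_cmul Lap_cmul)

lemma fischer_coord: "fischer n p \<Longrightarrow> fischer (Suc n) (\<lambda>x. x $ i * p x)"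
proof (induction rule: fischer.induct)
  case (harm m Y j)
  define c where "c = 1 / (2 * (real m + lk))"
  have "(\<lambda>x. x $ i * (norm x ^ (2 * j) * Y x)) =
      (\<lambda>x. norm x ^ (2 * j) * raise m i Y x + norm x ^ (2 * Suc j) * (c * D i Y x))"
    by (rule ext) (simp add: c_def raise_def power2_eq_square algebra_simps)
  moreover have "fischer (Suc (m + 2 * j)) (\<lambda>x. norm x ^ (2 * j) * raise m i Y x)"
    using fischer.harm[OF harm_raise[OF harm], of j i] by simp
  moreover have "fischer (Suc (m + 2 * j)) (\<lambda>x. norm x ^ (2 * Suc j) * (c * D i Y x))"
  \<comment> \<open>For m = 0 the term is the zero polynomial, but as |x|^(2j+2) times a constant it
    would have the wrong degree; 0 times the raised harmonic represents it in the right one.\<close>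
  proof (cases m)
    case 0
    then have "D i Y = (\<lambda>x. 0)" using D_hom_0 harm_hom[OF harm] by auto
    then show ?thesis
      using calculation(2) fischer.harm[OF harm_cmul[OF harm_raise[OF harm], of 0], of j i] 0 by simp
  next
    case (Suc k)
    then show ?thesis using fischer.harm[OF harm_cmul[OF harm_D[OF harm]], of "Suc j" c i] by simp
  qed
  ultimately show ?case by (simp add: fischer.add)
next
  case (add n p q)
  then show ?case by (simp add: distrib_left fischer.add)
qed

lemma hom_fischer: "hom n p \<Longrightarrow> fischer n p"
proof (induction rule: hom.induct)
  case (const c)
  show ?case using fischer.harm[OF harm_const, of 0 c] by simp
qed (auto intro: fischer.add fischer_coord)

text \<open>Maximum principle: at a maximum of \<open>\<bar>q\<bar>\<close> on the sphere the right-hand side of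
  \<open>E_eq\<close> has the sign of \<open>q\<close>.\<close>

lemma joint_kernel_trivial:
  assumes q: "hom n q" and n: "n > 0" and D0: "\<And>i. D i q = (\<lambda>x. 0)"
  shows "q = (\<lambda>x. 0)"
proof -
  have E0: "real n * q x + (\<Sum>v\<in>Rp. \<kappa> v * (q x - q (reflection v x))) = 0" for x
    using E_eq[OF q, of x] D0 by (simp add: E_def)
  have "\<exists>x\<in>sphere 0 1. \<forall>y\<in>sphere 0 1. \<bar>q y\<bar> \<le> \<bar>q x\<bar>"
    by (rule continuous_attains_sup) (auto intro!: continuous_intros hom_continuous[OF q])
  then obtain x where x: "norm x = 1" "\<And>y. norm y = 1 \<Longrightarrow> \<bar>q y\<bar> \<le> \<bar>q x\<bar>" by auto
  have "q x = 0"
  proof -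
    have "0 = q x * (real n * q x + (\<Sum>v\<in>Rp. \<kappa> v * (q x - q (reflection v x))))" using E0 by simp
    also have "\<dots> = real n * (q x)\<^sup>2 + (\<Sum>v\<in>Rp. \<kappa> v * (q x * q x - q x * q (reflection v x)))"
      by (simp add: distrib_left sum_distrib_left power2_eq_square algebra_simps)
    finally have "real n * (q x)\<^sup>2 + (\<Sum>v\<in>Rp. \<kappa> v * (q x * q x - q x * q (reflection v x))) = 0" by simp
    moreover have "(\<Sum>v\<in>Rp. \<kappa> v * (q x * q x - q x * q (reflection v x))) \<ge> 0"
    proof (intro sum_nonneg mult_nonneg_nonneg kappa_nonneg)
      fix v
      have "q x * q (reflection v x) \<le> \<bar>q x\<bar> * \<bar>q (reflection v x)\<bar>" by (metis abs_ge_self abs_mult)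
      also have "\<dots> \<le> \<bar>q x\<bar> * \<bar>q x\<bar>" using x by (intro mult_left_mono) auto
      finally show "0 \<le> q x * q x - q x * q (reflection v x)" by simp
    qed auto
    moreover have "real n * (q x)\<^sup>2 \<ge> 0" by simp
    ultimately have "real n * (q x)\<^sup>2 = 0" by linarith
    then show ?thesis using n by simp
  qed
  then have sph: "q y = 0" if "norm y = 1" for y using x that by force
  show ?thesis
  proof
    fix y
    show "q y = 0"
    proof (cases "y = 0")
      case True
      then show ?thesis using hom_scale[OF q, of 0 y] n by (simp add: power_0_left split: if_splits)
    next
      case False
      then have "q (norm y *\<^sub>R (y /\<^sub>R norm y)) = norm y ^ n * q (y /\<^sub>R norm y)" by (intro hom_scale[OF q])
      moreover have "q (y /\<^sub>R norm y) = 0" using False by (intro sph) simp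
      ultimately show ?thesis using False by simp
    qed
  qed
qed

end

section \<open>Lebesgue integrals of homogeneous functions\<close>

lemma nn_integral_lborel_plus:
  fixes f :: "'a::euclidean_space \<Rightarrow> ennreal"
  assumes [measurable]: "f \<in> borel_measurable borel"
  shows "(\<integral>\<^sup>+x. f (c + x) \<partial>lborel) = (\<integral>\<^sup>+x. f x \<partial>lborel)"
proof -
  have "(\<integral>\<^sup>+x. f x \<partial>lborel) = (\<integral>\<^sup>+x. f x \<partial>distr lborel borel ((+) c))"
    by (simp only: lborel_distr_plus)
  also have "\<dots> = (\<integral>\<^sup>+x. f (c + x) \<partial>lborel)"
    by (subst nn_integral_distr) simp_all
  finally show ?thesis ..
qed

text \<open>Integrating \<open>f (\<sigma> x) 1\<^sub>B (y - \<sigma> x)\<close> over \<open>x\<close> and \<open>y\<close>, with \<open>B\<close> the unit ball,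
  in both orders.\<close>

lemma nn_integral_isometry:
  fixes \<sigma> :: "'a::euclidean_space \<Rightarrow> 'a"
  assumes lin: "linear \<sigma>" and norm: "\<And>x. norm (\<sigma> x) = norm x" and inv: "\<And>x. \<sigma> (\<sigma> x) = x"
    and f [measurable]: "f \<in> borel_measurable borel"
  shows "(\<integral>\<^sup>+x. f (\<sigma> x) \<partial>lborel) = (\<integral>\<^sup>+x. f x \<partial>lborel)"
proof -
  have [measurable]: "\<sigma> \<in> borel_measurable borel"
    by (intro borel_measurable_continuous_onI linear_continuous_on linear_conv_bounded_linear[THEN iffD1] lin)
  define B :: "'a \<Rightarrow> ennreal" where "B = indicator (ball 0 1)"
  have [measurable]: "B \<in> borel_measurable borel" unfolding B_def by (intro borel_measurable_indicator) simp
  have B: "B (- \<sigma> x) = B x" for x by (simp add: B_def norm indicator_def)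
  define L where "L = (\<integral>\<^sup>+x. B x \<partial>lborel)"
  have L_eq: "L = emeasure lborel (ball 0 1 :: 'a set)" by (simp add: L_def B_def)
  have L: "L \<noteq> 0" "L \<noteq> \<infinity>"
    using emeasure_lborel_ball_finite[of 0 "1::real"] open_not_negligible[of "ball (0::'a) 1"]
    by (auto simp: L_eq less_top negligible_iff_emeasure0)
  have "(\<integral>\<^sup>+x. f (\<sigma> x) \<partial>lborel) * L = (\<integral>\<^sup>+x. f (\<sigma> x) * (\<integral>\<^sup>+y. B (- \<sigma> x + y) \<partial>lborel) \<partial>lborel)"
  proof -
    have "(\<integral>\<^sup>+y. B (- \<sigma> x + y) \<partial>lborel) = L" for x
      unfolding L_def by (rule nn_integral_lborel_plus) simp
    then show ?thesis by (simp only:) (simp add: nn_integral_multc)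
  qed
  also have "\<dots> = (\<integral>\<^sup>+x. (\<integral>\<^sup>+y. f (\<sigma> x) * B (- \<sigma> x + y) \<partial>lborel) \<partial>lborel)"
    by (simp add: nn_integral_cmult)
  also have "\<dots> = (\<integral>\<^sup>+y. (\<integral>\<^sup>+x. f (\<sigma> x) * B (- \<sigma> x + y) \<partial>lborel) \<partial>lborel)"
    by (rule lborel_pair.Fubini') simp
  \<comment> \<open>Translate x by \<sigma> y. As \<sigma> is an involution, \<open>f\<close> is
    then evaluated at \<sigma> x + y and \<open>B\<close> at - \<sigma> x, so that the integral in y
    absorbs the remaining \<sigma>.\<close>
  also have "\<dots> = (\<integral>\<^sup>+y. (\<integral>\<^sup>+x. f (\<sigma> (\<sigma> y + x)) * B (- \<sigma> (\<sigma> y + x) + y) \<partial>lborel) \<partial>lborel)"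
    by (intro nn_integral_cong nn_integral_lborel_plus[symmetric]) simp
  also have "\<dots> = (\<integral>\<^sup>+y. (\<integral>\<^sup>+x. f (\<sigma> x + y) * B x \<partial>lborel) \<partial>lborel)"
  proof -
    have e: "\<sigma> (\<sigma> y + x) = \<sigma> x + y" "- (\<sigma> x + y) + y = - \<sigma> x" for x y
      by (simp_all add: linear_add[OF lin] inv)
    show ?thesis by (simp only: e B)
  qed
  also have "\<dots> = (\<integral>\<^sup>+x. (\<integral>\<^sup>+y. f (\<sigma> x + y) * B x \<partial>lborel) \<partial>lborel)"
    by (rule lborel_pair.Fubini') simp
  also have "\<dots> = (\<integral>\<^sup>+x. f x \<partial>lborel) * L"
    by (simp add: nn_integral_multc nn_integral_lborel_plus nn_integral_cmult L_def)
  finally show ?thesis using L by (simp add: mult.commute[of _ L] ennreal_mult_cancel_left)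
qed

text \<open>Involutions cover both uses: the reflections, and the change of sign that kills odd
  moments.\<close>

lemma lborel_distr_isometry:
  fixes \<sigma> :: "'a::euclidean_space \<Rightarrow> 'a"
  assumes lin: "linear \<sigma>" and norm: "\<And>x. norm (\<sigma> x) = norm x" and inv: "\<And>x. \<sigma> (\<sigma> x) = x"
  shows "distr lborel borel \<sigma> = lborel"
proof (rule measure_eqI)
  have [measurable]: "\<sigma> \<in> borel_measurable borel"
    by (intro borel_measurable_continuous_onI linear_continuous_on linear_conv_bounded_linear[THEN iffD1] lin)
  fix A assume "A \<in> sets (distr lborel borel \<sigma>)"
  then have [measurable]: "A \<in> sets borel" by simp
  have "emeasure (distr lborel borel \<sigma>) A = (\<integral>\<^sup>+x. indicator A x \<partial>distr lborel borel \<sigma>)" by simp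
  also have "\<dots> = (\<integral>\<^sup>+x. indicator A (\<sigma> x) \<partial>lborel)" by (subst nn_integral_distr) simp_all
  also have "\<dots> = (\<integral>\<^sup>+x. indicator A x \<partial>lborel)"
    by (rule nn_integral_isometry[OF lin norm inv]) simp
  finally show "emeasure (distr lborel borel \<sigma>) A = emeasure lborel A" by simp
qed simp

lemma
  fixes \<sigma> :: "'a::euclidean_space \<Rightarrow> 'a" and f :: "'a \<Rightarrow> real"
  assumes lin: "linear \<sigma>" and norm: "\<And>x. norm (\<sigma> x) = norm x" and inv: "\<And>x. \<sigma> (\<sigma> x) = x"
    and f [measurable]: "f \<in> borel_measurable borel"
  shows integral_isometry: "(LINT x|lborel. f (\<sigma> x)) = (LINT x|lborel. f x)"
    and integrable_isometry: "integrable lborel (\<lambda>x. f (\<sigma> x)) \<longleftrightarrow> integrable lborel f"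
proof -
  have [measurable]: "\<sigma> \<in> borel_measurable borel"
    by (intro borel_measurable_continuous_onI linear_continuous_on linear_conv_bounded_linear[THEN iffD1] lin)
  have d: "distr lborel borel \<sigma> = lborel" using lborel_distr_isometry[OF lin norm inv] .
  show "(LINT x|lborel. f (\<sigma> x)) = (LINT x|lborel. f x)"
    using integral_distr[of \<sigma> lborel borel f] d by simp
  show "integrable lborel (\<lambda>x. f (\<sigma> x)) \<longleftrightarrow> integrable lborel f"
    using integrable_distr_eq[of \<sigma> lborel borel f] d by simp
qed

lemma nn_integral_lborel_scale:
  fixes f :: "'a::euclidean_space \<Rightarrow> ennreal"
  assumes [measurable]: "f \<in> borel_measurable borel" and c: "c > 0"
  shows "(\<integral>\<^sup>+x. f x \<partial>lborel) = ennreal (c ^ DIM('a)) * (\<integral>\<^sup>+x. f (c *\<^sub>R x) \<partial>lborel)"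
proof -
  have "(\<integral>\<^sup>+x. f x \<partial>lborel) = (\<integral>\<^sup>+x. f x \<partial>density (distr lborel borel (\<lambda>x. 0 + c *\<^sub>R x)) (\<lambda>_. ennreal (\<bar>c\<bar> ^ DIM('a))))"
    using lborel_affine[of c "0::'a"] c by simp
  also have "\<dots> = ennreal (c ^ DIM('a)) * (\<integral>\<^sup>+x. f (c *\<^sub>R x) \<partial>lborel)"
    using c by (simp add: nn_integral_density nn_integral_cmult nn_integral_distr)
  finally show ?thesis .
qed

text \<open>Polar coordinates for homogeneous densities without surface measure: the image under
  \<open>x \<mapsto> \<parallel>x\<parallel>\<^sup>2\<close> of the density \<open>F\<close> on the ball has an explicit distribution function, by scaling.\<close>

lemma distr_norm_square_homogeneous:
  fixes F :: "'a::euclidean_space \<Rightarrow> real" and K :: real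
  assumes F [measurable]: "F \<in> borel_measurable borel" and nonneg: "\<And>x. F x \<ge> 0"
    and hom: "\<And>c x. c > 0 \<Longrightarrow> F (c *\<^sub>R x) = c powr (K - DIM('a)) * F x"
    and K: "K > 0" and i: "i \<ge> 0"
    and I: "(\<integral>\<^sup>+x. ennreal (F x * indicator (cball 0 1) x) \<partial>lborel) = ennreal i"
  shows "distr (density lborel (\<lambda>x. ennreal (F x * indicator (cball 0 1) x))) borel (\<lambda>x. (norm x)\<^sup>2)
       = density lborel (\<lambda>s. ennreal (K / 2 * i * (s powr (K / 2 - 1) * indicator {0..1} s)))"
    (is "?M = ?N")
proof -
  have [measurable]: "cball (0::'a) c \<in> sets borel" for c by simp
  have dist: "(\<integral>\<^sup>+x. ennreal (F x * indicator (cball 0 1) x) * indicator {..R} ((norm x)\<^sup>2) \<partial>lborel)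
      = ennreal (R powr (K / 2) * i)" if R: "0 < R" "R \<le> 1" for R
  proof -
    define c where "c = sqrt R"
    have c: "c > 0" using R by (simp add: c_def)
    have cR: "c\<^sup>2 = R" using R by (simp add: c_def)
    have "(\<integral>\<^sup>+x. ennreal (F x * indicator (cball 0 1) x) * indicator {..R} ((norm x)\<^sup>2) \<partial>lborel)
       = (\<integral>\<^sup>+x. ennreal (F x * indicator (cball 0 c) x) \<partial>lborel)"
    proof (intro nn_integral_cong)
      fix x :: 'a
      have "(norm x)\<^sup>2 \<le> R \<longleftrightarrow> norm x \<le> c"
        using cR c by (metis less_imp_le norm_ge_zero power2_le_iff_abs_le abs_norm_cancel)
      moreover have "norm x \<le> c \<Longrightarrow> norm x \<le> 1"
        using R c_def real_sqrt_le_1_iff[of R] by (meson order_trans)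
      ultimately show "ennreal (F x * indicator (cball 0 1) x) * indicator {..R} ((norm x)\<^sup>2)
          = ennreal (F x * indicator (cball 0 c) x)"
        by (auto simp: indicator_def)
    qed
    also have "\<dots> = ennreal (c ^ DIM('a)) * (\<integral>\<^sup>+x. ennreal (F (c *\<^sub>R x) * indicator (cball 0 c) (c *\<^sub>R x)) \<partial>lborel)"
    proof (rule nn_integral_lborel_scale[OF _ c])
      have [measurable]: "cball (0::'a) c \<in> sets borel" by simp
      show "(\<lambda>x. ennreal (F x * indicator (cball 0 c) x)) \<in> borel_measurable borel" by measurable
    qed
    also have "(\<lambda>x::'a. ennreal (F (c *\<^sub>R x) * indicator (cball 0 c) (c *\<^sub>R x)))
       = (\<lambda>x. ennreal (c powr (K - DIM('a))) * ennreal (F x * indicator (cball 0 1) x))"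
    proof
      fix x :: 'a
      have "(indicator (cball 0 c) (c *\<^sub>R x) :: real) = indicator (cball 0 1) x"
        using c by (auto simp: indicator_def)
      then show "ennreal (F (c *\<^sub>R x) * indicator (cball 0 c) (c *\<^sub>R x))
         = ennreal (c powr (K - DIM('a))) * ennreal (F x * indicator (cball 0 1) x)"
        using nonneg[of x] by (simp add: hom[OF c] ennreal_mult'[symmetric] mult.assoc)
    qed
    also have "ennreal (c ^ DIM('a)) * (\<integral>\<^sup>+x. ennreal (c powr (K - DIM('a))) * ennreal (F x * indicator (cball 0 1) x) \<partial>lborel)
        = ennreal (c ^ DIM('a)) * (ennreal (c powr (K - DIM('a))) * ennreal i)"
      by (subst nn_integral_cmult) (simp_all add: I)
    also have "\<dots> = ennreal (c ^ DIM('a) * c powr (K - DIM('a)) * i)"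
      using c i by (simp add: ennreal_mult'[symmetric] mult.assoc)
    also have "c ^ DIM('a) * c powr (K - DIM('a)) = c powr K"
      using c by (simp add: powr_realpow[symmetric] powr_add[symmetric])
    also have "\<dots> = R powr (K / 2)"
      using R by (simp add: c_def powr_half_sqrt[symmetric] powr_powr)
    finally show ?thesis .
  qed
  have N: "(\<integral>\<^sup>+s. ennreal (K / 2 * i * (s powr (K / 2 - 1) * indicator {0..1} s)) * indicator {..R} s \<partial>lborel)
      = ennreal (R powr (K / 2) * i)" if R: "0 \<le> R" "R \<le> 1" for R
  proof -
    have "((\<lambda>s. s powr (K / 2 - 1)) has_integral (R powr (K / 2 - 1 + 1) / (K / 2 - 1 + 1))) {0..R}"
      using K R by (intro has_integral_powr_from_0) auto
    then have J: "(\<integral>\<^sup>+s. ennreal (indicator {0..R} s * s powr (K / 2 - 1)) \<partial>lborel) = ennreal (R powr (K / 2) / (K / 2))"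
      by (intro nn_integral_has_integral_lebesgue) auto
    have "(\<integral>\<^sup>+s. ennreal (K / 2 * i * (s powr (K / 2 - 1) * indicator {0..1} s)) * indicator {..R} s \<partial>lborel)
      = (\<integral>\<^sup>+s. ennreal (K / 2 * i) * ennreal (indicator {0..R} s * s powr (K / 2 - 1)) \<partial>lborel)"
      using R K i by (intro nn_integral_cong) (auto simp: indicator_def ennreal_mult'[symmetric])
    also have "\<dots> = ennreal (K / 2 * i) * ennreal (R powr (K / 2) / (K / 2))"
      by (subst nn_integral_cmult) (simp_all only: J, simp)
    also have "\<dots> = ennreal (R powr (K / 2) * i)"
      using K i by (simp add: ennreal_mult'[symmetric])
    finally show ?thesis .
  qed
  show ?thesis
  proof (rule measure_eqI_generator_eq[where E="range atMost" and \<Omega>=UNIV and A="\<lambda>n. {..real n}"])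
    show "Int_stable (range (atMost :: real \<Rightarrow> real set))"
      by (auto simp: Int_stable_def)
    show "sets ?M = sigma_sets UNIV (range atMost)" "sets ?N = sigma_sets UNIV (range atMost)"
      by (simp_all add: borel_eq_atMost)
    show "(\<Union>n. {..real n}) = UNIV" using real_arch_simple by auto
    have M: "emeasure ?M {..R} = (\<integral>\<^sup>+x. ennreal (F x * indicator (cball 0 1) x) * indicator {..R} ((norm x)\<^sup>2) \<partial>lborel)" for R
    proof -
      have "emeasure ?M {..R} = (\<integral>\<^sup>+y. indicator {..R} y \<partial>?M)" by simp
      also have "\<dots> = (\<integral>\<^sup>+x. ennreal (F x * indicator (cball 0 1) x) * indicator {..R} ((norm x)\<^sup>2) \<partial>lborel)"
        by (subst nn_integral_distr) (simp_all add: nn_integral_density)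
      finally show ?thesis .
    qed
    have N': "emeasure ?N {..R} = (\<integral>\<^sup>+s. ennreal (K / 2 * i * (s powr (K / 2 - 1) * indicator {0..1} s)) * indicator {..R} s \<partial>lborel)" for R
      by (simp add: emeasure_density)
    \<comment> \<open>Scaling settles 0 < R \<le> 1. Otherwise R is negative, or 0 where the origin
      is a null set, or beyond 1 where neither measure has further mass.\<close>
    have eq: "emeasure ?M {..R} = emeasure ?N {..R}" for R
    proof -
      consider "R < 0" | "R = 0" | "0 < R" "R \<le> 1" | "R > 1" by linarith
      then show ?thesis
      proof cases
        case 1
        then have "\<not> (norm x)\<^sup>2 \<le> R" for x :: 'a using zero_le_power2[of "norm x"] by linarith
        then have "emeasure ?M {..R} = 0" unfolding M by (simp add: indicator_def)
        moreover have z: "ennreal (K / 2 * i * (s powr (K / 2 - 1) * indicator {0..1} s)) * indicator {..R} s = 0" for s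
          using 1 by (auto simp: indicator_def)
        ultimately show ?thesis unfolding N' by (simp only: z) simp
      next
        case 2
        have "emeasure ?M {..R} = 0" unfolding M
        proof (subst nn_integral_0_iff_AE)
          have "AE x in lborel. x \<noteq> (0::'a)" by (rule AE_lborel_singleton)
          then show "AE x in lborel. ennreal (F x * indicator (cball 0 1) x) * indicator {..R} ((norm x)\<^sup>2) = 0"
            by eventually_elim (use 2 in \<open>simp add: indicator_def\<close>)
        qed simp
        then show ?thesis using N[of R] 2 unfolding N' by simp
      next
        case 3
        then show ?thesis unfolding M N' using dist[OF 3] N[of R] by (simp only: less_imp_le simp_thms)
      next
        case 4
        have "norm x \<le> 1 \<Longrightarrow> (norm x)\<^sup>2 \<le> 1 \<and> (norm x)\<^sup>2 \<le> R" for x :: 'a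
          using 4 power_le_one[of "norm x" 2] by auto
        then have "emeasure ?M {..R} = emeasure ?M {..1}" unfolding M
          by (intro nn_integral_cong) (auto simp: indicator_def)
        moreover have "emeasure ?N {..R} = emeasure ?N {..1}" unfolding N'
          using 4 by (intro nn_integral_cong) (auto simp: indicator_def)
        moreover have "emeasure ?M {..1} = emeasure ?N {..1}"
          unfolding M N' using dist[of 1] N[of 1] by (simp only: zero_le_one zero_less_one order_refl simp_thms)
        ultimately show ?thesis by simp
      qed
    qed
    show "\<And>X. X \<in> range atMost \<Longrightarrow> emeasure ?M X = emeasure ?N X" using eq by auto
    show "emeasure ?M {..real n} \<noteq> \<infinity>" for n
    proof -
      have "emeasure ?M {..real n} \<le> (\<integral>\<^sup>+x. ennreal (F x * indicator (cball 0 1) x) \<partial>lborel)"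
        unfolding M by (intro nn_integral_mono) (simp add: indicator_def)
      then have "emeasure ?M {..real n} < \<infinity>"
        unfolding I infinity_ennreal_def using ennreal_less_top by (rule le_less_trans)
      then show ?thesis by (rule less_imp_neq)
    qed
  qed auto
qed

section \<open>Radial Beta weights\<close>

lemma nn_integral_Beta:
  assumes "a > 0" "b > 0"
  shows "(\<integral>\<^sup>+s. ennreal (indicator {0..1} s * (s powr (a - 1) * (1 - s) powr (b - 1))) \<partial>lborel) = ennreal (Beta a b)"
  using assms by (intro nn_integral_has_integral_lebesgue has_integral_Beta_real) auto

lemma Beta_pos: "a > 0 \<Longrightarrow> b > 0 \<Longrightarrow> Beta a b > (0::real)"
  by (simp add: Beta_def Gamma_real_pos)

text \<open>\<open>K\<close> is the degree of \<open>F\<close> plus the dimension, so the mass of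
  \<open>F\<close> in the ball of radius c is proportional to c^K. By the preceding image measure
  the radial factor becomes a function of s = |x|^2, integrated against a multiple of s^(K/2 - 1): a
  Beta integral.\<close>

lemma radial_Beta_nonneg:
  fixes F :: "'a::euclidean_space \<Rightarrow> real" and K :: real
  assumes F [measurable]: "F \<in> borel_measurable borel" and nonneg: "\<And>x. F x \<ge> 0"
    and hom: "\<And>c x. c > 0 \<Longrightarrow> F (c *\<^sub>R x) = c powr (K - DIM('a)) * F x"
    and K: "K > 0" and int: "set_integrable lborel (cball 0 1) F"
    and a: "K / 2 + a > 0" and c: "c > -1"
  shows "has_bochner_integral lborel
      (\<lambda>x. indicator (cball 0 1) x * (F x * (norm x powr (2 * a) * (1 - (norm x)\<^sup>2) powr c)))
      (K / 2 * (LINT x:cball 0 1|lborel. F x) * Beta (K / 2 + a) (c + 1))"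
proof -
  have [measurable]: "cball (0::'a) c \<in> sets borel" for c by simp
  define i where "i = (LINT x:cball 0 1|lborel. F x)"
  have i: "i \<ge> 0" unfolding i_def set_lebesgue_integral_def
    by (intro integral_nonneg_AE) (simp add: nonneg)
  have I: "(\<integral>\<^sup>+x. ennreal (F x * indicator (cball 0 1) x) \<partial>lborel) = ennreal i"
    unfolding i_def set_lebesgue_integral_def
    using int nonneg by (subst nn_integral_eq_integral) (auto simp: set_integrable_def mult.commute)
  define \<phi> :: "real \<Rightarrow> real" where "\<phi> s = s powr a * (1 - s) powr c" for s
  have [measurable]: "\<phi> \<in> borel_measurable borel" unfolding \<phi>_def by measurable
  have "(\<integral>\<^sup>+x. ennreal (indicator (cball 0 1) x * (F x * (norm x powr (2 * a) * (1 - (norm x)\<^sup>2) powr c))) \<partial>lborel)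
     = (\<integral>\<^sup>+x. ennreal (F x * indicator (cball 0 1) x) * ennreal (\<phi> ((norm x)\<^sup>2)) \<partial>lborel)"
  proof (intro nn_integral_cong)
    fix x :: 'a
    have "(norm x)\<^sup>2 powr a = norm x powr (2 * a)"
    proof (cases "x = 0")
      case False
      then have "(norm x)\<^sup>2 = norm x powr 2" using powr_realpow[of "norm x" 2] by simp
      then show ?thesis by (simp only: powr_powr)
    qed simp
    then show "ennreal (indicator (cball 0 1) x * (F x * (norm x powr (2 * a) * (1 - (norm x)\<^sup>2) powr c)))
        = ennreal (F x * indicator (cball 0 1) x) * ennreal (\<phi> ((norm x)\<^sup>2))"
      using nonneg[of x] by (simp add: \<phi>_def ennreal_mult'[symmetric] mult_ac)
  qed
  also have "\<dots> = (\<integral>\<^sup>+s. ennreal (\<phi> s) \<partial>distr (density lborel (\<lambda>x. ennreal (F x * indicator (cball 0 1) x))) borel (\<lambda>x. (norm x)\<^sup>2))"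
    by (subst nn_integral_distr) (simp_all add: nn_integral_density)
  also have "\<dots> = (\<integral>\<^sup>+s. ennreal (K / 2 * i * (s powr (K / 2 - 1) * indicator {0..1} s)) * ennreal (\<phi> s) \<partial>lborel)"
    by (subst distr_norm_square_homogeneous[OF F nonneg hom K i I])
       (assumption, rule nn_integral_density, measurable)
  also have "\<dots> = (\<integral>\<^sup>+s. ennreal (K / 2 * i) * ennreal (indicator {0..1} s * (s powr (K / 2 + a - 1) * (1 - s) powr (c + 1 - 1))) \<partial>lborel)"
  proof (intro nn_integral_cong)
    fix s :: real
    have "s powr (K / 2 - 1) * s powr a = s powr (K / 2 + a - 1)"
      by (simp add: powr_add[symmetric] algebra_simps)
    then show "ennreal (K / 2 * i * (s powr (K / 2 - 1) * indicator {0..1} s)) * ennreal (\<phi> s)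
       = ennreal (K / 2 * i) * ennreal (indicator {0..1} s * (s powr (K / 2 + a - 1) * (1 - s) powr (c + 1 - 1)))"
      using i K by (auto simp: \<phi>_def indicator_def ennreal_mult'[symmetric] mult_ac)
  qed
  also have "\<dots> = ennreal (K / 2 * i) * ennreal (Beta (K / 2 + a) (c + 1))"
    using a c by (subst nn_integral_cmult) (simp_all only: nn_integral_Beta, auto)
  also have "\<dots> = ennreal (K / 2 * i * Beta (K / 2 + a) (c + 1))"
    using i K by (simp add: ennreal_mult'[symmetric])
  finally show ?thesis
    unfolding i_def[symmetric]
    using i K a c nonneg Beta_pos[of "K / 2 + a" "c + 1"]
    by (intro has_bochner_integral_nn_integral) auto
qed

text \<open>The positive and negative parts of \<open>F\<close> are homogeneous of the same degree,
  so the nonnegative case applies to each.\<close>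

lemma radial_Beta:
  fixes F :: "'a::euclidean_space \<Rightarrow> real" and K :: real
  assumes F [measurable]: "F \<in> borel_measurable borel"
    and hom: "\<And>c x. c > 0 \<Longrightarrow> F (c *\<^sub>R x) = c powr (K - DIM('a)) * F x"
    and K: "K > 0" and int: "set_integrable lborel (cball 0 1) F"
    and a: "K / 2 + a > 0" and c: "c > -1"
  shows "has_bochner_integral lborel
      (\<lambda>x. indicator (cball 0 1) x * (F x * (norm x powr (2 * a) * (1 - (norm x)\<^sup>2) powr c)))
      (K / 2 * (LINT x:cball 0 1|lborel. F x) * Beta (K / 2 + a) (c + 1))"
proof -
  have [measurable]: "cball (0::'a) c \<in> sets borel" for c by simp
  define P N where "P x = max 0 (F x)" and "N x = max 0 (- F x)" for x
  have [measurable]: "P \<in> borel_measurable borel" "N \<in> borel_measurable borel"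
    unfolding P_def[abs_def] N_def[abs_def] by measurable
  have FPN: "F x = P x - N x" for x by (auto simp: P_def N_def)
  have hP: "P (b *\<^sub>R x) = b powr (K - DIM('a)) * P x" "N (b *\<^sub>R x) = b powr (K - DIM('a)) * N x" if "b > 0" for b x
    using that by (auto simp: P_def N_def hom max_def mult_le_0_iff zero_le_mult_iff)
  have iP: "set_integrable lborel (cball 0 1) P" "set_integrable lborel (cball 0 1) N"
    using int unfolding P_def[abs_def] N_def[abs_def] set_integrable_def
    by (auto intro!: Bochner_Integration.integrable_bound[OF int[unfolded set_integrable_def]] simp: indicator_def)
  have "has_bochner_integral lborel
      (\<lambda>x. indicator (cball 0 1) x * (P x * (norm x powr (2 * a) * (1 - (norm x)\<^sup>2) powr c))
         - indicator (cball 0 1) x * (N x * (norm x powr (2 * a) * (1 - (norm x)\<^sup>2) powr c)))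
      (K / 2 * (LINT x:cball 0 1|lborel. P x) * Beta (K / 2 + a) (c + 1)
       - K / 2 * (LINT x:cball 0 1|lborel. N x) * Beta (K / 2 + a) (c + 1))"
    by (intro has_bochner_integral_diff radial_Beta_nonneg hP K iP a c) (auto simp: P_def N_def)
  moreover have "(LINT x:cball 0 1|lborel. F x) = (LINT x:cball 0 1|lborel. P x) - (LINT x:cball 0 1|lborel. N x)"
    unfolding FPN using iP by (rule set_integral_diff)
  moreover have "(\<lambda>x. indicator (cball 0 1) x * (F x * (norm x powr (2 * a) * (1 - (norm x)\<^sup>2) powr c))) =
      (\<lambda>x. indicator (cball 0 1) x * (P x * (norm x powr (2 * a) * (1 - (norm x)\<^sup>2) powr c))
         - indicator (cball 0 1) x * (N x * (norm x powr (2 * a) * (1 - (norm x)\<^sup>2) powr c)))"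
    unfolding FPN by (simp add: left_diff_distrib right_diff_distrib)
  ultimately show ?thesis by (simp only: left_diff_distrib right_diff_distrib)
qed

section \<open>The spherical functional and integration by parts\<close>

text \<open>By translation invariance the difference quotients of \<open>F\<close> along
  \<open>e\<close> have integral 0. The mean value theorem bounds them uniformly, and dominated
  convergence passes to the derivative.\<close>

lemma integral_directional_derivative_zero:
  fixes F F' :: "'a::euclidean_space \<Rightarrow> real" and e :: 'a
  assumes cF: "continuous_on UNIV F" and cF': "continuous_on UNIV F'"
    and d: "\<And>x. ((\<lambda>t. F (x + t *\<^sub>R e)) has_real_derivative F' x) (at 0)"
    and e: "norm e = 1"
    and sF: "\<And>x. norm x > 1 \<Longrightarrow> F x = 0" and sF': "\<And>x. norm x > 1 \<Longrightarrow> F' x = 0"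
  shows "(LINT x|lborel. F' x) = 0"
proof -
  have [measurable]: "F \<in> borel_measurable borel" "F' \<in> borel_measurable borel"
    using cF cF' by (simp_all add: borel_measurable_continuous_onI)
  obtain B where B: "\<And>x. \<bar>F' x\<bar> \<le> B" "B \<ge> 0"
  proof -
    have "bounded (F' ` cball 0 1)"
      by (intro compact_imp_bounded compact_continuous_image continuous_on_subset[OF cF']) auto
    then obtain B where B: "\<forall>x\<in>cball 0 1. \<bar>F' x\<bar> \<le> B" by (auto simp: bounded_iff)
    have "\<bar>F' 0\<bar> \<le> B" using B by simp
    then have "B \<ge> 0" by linarith
    moreover have "\<bar>F' x\<bar> \<le> B" for x
    proof (cases "norm x > 1")
      case True
      then show ?thesis using sF' \<open>B \<ge> 0\<close> by simp
    qed (use B in auto)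
    ultimately show ?thesis using that by blast
  qed
  have d': "((\<lambda>t. F (x + t *\<^sub>R e)) has_real_derivative F' (x + s *\<^sub>R e)) (at s)" for x s
  proof -
    have "(\<lambda>t. F ((x + s *\<^sub>R e) + t *\<^sub>R e)) = (\<lambda>t. F (x + (t + s) *\<^sub>R e))"
      by (simp add: algebra_simps)
    then have "((\<lambda>t. F (x + (t + s) *\<^sub>R e)) has_real_derivative F' (x + s *\<^sub>R e)) (at 0)"
      using d[of "x + s *\<^sub>R e"] by simp
    then show ?thesis using DERIV_shift[of "\<lambda>t. F (x + t *\<^sub>R e)" _ 0 s] by simp
  qed
  have lip: "\<bar>F (x + s *\<^sub>R e) - F x\<bar> \<le> B * s" if "s > 0" for x s
  proof -
    have "\<exists>z. 0 < z \<and> z < s \<and> F (x + s *\<^sub>R e) - F (x + 0 *\<^sub>R e) = (s - 0) * F' (x + z *\<^sub>R e)"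
      by (rule MVT2[OF that]) (rule d')
    then obtain z where "F (x + s *\<^sub>R e) - F x = s * F' (x + z *\<^sub>R e)" by auto
    then have "\<bar>F (x + s *\<^sub>R e) - F x\<bar> = s * \<bar>F' (x + z *\<^sub>R e)\<bar>" using that by (simp add: abs_mult)
    also have "\<dots> \<le> s * B" using that B by (intro mult_left_mono) auto
    finally show ?thesis by (simp add: mult.commute)
  qed
  have intF: "integrable lborel F"
  proof -
    have "bounded (F ` cball 0 1)"
      by (intro compact_imp_bounded compact_continuous_image continuous_on_subset[OF cF]) auto
    then obtain C where "\<forall>x\<in>cball 0 1. \<bar>F x\<bar> \<le> C" by (auto simp: bounded_iff)
    moreover have "integrable lborel (\<lambda>x. C * indicator (cball (0::'a) 1) x)"
      by (intro integrable_mult_right integrable_real_indicator emeasure_lborel_cball_finite) auto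
    ultimately show ?thesis using sF
      by (intro Bochner_Integration.integrable_bound[of _ "\<lambda>x. C * indicator (cball (0::'a) 1) x" F])
         (auto simp: indicator_def not_le intro!: always_eventually intro: order_trans[OF _ abs_ge_self])
  qed
  define u where "u n x = (F (x + inverse (real (Suc n)) *\<^sub>R e) - F x) * real (Suc n)" for n x
  have "(LINT x|lborel. u n x) = 0" for n
  proof -
    define c where "c = inverse (real (Suc n)) *\<^sub>R e"
    have "integrable lborel (\<lambda>x. F (c + x))" "(LINT x|lborel. F (c + x)) = (LINT x|lborel. F x)"
      using integrable_distr_eq[of "(+) c" lborel borel F] integral_distr[of "(+) c" lborel borel F] intF
      by (simp_all add: lborel_distr_plus)
    then show ?thesis using intF unfolding u_def c_def[symmetric] by (simp add: add.commute)
  qed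
  moreover have "(\<lambda>n. LINT x|lborel. u n x) \<longlonglongrightarrow> (LINT x|lborel. F' x)"
  proof (rule integral_dominated_convergence)
    \<comment> \<open>Steps have length at most 1 and \<open>F\<close> vanishes outside the unit
      ball, so the difference quotients vanish outside the ball of radius 2.\<close>
    show "integrable lborel (\<lambda>x. B * indicator (cball (0::'a) 2) x)"
      by (intro integrable_mult_right integrable_real_indicator emeasure_lborel_cball_finite) auto
    show "u n \<in> borel_measurable lborel" for n unfolding u_def[abs_def] by measurable
    show "AE x in lborel. (\<lambda>n. u n x) \<longlonglongrightarrow> F' x"
    proof (intro always_eventually allI)
      fix x
      have "((\<lambda>h. (F (x + h *\<^sub>R e) - F x) / h) \<longlongrightarrow> F' x) (at 0)"
        using d[of x] by (simp add: DERIV_def)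
      moreover have "filterlim (\<lambda>n. inverse (real (Suc n))) (at 0) sequentially"
        unfolding filterlim_at using LIMSEQ_inverse_real_of_nat by auto
      ultimately have "(\<lambda>n. (F (x + inverse (real (Suc n)) *\<^sub>R e) - F x) / inverse (real (Suc n))) \<longlonglongrightarrow> F' x"
        by (rule filterlim_compose)
      then show "(\<lambda>n. u n x) \<longlonglongrightarrow> F' x" by (simp add: u_def[abs_def] divide_inverse)
    qed
    show "AE x in lborel. norm (u n x) \<le> B * indicator (cball 0 2) x" for n
    proof (intro always_eventually allI)
      fix x :: 'a
      define s where "s = inverse (real (Suc n))"
      have s: "0 < s" "s \<le> 1" by (auto simp: s_def field_simps)
      have u: "\<bar>u n x\<bar> = \<bar>F (x + s *\<^sub>R e) - F x\<bar> / s" by (simp add: u_def s_def abs_mult divide_inverse)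
      show "norm (u n x) \<le> B * indicator (cball 0 2) x"
      proof (cases "norm x \<le> 2")
        case True
        then show ?thesis using lip[OF s(1), of x] s by (simp add: u field_simps)
      next
        case False
        have "norm (s *\<^sub>R e) \<le> 1" using s e by simp
        then have "norm (x + s *\<^sub>R e) > 1" using False norm_diff_ineq[of x "s *\<^sub>R e"] by linarith
        then show ?thesis using False sF by (simp add: u)
      qed
    qed
  qed (simp_all)
  ultimately show ?thesis by (simp add: LIMSEQ_const_iff)
qed

text \<open>Squaring the positive part removes its kink at 0, where the difference quotient is at
  most |h|. This is why the cut-off enters squared in the integration by parts.\<close>

lemma DERIV_max_square: "((\<lambda>t. (max 0 t)\<^sup>2) has_real_derivative 2 * max 0 t) (at t)"
proof -
  consider "t < 0" | "t > 0" | "t = 0" by linarith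
  then show ?thesis
  proof cases
    case 1
    have "((\<lambda>t. 0) has_real_derivative 2 * max 0 t) (at t)" using 1 by simp
    then show ?thesis
      by (rule has_field_derivative_transform_within_open[where S="{..<0}"]) (use 1 in auto)
  next
    case 2
    have "((\<lambda>t. t\<^sup>2) has_real_derivative 2 * max 0 t) (at t)" using 2 by (auto intro!: derivative_eq_intros)
    then show ?thesis
      by (rule has_field_derivative_transform_within_open[where S="{0<..}"]) (use 2 in auto)
  next
    case 3
    have "((\<lambda>h. (max 0 h)\<^sup>2 / h) \<longlongrightarrow> 0) (at (0::real))"
    proof (rule Lim_null_comparison)
      show "\<forall>\<^sub>F h in at 0. norm ((max 0 h)\<^sup>2 / h) \<le> \<bar>h\<bar>"
        by (intro always_eventually) (auto simp: max_def power2_eq_square)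
      show "(abs \<longlongrightarrow> 0) (at (0::real))" by (intro tendsto_rabs_zero) simp
    qed
    then show ?thesis using 3 by (simp add: DERIV_def)
  qed
qed

lemma hom_bounded:
  fixes p :: "real ^ 'n \<Rightarrow> real"
  assumes "hom n p"
  obtains B where "B \<ge> 0" "\<And>x. norm x \<le> 1 \<Longrightarrow> \<bar>p x\<bar> \<le> B"
proof -
  have "bounded (p ` cball 0 1)"
    by (intro compact_imp_bounded compact_continuous_image hom_continuous[OF assms]) auto
  then obtain B where "\<forall>x\<in>cball 0 1. \<bar>p x\<bar> \<le> B" by (auto simp: bounded_iff)
  then show ?thesis using that[of "max 0 B"] by force
qed

text \<open>Used to bound \<open>f x - f (reflection v x)\<close> by a multiple of |x.v|, which
  compensates the factor 1/(x.v) uniformly in the regularization.\<close>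

lemma hom_lipschitz:
  fixes p :: "real ^ 'n \<Rightarrow> real"
  assumes "hom n p"
  shows "\<exists>L\<ge>0. \<forall>x y. norm x \<le> 1 \<longrightarrow> norm y \<le> 1 \<longrightarrow> \<bar>p x - p y\<bar> \<le> L * norm (x - y)"
  using assms
proof (induction rule: hom.induct)
  case (const c)
  then show ?case by (auto intro: exI[of _ 0])
next
  case (coord n p i)
  then obtain L where L: "L \<ge> 0" "\<And>x y. norm x \<le> 1 \<Longrightarrow> norm y \<le> 1 \<Longrightarrow> \<bar>p x - p y\<bar> \<le> L * norm (x - y)"
    by blast
  from hom_bounded[OF coord.hyps] obtain B where B: "B \<ge> 0" "\<And>x. norm x \<le> 1 \<Longrightarrow> \<bar>p x\<bar> \<le> B" by blast
  have "\<bar>x $ i * p x - y $ i * p y\<bar> \<le> (L + B) * norm (x - y)" if "norm x \<le> 1" "norm y \<le> 1" for x y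
  proof -
    have "x $ i * p x - y $ i * p y = x $ i * (p x - p y) + (x - y) $ i * p y" by (simp add: algebra_simps)
    also have "\<bar>\<dots>\<bar> \<le> \<bar>x $ i\<bar> * \<bar>p x - p y\<bar> + \<bar>(x - y) $ i\<bar> * \<bar>p y\<bar>"
      by (metis abs_mult abs_triangle_ineq)
    also have "\<dots> \<le> 1 * (L * norm (x - y)) + norm (x - y) * B"
      using that L(2)[OF that] B component_le_norm_cart[of x i] component_le_norm_cart[of "x - y" i]
      by (intro add_mono mult_mono) (auto intro: order_trans)
    finally show ?thesis by (simp add: algebra_simps)
  qed
  then show ?case using L B by (intro exI[of _ "L + B"]) auto
next
  case (add n p q)
  then obtain L M where L: "L \<ge> 0" "\<And>x y. norm x \<le> 1 \<Longrightarrow> norm y \<le> 1 \<Longrightarrow> \<bar>p x - p y\<bar> \<le> L * norm (x - y)"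
    and M: "M \<ge> 0" "\<And>x y. norm x \<le> 1 \<Longrightarrow> norm y \<le> 1 \<Longrightarrow> \<bar>q x - q y\<bar> \<le> M * norm (x - y)"
    by blast
  have "\<bar>p x + q x - (p y + q y)\<bar> \<le> (L + M) * norm (x - y)" if "norm x \<le> 1" "norm y \<le> 1" for x y
    using L(2)[OF that] M(2)[OF that] by (simp add: algebra_simps)
  then show ?case using L M by (intro exI[of _ "L + M"]) auto
qed

lemma set_integrable_ball_bounded:
  fixes f :: "'a::euclidean_space \<Rightarrow> real"
  assumes [measurable]: "f \<in> borel_measurable borel" and B: "\<And>x. norm x \<le> 1 \<Longrightarrow> \<bar>f x\<bar> \<le> B"
  shows "set_integrable lborel (cball 0 1) f"
  unfolding set_integrable_def
proof (rule Bochner_Integration.integrable_bound)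
  show "integrable lborel (\<lambda>x. B * indicator (cball (0::'a) 1) x)"
    by (intro integrable_mult_right integrable_real_indicator emeasure_lborel_cball_finite) auto
  have [measurable]: "cball (0::'a) 1 \<in> sets borel" by simp
  show "(\<lambda>x. indicator (cball 0 1) x *\<^sub>R f x) \<in> borel_measurable lborel" by simp
qed (use B in \<open>auto simp: indicator_def intro!: always_eventually intro: order_trans[OF _ abs_ge_self]\<close>)

lemma tendsto_inverse_Suc: "(\<lambda>n. inverse (real (Suc n))) \<longlonglongrightarrow> 0"
  by (rule LIMSEQ_inverse_real_of_nat)

section \<open>The weight h^2 and spherical means\<close>

context dunkl_setting
begin

definition h2 :: "real ^ 'n \<Rightarrow> real" where "h2 x = (h_kappa Rp \<kappa> x)\<^sup>2"

lemma h2_measurable [measurable]: "h2 \<in> borel_measurable borel"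
  unfolding h2_def[abs_def] h_kappa_def[abs_def] by measurable

lemma h2_nonneg: "h2 x \<ge> 0" by (simp add: h2_def)

lemma h2_pos: "regular x \<Longrightarrow> h2 x > 0"
  unfolding h2_def h_kappa_def regular_def by (auto simp: prod_zero_iff)

lemma h2_scale:
  assumes "c > 0" shows "h2 (c *\<^sub>R x) = c powr (2 * gam) * h2 x"
proof -
  have "h_kappa Rp \<kappa> (c *\<^sub>R x) = c powr gam * h_kappa Rp \<kappa> x"
    unfolding h_kappa_def gamma_kappa_def using assms
    by (simp add: abs_mult powr_mult prod.distrib powr_sum)
  then show ?thesis using assms
    by (simp add: h2_def power_mult_distrib powr_power mult.commute)
qed

lemma h2_reflection: "v \<in> Rp \<Longrightarrow> h2 (reflection v x) = h2 x"
  unfolding h2_def h_kappa_def using prod_roots_reflection[of v "\<lambda>s k. \<bar>s\<bar> powr k" x] by simp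

lemma h2_bounded:
  obtains B where "B \<ge> 0" "\<And>x. norm x \<le> 1 \<Longrightarrow> h2 x \<le> B"
proof (rule that[of "(\<Prod>v\<in>Rp. norm v powr \<kappa> v)\<^sup>2"])
  fix x :: "real ^ 'n" assume x: "norm x \<le> 1"
  have "\<bar>x \<bullet> v\<bar> powr \<kappa> v \<le> norm v powr \<kappa> v" if "v \<in> Rp" for v
  proof (rule powr_mono2)
    have "\<bar>x \<bullet> v\<bar> \<le> norm x * norm v" by (rule Cauchy_Schwarz_ineq2)
    also have "\<dots> \<le> 1 * norm v" using x by (intro mult_right_mono) auto
    finally show "\<bar>x \<bullet> v\<bar> \<le> norm v" by simp
  qed (use kappa_nonneg[OF that] in auto)
  then have "h_kappa Rp \<kappa> x \<le> (\<Prod>v\<in>Rp. norm v powr \<kappa> v)"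
    unfolding h_kappa_def by (intro prod_mono) auto
  then show "h2 x \<le> (\<Prod>v\<in>Rp. norm v powr \<kappa> v)\<^sup>2"
    unfolding h2_def by (intro power_mono) (auto simp: h_kappa_def intro: prod_nonneg)
qed simp

lemma AE_regular: "AE x in lborel. regular x"
proof -
  have "AE x in lborel. x \<bullet> v \<noteq> 0" if "v \<in> Rp" for v
  proof -
    have "negligible {x :: real ^ 'n. v \<bullet> x = 0}" using Rp_nonzero[OF that] by (intro negligible_hyperplane) auto
    then have "{x. v \<bullet> x = 0} \<in> null_sets lebesgue" by (simp add: negligible_iff_null_sets)
    moreover have "{x. v \<bullet> x = 0} \<in> sets borel" by (intro borel_closed closed_hyperplane)
    ultimately have "{x. v \<bullet> x = 0} \<in> null_sets lborel" by (simp add: null_sets_completion_iff)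
    then show ?thesis using AE_not_in by (fastforce simp: inner_commute)
  qed
  then show ?thesis unfolding regular_def by (intro AE_finite_allI finite_Rp)
qed

text \<open>The integral of p h^2 over the unit sphere if \<open>p\<close> is homogeneous of degree
  k: in polar coordinates the integral over the ball is the spherical one divided by k + 2\<gamma> +
  d = k + 2 lk + 2. The degree is an argument because a function does not carry it.\<close>

definition S :: "nat \<Rightarrow> (real ^ 'n \<Rightarrow> real) \<Rightarrow> real" where
  "S k p = (real k + 2 * lk + 2) * (LINT x:cball 0 1|lborel. p x * h2 x)"

lemma hom_h2_integrable:
  assumes "hom k p" shows "set_integrable lborel (cball 0 1) (\<lambda>x. p x * h2 x)"
proof -
  obtain A where A: "A \<ge> 0" "\<And>x. norm x \<le> 1 \<Longrightarrow> \<bar>p x\<bar> \<le> A" using hom_bounded[OF assms] by blast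
  obtain B where B: "B \<ge> 0" "\<And>x. norm x \<le> 1 \<Longrightarrow> h2 x \<le> B" using h2_bounded by blast
  have [measurable]: "p \<in> borel_measurable borel" by (rule hom_measurable[OF assms])
  show ?thesis
    by (rule set_integrable_ball_bounded[where B="A * B"])
       (auto simp: abs_mult h2_nonneg intro!: mult_mono A B)
qed

text \<open>The bridge from the sphere to every radial weight used later. It is
  \<open>radial_Beta\<close> for p h^2, which has degree k + 2\<gamma>.\<close>

lemma S_radial:
  assumes p: "hom k p" and a: "real k / 2 + lk + 1 + a > 0" and c: "c > -1"
  shows "has_bochner_integral lborel
     (\<lambda>x. indicator (cball 0 1) x * (p x * h2 x * (norm x powr (2 * a) * (1 - (norm x)\<^sup>2) powr c)))
     (S k p / 2 * Beta (real k / 2 + lk + 1 + a) (c + 1))"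
proof -
  define K where "K = real k + 2 * lk + 2"
  have K: "K > 0" using lk_nonneg by (simp add: K_def)
  have [measurable]: "p \<in> borel_measurable borel" by (rule hom_measurable[OF p])
  have "has_bochner_integral lborel
     (\<lambda>x. indicator (cball 0 1) x * (p x * h2 x * (norm x powr (2 * a) * (1 - (norm x)\<^sup>2) powr c)))
     (K / 2 * (LINT x:cball 0 1|lborel. p x * h2 x) * Beta (K / 2 + a) (c + 1))"
  proof (rule radial_Beta)
    fix b :: real and x :: "real ^ 'n" assume b: "b > 0"
    have "K - real DIM(real ^ 'n) = real k + 2 * gam" by (simp add: K_def lk_def field_simps)
    then show "p (b *\<^sub>R x) * h2 (b *\<^sub>R x) = b powr (K - real DIM(real ^ 'n)) * (p x * h2 x)"
      using b by (simp add: hom_scale[OF p] h2_scale powr_add powr_realpow)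
  qed (use K a c hom_h2_integrable[OF p] in \<open>auto simp: K_def field_simps\<close>)
  moreover have "K / 2 = real k / 2 + lk + 1" by (simp add: K_def field_simps)
  moreover have "S k p / 2 = K / 2 * (LINT x:cball 0 1|lborel. p x * h2 x)" by (simp add: S_def K_def)
  ultimately show ?thesis by (simp only:)
qed

lemma S_cmul: "S k (\<lambda>x. c * p x) = c * S k p"
  by (simp add: S_def mult.assoc)

lemma S_zero: "S k (\<lambda>x. 0) = 0"
  by (simp add: S_def)

lemma S_add: "hom k p \<Longrightarrow> hom k q \<Longrightarrow> S k (\<lambda>x. p x + q x) = S k p + S k q"
  using set_integral_add(2)[OF hom_h2_integrable hom_h2_integrable, of k p k q]
  by (simp add: S_def distrib_left distrib_right)

lemma S_sum: "(\<And>i. i \<in> A \<Longrightarrow> hom k (f i)) \<Longrightarrow> S k (\<lambda>x. \<Sum>i\<in>A. f i x) = (\<Sum>i\<in>A. S k (f i))"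
proof (induction A rule: infinite_finite_induct)
  case (insert a A)
  then show ?case using S_add[of k "f a" "\<lambda>x. \<Sum>i\<in>A. f i x"] by (simp add: hom_sum)
qed (simp_all add: S_zero)

lemma S_diff: "hom k p \<Longrightarrow> hom k q \<Longrightarrow> S k (\<lambda>x. p x - q x) = S k p - S k q"
  using S_add[of k p "\<lambda>x. (-1) * q x"] S_cmul[of k "-1" q] hom_cmul[of k q "-1"] by simp

lemma integral_reflection:
  fixes f :: "real ^ 'n \<Rightarrow> real"
  assumes "f \<in> borel_measurable borel"
  shows "(LINT x|lborel. f (reflection v x)) = (LINT x|lborel. f x)"
    "integrable lborel (\<lambda>x. f (reflection v x)) \<longleftrightarrow> integrable lborel f"
  using integral_isometry[OF reflection_linear reflection_norm reflection_involution assms]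
    integrable_isometry[OF reflection_linear reflection_norm reflection_involution assms] by auto

lemma S_reflection:
  assumes p: "hom k p" and v: "v \<in> Rp" shows "S k (\<lambda>x. p (reflection v x)) = S k p"
proof -
  have [measurable]: "p \<in> borel_measurable borel" by (rule hom_measurable[OF p])
  have [measurable]: "cball (0 :: real ^ 'n) 1 \<in> sets borel" by simp
  have "(LINT x|lborel. indicator (cball 0 1) (reflection v x) *\<^sub>R (p (reflection v x) * h2 (reflection v x)))
    = (LINT x|lborel. indicator (cball 0 1) x *\<^sub>R (p x * h2 x))"
    by (rule integral_reflection) measurable
  moreover have "indicator (cball 0 1) (reflection v x) = (indicator (cball 0 1) x :: real)" for x
    by (simp add: indicator_def)
  ultimately show ?thesis by (simp add: S_def set_lebesgue_integral_def h2_reflection[OF v])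
qed

text \<open>On the sphere |x|^2 = 1. Without a surface measure, the integral of |x|^4 (1 - |x|^2) p
  h^2 is evaluated twice by \<open>S_radial\<close>, with one factor |x|^2 counted first as part of
  the polynomial and then as part of the radial weight.\<close>

lemma S_norm_mult:
  assumes p: "hom k p" shows "S (k + 2) (\<lambda>x. (norm x)\<^sup>2 * p x) = S k p"
proof -
  have e: "(norm x)\<^sup>2 * p x * h2 x * (norm x powr (2 * 1) * (1 - (norm x)\<^sup>2) powr 1)
      = p x * h2 x * (norm x powr (2 * 2) * (1 - (norm x)\<^sup>2) powr 1)" for x
    by (cases "x = 0") (auto simp: powr_realpow[of _ 4, simplified] powr_realpow[of _ 2, simplified] power2_eq_square power4_eq_xxxx)
  have "has_bochner_integral lborel
     (\<lambda>x. indicator (cball 0 1) x * (p x * h2 x * (norm x powr (2 * 2) * (1 - (norm x)\<^sup>2) powr 1)))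
     (S (k + 2) (\<lambda>x. (norm x)\<^sup>2 * p x) / 2 * Beta (real (k + 2) / 2 + lk + 1 + 1) (1 + 1))"
  proof -
    have "real (k + 2) / 2 + lk + 1 + 1 > 0" using lk_nonneg by (simp add: add_pos_nonneg)
    from S_radial[OF hom_norm_mult[OF p] this, of 1] show ?thesis unfolding e by simp
  qed
  moreover have "has_bochner_integral lborel
     (\<lambda>x. indicator (cball 0 1) x * (p x * h2 x * (norm x powr (2 * 2) * (1 - (norm x)\<^sup>2) powr 1)))
     (S k p / 2 * Beta (real k / 2 + lk + 1 + 2) (1 + 1))"
    using S_radial[OF p, of 2 1] lk_nonneg by simp
  ultimately have "S (k + 2) (\<lambda>x. (norm x)\<^sup>2 * p x) / 2 * Beta (real k / 2 + lk + 3) 2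
      = S k p / 2 * Beta (real k / 2 + lk + 3) 2"
    using has_bochner_integral_eq by (fastforce simp: field_simps)
  moreover have "Beta (real k / 2 + lk + 3) 2 > 0" using lk_nonneg by (intro Beta_pos) auto
  ultimately show ?thesis by simp
qed

section \<open>Regularization and integration by parts\<close>

definition cut :: "real ^ 'n \<Rightarrow> real" where "cut x = max 0 (1 - (norm x)\<^sup>2)"

definition hreg :: "real \<Rightarrow> real ^ 'n \<Rightarrow> real" where
  "hreg \<epsilon> x = exp (\<Sum>v\<in>Rp. \<kappa> v * ln ((x \<bullet> v)\<^sup>2 + \<epsilon>))"

text \<open>A regularized 1/(x.v): multiplied by 2 \<kappa>(v) v_i it is the contribution of
  \<open>v\<close> to the logarithmic derivative of \<open>hreg \<epsilon>\<close> in direction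
  i.\<close>

definition quot :: "real \<Rightarrow> real ^ 'n \<Rightarrow> real ^ 'n \<Rightarrow> real" where
  "quot \<epsilon> v x = (x \<bullet> v) / ((x \<bullet> v)\<^sup>2 + \<epsilon>)"

lemma cut_continuous: "continuous_on A cut"
  unfolding cut_def[abs_def] by (intro continuous_intros)

lemma hreg_continuous: "\<epsilon> > 0 \<Longrightarrow> continuous_on A (hreg \<epsilon>)"
  unfolding hreg_def[abs_def] by (intro continuous_intros) (metis add_nonneg_pos less_irrefl zero_le_power2)

lemma quot_continuous: "\<epsilon> > 0 \<Longrightarrow> continuous_on A (quot \<epsilon> v)"
  unfolding quot_def[abs_def] by (intro continuous_intros) (metis add_nonneg_pos less_irrefl zero_le_power2)

lemma cut_outside: "norm x > 1 \<Longrightarrow> cut x = 0"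
  unfolding cut_def using power_strict_mono[of 1 "norm x" 2] by simp

text \<open>The integrand is the i-th derivative of p cut^2 hreg, continuous and supported in the
  unit ball, so no boundary term arises; the term with 4 x_i comes from the cut-off and the sum from
  \<open>hreg\<close>.\<close>

lemma integral_derivative_regularized:
  assumes p: "hom k p" and \<epsilon>: "\<epsilon> > 0"
  shows "(LINT x|lborel. (partial_deriv i p x * (cut x)\<^sup>2 - 4 * x $ i * p x * cut x
     + (\<Sum>v\<in>Rp. 2 * \<kappa> v * v $ i * quot \<epsilon> v x * p x * (cut x)\<^sup>2)) * hreg \<epsilon> x) = 0"
proof (rule integral_directional_derivative_zero[of "\<lambda>x. p x * (cut x)\<^sup>2 * hreg \<epsilon> x" _ "axis i 1"])
  show "continuous_on UNIV (\<lambda>x. p x * (cut x)\<^sup>2 * hreg \<epsilon> x)"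
    by (intro continuous_intros hom_continuous[OF p] cut_continuous hreg_continuous \<epsilon>)
  show "continuous_on UNIV (\<lambda>x. (partial_deriv i p x * (cut x)\<^sup>2 - 4 * x $ i * p x * cut x
     + (\<Sum>v\<in>Rp. 2 * \<kappa> v * v $ i * quot \<epsilon> v x * p x * (cut x)\<^sup>2)) * hreg \<epsilon> x)"
    by (intro continuous_intros hom_continuous[OF p] hom_continuous[OF partial_deriv_pred[OF p]]
        cut_continuous hreg_continuous quot_continuous \<epsilon>)
  fix x :: "real ^ 'n"
  have in_ax: "axis i 1 \<bullet> y = y $ i" "y \<bullet> axis i 1 = y $ i" for y :: "real ^ 'n"
    by (simp_all add: inner_axis inner_axis')
  have line: "((\<lambda>t. (x + t *\<^sub>R axis i 1) \<bullet> v) has_real_derivative v $ i) (at 0)" for v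
    by (auto simp: inner_add_left in_ax intro!: derivative_eq_intros)
  have "((\<lambda>t. 1 - (norm (x + t *\<^sub>R axis i 1))\<^sup>2) has_real_derivative (- 2 * x $ i)) (at 0)"
    by (auto simp: power2_norm_eq_inner inner_add_left inner_add_right in_ax intro!: derivative_eq_intros)
  then have dcut: "((\<lambda>t. (cut (x + t *\<^sub>R axis i 1))\<^sup>2) has_real_derivative (2 * cut x * (- 2 * x $ i))) (at 0)"
    using DERIV_chain2[OF DERIV_max_square] unfolding cut_def by fastforce
  have pos: "(x \<bullet> v)\<^sup>2 + \<epsilon> > 0" for v using \<epsilon> by (simp add: add_nonneg_pos)
  have "((\<lambda>t. \<Sum>v\<in>Rp. \<kappa> v * ln (((x + t *\<^sub>R axis i 1) \<bullet> v)\<^sup>2 + \<epsilon>)) has_real_derivative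
      (\<Sum>v\<in>Rp. 2 * \<kappa> v * v $ i * quot \<epsilon> v x)) (at 0)"
  proof (rule DERIV_sum)
    fix v
    show "((\<lambda>t. \<kappa> v * ln (((x + t *\<^sub>R axis i 1) \<bullet> v)\<^sup>2 + \<epsilon>)) has_real_derivative
      2 * \<kappa> v * v $ i * quot \<epsilon> v x) (at 0)"
      using pos[of v] by (auto intro!: derivative_eq_intros line simp: quot_def field_simps)
  qed
  from DERIV_chain2[OF DERIV_exp this]
  have dh: "((\<lambda>t. hreg \<epsilon> (x + t *\<^sub>R axis i 1)) has_real_derivative
      hreg \<epsilon> x * (\<Sum>v\<in>Rp. 2 * \<kappa> v * v $ i * quot \<epsilon> v x)) (at 0)"
    by (simp add: hreg_def)
  show "((\<lambda>t. p (x + t *\<^sub>R axis i 1) * (cut (x + t *\<^sub>R axis i 1))\<^sup>2 * hreg \<epsilon> (x + t *\<^sub>R axis i 1))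
     has_real_derivative (partial_deriv i p x * (cut x)\<^sup>2 - 4 * x $ i * p x * cut x
     + (\<Sum>v\<in>Rp. 2 * \<kappa> v * v $ i * quot \<epsilon> v x * p x * (cut x)\<^sup>2)) * hreg \<epsilon> x) (at 0)"
    by (rule DERIV_cong[OF DERIV_mult[OF DERIV_mult[OF has_derivative_along[OF p] dcut] dh]])
       (simp add: algebra_simps sum_distrib_left)
  show "norm x > 1 \<Longrightarrow> p x * (cut x)\<^sup>2 * hreg \<epsilon> x = 0" by (simp add: cut_outside)
  show "norm x > 1 \<Longrightarrow> (partial_deriv i p x * (cut x)\<^sup>2 - 4 * x $ i * p x * cut x
     + (\<Sum>v\<in>Rp. 2 * \<kappa> v * v $ i * quot \<epsilon> v x * p x * (cut x)\<^sup>2)) * hreg \<epsilon> x = 0"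
    by (simp add: cut_outside)
qed simp

lemma integrable_cut:
  assumes "continuous_on UNIV f" shows "integrable lborel (\<lambda>x. f x * cut x)"
proof -
  have [measurable]: "(\<lambda>x. f x * cut x) \<in> borel_measurable borel"
    by (intro borel_measurable_continuous_onI continuous_intros assms cut_continuous)
  have "bounded ((\<lambda>x. f x * cut x) ` cball 0 1)"
    by (intro compact_imp_bounded compact_continuous_image continuous_intros cut_continuous
        continuous_on_subset[OF assms]) auto
  then obtain B where "\<forall>x\<in>cball 0 1. \<bar>f x * cut x\<bar> \<le> B" by (auto simp: bounded_iff)
  then have "set_integrable lborel (cball 0 1) (\<lambda>x. f x * cut x)"
    by (intro set_integrable_ball_bounded[where B=B]) auto
  moreover have "(\<lambda>x. indicator (cball 0 1) x *\<^sub>R (f x * cut x)) = (\<lambda>x. f x * cut x)"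
    using cut_outside by (auto simp: indicator_def fun_eq_iff)
  ultimately show ?thesis by (simp add: set_integrable_def)
qed

text \<open>The regularized singular term, symmetrized under the reflection in \<open>v\<close>, which
  changes the sign of \<open>quot \<epsilon> v\<close> and fixes the other factors.\<close>

lemma symmetrize_quot:
  assumes f: "hom a f" and g: "hom b g" and v: "v \<in> Rp" and \<epsilon>: "\<epsilon> > 0"
  shows "(LINT x|lborel. 2 * quot \<epsilon> v x * (f x * g x) * (cut x)\<^sup>2 * hreg \<epsilon> x) =
     (LINT x|lborel. quot \<epsilon> v x * ((f x - f (reflection v x)) * g x + f x * (g x - g (reflection v x))) * (cut x)\<^sup>2 * hreg \<epsilon> x)"
proof -
  define s where "s = (\<lambda>x. quot \<epsilon> v x * (f (reflection v x) * g x + f x * g (reflection v x)) * (cut x)\<^sup>2 * hreg \<epsilon> x)"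
  define A where "A = (\<lambda>x. 2 * quot \<epsilon> v x * (f x * g x) * (cut x)\<^sup>2 * hreg \<epsilon> x)"
  note cs = hom_continuous[OF f] hom_continuous[OF g] hom_continuous[OF hom_reflection[OF f]]
    hom_continuous[OF hom_reflection[OF g]] quot_continuous[OF \<epsilon>] hreg_continuous[OF \<epsilon>] cut_continuous
  have "integrable lborel (\<lambda>x. (quot \<epsilon> v x * (f (reflection v x) * g x + f x * g (reflection v x)) * cut x * hreg \<epsilon> x) * cut x)"
    by (intro integrable_cut continuous_intros cs)
  then have iS: "integrable lborel s" by (simp add: s_def power2_eq_square mult_ac)
  have "integrable lborel (\<lambda>x. (2 * quot \<epsilon> v x * (f x * g x) * cut x * hreg \<epsilon> x) * cut x)"
    by (intro integrable_cut continuous_intros cs)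
  then have iA: "integrable lborel A" by (simp add: A_def power2_eq_square mult_ac)
  have odd: "s (reflection v x) = - s x" for x
  proof -
    have "quot \<epsilon> v (reflection v x) = - quot \<epsilon> v x"
      by (simp add: quot_def reflection_inner Rp_nonzero[OF v])
    moreover have "cut (reflection v x) = cut x" by (simp add: cut_def)
    moreover have "hreg \<epsilon> (reflection v x) = hreg \<epsilon> x"
      unfolding hreg_def using sum_roots_reflection[OF v, of "\<lambda>s k. k * ln (s\<^sup>2 + \<epsilon>)" x] by simp
    ultimately show ?thesis by (simp add: s_def algebra_simps)
  qed
  have [measurable]: "s \<in> borel_measurable borel" unfolding s_def
    by (intro borel_measurable_continuous_onI continuous_intros cs)
  have "(LINT x|lborel. s x) = - (LINT x|lborel. s x)"
    using integral_reflection(1)[of s v] by (simp add: odd)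
  then have "(LINT x|lborel. A x) = (LINT x|lborel. A x - s x)" using iA iS by simp
  also have "(\<lambda>x. A x - s x) = (\<lambda>x. quot \<epsilon> v x * ((f x - f (reflection v x)) * g x + f x * (g x - g (reflection v x))) * (cut x)\<^sup>2 * hreg \<epsilon> x)"
    by (simp add: A_def s_def algebra_simps fun_eq_iff)
  finally show ?thesis by (simp add: A_def)
qed


lemma integrable_cut_h2:
  assumes "continuous_on UNIV f" shows "integrable lborel (\<lambda>x. f x * cut x * h2 x)"
proof -
  obtain H where H: "H \<ge> 0" "\<And>x. norm x \<le> 1 \<Longrightarrow> h2 x \<le> H" using h2_bounded by blast
  have [measurable]: "(\<lambda>x. f x * cut x) \<in> borel_measurable borel"
    by (intro borel_measurable_continuous_onI continuous_intros assms cut_continuous)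
  have "bounded ((\<lambda>x. f x * cut x) ` cball 0 1)"
    by (intro compact_imp_bounded compact_continuous_image continuous_intros cut_continuous
        continuous_on_subset[OF assms]) auto
  then obtain B where B: "\<forall>x\<in>cball 0 1. \<bar>f x * cut x\<bar> \<le> B" by (auto simp: bounded_iff)
  have "set_integrable lborel (cball 0 1) (\<lambda>x. f x * cut x * h2 x)"
  proof (rule set_integrable_ball_bounded[where B="B * H"])
    fix x :: "real ^ 'n" assume x: "norm x \<le> 1"
    have "\<bar>f x * cut x\<bar> * \<bar>h2 x\<bar> \<le> B * H"
      using B H x by (intro mult_mono) (auto simp: h2_nonneg intro: order_trans[OF abs_ge_zero])
    then show "\<bar>f x * cut x * h2 x\<bar> \<le> B * H" by (simp add: abs_mult)
  qed measurable
  moreover have "(\<lambda>x. indicator (cball 0 1) x *\<^sub>R (f x * cut x * h2 x)) = (\<lambda>x. f x * cut x * h2 x)"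
    using cut_outside by (auto simp: indicator_def fun_eq_iff)
  ultimately show ?thesis by (simp add: set_integrable_def)
qed

lemma hreg_tendsto:
  assumes "regular x"
  shows "(\<lambda>n. hreg (inverse (real (Suc n))) x) \<longlonglongrightarrow> h2 x"
proof -
  have "(\<lambda>n. hreg (inverse (real (Suc n))) x) \<longlonglongrightarrow> exp (\<Sum>v\<in>Rp. \<kappa> v * ln ((x \<bullet> v)\<^sup>2 + 0))"
    unfolding hreg_def using assms
    by (intro tendsto_intros tendsto_inverse_Suc) (auto simp: regular_def)
  also have "exp (\<Sum>v\<in>Rp. \<kappa> v * ln ((x \<bullet> v)\<^sup>2 + 0)) = h2 x"
  proof -
    have "exp (\<kappa> v * ln ((x \<bullet> v)\<^sup>2)) = (\<bar>x \<bullet> v\<bar> powr \<kappa> v)\<^sup>2" if "v \<in> Rp" for v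
    proof -
      have nz: "x \<bullet> v \<noteq> 0" using assms that by (auto simp: regular_def)
      then have "ln ((x \<bullet> v)\<^sup>2) = 2 * ln \<bar>x \<bullet> v\<bar>"
        by (metis ln_realpow of_nat_numeral power2_abs zero_less_abs_iff)
      then show ?thesis using nz by (simp add: powr_def exp_double[symmetric] mult_ac)
    qed
    then show ?thesis by (simp add: exp_sum h2_def h_kappa_def prod_power_distrib)
  qed
  finally show ?thesis .
qed

lemma hreg_bounded:
  obtains H where "H \<ge> 0" "\<And>\<epsilon> x. 0 < \<epsilon> \<Longrightarrow> \<epsilon> \<le> 1 \<Longrightarrow> norm x \<le> 1 \<Longrightarrow> hreg \<epsilon> x \<le> H"
proof (rule that[of "exp (\<Sum>v\<in>Rp. \<kappa> v * ln ((norm v)\<^sup>2 + 1))"])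
  fix \<epsilon> :: real and x :: "real ^ 'n" assume \<epsilon>: "0 < \<epsilon>" "\<epsilon> \<le> 1" and x: "norm x \<le> 1"
  have "ln ((x \<bullet> v)\<^sup>2 + \<epsilon>) \<le> ln ((norm v)\<^sup>2 + 1)" for v
  proof (subst ln_le_cancel_iff)
    have "\<bar>x \<bullet> v\<bar> \<le> norm x * norm v" by (rule Cauchy_Schwarz_ineq2)
    also have "\<dots> \<le> 1 * norm v" using x by (intro mult_right_mono) auto
    finally have "(x \<bullet> v)\<^sup>2 \<le> (norm v)\<^sup>2" by (simp add: abs_le_square_iff[symmetric])
    then show "(x \<bullet> v)\<^sup>2 + \<epsilon> \<le> (norm v)\<^sup>2 + 1" using \<epsilon> by simp
  qed (use \<epsilon> in \<open>auto simp: add_nonneg_pos\<close>)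
  then show "hreg \<epsilon> x \<le> exp (\<Sum>v\<in>Rp. \<kappa> v * ln ((norm v)\<^sup>2 + 1))"
    unfolding hreg_def by (auto intro!: sum_mono mult_left_mono kappa_nonneg)
qed simp

text \<open>Differentiating h^2 produces p h^2 / (x.v), which can be unbounded when \<kappa>(v) is
  small. Symmetrizing before the limit replaces it by differences of \<open>f\<close> and
  \<open>g\<close> across the hyperplane. These are O(|x.v|), and they are exactly the difference
  quotients in \<open>D i f x * g x + f x * D i g x\<close>.\<close>

lemma integration_by_parts:
  assumes f: "hom a f" and g: "hom b g"
  shows "(LINT x|lborel. (D i f x * g x + f x * D i g x) * (cut x)\<^sup>2 * h2 x) =
     4 * (LINT x|lborel. x $ i * (f x * g x) * cut x * h2 x)"
proof -
  define T where "T v x = (f x - f (reflection v x)) * g x + f x * (g x - g (reflection v x))" for v x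
  define p where "p = (\<lambda>x. f x * g x)"
  have p: "hom (a + b) p" unfolding p_def by (rule hom_mult[OF f g])
  define A where "A \<epsilon> x = (partial_deriv i p x * (cut x)\<^sup>2 - 4 * x $ i * p x * cut x
     + (\<Sum>v\<in>Rp. \<kappa> v * v $ i * (quot \<epsilon> v x * T v x) * (cut x)\<^sup>2)) * hreg \<epsilon> x" for \<epsilon> x
  have cT: "continuous_on UNIV (T v)" for v
    unfolding T_def[abs_def] by (intro continuous_intros hom_continuous[OF f] hom_continuous[OF g]
        hom_continuous[OF hom_reflection[OF f]] hom_continuous[OF hom_reflection[OF g]])
  note cs = hom_continuous[OF p] hom_continuous[OF partial_deriv_pred[OF p]] quot_continuous
    hreg_continuous cut_continuous cT
  have A0: "(LINT x|lborel. A \<epsilon> x) = 0" if \<epsilon>: "\<epsilon> > 0" for \<epsilon>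
  proof -
    define B where "B x = (partial_deriv i p x * cut x - 4 * x $ i * p x) * hreg \<epsilon> x * cut x" for x
    define Q where "Q v x = quot \<epsilon> v x * T v x * (cut x)\<^sup>2 * hreg \<epsilon> x" for v x
    define R where "R v x = 2 * quot \<epsilon> v x * p x * (cut x)\<^sup>2 * hreg \<epsilon> x" for v x
    have iB: "integrable lborel B" unfolding B_def[abs_def]
      by (intro integrable_cut continuous_intros cs \<epsilon>)
    have "integrable lborel (\<lambda>x. (quot \<epsilon> v x * T v x * cut x * hreg \<epsilon> x) * cut x)" for v
      by (intro integrable_cut continuous_intros cs \<epsilon>)
    then have iQ: "integrable lborel (Q v)" for v by (simp add: Q_def[abs_def] power2_eq_square mult_ac)
    have "integrable lborel (\<lambda>x. (2 * quot \<epsilon> v x * p x * cut x * hreg \<epsilon> x) * cut x)" for v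
      by (intro integrable_cut continuous_intros cs \<epsilon>)
    then have iR: "integrable lborel (R v)" for v by (simp add: R_def[abs_def] power2_eq_square mult_ac)
    have QR: "(LINT x|lborel. R v x) = (LINT x|lborel. Q v x)" if "v \<in> Rp" for v
      using symmetrize_quot[OF f g that \<epsilon>] by (simp add: R_def Q_def p_def T_def)
    have "A \<epsilon> = (\<lambda>x. B x + (\<Sum>v\<in>Rp. (\<kappa> v * v $ i) * Q v x))"
      by (simp add: A_def[abs_def] B_def Q_def fun_eq_iff algebra_simps sum_distrib_left power2_eq_square)
    then have "(LINT x|lborel. A \<epsilon> x) = (LINT x|lborel. B x) + (\<Sum>v\<in>Rp. (\<kappa> v * v $ i) * (LINT x|lborel. Q v x))"
      using iB iQ by (simp add: integral_sum)
    also have "\<dots> = (LINT x|lborel. B x) + (\<Sum>v\<in>Rp. (\<kappa> v * v $ i) * (LINT x|lborel. R v x))"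
      using QR by simp
    also have "\<dots> = (LINT x|lborel. B x + (\<Sum>v\<in>Rp. (\<kappa> v * v $ i) * R v x))"
      using iB iR by (simp add: integral_sum)
    also have "(\<lambda>x. B x + (\<Sum>v\<in>Rp. (\<kappa> v * v $ i) * R v x)) =
       (\<lambda>x. (partial_deriv i p x * (cut x)\<^sup>2 - 4 * x $ i * p x * cut x
          + (\<Sum>v\<in>Rp. 2 * \<kappa> v * v $ i * quot \<epsilon> v x * p x * (cut x)\<^sup>2)) * hreg \<epsilon> x)"
      by (simp add: B_def R_def fun_eq_iff algebra_simps sum_distrib_left power2_eq_square)
    finally show ?thesis using integral_derivative_regularized[OF p \<epsilon>] by simp
  qed
  define A' where "A' x = (partial_deriv i p x * (cut x)\<^sup>2 - 4 * x $ i * p x * cut x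
     + (\<Sum>v\<in>Rp. \<kappa> v * v $ i * (1 / (x \<bullet> v) * T v x) * (cut x)\<^sup>2)) * h2 x" for x
  obtain Bf where Bf: "Bf \<ge> 0" "\<And>x. norm x \<le> 1 \<Longrightarrow> \<bar>f x\<bar> \<le> Bf" using hom_bounded[OF f] by blast
  obtain Bg where Bg: "Bg \<ge> 0" "\<And>x. norm x \<le> 1 \<Longrightarrow> \<bar>g x\<bar> \<le> Bg" using hom_bounded[OF g] by blast
  obtain Bp where Bp: "Bp \<ge> 0" "\<And>x. norm x \<le> 1 \<Longrightarrow> \<bar>p x\<bar> \<le> Bp" using hom_bounded[OF p] by blast
  obtain Bd where Bd: "Bd \<ge> 0" "\<And>x. norm x \<le> 1 \<Longrightarrow> \<bar>partial_deriv i p x\<bar> \<le> Bd"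
    using hom_bounded[OF partial_deriv_pred[OF p]] by blast
  obtain Lf where Lf: "Lf \<ge> 0" "\<And>x y. norm x \<le> 1 \<Longrightarrow> norm y \<le> 1 \<Longrightarrow> \<bar>f x - f y\<bar> \<le> Lf * norm (x - y)"
    using hom_lipschitz[OF f] by blast
  obtain Lg where Lg: "Lg \<ge> 0" "\<And>x y. norm x \<le> 1 \<Longrightarrow> norm y \<le> 1 \<Longrightarrow> \<bar>g x - g y\<bar> \<le> Lg * norm (x - y)"
    using hom_lipschitz[OF g] by blast
  obtain H where H: "H \<ge> 0" "\<And>\<epsilon> x. 0 < \<epsilon> \<Longrightarrow> \<epsilon> \<le> 1 \<Longrightarrow> norm x \<le> 1 \<Longrightarrow> hreg \<epsilon> x \<le> H"
    using hreg_bounded by blast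
  \<comment> \<open>The distance from x to its reflection is 2 |x.v| / |v|; the Lipschitz constants
    are multiplied by this factor.\<close>
  define M where "M v = (Lf * Bg + Bf * Lg) * (2 / norm v)" for v :: "real ^ 'n"
  have M0: "M v \<ge> 0" for v using Lf Bg Bf Lg by (simp add: M_def)
  \<comment> \<open>Uniform in \<epsilon>: the factor |x.v| from \<open>T\<close> and the one in the
    numerator of \<open>quot\<close> give (x.v)^2, which is at most the denominator.\<close>
  have qT: "\<bar>quot \<epsilon> v x * T v x\<bar> \<le> M v" if \<epsilon>: "\<epsilon> > 0" and v: "v \<in> Rp" and x: "norm x \<le> 1" for \<epsilon> v x
  proof -
    have nv: "norm v > 0" using Rp_nonzero[OF v] by simp
    have d: "norm (x - reflection v x) = 2 * \<bar>x \<bullet> v\<bar> / norm v"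
      using nv by (simp add: reflection_def power2_eq_square)
    have "\<bar>T v x\<bar> \<le> \<bar>f x - f (reflection v x)\<bar> * \<bar>g x\<bar> + \<bar>f x\<bar> * \<bar>g x - g (reflection v x)\<bar>"
      unfolding T_def by (metis abs_mult abs_triangle_ineq)
    also have "\<dots> \<le> (Lf * norm (x - reflection v x)) * Bg + Bf * (Lg * norm (x - reflection v x))"
      using x Lf Lg Bf Bg by (intro add_mono mult_mono) auto
    also have "\<dots> = M v * \<bar>x \<bullet> v\<bar>" by (simp add: d M_def algebra_simps)
    finally have T: "\<bar>T v x\<bar> \<le> M v * \<bar>x \<bullet> v\<bar>" .
    have pos: "(x \<bullet> v)\<^sup>2 + \<epsilon> > 0" using \<epsilon> by (simp add: add_nonneg_pos)
    have "\<bar>quot \<epsilon> v x * T v x\<bar> = \<bar>x \<bullet> v\<bar> / ((x \<bullet> v)\<^sup>2 + \<epsilon>) * \<bar>T v x\<bar>"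
      using pos by (simp add: quot_def abs_mult)
    also have "\<dots> \<le> \<bar>x \<bullet> v\<bar> / ((x \<bullet> v)\<^sup>2 + \<epsilon>) * (M v * \<bar>x \<bullet> v\<bar>)"
      using pos T by (intro mult_left_mono) auto
    also have "\<dots> = M v * ((x \<bullet> v)\<^sup>2 / ((x \<bullet> v)\<^sup>2 + \<epsilon>))" by (simp add: power2_eq_square)
    also have "\<dots> \<le> M v * 1" using pos \<epsilon> M0 by (intro mult_left_mono) auto
    finally show ?thesis by simp
  qed
  have cut1: "0 \<le> cut x" "cut x \<le> 1" for x by (auto simp: cut_def)
  define C where "C = (Bd + 4 * Bp + (\<Sum>v\<in>Rp. \<kappa> v * \<bar>v $ i\<bar> * M v)) * H"
  have bound: "\<bar>A \<epsilon> x\<bar> \<le> C * indicator (cball 0 1) x" if \<epsilon>: "\<epsilon> > 0" "\<epsilon> \<le> 1" for \<epsilon> x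
  proof (cases "norm x \<le> 1")
    case True
    have c2: "(cut x)\<^sup>2 \<le> 1" using cut1[of x] by (simp add: power_le_one)
    have 1: "\<bar>partial_deriv i p x * (cut x)\<^sup>2\<bar> \<le> Bd * 1"
      unfolding abs_mult using Bd True c2 by (intro mult_mono) auto
    have "\<bar>x $ i\<bar> \<le> 1" using component_le_norm_cart[of x i] True by linarith
    then have "\<bar>x $ i\<bar> * \<bar>p x\<bar> * \<bar>cut x\<bar> \<le> 1 * Bp * 1"
      using Bp True cut1[of x] by (intro mult_mono) auto
    then have 2: "\<bar>4 * x $ i * p x * cut x\<bar> \<le> 4 * Bp" by (simp add: abs_mult)
    have 3: "\<bar>\<Sum>v\<in>Rp. \<kappa> v * v $ i * (quot \<epsilon> v x * T v x) * (cut x)\<^sup>2\<bar> \<le> (\<Sum>v\<in>Rp. \<kappa> v * \<bar>v $ i\<bar> * M v)"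
    proof (rule order_trans[OF sum_abs], rule sum_mono)
      fix v assume v: "v \<in> Rp"
      have "\<kappa> v * \<bar>v $ i\<bar> * \<bar>quot \<epsilon> v x * T v x\<bar> * (cut x)\<^sup>2 \<le> \<kappa> v * \<bar>v $ i\<bar> * M v * 1"
        using qT[OF \<epsilon>(1) v True] c2 kappa_nonneg[OF v] M0 by (intro mult_mono) auto
      then show "\<bar>\<kappa> v * v $ i * (quot \<epsilon> v x * T v x) * (cut x)\<^sup>2\<bar> \<le> \<kappa> v * \<bar>v $ i\<bar> * M v"
        using kappa_nonneg[OF v] by (simp add: abs_mult)
    qed
    have "\<bar>A \<epsilon> x\<bar> \<le> (Bd + 4 * Bp + (\<Sum>v\<in>Rp. \<kappa> v * \<bar>v $ i\<bar> * M v)) * H"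
      unfolding A_def abs_mult[of _ "hreg \<epsilon> x"]
    proof (rule mult_mono)
      show "\<bar>hreg \<epsilon> x\<bar> \<le> H" using H(2)[OF \<epsilon> True] by (simp add: hreg_def)
      show "\<bar>partial_deriv i p x * (cut x)\<^sup>2 - 4 * x $ i * p x * cut x +
        (\<Sum>v\<in>Rp. \<kappa> v * v $ i * (quot \<epsilon> v x * T v x) * (cut x)\<^sup>2)\<bar>
        \<le> Bd + 4 * Bp + (\<Sum>v\<in>Rp. \<kappa> v * \<bar>v $ i\<bar> * M v)"
        using 1 2 3 by linarith
      then show "0 \<le> Bd + 4 * Bp + (\<Sum>v\<in>Rp. \<kappa> v * \<bar>v $ i\<bar> * M v)" by linarith
    qed simp
    then show ?thesis using True by (simp add: C_def)
  next
    case False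
    then show ?thesis by (simp add: A_def cut_outside)
  qed
  have [measurable]: "A \<epsilon> \<in> borel_measurable borel" if "\<epsilon> > 0" for \<epsilon>
    unfolding A_def[abs_def] by (intro borel_measurable_continuous_onI continuous_intros cs that)
  have [measurable]: "p \<in> borel_measurable borel" "partial_deriv i p \<in> borel_measurable borel"
    "cut \<in> borel_measurable borel" "T v \<in> borel_measurable borel" for v
    by (intro borel_measurable_continuous_onI cs)+
  have "(\<lambda>n. LINT x|lborel. A (inverse (real (Suc n))) x) \<longlonglongrightarrow> (LINT x|lborel. A' x)"
  proof (rule integral_dominated_convergence)
    show "integrable lborel (\<lambda>x. C * indicator (cball (0::real ^ 'n) 1) x)"
      by (intro integrable_mult_right integrable_real_indicator emeasure_lborel_cball_finite) auto
    show "A (inverse (real (Suc n))) \<in> borel_measurable lborel" for n by simp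
    show "A' \<in> borel_measurable lborel" unfolding A'_def[abs_def] by measurable
    show "AE x in lborel. (\<lambda>n. A (inverse (real (Suc n))) x) \<longlonglongrightarrow> A' x"
      using AE_regular
    proof eventually_elim
      fix x :: "real ^ 'n" assume x: "regular x"
      have q: "(\<lambda>n. quot (inverse (real (Suc n))) v x) \<longlonglongrightarrow> 1 / (x \<bullet> v)" if "v \<in> Rp" for v
      proof -
        have nz: "x \<bullet> v \<noteq> 0" using x that by (auto simp: regular_def)
        have "(\<lambda>n. quot (inverse (real (Suc n))) v x) \<longlonglongrightarrow> (x \<bullet> v) / ((x \<bullet> v)\<^sup>2 + 0)"
          unfolding quot_def using nz by (intro tendsto_intros tendsto_inverse_Suc) auto
        then show ?thesis using nz by (simp add: power2_eq_square)
      qed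
      show "(\<lambda>n. A (inverse (real (Suc n))) x) \<longlonglongrightarrow> A' x"
        unfolding A_def A'_def by (intro tendsto_intros q hreg_tendsto x)
    qed
    show "AE x in lborel. norm (A (inverse (real (Suc n))) x) \<le> C * indicator (cball 0 1) x" for n
      using bound[of "inverse (real (Suc n))"] by (auto intro!: always_eventually simp: field_simps)
  qed
  moreover have "(LINT x|lborel. A (inverse (real (Suc n))) x) = 0" for n by (rule A0) simp
  ultimately have A'0: "(LINT x|lborel. A' x) = 0" by (simp add: LIMSEQ_const_iff)
  define P Q where "P x = (D i f x * g x + f x * D i g x) * (cut x)\<^sup>2 * h2 x"
    and "Q x = 4 * (x $ i * (f x * g x) * cut x * h2 x)" for x
  note cfg = hom_continuous[OF f] hom_continuous[OF g] hom_continuous[OF D_hom[OF f]] hom_continuous[OF D_hom[OF g]]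
  have "integrable lborel (\<lambda>x. (D i f x * g x + f x * D i g x) * cut x * cut x * h2 x)"
    by (intro integrable_cut_h2 continuous_intros cfg cut_continuous)
  then have iP: "integrable lborel P" by (simp add: P_def[abs_def] power2_eq_square mult.assoc)
  have iQ: "integrable lborel Q" unfolding Q_def[abs_def]
    by (intro integrable_mult_right integrable_cut_h2 continuous_intros cfg)
  \<comment> \<open>Off the hyperplanes the partial derivatives of \<open>p\<close> and the limits
    of the symmetrized terms assemble to the Dunkl operators.\<close>
  have "A' x = P x - Q x" if x: "regular x" for x
  proof -
    define W where "W = (\<Sum>v\<in>Rp. \<kappa> v * v $ i * (1 / (x \<bullet> v) * T v x))"
    have s: "(\<Sum>v\<in>Rp. \<kappa> v * v $ i * (1 / (x \<bullet> v) * T v x) * (cut x)\<^sup>2) = W * (cut x)\<^sup>2"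
      by (simp only: W_def sum_distrib_right)
    have e1: "partial_deriv i p x = f x * partial_deriv i g x + partial_deriv i f x * g x"
      unfolding p_def by (intro partial_deriv_mult hom_differentiable[OF f] hom_differentiable[OF g])
    have e2: "D i f x * g x + f x * D i g x = f x * partial_deriv i g x + partial_deriv i f x * g x + W"
    proof -
      have "W =
        (\<Sum>v\<in>Rp. \<kappa> v * ((f x - f (reflection v x)) / (x \<bullet> v)) * v $ i) * g x
        + f x * (\<Sum>v\<in>Rp. \<kappa> v * ((g x - g (reflection v x)) / (x \<bullet> v)) * v $ i)"
        unfolding W_def sum_distrib_left sum_distrib_right sum.distrib[symmetric]
        by (intro sum.cong) (auto simp: T_def algebra_simps add_divide_distrib diff_divide_distrib)
      then show ?thesis unfolding D_regular[OF x] by (simp add: algebra_simps)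
    qed
    show ?thesis unfolding A'_def P_def Q_def s e1 e2 by (simp add: p_def algebra_simps)
  qed
  then have "(LINT x|lborel. A' x) = (LINT x|lborel. P x - Q x)"
    using AE_regular iP iQ unfolding A'_def[abs_def]
    by (intro integral_cong_AE) (measurable, auto simp: A'_def[symmetric] elim: eventually_mono)
  then have "(LINT x|lborel. P x) = (LINT x|lborel. Q x)" using A'0 iP iQ by simp
  then show ?thesis by (simp add: P_def Q_def)
qed

section \<open>Integration by parts on the sphere and orthogonality of h-harmonics\<close>

lemma S_cut:
  assumes p: "hom k p" and m: "m > 0"
  shows "(LINT x|lborel. p x * cut x ^ m * h2 x) = S k p / 2 * Beta (real k / 2 + lk + 1) (real m + 1)"
proof -
  have [measurable]: "p \<in> borel_measurable borel" "cut \<in> borel_measurable borel"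
    by (intro borel_measurable_continuous_onI hom_continuous[OF p] cut_continuous)+
  have [measurable]: "cball (0 :: real ^ 'n) 1 \<in> sets borel" by simp
  have "has_bochner_integral lborel
     (\<lambda>x. indicator (cball 0 1) x * (p x * h2 x * (norm x powr (2 * 0) * (1 - (norm x)\<^sup>2) powr real m)))
     (S k p / 2 * Beta (real k / 2 + lk + 1 + 0) (real m + 1))"
    using lk_nonneg by (intro S_radial p) (auto simp: add_nonneg_pos)
  then have "(LINT x|lborel. indicator (cball 0 1) x * (p x * h2 x * (norm x powr (2 * 0) * (1 - (norm x)\<^sup>2) powr real m)))
     = S k p / 2 * Beta (real k / 2 + lk + 1) (real m + 1)"
    by (simp add: has_bochner_integral_iff)
  moreover have "(LINT x|lborel. indicator (cball 0 1) x * (p x * h2 x * (norm x powr (2 * 0) * (1 - (norm x)\<^sup>2) powr real m)))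
     = (LINT x|lborel. p x * cut x ^ m * h2 x)"
  proof (rule integral_cong_AE)
    show "AE x in lborel. indicator (cball 0 1) x * (p x * h2 x * (norm x powr (2 * 0) * (1 - (norm x)\<^sup>2) powr real m))
      = p x * cut x ^ m * h2 x"
      using AE_lborel_singleton[of "0 :: real ^ 'n"]
    proof eventually_elim
      fix x :: "real ^ 'n" assume x: "x \<noteq> 0"
      show "indicator (cball 0 1) x * (p x * h2 x * (norm x powr (2 * 0) * (1 - (norm x)\<^sup>2) powr real m))
        = p x * cut x ^ m * h2 x"
      proof (cases "norm x \<le> 1")
        case True
        then have "cut x = 1 - (norm x)\<^sup>2" "1 - (norm x)\<^sup>2 \<ge> 0"
          by (auto simp: cut_def power_le_one)
        then show ?thesis using True x m by (cases "1 - (norm x)\<^sup>2 = 0") (auto simp: powr_realpow)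
      next
        case False
        \<comment> \<open>Outside the ball a zeroth power of \<open>cut\<close> would be 1; positive
          powers vanish there.\<close>
        then show ?thesis using m by (simp add: cut_outside)
      qed
    qed
  qed measurable
  ultimately show ?thesis by simp
qed

text \<open>\<open>S_cut\<close> evaluates both sides of the identity on the ball: cut^2 in degree a
  + b - 1 gives Beta z 3, and cut in degree a + b + 1 gives Beta (z + 1) 2. Their ratio turns the
  factor 4 into 2z = a + b + 1 + 2 lk.\<close>

lemma S_integration_by_parts:
  assumes f: "hom a f" and g: "hom b g"
  shows "S (a + b - 1) (\<lambda>x. D i f x * g x + f x * D i g x) =
     (real (a + b) + 1 + 2 * lk) * S (a + b + 1) (\<lambda>x. x $ i * (f x * g x))"
proof -
  define z where "z = (real (a + b) + 1) / 2 + lk"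
  have z: "z > 0" using lk_nonneg by (simp add: z_def add_pos_nonneg)
  have B0: "Beta z 3 > 0" "Beta (z + 1) 2 > 0" using z by (auto intro: Beta_pos)
  have B: "z * Beta z 3 = 2 * Beta (z + 1) 2"
  proof -
    have "z \<notin> \<int>\<^sub>\<le>\<^sub>0" "(2::real) \<notin> \<int>\<^sub>\<le>\<^sub>0" using z by auto
    then have "(z + 2) * Beta z (2 + 1) = 2 * Beta z 2" "(z + 2) * Beta (z + 1) 2 = z * Beta z 2"
      using Beta_plus1_right Beta_plus1_left by blast+
    then have "(z + 2) * (z * Beta z 3) = (z + 2) * (2 * Beta (z + 1) 2)" by (simp add: mult_ac)
    then show ?thesis using z by simp
  qed
  have x: "hom (a + b + 1) (\<lambda>x. x $ i * (f x * g x))"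
    using hom.coord[OF hom_mult[OF f g]] by simp
  have L: "(LINT x|lborel. (D i f x * g x + f x * D i g x) * (cut x)\<^sup>2 * h2 x) =
     4 * (S (a + b + 1) (\<lambda>x. x $ i * (f x * g x)) / 2 * Beta (z + 1) 2)"
    using integration_by_parts[OF f g, of i] S_cut[OF x, of 1] by (simp add: z_def field_simps)
  show ?thesis
  proof (cases "a + b = 0")
    \<comment> \<open>Here the degree a + b - 1 is truncated; the left side is 0, and
      \<open>L\<close> forces the mean on the right to be 0.\<close>
    case True
    then have "D i f = (\<lambda>x. 0)" "D i g = (\<lambda>x. 0)" using D_hom_0 f g by auto
    then show ?thesis using L B0 by (simp add: S_zero)
  next
    case False
    have 1: "hom (a + b - 1) (\<lambda>x. D i f x * g x)"
    proof (cases a)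
      case 0
      then show ?thesis using D_hom_0 f by (auto intro: hom_zero)
    next
      case (Suc a')
      then show ?thesis using hom_mult[OF D_hom[OF f] g] by simp
    qed
    have 2: "hom (a + b - 1) (\<lambda>x. f x * D i g x)"
    proof (cases b)
      case 0
      then show ?thesis using D_hom_0 g by (auto intro: hom_zero)
    next
      case (Suc b')
      then show ?thesis using hom_mult[OF f D_hom[OF g]] by simp
    qed
    have "real (a + b - 1) = real (a + b) - 1" using False by (subst of_nat_diff) auto
    then have "real (a + b - 1) / 2 + lk + 1 = z" by (simp add: z_def field_simps)
    then have "S (a + b - 1) (\<lambda>x. D i f x * g x + f x * D i g x) / 2 * Beta z 3 =
       4 * (S (a + b + 1) (\<lambda>x. x $ i * (f x * g x)) / 2 * Beta (z + 1) 2)"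
      using S_cut[OF hom.add[OF 1 2], of 2] L by simp
    also have "\<dots> = 2 * z * S (a + b + 1) (\<lambda>x. x $ i * (f x * g x)) / 2 * Beta z 3"
      using B by simp
    finally have "S (a + b - 1) (\<lambda>x. D i f x * g x + f x * D i g x) = 2 * z * S (a + b + 1) (\<lambda>x. x $ i * (f x * g x))"
      using B0 by simp
    moreover have "2 * z = real (a + b) + 1 + 2 * lk" by (simp add: z_def)
    ultimately show ?thesis by (simp only:)
  qed
qed

text \<open>Integrating by parts with f = D_i Y and g = 1 and summing over i turns the mean of the
  Laplacian of Y into m + 2 lk times the mean of \<open>E Y\<close>. There the reflection
  differences have mean 0, so m (m + 2 lk) S(Y) = 0.\<close>

lemma S_harm_zero:
  assumes Y: "harm m Y" and m: "m > 0"
  shows "S m Y = 0"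
proof -
  have h: "hom m Y" and L: "Lap Y = (\<lambda>x. 0)" using Y by (auto simp: harm_def)
  have 1: "S (m - 1 - 1) (D i (D i Y)) = (real m + 2 * lk) * S m (\<lambda>x. x $ i * D i Y x)" for i
    using S_integration_by_parts[OF D_hom[OF h] hom.const[of 1], of i i] m D_hom_0[OF hom.const, of i 1]
    by (simp add: of_nat_diff)
  have hx: "hom m (\<lambda>x. x $ i * D i Y x)" for i
    using hom.coord[OF D_hom[OF h]] m by simp
  have "0 = S (m - 1 - 1) (Lap Y)" using L by (simp add: S_zero)
  also have "\<dots> = (\<Sum>i\<in>UNIV. S (m - 1 - 1) (D i (D i Y)))"
    unfolding Lap_def[abs_def] by (rule S_sum) (intro D_hom h)
  also have "\<dots> = (real m + 2 * lk) * (\<Sum>i\<in>UNIV. S m (\<lambda>x. x $ i * D i Y x))"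
    by (simp only: 1 sum_distrib_left)
  also have "(\<Sum>i\<in>UNIV. S m (\<lambda>x. x $ i * D i Y x)) = S m (E Y)"
    unfolding E_def[abs_def] by (rule S_sum[symmetric]) (rule hx)
  also have "E Y = (\<lambda>x. real m * Y x + (\<Sum>v\<in>Rp. \<kappa> v * (Y x - Y (reflection v x))))"
    using E_eq[OF h] by auto
  also have "S m \<dots> = S m (\<lambda>x. real m * Y x) + S m (\<lambda>x. \<Sum>v\<in>Rp. \<kappa> v * (Y x - Y (reflection v x)))"
    by (intro S_add hom_cmul hom_sum hom_diff h hom_reflection)
  also have "S m (\<lambda>x. \<Sum>v\<in>Rp. \<kappa> v * (Y x - Y (reflection v x))) = (\<Sum>v\<in>Rp. S m (\<lambda>x. \<kappa> v * (Y x - Y (reflection v x))))"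
    by (intro S_sum hom_cmul hom_diff h hom_reflection)
  also have "\<dots> = 0"
    by (intro sum.neutral) (simp add: S_cmul S_diff[OF h hom_reflection[OF h]] S_reflection[OF h])
  finally show ?thesis using m lk_nonneg by (simp add: S_cmul)
qed

text \<open>Integration by parts removes a coordinate x_i from p = x_i q. The two products that
  arise, D_i q with Y and q with D_i Y, still have a polynomial of smaller degree than the harmonic,
  so the induction applies to both.\<close>

lemma S_orthogonal:
  assumes "hom N p" "harm m Y" "N < m"
  shows "S (N + m) (\<lambda>x. p x * Y x) = 0"
  using assms
proof (induction N arbitrary: p m Y rule: less_induct)
  case (less N)
  have h: "hom m Y" using less.prems by (simp add: harm_def)
  show ?case
  proof (cases N)
    case 0
    then obtain c where "p = (\<lambda>x. c)" using hom_0D less.prems by blast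
    then show ?thesis using S_harm_zero[OF less.prems(2)] less.prems(3) 0 by (simp add: S_cmul)
  next
    case (Suc N')
    then obtain q where q: "\<And>i. hom N' (q i)" and p: "p = (\<lambda>x. \<Sum>i\<in>UNIV. x $ i * q i x)"
      using hom_SucD less.prems(1) by blast
    have hx: "hom (N + m) (\<lambda>x. x $ i * (q i x * Y x))" for i
      using hom.coord[OF hom_mult[OF q h]] Suc by simp
    have z: "S (N + m) (\<lambda>x. x $ i * (q i x * Y x)) = 0" for i
    proof -
      have 1: "hom (N' + m - 1) (\<lambda>x. D i (q i) x * Y x)" "S (N' + m - 1) (\<lambda>x. D i (q i) x * Y x) = 0"
      proof -
        have "hom (N' + m - 1) (\<lambda>x. D i (q i) x * Y x) \<and> S (N' + m - 1) (\<lambda>x. D i (q i) x * Y x) = 0"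
        proof (cases N')
          case 0
          then have "D i (q i) = (\<lambda>x. 0)" using D_hom_0 q by metis
          then show ?thesis by (simp add: S_zero hom_zero)
        next
          case (Suc N'')
          then show ?thesis
            using less.IH[of N'' "D i (q i)" m Y] hom_mult[OF D_hom[OF q] h, of i] D_hom[OF q, of i] less.prems \<open>N = Suc N'\<close>
            by simp
        qed
        then show "hom (N' + m - 1) (\<lambda>x. D i (q i) x * Y x)" "S (N' + m - 1) (\<lambda>x. D i (q i) x * Y x) = 0" by auto
      qed
      have 2: "hom (N' + m - 1) (\<lambda>x. q i x * D i Y x)" "S (N' + m - 1) (\<lambda>x. q i x * D i Y x) = 0"
        using less.IH[of N' "q i" "m - 1" "D i Y"] hom_mult[OF q D_hom[OF h]] harm_D[OF less.prems(2)] q less.prems(3) Suc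
        by simp_all
      have "(real (N' + m) + 1 + 2 * lk) * S (N' + m + 1) (\<lambda>x. x $ i * (q i x * Y x)) = 0"
        using S_integration_by_parts[OF q h, of i i] S_add[OF 1(1) 2(1)] 1 2 by simp
      moreover have "real (N' + m) + 1 + 2 * lk > 0" using lk_nonneg by simp
      ultimately show ?thesis using Suc by simp
    qed
    have "(\<lambda>x. p x * Y x) = (\<lambda>x. \<Sum>i\<in>UNIV. x $ i * (q i x * Y x))"
      by (simp add: p sum_distrib_right mult.assoc)
    then show ?thesis using S_sum[of UNIV "N + m" "\<lambda>i x. x $ i * (q i x * Y x)"] hx z by simp
  qed
qed

lemma S_harm_orthogonal:
  assumes "harm m Y" "harm m' Y'" "m \<noteq> m'"
  shows "S (m + m') (\<lambda>x. Y x * Y' x) = 0"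
  using S_orthogonal[OF harm_hom[OF assms(1)] assms(2)] S_orthogonal[OF harm_hom[OF assms(2)] assms(1)] assms(3)
  by (cases "m < m'") (simp_all add: add.commute mult.commute)

end

section \<open>A Hagen--Rothe identity and coefficients of the Funk--Hecke formula\<close>

text \<open>The polynomial form of x/(x+2b) binom(x+2b, b), the coefficient of z^b in B(z)^x for the
  Catalan series B = 1 + z B^2. In this form it makes sense at x + 2b = 0 as well.\<close>

definition rothe :: "nat \<Rightarrow> real \<Rightarrow> real" where
  "rothe b x = (case b of 0 \<Rightarrow> 1 | Suc k \<Rightarrow> x * pochhammer (x + real k + 2) k / fact (Suc k))"

text \<open>The binomial coefficient binom(y+2a, a) as a polynomial in y.\<close>

definition hagen :: "nat \<Rightarrow> real \<Rightarrow> real" where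
  "hagen a y = pochhammer (y + real a + 1) a / fact a"

text \<open>The coefficient form of B^x = B^(x-1) + z B^(x+1) for B = 1 + z B^2, times a series
  independent of x; \<open>rothe_rec\<close> is the same relation without that series.\<close>

lemma hagen_rec: "hagen (Suc a) y = hagen (Suc a) (y - 1) + hagen a (y + 1)"
proof -
  have "pochhammer (y + real (Suc a) + 1) (Suc a) = pochhammer (y + real a + 2) a * (y + 2 * real a + 2)"
    by (simp add: pochhammer_Suc algebra_simps)
  moreover have "pochhammer (y - 1 + real (Suc a) + 1) (Suc a) = (y + real a + 1) * pochhammer (y + real a + 2) a"
    by (simp add: pochhammer_rec algebra_simps)
  moreover have "y + 1 + real a + 1 = y + real a + 2" by simp
  ultimately show ?thesis by (simp add: hagen_def field_simps del: of_nat_Suc)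
    (simp add: algebra_simps)
qed

lemma rothe_rec: "rothe (Suc b) x = rothe (Suc b) (x - 1) + rothe b (x + 1)"
proof (cases b)
  case (Suc k)
  define P where "P = pochhammer (x + real k + 3) k"
  have 1: "pochhammer (x + real (Suc k) + 2) (Suc k) = P * (x + 2 * real k + 3)"
    by (simp add: P_def pochhammer_Suc algebra_simps)
  have 2: "pochhammer (x - 1 + real (Suc k) + 2) (Suc k) = (x + real k + 2) * P"
    by (simp add: P_def pochhammer_rec algebra_simps)
  have 3: "pochhammer (x + 1 + real k + 2) k = P" by (simp add: P_def algebra_simps)
  have f: "fact (Suc (Suc k)) = (real k + 2) * fact (Suc k)" by simp
  have nz: "fact (Suc k) \<noteq> (0::real)" "real k + 2 \<noteq> 0" by auto
  have "x * (P * (x + 2 * real k + 3)) = (x - 1) * ((x + real k + 2) * P) + (real k + 2) * ((x + 1) * P)"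
    by (simp add: algebra_simps)
  then have "x * (P * (x + 2 * real k + 3)) / ((real k + 2) * fact (Suc k)) =
      (x - 1) * ((x + real k + 2) * P) / ((real k + 2) * fact (Suc k)) + (x + 1) * P / fact (Suc k)"
    using nz by (simp only: add_divide_distrib) simp
  then show ?thesis
    unfolding rothe_def Suc nat.case 1 2 3 f .
qed (simp add: rothe_def)

lemma real_polynomial_function_pochhammer:
  "real_polynomial_function f \<Longrightarrow> real_polynomial_function (\<lambda>x. pochhammer (f x) n)"
  unfolding pochhammer_prod by (intro real_polynomial_function_prod) auto

lemma real_polynomial_function_ident: "real_polynomial_function (\<lambda>x::real. x)"
  by (intro real_polynomial_function.intros(1) bounded_linear_ident)

lemma polynomial_zero_on_nat:
  fixes f :: "real \<Rightarrow> real"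
  assumes "real_polynomial_function f" "\<And>k::nat. f (real k) = 0"
  shows "f x = 0"
proof -
  obtain a n where f: "f = (\<lambda>x. \<Sum>i\<le>n. a i * x ^ i)"
    using real_polynomial_function_imp_sum[OF assms(1)] by blast
  have "\<forall>i\<le>n. a i = 0"
  proof (rule ccontr)
    assume "\<not> ?thesis"
    then have "finite {x. (\<Sum>i\<le>n. a i * x ^ i) = 0}"
      using polyfun_finite_roots[of a n] by blast
    moreover have "range real \<subseteq> {x. (\<Sum>i\<le>n. a i * x ^ i) = 0}" using assms(2) f by auto
    ultimately have "finite (range real)" using finite_subset by blast
    then show False using range_inj_infinite[of real] inj_of_nat by blast
  qed
  then show ?thesis by (simp add: f)
qed

text \<open>The difference of the two sides is a polynomial in \<open>x\<close> that, by the recurrences and induction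
  on \<open>n\<close>, has period \<open>1\<close> and vanishes at \<open>0\<close>.\<close>

lemma hagen_rothe: "(\<Sum>b\<le>n. rothe b x * hagen (n - b) y) = hagen n (x + y)"
proof (induction n arbitrary: x)
  case 0
  then show ?case by (simp add: rothe_def hagen_def)
next
  case (Suc n)
  define f where "f x = (\<Sum>b\<le>Suc n. rothe b x * hagen (Suc n - b) y) - hagen (Suc n) (x + y)" for x
  \<comment> \<open>The two recurrences reduce the difference to the identity in degree n at x +
    1.\<close>
  have per: "f x = f (x - 1)" for x
  proof -
    have "(\<Sum>b\<le>Suc n. rothe b x * hagen (Suc n - b) y) =
        hagen (Suc n) y + (\<Sum>b\<le>n. rothe (Suc b) x * hagen (n - b) y)" for x
      by (subst sum.atMost_Suc_shift) (simp add: rothe_def)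
    then have "f x - f (x - 1) = (\<Sum>b\<le>n. (rothe (Suc b) x - rothe (Suc b) (x - 1)) * hagen (n - b) y)
        - (hagen (Suc n) (x + y) - hagen (Suc n) (x + y - 1))"
      by (simp add: f_def left_diff_distrib sum_subtractf algebra_simps)
    also have "\<dots> = (\<Sum>b\<le>n. rothe b (x + 1) * hagen (n - b) y) - hagen n (x + 1 + y)"
      using rothe_rec[of _ x] hagen_rec[of n "x + y"] by (simp add: algebra_simps)
    also have "\<dots> = 0" using Suc.IH by simp
    finally show ?thesis by simp
  qed
  have "f 0 = 0"
  proof -
    have "(\<Sum>b\<le>Suc n. rothe b 0 * hagen (Suc n - b) y) = hagen (Suc n) y + (\<Sum>b\<le>n. rothe (Suc b) 0 * hagen (n - b) y)"
      by (subst sum.atMost_Suc_shift) (simp add: rothe_def)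
    also have "\<dots> = hagen (Suc n) y" by (simp add: rothe_def)
    finally show ?thesis by (simp add: f_def)
  qed
  then have "f (real k) = 0" for k
  proof (induction k)
    case (Suc k)
    then show ?case using per[of "real (Suc k)"] by simp
  qed simp
  moreover have "real_polynomial_function f"
  proof -
    have "real_polynomial_function (rothe b)" for b
      unfolding rothe_def[abs_def]
      by (cases b) (auto simp del: fact_Suc intro!: real_polynomial_function_pochhammer real_polynomial_function_divide
          real_polynomial_function_ident real_polynomial_function.intros(2-4))
    moreover have "real_polynomial_function (\<lambda>x. hagen (Suc n) (x + y))"
      unfolding hagen_def
      by (intro real_polynomial_function_pochhammer real_polynomial_function_divide
          real_polynomial_function_ident real_polynomial_function.intros(2-4))
    ultimately show ?thesis unfolding f_def[abs_def]
      by (intro real_polynomial_function_diff real_polynomial_function_sum real_polynomial_function.intros(2-4)) auto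
  qed
  ultimately have "f x = 0" by (rule polynomial_zero_on_nat[of f x, rotated])
  then show ?case by (simp add: f_def)
qed

text \<open>The ratio in which the Rothe number appears in \<open>fhc_shift\<close>: the Pochhammer
  symbol of length 2b is split after its first factor and after the next b.\<close>

lemma rothe_eq:
  assumes "x > 0" shows "rothe b x = pochhammer x (2 * b) / (fact b * pochhammer (x + 1) b)"
proof (cases b)
  case (Suc k)
  have "2 * b = Suc (b + k)" using Suc by simp
  then have "pochhammer x (2 * b) = x * pochhammer (x + 1) (b + k)"
    by (simp only: pochhammer_rec)
  also have "pochhammer (x + 1) (b + k) = pochhammer (x + 1) b * pochhammer (x + 1 + real b) k"
    by (simp add: pochhammer_product'[symmetric])
  also have "x + 1 + real b = x + real k + 2" using Suc by simp
  finally have *: "pochhammer x (2 * b) = x * (pochhammer (x + 1) b * pochhammer (x + real k + 2) k)" .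
  have "pochhammer (x + 1) b > 0" using assms by (intro pochhammer_pos) simp
  then show ?thesis unfolding * by (simp add: rothe_def Suc)
qed (simp add: rothe_def)

lemma hagen_eq:
  assumes "l > -1"
  shows "hagen a (l + real m) = pochhammer (l + 1) (m + 2 * a) / (fact a * pochhammer (l + 1) (m + a))"
proof -
  have "pochhammer (l + 1) (m + a + a) = pochhammer (l + 1) (m + a) * pochhammer (l + 1 + real (m + a)) a"
    by (rule pochhammer_product')
  moreover have "pochhammer (l + 1) (m + a) > 0" using assms by (intro pochhammer_pos) simp
  moreover have "m + 2 * a = m + a + a" "l + real m + real a + 1 = l + 1 + real (m + a)" by simp_all
  ultimately show ?thesis by (simp only: hagen_def) simp
qed

text \<open>The coefficient of \<open>s\<^sup>N\<close> in the Funk--Hecke formula for harmonics of degree \<open>m\<close>: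
  the \<open>N\<close>-th moment of the normalized Gegenbauer polynomial \<open>C\<^sub>m\<^sup>l / C\<^sub>m\<^sup>l(1)\<close>.\<close>

definition fhc :: "real \<Rightarrow> nat \<Rightarrow> nat \<Rightarrow> real" where
  "fhc l N m = (if m \<le> N \<and> even (N - m)
     then fact N / (2 ^ N * fact ((N - m) div 2) * pochhammer (l + 1) (m + (N - m) div 2)) else 0)"

lemma fhc_add: "fhc l (m + 2 * i) m = fact (m + 2 * i) / (2 ^ (m + 2 * i) * fact i * pochhammer (l + 1) (m + i))"
  by (simp add: fhc_def)

text \<open>\<open>sym_moment a c\<close> is the mean of \<open>t\<^sup>2\<^sup>c\<close> for the density \<open>(1 - t\<^sup>2)\<^sup>a\<^sup>-\<^sup>1\<close> on \<open>[-1,1]\<close>, and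
  \<open>beta_moment a b p k\<close> the mean of \<open>u\<^sup>p (1 - u)\<^sup>k\<close> for the Beta distribution with parameters
  \<open>a\<close> and \<open>b\<close>.\<close>

definition sym_moment :: "real \<Rightarrow> nat \<Rightarrow> real" where
  "sym_moment a c = pochhammer (1 / 2) c / pochhammer (a + 1 / 2) c"

definition beta_moment :: "real \<Rightarrow> real \<Rightarrow> nat \<Rightarrow> nat \<Rightarrow> real" where
  "beta_moment a b p k = pochhammer a p * pochhammer b k / pochhammer (a + b) (p + k)"

lemma fact_double_half: "fact (2 * n) = (4 ^ n * fact n * pochhammer (1 / 2) n :: real)"
  using fact_double[of n, where 'a=real] by (simp add: power_mult)

text \<open>Each summand is a constant times
  \<open>rothe b \<nu> * hagen (e - b) (l + real m)\<close>: the duplication formula for (2b)!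
  removes the Pochhammer symbol at 1/2, and the factorials of the lower degree cancel. Hagen-Rothe
  with x = \<nu> and y = l + m sums them to \<open>hagen e\<close> at l + \<nu> + m, the same
  expression for the index l + \<nu>.\<close>

lemma fhc_shift:
  assumes nu: "\<nu> > 0" and l: "l > -1"
  shows "(\<Sum>b\<le>e. real ((m + 2 * e) choose (2 * b)) * beta_moment \<nu> (l + 1) (2 * b) (m + 2 * e - 2 * b)
      * sym_moment (\<nu> + 1 / 2) b * fhc l (m + 2 * e - 2 * b) m) = fhc (l + \<nu>) (m + 2 * e) m"
proof -
  define N where "N = m + 2 * e"
  \<comment> \<open>What does not depend on b: N!/2^N, and the denominator of the Beta moment, whose
    length is always N.\<close>
  define c where "c = fact N / (2 ^ N * pochhammer (\<nu> + l + 1) N)"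
  have P0: "pochhammer (\<nu> + l + 1) N > 0" using nu l by (intro pochhammer_pos) simp
  have tm: "real (N choose (2 * b)) * beta_moment \<nu> (l + 1) (2 * b) (N - 2 * b)
      * sym_moment (\<nu> + 1 / 2) b * fhc l (N - 2 * b) m = c * (rothe b \<nu> * hagen (e - b) (l + real m))"
    if b: "b \<le> e" for b
  proof -
    define a where "a = e - b"
    have N: "N - 2 * b = m + 2 * a" "N = m + 2 * a + 2 * b" using b by (auto simp: N_def a_def)
    have pos: "pochhammer (\<nu> + 1) b > 0" "pochhammer (l + 1) (m + a) > 0" "pochhammer (1 / 2 :: real) b > 0"
      using nu l by (auto intro!: pochhammer_pos)
    have bin: "real (N choose (2 * b)) = fact N / (fact (2 * b) * fact (m + 2 * a))"
      using N b by (subst binomial_fact) (auto simp: N_def)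
    have pw: "(2::real) ^ N = 4 ^ b * 2 ^ (m + 2 * a)"
      unfolding N(2) by (simp add: power_add power_mult)
    have arg: "\<nu> + (l + 1) = \<nu> + l + 1" "2 * b + (m + 2 * a) = N" "\<nu> + 1 / 2 + 1 / 2 = \<nu> + 1"
      using N by simp_all
    have "real (N choose (2 * b)) * beta_moment \<nu> (l + 1) (2 * b) (N - 2 * b)
        * sym_moment (\<nu> + 1 / 2) b * fhc l (N - 2 * b) m
      = fact N / (4 ^ b * fact b * pochhammer (1 / 2) b * fact (m + 2 * a))
        * (pochhammer \<nu> (2 * b) * pochhammer (l + 1) (m + 2 * a) / pochhammer (\<nu> + l + 1) N)
        * (pochhammer (1 / 2) b / pochhammer (\<nu> + 1) b)
        * (fact (m + 2 * a) / (2 ^ (m + 2 * a) * fact a * pochhammer (l + 1) (m + a)))"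
      unfolding bin N(1) beta_moment_def sym_moment_def fhc_add arg fact_double_half ..
    also have "\<dots> = c * (rothe b \<nu> * hagen a (l + real m))"
      unfolding rothe_eq[OF nu] hagen_eq[OF l] c_def pw using pos P0 by (simp add: field_simps)
    finally show ?thesis by (simp add: a_def)
  qed
  have "(\<Sum>b\<le>e. real (N choose (2 * b)) * beta_moment \<nu> (l + 1) (2 * b) (N - 2 * b)
      * sym_moment (\<nu> + 1 / 2) b * fhc l (N - 2 * b) m) = c * hagen e (\<nu> + (l + real m))"
    using hagen_rothe[of \<nu> e "l + real m"] by (simp add: tm sum_distrib_left[symmetric])
  also have "\<nu> + (l + real m) = (l + \<nu>) + real m" by simp
  also have "c * hagen e (l + \<nu> + real m) = fhc (l + \<nu>) N m"
  proof -
    have l': "l + \<nu> > -1" using nu l by simp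
    have "pochhammer (l + \<nu> + 1) (m + e) > 0" using l' by (intro pochhammer_pos) simp
    then show ?thesis unfolding hagen_eq[OF l'] c_def N_def fhc_add
      using P0 by (simp add: N_def add.commute[of \<nu> l])
  qed
  finally show ?thesis by (simp add: N_def)
qed

text \<open>Matches the coefficients of \<open>raise m i Y\<close> when \<open>D i\<close> is
  applied to both sides of the Funk-Hecke formula for the power \<open>Suc N\<close>.\<close>

lemma fhc_raise: "real (Suc N) * fhc l N (Suc m) = (if m \<le> Suc N \<and> even (Suc N - m)
    then real (Suc N - m) * fhc l (Suc N) m else 0)"
proof (cases "m \<le> Suc N \<and> even (Suc N - m)")
  case True
  then obtain j where j: "Suc N = m + 2 * j" by (metis dvdE le_add_diff_inverse)
  show ?thesis
  proof (cases j)
    case 0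
    then show ?thesis using j by (simp add: fhc_def)
  next
    case (Suc i)
    then have N: "N = Suc m + 2 * i" using j by simp
    have "fhc l (Suc N) m = fact (Suc N) / (2 ^ Suc N * fact (Suc i) * pochhammer (l + 1) (m + Suc i))"
      using fhc_add[of l m j] j Suc by simp
    moreover have "fhc l N (Suc m) = fact N / (2 ^ N * fact i * pochhammer (l + 1) (Suc m + i))"
      unfolding N by (rule fhc_add)
    moreover have "real (Suc N - m) = 2 * real (Suc i)" using j Suc by simp
    moreover have "m \<le> Suc N \<and> even (Suc N - m)" using True .
    moreover have "n * (F / (T * J * P)) = 2 * I * (n * F / (2 * T * (I * J) * P))"
      if "T \<noteq> 0" "J \<noteq> 0" "I \<noteq> 0" for n F T J P I :: real
      using that by simp
    from this[of "2 ^ N" "fact i" "real (Suc i)" "real (Suc N)" "fact N" "pochhammer (l + 1) (m + Suc i)"]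
    have "real (Suc N) * (fact N / (2 ^ N * fact i * pochhammer (l + 1) (m + Suc i))) =
      2 * real (Suc i) * (fact (Suc N) / (2 ^ Suc N * fact (Suc i) * pochhammer (l + 1) (m + Suc i)))"
      by (simp only: fact_Suc power_Suc of_nat_mult of_nat_fact) simp
    ultimately show ?thesis by simp
  qed
next
  case False
  then have "fhc l N (Suc m) = 0" by (auto simp: fhc_def Suc_diff_le)
  with False show ?thesis by (simp only: if_False mult_zero_right)
qed

text \<open>The companion of \<open>fhc_raise\<close>: it matches the coefficients of
  \<open>D i Y\<close> for Y of degree \<open>Suc m\<close>. The factor l + Suc m + (N - m)/2
  combines the derivative of Y with the lower part of x_i Y that the derivative of the power of |x|
  brings in.\<close>

lemma fhc_lower:
  assumes l: "l > -1"
  shows "real (Suc N) * fhc l N m = (if Suc m \<le> Suc N \<and> even (Suc N - Suc m)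
    then 2 * (l + real (Suc m + (N - m) div 2)) * fhc l (Suc N) (Suc m) else 0)"
proof (cases "m \<le> N \<and> even (N - m)")
  case True
  then obtain j where N: "N = m + 2 * j" by (metis dvdE le_add_diff_inverse)
  have "fhc l (Suc N) (Suc m) = fact (Suc N) / (2 ^ Suc N * fact j * pochhammer (l + 1) (Suc m + j))"
    using fhc_add[of l "Suc m" j] N by simp
  moreover have "fhc l N m = fact N / (2 ^ N * fact j * pochhammer (l + 1) (m + j))"
    unfolding N by (rule fhc_add)
  moreover have "pochhammer (l + 1) (Suc m + j) = pochhammer (l + 1) (m + j) * (l + real (Suc m + j))"
    by (simp add: pochhammer_Suc algebra_simps)
  moreover have "pochhammer (l + 1) (m + j) > 0" using l by (intro pochhammer_pos) simp
  moreover have "l + real (Suc m + j) > 0" using l by simp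
  moreover have "(N - m) div 2 = j" using N by simp
  moreover have "n * (F / (T * J * P)) = 2 * L * (n * F / (2 * T * J * (P * L)))"
    if "P > 0" "L > 0" for n F T J P L :: real
    using that by simp
  from this[of "pochhammer (l + 1) (m + j)" "l + real (Suc m + j)" "real (Suc N)" "fact N" "2 ^ N" "fact j"]
    calculation(4,5)
  have "real (Suc N) * (fact N / (2 ^ N * fact j * pochhammer (l + 1) (m + j))) =
     2 * (l + real (Suc m + j)) * (fact (Suc N) / (2 ^ Suc N * fact j * (pochhammer (l + 1) (m + j) * (l + real (Suc m + j)))))"
    by (simp only: fact_Suc power_Suc of_nat_mult of_nat_fact)
  moreover have t: "Suc m \<le> Suc N \<and> even (Suc N - Suc m)" using N by simp
  ultimately show ?thesis unfolding if_P[OF t] by simp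
next
  case False
  then have "\<not> (Suc m \<le> Suc N \<and> even (Suc N - Suc m))" by simp
  moreover have "fhc l N m = 0" unfolding fhc_def by (rule if_not_P[OF False])
  ultimately show ?thesis by (simp only: if_False mult_zero_right)
qed

section \<open>The Funk--Hecke formula for the intertwining operator\<close>

text \<open>Finite sums of products b(y) a(z). With \<open>V\<close> acting in z and the spherical
  mean in y, the exchange of the two is linearity, which is available for \<open>V\<close> on
  polynomials.\<close>

inductive bihom :: "nat \<Rightarrow> (real ^ 'n \<Rightarrow> real ^ 'n \<Rightarrow> real) \<Rightarrow> bool" where
  prod: "hom N a \<Longrightarrow> hom N b \<Longrightarrow> bihom N (\<lambda>z y. b y * a z)"
| add: "bihom N F \<Longrightarrow> bihom N G \<Longrightarrow> bihom N (\<lambda>z y. F z y + G z y)"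

lemma bihom_coord: "bihom N F \<Longrightarrow> bihom (Suc N) (\<lambda>z y. (z $ i * y $ i) * F z y)"
proof (induction rule: bihom.induct)
  case (prod N a b)
  from bihom.prod[OF hom.coord[OF prod(1), of i] hom.coord[OF prod(2), of i]]
  show ?case by (simp add: mult_ac)
qed (auto simp: distrib_left intro: bihom.add)

lemma bihom_zero: "bihom N (\<lambda>z y. 0)"
  using bihom.prod[OF hom_zero hom_zero, of N] by simp

lemma bihom_sum: "(\<And>i. i \<in> A \<Longrightarrow> bihom N (F i)) \<Longrightarrow> bihom N (\<lambda>z y. \<Sum>i\<in>A. F i z y)"
  by (induction A rule: infinite_finite_induct) (auto intro: bihom_zero bihom.add)

lemma bihom_inner_power: "bihom N (\<lambda>(z :: real ^ 'n) y. (z \<bullet> y) ^ N)"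
proof (induction N)
  case 0
  then show ?case using bihom.prod[OF hom.const[of 1] hom.const[of 1]] by simp
next
  case (Suc N)
  have "bihom (Suc N) (\<lambda>(z :: real ^ 'n) y. \<Sum>i\<in>UNIV. (z $ i * y $ i) * (z \<bullet> y) ^ N)"
    by (intro bihom_sum bihom_coord Suc)
  then show ?case by (simp add: inner_vec_def sum_distrib_right)
qed

lemma hom_inner_power: "hom N (\<lambda>z. (z \<bullet> y) ^ N)"
proof (induction N)
  case 0
  then show ?case using hom.const[of 1] by simp
next
  case (Suc N)
  from hom_mult_inner[OF this, of y] show ?case by simp
qed

lemma partial_deriv_inner_power:
  "partial_deriv i (\<lambda>z. (z \<bullet> y) ^ Suc N) = (\<lambda>z. real (Suc N) * y $ i * (z \<bullet> y) ^ N)"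
proof
  fix z
  have "((\<lambda>z. (z \<bullet> y) ^ Suc N) has_derivative (\<lambda>h. real (Suc N) * (h \<bullet> y) * (z \<bullet> y) ^ N)) (at z)"
    by (auto intro!: derivative_eq_intros simp del: power_Suc of_nat_Suc)
  from partial_deriv_eqI[OF this, of i]
  show "partial_deriv i (\<lambda>z. (z \<bullet> y) ^ Suc N) z = real (Suc N) * y $ i * (z \<bullet> y) ^ N"
    by (simp add: inner_axis' del: power_Suc of_nat_Suc)
qed

context dunkl_setting
begin

lemma bihom_hom: "bihom N F \<Longrightarrow> hom N (\<lambda>z. F z y)"
  by (induction rule: bihom.induct) (auto intro: hom_cmul hom.add)

lemma V_scaled: "hom n a \<Longrightarrow> V (\<lambda>z. c * a z) x = V a x * c"
  using V_cmul[of n a c] by simp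

lemma V_partial_deriv_scaled:
  assumes "hom n a" shows "V (partial_deriv i (\<lambda>z. c * a z)) x = V (partial_deriv i a) x * c"
proof -
  have "partial_deriv i (\<lambda>z. c * a z) = (\<lambda>z. c * partial_deriv i a z)"
    by (intro ext partial_deriv_cmul[OF assms])
  then show ?thesis using V_scaled[OF partial_deriv_pred[OF assms]] by simp
qed

lemma V_add_apply: "hom n p \<Longrightarrow> hom n q \<Longrightarrow> V (\<lambda>z. p z + q z) x = V p x + V q x"
  by (simp add: V_add)

lemma V_partial_deriv_add:
  assumes "hom n p" "hom n q"
  shows "V (partial_deriv i (\<lambda>z. p z + q z)) x = V (partial_deriv i p) x + V (partial_deriv i q) x"
proof -
  have "partial_deriv i (\<lambda>z. p z + q z) = (\<lambda>z. partial_deriv i p z + partial_deriv i q z)"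
    by (intro ext partial_deriv_add hom_differentiable[OF assms(1)] hom_differentiable[OF assms(2)])
  then show ?thesis using V_add_apply[OF partial_deriv_pred partial_deriv_pred, OF assms] by simp
qed

lemma bihom_V: "bihom N F \<Longrightarrow> hom N (\<lambda>y. V (\<lambda>z. F z y) x)"
proof (induction rule: bihom.induct)
  case (prod N a b)
  show ?case unfolding V_scaled[OF prod(1)] by (rule hom_cmul[OF prod(2)])
next
  case (add N F G)
  show ?case unfolding V_add_apply[OF bihom_hom[OF add.hyps(1)] bihom_hom[OF add.hyps(2)]]
    by (rule hom.add[OF add.IH])
qed

lemma bihom_V_partial_deriv: "bihom N F \<Longrightarrow> hom N (\<lambda>y. V (partial_deriv i (\<lambda>z. F z y)) x)"
proof (induction rule: bihom.induct)
  case (prod N a b)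
  show ?case unfolding V_partial_deriv_scaled[OF prod(1)] by (rule hom_cmul[OF prod(2)])
next
  case (add N F G)
  show ?case unfolding V_partial_deriv_add[OF bihom_hom[OF add.hyps(1)] bihom_hom[OF add.hyps(2)]]
    by (rule hom.add[OF add.IH])
qed

text \<open>Linear in F, hence reduced to a product, where \<open>V a x\<close> factors out of the
  mean over y and \<open>D i\<close> meets only \<open>V a\<close>.\<close>

lemma bihom_S:
  assumes "bihom N F" and Y: "hom m Y"
  shows "hom N (\<lambda>x. S (N + m) (\<lambda>y. V (\<lambda>z. F z y) x * Y y)) \<and>
    D i (\<lambda>x. S (N + m) (\<lambda>y. V (\<lambda>z. F z y) x * Y y))
      = (\<lambda>x. S (N + m) (\<lambda>y. V (partial_deriv i (\<lambda>z. F z y)) x * Y y))"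
  using assms(1)
proof (induction rule: bihom.induct)
  case (prod N a b)
  have 1: "(\<lambda>x. S (N + m) (\<lambda>y. V (\<lambda>z. b y * a z) x * Y y)) = (\<lambda>x. S (N + m) (\<lambda>y. b y * Y y) * V a x)"
    unfolding V_scaled[OF prod(1)] mult.assoc S_cmul by (simp add: mult.commute)
  have 2: "(\<lambda>x. S (N + m) (\<lambda>y. V (partial_deriv i (\<lambda>z. b y * a z)) x * Y y))
     = (\<lambda>x. S (N + m) (\<lambda>y. b y * Y y) * V (partial_deriv i a) x)"
    unfolding V_partial_deriv_scaled[OF prod(1)] mult.assoc S_cmul by (simp add: mult.commute)
  show ?case unfolding 1 2
    using hom_cmul[OF V_hom[OF prod(1)]] D_cmul[OF V_hom[OF prod(1)]] V_D[OF prod(1)] by simp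
next
  case (add N F G)
  note h = bihom_hom[OF add.hyps(1)] bihom_hom[OF add.hyps(2)]
  have 1: "(\<lambda>x. S (N + m) (\<lambda>y. V (\<lambda>z. F z y + G z y) x * Y y)) =
    (\<lambda>x. S (N + m) (\<lambda>y. V (\<lambda>z. F z y) x * Y y) + S (N + m) (\<lambda>y. V (\<lambda>z. G z y) x * Y y))"
    unfolding V_add_apply[OF h] distrib_right
    by (intro ext S_add hom_mult[OF bihom_V[OF add.hyps(1)] Y] hom_mult[OF bihom_V[OF add.hyps(2)] Y])
  have 2: "(\<lambda>x. S (N + m) (\<lambda>y. V (partial_deriv i (\<lambda>z. F z y + G z y)) x * Y y)) =
    (\<lambda>x. S (N + m) (\<lambda>y. V (partial_deriv i (\<lambda>z. F z y)) x * Y y) + S (N + m) (\<lambda>y. V (partial_deriv i (\<lambda>z. G z y)) x * Y y))"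
    unfolding V_partial_deriv_add[OF h] distrib_right
    by (intro ext S_add hom_mult[OF bihom_V_partial_deriv[OF add.hyps(1)] Y] hom_mult[OF bihom_V_partial_deriv[OF add.hyps(2)] Y])
  note hF = add.IH(1)[THEN conjunct1] and hG = add.IH(2)[THEN conjunct1]
  show ?case unfolding 1 2 using hom.add[OF hF hG] D_add[OF hF hG, of i] add.IH by simp
qed

text \<open>N! times the component of degree N of the Dunkl kernel V[exp <.,y>](x).\<close>

definition vk :: "nat \<Rightarrow> real ^ 'n \<Rightarrow> real ^ 'n \<Rightarrow> real" where
  "vk N x y = V (\<lambda>z. (z \<bullet> y) ^ N) x"

lemma vk_hom_right: "hom N (vk N x)"
  using bihom_V[OF bihom_inner_power, of N x] by (simp add: vk_def[abs_def])

lemma vk_hom_left: "hom N (\<lambda>x. vk N x y)"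
  unfolding vk_def by (rule V_hom[OF hom_inner_power])

lemma vk_0: "vk 0 x y = 1"
  by (simp add: vk_def V_one)

lemma D_norm_power_mult:
  assumes p: "hom n p"
  shows "D i (\<lambda>x. norm x ^ (2 * j) * p x) x =
    norm x ^ (2 * j) * D i p x + (if j = 0 then 0 else 2 * real j * norm x ^ (2 * j - 2) * (x $ i * p x))"
proof (induction j)
  case (Suc j)
  have "D i (\<lambda>x. norm x ^ (2 * Suc j) * p x) x = D i (\<lambda>x. (norm x)\<^sup>2 * (norm x ^ (2 * j) * p x)) x"
    by (simp add: power2_eq_square mult.assoc)
  also have "\<dots> = (norm x)\<^sup>2 * D i (\<lambda>x. norm x ^ (2 * j) * p x) x + 2 * x $ i * (norm x ^ (2 * j) * p x)"
    by (rule D_norm_mult[OF hom_norm_power_mult[OF p]])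
  also have "\<dots> = norm x ^ (2 * Suc j) * D i p x + 2 * real (Suc j) * norm x ^ (2 * Suc j - 2) * (x $ i * p x)"
    unfolding Suc.IH by (cases j) (auto simp: power2_eq_square algebra_simps)
  finally show ?case by simp
qed simp

lemma S_const: "S 0 (\<lambda>x. c) = c * S 0 (\<lambda>x. 1)"
  using S_cmul[of 0 c "\<lambda>x. 1"] by simp

text \<open>Both sides are homogeneous of degree N in x, so for N > 0 they agree once all their
  images under \<open>D i\<close> do. On the left \<open>D i\<close> lowers the power under
  \<open>V\<close> and brings in the factor N y_i, to which the induction hypothesis applies;
  \<open>fhc_raise\<close> and \<open>fhc_lower\<close> compare the coefficients. For N < m the
  exponent N - m is truncated, but the coefficient is 0.\<close>

theorem funk_hecke:
  assumes "harm m Y"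
  shows "S (N + m) (\<lambda>y. vk N x y * Y y) = S 0 (\<lambda>x. 1) * fhc lk N m * norm x ^ (N - m) * Y x"
  using assms
proof (induction N arbitrary: m Y x)
  case 0
  show ?case
  proof (cases "m = 0")
    case True
    then obtain c where "Y = (\<lambda>x. c)" using hom_0D harm_hom 0 by blast
    then show ?thesis using True S_const[of c] by (simp add: vk_0 fhc_def)
  next
    case False
    then show ?thesis using S_harm_zero[OF 0] by (simp add: vk_0 fhc_def)
  qed
next
  case (Suc N)
  note h = harm_hom[OF Suc.prems]
  define \<omega> where "\<omega> = S 0 (\<lambda>x. 1)"
  define R where "R = (\<lambda>x. S (Suc N + m) (\<lambda>y. vk (Suc N) x y * Y y))"
  define Q where "Q = (\<lambda>x. \<omega> * fhc lk (Suc N) m * norm x ^ (Suc N - m) * Y x)"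
  have hR: "hom (Suc N) R" unfolding R_def vk_def using bihom_S[OF bihom_inner_power h] by blast
  have hQ: "hom (Suc N) Q"
  proof (cases "m \<le> Suc N \<and> even (Suc N - m)")
    case True
    then obtain j where j: "Suc N = m + 2 * j" by (metis dvdE le_add_diff_inverse)
    then have "Q = (\<lambda>x. (\<omega> * fhc lk (Suc N) m) * (norm x ^ (2 * j) * Y x))" by (simp add: Q_def mult.assoc)
    then show ?thesis using hom_cmul[OF hom_norm_power_mult[OF h]] j by simp
  next
    case False
    then have "Q = (\<lambda>x. 0)" by (auto simp: Q_def fhc_def)
    then show ?thesis by (simp add: hom_zero)
  qed
  have "D i (\<lambda>x. R x - Q x) = (\<lambda>x. 0)" for i
  proof -
    have DR: "D i R x = \<omega> * real (Suc N) * (fhc lk N (Suc m) * norm x ^ (N - Suc m) * raise m i Y x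
       + fhc lk N (m - 1) * norm x ^ (N - (m - 1)) * (D i Y x / (2 * (real m + lk))))" for x
    proof -
      have "D i R x = S (Suc N + m) (\<lambda>y. (real (Suc N) * y $ i * vk N x y) * Y y)"
      proof -
        have "V (\<lambda>z. real (Suc N) * y $ i * (z \<bullet> y) ^ N) x = real (Suc N) * y $ i * vk N x y" for y
          unfolding vk_def V_scaled[OF hom_inner_power] by (rule mult.commute)
        then show ?thesis unfolding R_def vk_def
          using bihom_S[OF bihom_inner_power[of "Suc N"] h, of i]
          unfolding partial_deriv_inner_power by (simp add: vk_def del: power_Suc of_nat_Suc)
      qed
      also have "\<dots> = real (Suc N) * S (Suc N + m) (\<lambda>y. vk N x y * (y $ i * Y y))"
        unfolding S_cmul[symmetric] by (simp add: mult_ac)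
      \<comment> \<open>The product y_i Y splits into |y|^0 and |y|^2 times harmonics of degrees m +
        1 and m - 1, so the induction hypothesis applies to both parts.\<close>
      also have "S (Suc N + m) (\<lambda>y. vk N x y * (y $ i * Y y)) =
         S (Suc N + m) (\<lambda>y. vk N x y * raise m i Y y + (1 / (2 * (real m + lk))) * ((norm y)\<^sup>2 * (vk N x y * D i Y y)))"
      proof -
        have "vk N x y * (y $ i * Y y) =
           vk N x y * raise m i Y y + (1 / (2 * (real m + lk))) * ((norm y)\<^sup>2 * (vk N x y * D i Y y))" for y
          unfolding coord_mult_harm[of y i Y m] by (simp add: distrib_left)
        then show ?thesis by (simp only:)
      qed
      also have "\<dots> = S (N + Suc m) (\<lambda>y. vk N x y * raise m i Y y)
          + S (Suc N + m) (\<lambda>y. (1 / (2 * (real m + lk))) * ((norm y)\<^sup>2 * (vk N x y * D i Y y)))"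
      proof -
        have "hom (Suc N + m) (\<lambda>y. vk N x y * raise m i Y y)"
          using hom_mult[OF vk_hom_right harm_hom[OF harm_raise[OF Suc.prems]]] by simp
        moreover have "hom (Suc N + m) (\<lambda>y. (1 / (2 * (real m + lk))) * ((norm y)\<^sup>2 * (vk N x y * D i Y y)))"
        proof (cases m)
          case 0
          then show ?thesis using D_hom_0 h by (simp add: hom_zero)
        next
          case (Suc k)
          then show ?thesis using hom_cmul[OF hom_norm_mult[OF hom_mult[OF vk_hom_right[of N x] D_hom[OF h, of i]]],
              of "1 / (2 * (real m + lk))"] by simp
        qed
        ultimately show ?thesis using S_add by simp
      qed
      also have "S (N + Suc m) (\<lambda>y. vk N x y * raise m i Y y) = \<omega> * fhc lk N (Suc m) * norm x ^ (N - Suc m) * raise m i Y x"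
        unfolding \<omega>_def by (rule Suc.IH[OF harm_raise[OF Suc.prems]])
      also have "S (Suc N + m) (\<lambda>y. (1 / (2 * (real m + lk))) * ((norm y)\<^sup>2 * (vk N x y * D i Y y)))
         = \<omega> * fhc lk N (m - 1) * norm x ^ (N - (m - 1)) * (D i Y x / (2 * (real m + lk)))"
      proof (cases m)
        case 0
        then show ?thesis using D_hom_0 h by (simp add: S_zero)
      next
        case (Suc k)
        have hk: "hom (N + k) (\<lambda>y. vk N x y * D i Y y)" using hom_mult[OF vk_hom_right D_hom[OF h]] Suc by simp
        have "S (N + k) (\<lambda>y. vk N x y * D i Y y) = \<omega> * fhc lk N k * norm x ^ (N - k) * D i Y x"
          unfolding \<omega>_def using harm_D[OF Suc.prems, of i] Suc by (intro Suc.IH) simp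
        then show ?thesis unfolding S_cmul using S_norm_mult[OF hk] Suc by simp
      qed
      finally show ?thesis by (simp add: algebra_simps)
    qed
    have DQ: "D i Q x = (if m \<le> Suc N \<and> even (Suc N - m) then \<omega> * fhc lk (Suc N) m *
        (norm x ^ (Suc N - m) * D i Y x + (if Suc N = m then 0 else
          real (Suc N - m) * norm x ^ (Suc N - m - 2) * (x $ i * Y x))) else 0)" for x
    proof (cases "m \<le> Suc N \<and> even (Suc N - m)")
      case True
      then obtain j where j: "Suc N = m + 2 * j" by (metis dvdE le_add_diff_inverse)
      have "Q = (\<lambda>x. (\<omega> * fhc lk (Suc N) m) * (norm x ^ (2 * j) * Y x))" using j by (simp add: Q_def mult.assoc)
      then have "D i Q x = \<omega> * fhc lk (Suc N) m * D i (\<lambda>x. norm x ^ (2 * j) * Y x) x"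
        using D_cmul[OF hom_norm_power_mult[OF h]] by simp
      then show ?thesis using True j D_norm_power_mult[OF h, of i j x] by simp
    next
      case False
      then have "Q = (\<lambda>x. 0)" by (auto simp: Q_def fhc_def)
      then show ?thesis using False by (simp only: if_False D_zero)
    qed
    have "D i R x = D i Q x" for x
    proof (cases "m \<le> Suc N \<and> even (Suc N - m)")
      case True
      then obtain j where j: "Suc N = m + 2 * j" by (metis dvdE le_add_diff_inverse)
      define a where "a = fhc lk (Suc N) m"
      have up: "real (Suc N) * fhc lk N (Suc m) = 2 * real j * a"
        using fhc_raise[of N lk m] True j by (simp add: a_def)
      have low: "real (Suc N) * fhc lk N (m - 1) * (D i Y x / (2 * (real m + lk)))
          = a * (1 + real j / (real m + lk)) * D i Y x"
      proof (cases m)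
        case 0
        then show ?thesis using D_hom_0 h by simp
      next
        case (Suc k)
        have pos: "real m + lk > 0" using lk_nonneg Suc by simp
        have t: "Suc k \<le> Suc N \<and> even (Suc N - Suc k)" using True Suc by (simp only:)
        have "real (Suc N) * fhc lk N k = 2 * (lk + real (m + (N - k) div 2)) * a"
          using fhc_lower[of lk N k] lk_nonneg Suc unfolding if_P[OF t] by (simp add: a_def)
        moreover have "(N - k) div 2 = j" using j Suc by simp
        ultimately have "real (Suc N) * fhc lk N (m - 1) = 2 * (lk + real m + real j) * a" using Suc by simp
        then have "real (Suc N) * fhc lk N (m - 1) * (D i Y x / (2 * (real m + lk)))
          = 2 * (lk + real m + real j) * a * (D i Y x / (2 * (real m + lk)))" by simp
        also have "\<dots> = a * (1 + real j / (real m + lk)) * D i Y x" using pos by (simp add: field_simps)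
        finally show ?thesis .
      qed
      have DY0: "m = 0 \<Longrightarrow> D i Y x = 0" using D_hom_0 h by auto
      \<comment> \<open>For m = 0 truncation makes the exponent N instead of N + 1, but then
        \<open>D i Y x\<close> is 0.\<close>
      have ex: "N - (m - 1) = 2 * j \<or> D i Y x = 0" using j DY0 by (cases m) auto
      have "D i R x = \<omega> * ((real (Suc N) * fhc lk N (Suc m)) * norm x ^ (N - Suc m) * raise m i Y x
         + norm x ^ (N - (m - 1)) * (real (Suc N) * fhc lk N (m - 1) * (D i Y x / (2 * (real m + lk)))))"
        unfolding DR by (simp add: algebra_simps del: of_nat_Suc)
      also have "\<dots> = \<omega> * (2 * real j * a * norm x ^ (N - Suc m) * raise m i Y x
         + norm x ^ (2 * j) * (a * (1 + real j / (real m + lk)) * D i Y x))"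
        unfolding up low using ex by auto
      also have "\<dots> = \<omega> * a * (norm x ^ (2 * j) * D i Y x
          + (if j = 0 then 0 else 2 * real j * norm x ^ (2 * j - 2) * (x $ i * Y x)))"
      proof (cases j)
        case (Suc k)
        then have "N - Suc m = 2 * k" using j by simp
        define u where "u = D i Y x / (real m + lk)"
        have e1: "x $ i * Y x = raise m i Y x + (norm x)\<^sup>2 * u / 2"
          unfolding coord_mult_harm[of x i Y m] u_def by simp
        have e2: "a * (1 + real j / (real m + lk)) * D i Y x = a * (D i Y x + real j * u)"
          by (simp add: u_def algebra_simps)
        show ?thesis unfolding e1 e2 using Suc \<open>N - Suc m = 2 * k\<close>
          by (simp add: power2_eq_square algebra_simps)
      qed simp
      also have "\<dots> = D i Q x" unfolding DQ using True j by (simp add: a_def)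
      finally show ?thesis .
    next
      case False
      have 1: "real (Suc N) * fhc lk N (Suc m) = 0" using fhc_raise[of N lk m] False by (simp only: if_False)
      have 2: "fhc lk N (m - 1) = 0 \<or> D i Y x = 0"
      proof (cases m)
        case 0
        then show ?thesis using D_hom_0 h by auto
      next
        case (Suc k)
        then have "real (Suc N) * fhc lk N (m - 1) = 0" using fhc_lower[of lk N k] False lk_nonneg by auto
        then show ?thesis by simp
      qed
      have "D i R x = 0" unfolding DR using 1 2 by auto
      then show ?thesis using False by (simp only: DQ if_False)
    qed
    then show ?thesis using D_diff[OF hR hQ] by simp
  qed
  then have "(\<lambda>x. R x - Q x) = (\<lambda>x. 0)"
    by (intro joint_kernel_trivial[OF hom_diff[OF hR hQ]]) auto
  then have "R x = Q x" by (metis eq_iff_diff_eq_0)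
  then show ?case by (simp add: R_def Q_def \<omega>_def)
qed

end

section \<open>The kernel on the ball\<close>

lemma Beta_shift:
  assumes "a > 0" "b > 0"
  shows "Beta (a + real m) (b + real n) = Beta a b * (pochhammer a m * pochhammer b n / pochhammer (a + b) (m + n) :: real)"
proof -
  have G: "Gamma (z + real k) = Gamma z * pochhammer z k" if "z > 0" for z :: real and k
  proof -
    have "z \<notin> \<int>\<^sub>\<le>\<^sub>0" using that by (auto elim!: nonpos_Ints_cases)
    then have "pochhammer z k = Gamma (z + real k) / Gamma z" by (rule pochhammer_Gamma)
    moreover have "Gamma z > 0" using that by (rule Gamma_real_pos)
    ultimately show ?thesis by simp
  qed
  have "a + real m + (b + real n) = (a + b) + real (m + n)" by simp
  then have "Gamma (a + real m + (b + real n)) = Gamma (a + b) * pochhammer (a + b) (m + n)"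
    using G[of "a + b" "m + n"] assms by (simp only: add_pos_pos)
  then show ?thesis unfolding Beta_def G[OF assms(1)] G[OF assms(2)] by simp
qed

lemma beta_moment_Beta:
  assumes "a > 0" "b > 0"
  shows "Beta (a + real p) (b + real k) = Beta a b * beta_moment a b p k"
  unfolding beta_moment_def using Beta_shift[OF assms] .

context dunkl_setting
begin

text \<open>\<open>gk \<nu> M x y\<close> is the mean of \<open>V[(\<parallel>x\<parallel>\<parallel>y\<parallel>uv + (1-u)\<langle>\<cdot>,y\<rangle>)\<^sup>M](x)\<close>
  over the normalized measures in \<open>u\<close> and \<open>v\<close>.\<close>

definition gk :: "real \<Rightarrow> nat \<Rightarrow> real ^ 'n \<Rightarrow> real ^ 'n \<Rightarrow> real" where
  "gk \<nu> M x y = (\<Sum>b\<le>M div 2. real (M choose (2 * b)) * beta_moment \<nu> (lk + 1) (2 * b) (M - 2 * b)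
     * sym_moment (\<nu> + 1 / 2) b * norm x ^ (2 * b) * (norm y ^ (2 * b) * vk (M - 2 * b) x y))"

lemma hom_gk: "hom M (gk \<nu> M x)"
  unfolding gk_def[abs_def]
proof (intro hom_sum hom_cmul)
  fix b assume "b \<in> {..M div 2}"
  then have "M - 2 * b + 2 * b = M" by auto
  then show "hom M (\<lambda>y. norm y ^ (2 * b) * vk (M - 2 * b) x y)"
    using hom_norm_power_mult[OF vk_hom_right[of "M - 2 * b" x], of b] by simp
qed

lemma S_norm_power_mult: "hom k p \<Longrightarrow> S (k + 2 * j) (\<lambda>x. norm x ^ (2 * j) * p x) = S k p"
proof (induction j)
  case (Suc j)
  have "(\<lambda>x. norm x ^ (2 * Suc j) * p x) = (\<lambda>x. (norm x)\<^sup>2 * (norm x ^ (2 * j) * p x))"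
    by (simp add: power2_eq_square mult.assoc)
  then show ?case using S_norm_mult[OF hom_norm_power_mult[OF Suc.prems, of j]] Suc by simp
qed simp

text \<open>The factors |y|^(2b) do not change the spherical mean, and |x|^(2b) completes the power
  of |x| from \<open>funk_hecke\<close> to M - m. Thus only coefficients depend on b, and
  \<open>fhc_shift\<close> sums them; terms with M - 2b < m vanish.\<close>

theorem funk_hecke_gk:
  assumes nu: "\<nu> > 0" and Y: "harm m Y"
  shows "S (M + m) (\<lambda>y. gk \<nu> M x y * Y y) = S 0 (\<lambda>x. 1) * fhc (lk + \<nu>) M m * norm x ^ (M - m) * Y x"
proof -
  define c where "c b = real (M choose (2 * b)) * beta_moment \<nu> (lk + 1) (2 * b) (M - 2 * b) * sym_moment (\<nu> + 1 / 2) b" for b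
  define \<omega> where "\<omega> = S 0 (\<lambda>x. 1)"
  have tm: "S (M + m) (\<lambda>y. (c b * norm x ^ (2 * b)) * (norm y ^ (2 * b) * (vk (M - 2 * b) x y * Y y)))
      = \<omega> * (c b * fhc lk (M - 2 * b) m) * norm x ^ (M - m) * Y x"
    and hm: "hom (M + m) (\<lambda>y. (c b * norm x ^ (2 * b)) * (norm y ^ (2 * b) * (vk (M - 2 * b) x y * Y y)))"
    if b: "b \<in> {..M div 2}" for b
  proof -
    have h: "hom (M - 2 * b + m) (\<lambda>y. vk (M - 2 * b) x y * Y y)"
      by (rule hom_mult[OF vk_hom_right harm_hom[OF Y]])
    have e: "M - 2 * b + m + 2 * b = M + m" using b by auto
    show "hom (M + m) (\<lambda>y. (c b * norm x ^ (2 * b)) * (norm y ^ (2 * b) * (vk (M - 2 * b) x y * Y y)))"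
      using hom_cmul[OF hom_norm_power_mult[OF h, of b]] unfolding e .
    have "S (M + m) (\<lambda>y. (c b * norm x ^ (2 * b)) * (norm y ^ (2 * b) * (vk (M - 2 * b) x y * Y y)))
       = c b * norm x ^ (2 * b) * (\<omega> * fhc lk (M - 2 * b) m * norm x ^ (M - 2 * b - m) * Y x)"
      unfolding S_cmul using S_norm_power_mult[OF h, of b] funk_hecke[OF Y, of "M - 2 * b" x] by (simp only: e \<omega>_def)
    also have "\<dots> = \<omega> * (c b * fhc lk (M - 2 * b) m) * norm x ^ (M - m) * Y x"
    proof (cases "m \<le> M - 2 * b")
      case True
      then have "norm x ^ (2 * b) * norm x ^ (M - 2 * b - m) = norm x ^ (M - m)"
        using b by (simp add: power_add[symmetric])
      then show ?thesis by (simp add: mult_ac)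
    next
      case False
      then show ?thesis by (simp add: fhc_def)
    qed
    finally show "S (M + m) (\<lambda>y. (c b * norm x ^ (2 * b)) * (norm y ^ (2 * b) * (vk (M - 2 * b) x y * Y y)))
      = \<omega> * (c b * fhc lk (M - 2 * b) m) * norm x ^ (M - m) * Y x" .
  qed
  have "(\<lambda>y. gk \<nu> M x y * Y y) =
      (\<lambda>y. \<Sum>b\<le>M div 2. (c b * norm x ^ (2 * b)) * (norm y ^ (2 * b) * (vk (M - 2 * b) x y * Y y)))"
    by (simp add: gk_def c_def sum_distrib_right mult.assoc)
  then have "S (M + m) (\<lambda>y. gk \<nu> M x y * Y y) =
      (\<Sum>b\<le>M div 2. \<omega> * (c b * fhc lk (M - 2 * b) m) * norm x ^ (M - m) * Y x)"
    using S_sum[OF hm, of "{..M div 2}"] tm by simp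
  also have "\<dots> = \<omega> * (\<Sum>b\<le>M div 2. c b * fhc lk (M - 2 * b) m) * norm x ^ (M - m) * Y x"
    by (simp add: sum_distrib_left sum_distrib_right)
  also have "(\<Sum>b\<le>M div 2. c b * fhc lk (M - 2 * b) m) = fhc (lk + \<nu>) M m"
  proof (cases "m \<le> M \<and> even (M - m)")
    case True
    then obtain e where e: "M = m + 2 * e" by (metis dvdE le_add_diff_inverse)
    have "(\<Sum>b\<le>M div 2. c b * fhc lk (M - 2 * b) m) = (\<Sum>b\<le>e. c b * fhc lk (M - 2 * b) m)"
      using e by (intro sum.mono_neutral_right) (auto simp: fhc_def)
    then show ?thesis using fhc_shift[OF nu, of lk m e] lk_nonneg e by (simp add: c_def)
  next
    case False
    have "fhc lk (M - 2 * b) m = 0" if "b \<le> M div 2" for b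
      using False that by (auto simp: fhc_def)
    then show ?thesis using False by (auto simp: fhc_def)
  qed
  finally show ?thesis by (simp add: \<omega>_def)
qed

end

section \<open>The inner product on the ball\<close>

locale dunkl_ball = dunkl_setting G Rp \<kappa> V
  for G :: "(real ^ 'n \<Rightarrow> real ^ 'n) set" and Rp \<kappa> V +
  fixes \<mu> \<nu> :: real
  assumes mu: "\<mu> \<ge> 0" and nu: "\<nu> > 0"
begin

abbreviation "w \<equiv> weight Rp \<kappa> \<mu> \<nu>"
abbreviation "ip \<equiv> ball_inner Rp \<kappa> \<mu> \<nu>"

text \<open>The Gegenbauer index after the means over u and v; \<open>lam\<close> adds \<mu> + 1/2
  for the mean over t.\<close>

definition lp :: real where "lp = lk + \<nu>"
definition lam :: real where "lam = lp + \<mu> + 1 / 2"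

lemma lp_pos: "lp > 0" using nu lk_nonneg by (simp add: lp_def)

lemma lam_pos: "lam > 0" using mu lp_pos by (simp add: lam_def)

lemma lam_eq: "lambda_const Rp \<kappa> \<mu> \<nu> = lam"
  by (simp add: lambda_const_def lam_def lp_def lk_def field_simps)

lemma weight_eq: "w x = h2 x * norm x powr (2 * \<nu>) * (1 - (norm x)\<^sup>2) powr (\<mu> - 1 / 2)"
  by (simp add: weight_def h2_def)

lemma w_measurable [measurable]: "w \<in> borel_measurable borel"
  unfolding weight_eq[abs_def] by measurable

lemma w_nonneg: "w x \<ge> 0"
  by (simp add: weight_eq h2_nonneg)

text \<open>For every \<mu> \<ge> 0 the exponent \<mu> - 1/2 exceeds -1, so one computation serves
  \<mu> > 0 and \<mu> = 0. Powers of |x|^2 and of 1 - |x|^2 shift the two Beta parameters.\<close>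

lemma ball_integral:
  assumes p: "hom k p"
  shows "has_bochner_integral lborel
     (\<lambda>x. indicator (cball 0 1) x * (p x * norm x ^ (2 * j) * (1 - (norm x)\<^sup>2) ^ c * w x))
     (S k p / 2 * Beta (real k / 2 + lp + 1 + real j) (\<mu> + 1 / 2 + real c))"
proof -
  have "(\<lambda>x. indicator (cball 0 1) x * (p x * norm x ^ (2 * j) * (1 - (norm x)\<^sup>2) ^ c * w x)) =
     (\<lambda>x. indicator (cball 0 1) x * (p x * h2 x * (norm x powr (2 * (\<nu> + real j)) * (1 - (norm x)\<^sup>2) powr (\<mu> - 1 / 2 + real c))))"
  proof
    fix x :: "real ^ 'n"
    have 1: "norm x ^ (2 * j) * norm x powr (2 * \<nu>) = norm x powr (2 * (\<nu> + real j))"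
      by (cases "x = 0") (auto simp: powr_realpow[symmetric] powr_add[symmetric] algebra_simps)
    have 2: "(1 - (norm x)\<^sup>2) ^ c * (1 - (norm x)\<^sup>2) powr (\<mu> - 1 / 2) = (1 - (norm x)\<^sup>2) powr (\<mu> - 1 / 2 + real c)"
      if "norm x \<le> 1"
    proof (cases "norm x = 1")
      case False
      with that have "norm x < 1" by simp
      then have "(norm x)\<^sup>2 < 1" by (simp add: power_less_one_iff abs_square_less_1)
      then show ?thesis by (simp add: powr_realpow[symmetric] powr_add[symmetric] add.commute)
    qed simp
    show "indicator (cball 0 1) x * (p x * norm x ^ (2 * j) * (1 - (norm x)\<^sup>2) ^ c * w x) =
      indicator (cball 0 1) x * (p x * h2 x * (norm x powr (2 * (\<nu> + real j)) * (1 - (norm x)\<^sup>2) powr (\<mu> - 1 / 2 + real c)))"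
      unfolding 1[symmetric] weight_eq using 2 by (simp add: indicator_def)
  qed
  moreover have "has_bochner_integral lborel
     (\<lambda>x. indicator (cball 0 1) x * (p x * h2 x * (norm x powr (2 * (\<nu> + real j)) * (1 - (norm x)\<^sup>2) powr (\<mu> - 1 / 2 + real c))))
     (S k p / 2 * Beta (real k / 2 + lk + 1 + (\<nu> + real j)) (\<mu> - 1 / 2 + real c + 1))"
    using lk_nonneg nu mu by (intro S_radial[OF p]) (auto simp: add_pos_nonneg add_nonneg_pos)
  moreover have "real k / 2 + lk + 1 + (\<nu> + real j) = real k / 2 + lp + 1 + real j"
    "\<mu> - 1 / 2 + real c + 1 = \<mu> + 1 / 2 + real c" by (simp_all add: lp_def)
  ultimately show ?thesis by (simp only:)
qed

lemma w_integrable: "set_integrable lborel (cball 0 1) w"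
  using ball_integral[OF hom.const[of 1], of 0 0] by (simp add: set_integrable_def has_bochner_integral_iff)

lemma bounded_w_integrable:
  assumes [measurable]: "f \<in> borel_measurable borel" and B: "\<And>x. norm x \<le> 1 \<Longrightarrow> \<bar>f x\<bar> \<le> B"
  shows "set_integrable lborel (cball 0 1) (\<lambda>x. f x * w x)"
  unfolding set_integrable_def
proof (rule Bochner_Integration.integrable_bound)
  have [measurable]: "cball (0 :: real ^ 'n) 1 \<in> sets borel" by simp
  show "integrable lborel (\<lambda>x. B * (indicator (cball 0 1) x *\<^sub>R w x))"
    using w_integrable by (intro integrable_mult_right) (simp add: set_integrable_def)
  show "(\<lambda>x. indicator (cball 0 1) x *\<^sub>R (f x * w x)) \<in> borel_measurable lborel" by simp
  show "AE x in lborel. norm (indicator (cball 0 1) x *\<^sub>R (f x * w x)) \<le> norm (B * (indicator (cball 0 1) x *\<^sub>R w x))"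
  proof (intro always_eventually allI)
    fix x :: "real ^ 'n"
    show "norm (indicator (cball 0 1) x *\<^sub>R (f x * w x)) \<le> norm (B * (indicator (cball 0 1) x *\<^sub>R w x))"
      using B[of x] w_nonneg[of x]
      by (auto simp: indicator_def abs_mult intro!: mult_right_mono intro: order_trans[OF _ abs_ge_self])
  qed
qed

lemma continuous_w_integrable:
  assumes "continuous_on UNIV f" shows "set_integrable lborel (cball 0 1) (\<lambda>x. f x * w x)"
proof -
  have "bounded (f ` cball 0 1)"
    by (intro compact_imp_bounded compact_continuous_image continuous_on_subset[OF assms]) auto
  then obtain B where "\<forall>x\<in>cball 0 1. \<bar>f x\<bar> \<le> B" by (auto simp: bounded_iff)
  then show ?thesis using assms
    by (intro bounded_w_integrable[where B=B] borel_measurable_continuous_onI) auto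
qed

abbreviation "b0 \<equiv> b_const Rp \<kappa> \<mu> \<nu>"

text \<open>The weight is positive almost everywhere on the ball, so the open set of points of the
  open ball where \<open>f\<close> is nonzero has measure 0 and is empty.\<close>

lemma zero_integral_square:
  assumes f: "continuous_on UNIV f" and z: "(LINT x:cball 0 1|lborel. f x * f x * w x) = 0"
    and x: "norm x < 1"
  shows "f x = 0"
proof (rule ccontr)
  assume fx: "f x \<noteq> 0"
  have int: "integrable lborel (\<lambda>x. indicator (cball 0 1) x *\<^sub>R (f x * f x * w x))"
    using continuous_w_integrable[of "\<lambda>x. f x * f x"] f by (auto simp: set_integrable_def intro: continuous_intros)
  have "AE x in lborel. indicator (cball 0 1) x *\<^sub>R (f x * f x * w x) = 0"
    using z int unfolding set_lebesgue_integral_def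
    by (subst integral_nonneg_eq_0_iff_AE[symmetric]) (auto simp: w_nonneg intro!: always_eventually)
  then have "AE y in lborel. y \<notin> ball 0 1 \<inter> {y. f y \<noteq> 0}"
    using AE_regular AE_lborel_singleton[of "0 :: real ^ 'n"]
  proof eventually_elim
    fix y assume y: "indicator (cball 0 1) y *\<^sub>R (f y * f y * w y) = 0" "regular y" "y \<noteq> 0"
    show "y \<notin> ball 0 1 \<inter> {y. f y \<noteq> 0}"
    proof
      assume "y \<in> ball 0 1 \<inter> {y. f y \<noteq> 0}"
      then have n: "norm y < 1" "f y \<noteq> 0" by auto
      then have "(norm y)\<^sup>2 < 1" by (simp add: abs_square_less_1)
      then have "w y > 0" unfolding weight_eq using h2_pos[OF y(2)] y(3) by simp
      then show False using y(1) n by simp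
    qed
  qed
  then have "ball 0 1 \<inter> {y. f y \<noteq> 0} \<in> null_sets lborel"
  proof (subst AE_iff_null_sets)
    have "open {y. f y \<noteq> 0}" using f by (intro open_Collect_neq continuous_intros) auto
    then show "ball 0 1 \<inter> {y. f y \<noteq> 0} \<in> sets lborel" by auto
  qed
  then have "negligible (ball 0 1 \<inter> {y. f y \<noteq> 0})"
    using null_sets_completionI negligible_iff_null_sets by blast
  moreover have "open (ball 0 1 \<inter> {y. f y \<noteq> 0})" using f by (intro open_Int open_Collect_neq continuous_intros) auto
  ultimately have "ball 0 1 \<inter> {y. f y \<noteq> 0} = {}" using open_not_negligible by blast
  then show False using x fx by auto
qed

lemma total_mass: "(LINT x:cball 0 1|lborel. w x) = S 0 (\<lambda>x. 1) / 2 * Beta (lp + 1) (\<mu> + 1 / 2)"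
  using ball_integral[OF hom.const[of 1], of 0 0] by (simp add: has_bochner_integral_iff set_lebesgue_integral_def)

text \<open>Positivity comes from \<open>zero_integral_square\<close> for the constant 1. Through
  \<open>b0_S\<close> it also shows that the mass of the sphere is nonzero, so that spherical means
  can be normalized.\<close>

lemma total_mass_pos: "(LINT x:cball 0 1|lborel. w x) > 0"
proof -
  have "(LINT x:cball 0 1|lborel. w x) \<ge> 0"
    unfolding set_lebesgue_integral_def by (intro integral_nonneg_AE) (simp add: w_nonneg)
  moreover have "(LINT x:cball 0 1|lborel. w x) \<noteq> 0"
    using zero_integral_square[of "\<lambda>x. 1" 0] by auto
  ultimately show ?thesis by simp
qed

lemma b0_pos: "b0 > 0"
  using total_mass_pos by (simp add: b_const_def)

lemma ip_commute: "ip f g = ip g f"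
  by (simp add: ball_inner_def mult.commute[of "f _"])

lemma ip_add_left:
  assumes "continuous_on UNIV f" "continuous_on UNIV g" "continuous_on UNIV h"
  shows "ip (\<lambda>x. f x + g x) h = ip f h + ip g h"
proof -
  have "(LINT x:cball 0 1|lborel. (f x + g x) * h x * w x) = (LINT x:cball 0 1|lborel. f x * h x * w x + g x * h x * w x)"
    by (simp add: algebra_simps)
  also have "\<dots> = (LINT x:cball 0 1|lborel. f x * h x * w x) + (LINT x:cball 0 1|lborel. g x * h x * w x)"
    using assms by (intro set_integral_add continuous_w_integrable continuous_intros)
  finally show ?thesis by (simp add: ball_inner_def distrib_left)
qed

lemma ip_cmul_left: "ip (\<lambda>x. c * f x) h = c * ip f h"
  by (simp add: ball_inner_def mult.assoc)

lemma ip_zero_left: "ip (\<lambda>x. 0) h = 0"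
  using ip_cmul_left[of 0 "\<lambda>x. 0" h] by simp

lemma ip_diff_left:
  assumes "continuous_on UNIV f" "continuous_on UNIV g" "continuous_on UNIV h"
  shows "ip (\<lambda>x. f x - g x) h = ip f h - ip g h"
  using ip_add_left[of f "\<lambda>x. (-1) * g x" h] ip_cmul_left[of "-1" g h] assms by (simp add: continuous_intros)

lemma ip_sum_left:
  assumes "\<And>a. a \<in> A \<Longrightarrow> continuous_on UNIV (f a)" "continuous_on UNIV h"
  shows "ip (\<lambda>x. \<Sum>a\<in>A. f a x) h = (\<Sum>a\<in>A. ip (f a) h)"
  using assms(1)
proof (induction A rule: infinite_finite_induct)
  case (insert a A)
  then show ?case using ip_add_left[of "f a" "\<lambda>x. \<Sum>a\<in>A. f a x" h] assms(2)
    by (simp add: continuous_on_sum)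
qed (simp_all add: ip_zero_left)

lemma ip_positive:
  assumes p: "p \<in> polys_lt n"
  shows "ip p p \<ge> 0" "ip p p = 0 \<Longrightarrow> p = (\<lambda>x. 0)"
proof -
  show "ip p p \<ge> 0"
    unfolding ball_inner_def set_lebesgue_integral_def using b0_pos
    by (intro mult_nonneg_nonneg integral_nonneg_AE) (auto simp: w_nonneg intro!: always_eventually)
  assume "ip p p = 0"
  then have "(LINT x:cball 0 1|lborel. p x * p x * w x) = 0" using b0_pos by (simp add: ball_inner_def)
  then show "p = (\<lambda>x. 0)"
    using zero_integral_square polys_lt_continuous[OF p] by (intro polys_lt_zero_on_ball[OF p]) blast
qed

lemma b0_S: "b0 * (S 0 (\<lambda>x. 1) / 2) * Beta (lp + 1) (\<mu> + 1 / 2) = 1"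
proof -
  have "b0 * (LINT x:cball 0 1|lborel. w x) = 1" using total_mass_pos by (simp add: b_const_def)
  then show ?thesis unfolding total_mass by (simp add: mult_ac)
qed

text \<open>Normalizing by \<open>b0_S\<close> cancels the Beta constant; means over the ball become
  normalized spherical means times a ratio of Pochhammer symbols.\<close>

lemma b0_ball_integral:
  assumes p: "hom (2 * m) p"
  shows "b0 * (LINT x:cball 0 1|lborel. p x * norm x ^ (2 * j) * (1 - (norm x)\<^sup>2) ^ c * w x)
    = S (2 * m) p / S 0 (\<lambda>x. 1) * beta_moment (lp + 1) (\<mu> + 1 / 2) (m + j) c"
proof -
  have S0: "S 0 (\<lambda>x. 1) \<noteq> 0" using b0_S by auto
  have "(LINT x:cball 0 1|lborel. p x * norm x ^ (2 * j) * (1 - (norm x)\<^sup>2) ^ c * w x)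
     = S (2 * m) p / 2 * Beta ((lp + 1) + real (m + j)) (\<mu> + 1 / 2 + real c)"
    using ball_integral[OF p, of j c] by (simp add: has_bochner_integral_iff set_lebesgue_integral_def algebra_simps)
  also have "\<dots> = S (2 * m) p / 2 * (Beta (lp + 1) (\<mu> + 1 / 2) * beta_moment (lp + 1) (\<mu> + 1 / 2) (m + j) c)"
    using lp_pos mu by (subst beta_moment_Beta) auto
  finally have "b0 * (LINT x:cball 0 1|lborel. p x * norm x ^ (2 * j) * (1 - (norm x)\<^sup>2) ^ c * w x)
     = (b0 * (S 0 (\<lambda>x. 1) / 2) * Beta (lp + 1) (\<mu> + 1 / 2)) * (S (2 * m) p / S 0 (\<lambda>x. 1) * beta_moment (lp + 1) (\<mu> + 1 / 2) (m + j) c)"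
    using S0 by simp
  then show ?thesis unfolding b0_S by simp
qed

end

section \<open>The kernel operator acts as a projection\<close>

text \<open>The sum is the e-th backward difference in z of a polynomial of degree j < e. One
  difference turns the Pochhammer symbol of length j into j times one of length j - 1.\<close>

lemma alternating_pochhammer_zero:
  "j < e \<Longrightarrow> (\<Sum>k\<le>e. (-1) ^ k * real (e choose k) * pochhammer (z - real k) j) = 0"
proof (induction e arbitrary: j z)
  case (Suc e)
  define d where "d j z = (\<Sum>k\<le>e. (-1) ^ k * real (e choose k) * pochhammer (z - real k) j)" for j z
  have "(\<Sum>k\<le>Suc e. (-1) ^ k * real (Suc e choose k) * pochhammer (z - real k) j)
     = pochhammer z j + (\<Sum>k\<le>e. (-1) ^ Suc k * real (Suc e choose Suc k) * pochhammer (z - real (Suc k)) j)"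
    by (subst sum.atMost_Suc_shift) simp
  also have "(\<Sum>k\<le>e. (-1) ^ Suc k * real (Suc e choose Suc k) * pochhammer (z - real (Suc k)) j)
     = (\<Sum>k\<le>e. (-1) ^ Suc k * real (e choose Suc k) * pochhammer (z - real (Suc k)) j) - d j (z - 1)"
    unfolding d_def sum_subtractf[symmetric]
    by (intro sum.cong) (auto simp: algebra_simps)
  also have "pochhammer z j + ((\<Sum>k\<le>e. (-1) ^ Suc k * real (e choose Suc k) * pochhammer (z - real (Suc k)) j) - d j (z - 1))
     = (\<Sum>k\<le>Suc e. (-1) ^ k * real (e choose k) * pochhammer (z - real k) j) - d j (z - 1)"
    by (subst sum.atMost_Suc_shift) simp
  also have "\<dots> = d j z - d j (z - 1)" by (simp add: d_def)
  finally have *: "(\<Sum>k\<le>Suc e. (-1) ^ k * real (Suc e choose k) * pochhammer (z - real k) j) = d j z - d j (z - 1)" .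
  show ?case
  proof (cases j)
    case 0
    then show ?thesis unfolding * by (simp add: d_def)
  next
    case (Suc i)
    have "pochhammer (z - real k) j - pochhammer (z - 1 - real k) j = real j * pochhammer (z - real k) i" for k
    proof -
      have "pochhammer (z - 1 - real k) (Suc i) = (z - 1 - real k) * pochhammer (z - real k) i"
        by (subst pochhammer_rec) (simp add: algebra_simps)
      then show ?thesis unfolding Suc by (simp add: pochhammer_Suc algebra_simps)
    qed
    then have "d j z - d j (z - 1) = real j * d i z"
      unfolding d_def sum_subtractf[symmetric] sum_distrib_left
      by (intro sum.cong) (auto simp: algebra_simps right_diff_distrib[symmetric])
    also have "d i z = 0" using Suc.IH[of i z] Suc.prems Suc by (simp add: d_def)
    finally show ?thesis unfolding * by simp
  qed
qed simp

definition zc :: "nat \<Rightarrow> real \<Rightarrow> nat \<Rightarrow> real" where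
  "zc n l k = (real n + l) / l * ((- 1) ^ k * pochhammer l (n - k) / (fact k * fact (n - 2 * k)) * 2 ^ (n - 2 * k))"

lemma Z_poly_eq: "Z_poly n l t = (\<Sum>k\<le>n div 2. zc n l k * t ^ (n - 2 * k))"
  by (simp add: Z_poly_def gegenbauer_def zc_def sum_distrib_left power_mult_distrib mult_ac)

text \<open>Gegenbauer orthogonality: the left side is the mean of Z_n^l C_n'^l / C_n'^l(1). In the
  algebraic proof, n = n' + 2e with e > 0 leads to an e-th difference of a polynomial of degree e -
  1.\<close>

lemma zc_fhc:
  assumes l: "l > 0"
  shows "(\<Sum>k\<le>n div 2. zc n l k * fhc l (n - 2 * k) n') = (if n = n' then 1 else 0)"
proof (cases "n' \<le> n \<and> even (n - n')")
  case True
  then obtain e where n: "n = n' + 2 * e" by (metis dvdE le_add_diff_inverse)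
  have "(\<Sum>k\<le>n div 2. zc n l k * fhc l (n - 2 * k) n') = (\<Sum>k\<le>e. zc n l k * fhc l (n - 2 * k) n')"
    using n by (intro sum.mono_neutral_right) (auto simp: fhc_def)
  also have "\<dots> = (\<Sum>k\<le>e. (real n + l) / l * ((- 1) ^ k * pochhammer l (n - k) / (fact k * fact (e - k) * pochhammer (l + 1) (n' + (e - k)))))"
  proof (intro sum.cong refl)
    fix k assume "k \<in> {..e}"
    then have N: "n - 2 * k = n' + 2 * (e - k)" using n by auto
    show "zc n l k * fhc l (n - 2 * k) n' = (real n + l) / l * ((- 1) ^ k * pochhammer l (n - k) / (fact k * fact (e - k) * pochhammer (l + 1) (n' + (e - k))))"
      unfolding zc_def N fhc_add by simp
  qed
  also have "\<dots> = (if n = n' then 1 else 0)"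
  proof (cases e)
    case 0
    have "pochhammer l (Suc n) = l * pochhammer (l + 1) n" by (rule pochhammer_rec)
    then have "pochhammer l n * (l + real n) = l * pochhammer (l + 1) n" by (simp add: pochhammer_Suc)
    moreover have "pochhammer (l + 1) n > 0" using l by (intro pochhammer_pos) simp
    ultimately show ?thesis using 0 n l by (simp add: field_simps)
  next
    case (Suc d)
    define z where "z = l + 1 + real (n' + e)"
    have "(real n + l) / l * ((- 1) ^ k * pochhammer l (n - k) / (fact k * fact (e - k) * pochhammer (l + 1) (n' + (e - k))))
      = (real n + l) / fact e * ((- 1) ^ k * real (e choose k) * pochhammer (z - real k) d)" if k: "k \<le> e" for k
    proof -
      have "n - k = Suc ((n' + (e - k)) + d)" using n Suc k by simp
      then have "pochhammer l (n - k) = l * pochhammer (l + 1) ((n' + (e - k)) + d)" by (simp only: pochhammer_rec)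
      also have "\<dots> = l * (pochhammer (l + 1) (n' + (e - k)) * pochhammer (l + 1 + real (n' + (e - k))) d)"
        by (simp only: pochhammer_product')
      also have "l + 1 + real (n' + (e - k)) = z - real k" using k by (simp add: z_def of_nat_diff)
      finally have p: "pochhammer l (n - k) = l * (pochhammer (l + 1) (n' + (e - k)) * pochhammer (z - real k) d)" .
      have "pochhammer (l + 1) (n' + (e - k)) > 0" using l by (intro pochhammer_pos) simp
      then show ?thesis unfolding p binomial_fact[OF k, where 'a=real] using l by simp
    qed
    then have "(\<Sum>k\<le>e. (real n + l) / l * ((- 1) ^ k * pochhammer l (n - k) / (fact k * fact (e - k) * pochhammer (l + 1) (n' + (e - k)))))
       = (real n + l) / fact e * (\<Sum>k\<le>e. (- 1) ^ k * real (e choose k) * pochhammer (z - real k) d)"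
      unfolding sum_distrib_left by (intro sum.cong) auto
    then show ?thesis using alternating_pochhammer_zero[of d e z] Suc n by simp
  qed
  finally show ?thesis .
next
  case False
  have "fhc l (n - 2 * k) n' = 0" if "k \<le> n div 2" for k
    using False that by (auto simp: fhc_def)
  then show ?thesis using False by auto
qed

text \<open>The mean of \<open>pochhammer (\<beta> + E) j\<close> for a binomial variable E with i
  trials and success probability X. Later X = |x|^2, the weights being the powers of |x|^2 and 1 -
  |x|^2 in \<open>kern\<close>.\<close>

definition bin_mean :: "nat \<Rightarrow> nat \<Rightarrow> real \<Rightarrow> real \<Rightarrow> real" where
  "bin_mean i j \<beta> X = (\<Sum>e\<le>i. real (i choose e) * X ^ e * (1 - X) ^ (i - e) * pochhammer (\<beta> + real e) j)"

lemma bin_mean_0: "bin_mean i 0 \<beta> X = 1"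
  using binomial_ring[of X "1 - X" i] by (simp add: bin_mean_def)

text \<open>The first factor \<beta> + e of the Pochhammer symbol is split off. In the part with e,
  the identity e binom(i,e) = i binom(i-1,e-1) lowers the number of trials.\<close>

lemma bin_mean_Suc:
  "bin_mean i (Suc j) \<beta> X = \<beta> * bin_mean i j (\<beta> + 1) X + real i * X * bin_mean (i - 1) j (\<beta> + 2) X"
proof -
  have "bin_mean i (Suc j) \<beta> X = \<beta> * bin_mean i j (\<beta> + 1) X +
     (\<Sum>e\<le>i. real e * real (i choose e) * X ^ e * (1 - X) ^ (i - e) * pochhammer (\<beta> + 1 + real e) j)"
    unfolding bin_mean_def sum_distrib_left sum.distrib[symmetric]
    by (intro sum.cong) (auto simp: pochhammer_rec algebra_simps)
  also have "(\<Sum>e\<le>i. real e * real (i choose e) * X ^ e * (1 - X) ^ (i - e) * pochhammer (\<beta> + 1 + real e) j)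
     = real i * X * bin_mean (i - 1) j (\<beta> + 2) X"
  proof (cases i)
    case (Suc k)
    have "real (Suc e) * real (Suc k choose Suc e) = real (Suc k) * real (k choose e)" for e
      unfolding of_nat_mult[symmetric] by (simp only: Suc_times_binomial)
    then have tm: "real (Suc e) * real (Suc k choose Suc e) * X ^ Suc e * (1 - X) ^ (Suc k - Suc e) * pochhammer (\<beta> + 1 + real (Suc e)) j
      = real (Suc k) * X * (real (k choose e) * X ^ e * (1 - X) ^ (k - e) * pochhammer (\<beta> + 2 + real e) j)" for e
      by (simp add: algebra_simps)
    show ?thesis unfolding Suc
      by (subst sum.atMost_Suc_shift) (simp only: tm, simp add: bin_mean_def sum_distrib_left)
  qed simp
  finally show ?thesis .
qed

text \<open>The top coefficient is the falling factorial of i of length j, as for the factorial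
  moments of the binomial law. The other coefficients only contribute polynomials of lower
  degree.\<close>

lemma bin_mean_polynomial:
  "\<exists>a. \<forall>X. bin_mean i j \<beta> X = (\<Sum>l<j. a l * X ^ l) + (if j \<le> i then fact i / fact (i - j) else 0) * X ^ j"
proof (induction j arbitrary: i \<beta>)
  case 0
  then show ?case by (simp add: bin_mean_0)
next
  case (Suc j)
  obtain a where a: "\<And>X. bin_mean i j (\<beta> + 1) X = (\<Sum>l<j. a l * X ^ l) + (if j \<le> i then fact i / fact (i - j) else 0) * X ^ j"
    using Suc.IH by blast
  obtain b where b: "\<And>X. bin_mean (i - 1) j (\<beta> + 2) X = (\<Sum>l<j. b l * X ^ l)
      + (if j \<le> i - 1 then fact (i - 1) / fact (i - 1 - j) else 0) * X ^ j"
    using Suc.IH by blast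
  \<comment> \<open>The first summand of \<open>bin_mean_Suc\<close> ends at X^j, so its top term
    counts among the lower coefficients; the second summand is shifted by the factor X.\<close>
  define c where "c l = \<beta> * (if l < j then a l else (if j \<le> i then fact i / fact (i - j) else 0))
     + (if l = 0 then 0 else real i * b (l - 1))" for l
  have "bin_mean i (Suc j) \<beta> X = (\<Sum>l<Suc j. c l * X ^ l)
     + (if Suc j \<le> i then fact i / fact (i - Suc j) else 0) * X ^ Suc j" for X
  proof -
    have "(\<Sum>l<Suc j. c l * X ^ l) = \<beta> * ((\<Sum>l<j. a l * X ^ l) + (if j \<le> i then fact i / fact (i - j) else 0) * X ^ j)
       + (\<Sum>l<Suc j. (if l = 0 then 0 else real i * b (l - 1)) * X ^ l)"
      unfolding c_def distrib_right sum.distrib by (simp add: sum_distrib_left distrib_left mult.assoc)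
    also have "(\<Sum>l<Suc j. (if l = 0 then 0 else real i * b (l - 1)) * X ^ l) = real i * X * (\<Sum>l<j. b l * X ^ l)"
      by (subst sum.lessThan_Suc_shift) (simp add: sum_distrib_left mult_ac)
    finally have 1: "(\<Sum>l<Suc j. c l * X ^ l) = \<beta> * bin_mean i j (\<beta> + 1) X + real i * X * (\<Sum>l<j. b l * X ^ l)"
      unfolding a .
    have 2: "real i * (if j \<le> i - 1 then fact (i - 1) / fact (i - 1 - j) else 0)
        = (if Suc j \<le> i then fact i / fact (i - Suc j) else (0::real))"
      by (cases i) auto
    have "real i * X * bin_mean (i - 1) j (\<beta> + 2) X = real i * X * (\<Sum>l<j. b l * X ^ l)
       + (real i * (if j \<le> i - 1 then fact (i - 1) / fact (i - 1 - j) else 0)) * X ^ Suc j"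
      unfolding b by (simp add: algebra_simps)
    then show ?thesis unfolding bin_mean_Suc 1 2 by simp
  qed
  then show ?case by blast
qed

lemma cutoff_power_polys_lt:
  "p \<in> polys_lt n \<Longrightarrow> (\<lambda>y. (1 - (norm y)\<^sup>2) ^ c * p y) \<in> polys_lt (n + 2 * c)"
proof (induction c)
  case (Suc c)
  define q where "q = (\<lambda>y. (1 - (norm y)\<^sup>2) ^ c * p y)"
  have q: "q \<in> polys_lt (n + 2 * c)" using Suc by (simp add: q_def)
  have "hom 2 (\<lambda>y :: real ^ 'a. (norm y)\<^sup>2)" using hom_norm_mult[OF hom.const[of 1]] by (simp add: numeral_2_eq_2)
  from polys_lt_mult_hom[OF q this] have "(\<lambda>y. (norm y)\<^sup>2 * q y) \<in> polys_lt (n + 2 * Suc c)" by simp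
  moreover have "q \<in> polys_lt (n + 2 * Suc c)" by (rule polys_lt_mono[OF _ q]) simp
  ultimately have "(\<lambda>y. q y - (norm y)\<^sup>2 * q y) \<in> polys_lt (n + 2 * Suc c)" by (intro polys_lt_diff)
  then show ?case by (simp add: q_def algebra_simps)
qed simp

section \<open>The kernel on radial powers times h-harmonics\<close>

context dunkl_ball
begin

text \<open>\<open>kern N x y\<close> is the mean of \<open>V[\<zeta>\<^sup>N](x')\<close>; \<open>ker n\<close> is the resulting closed form of the
  right-hand side of the theorem, as a polynomial in both variables.\<close>

definition kern :: "nat \<Rightarrow> real ^ 'n \<Rightarrow> real ^ 'n \<Rightarrow> real" where
  "kern N x y = (\<Sum>c\<le>N div 2. (real (N choose (2 * c)) * sym_moment \<mu> c * (1 - (norm x)\<^sup>2) ^ c)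
     * ((1 - (norm y)\<^sup>2) ^ c * gk \<nu> (N - 2 * c) x y))"

definition ker :: "nat \<Rightarrow> real ^ 'n \<Rightarrow> real ^ 'n \<Rightarrow> real" where
  "ker n x y = (\<Sum>k\<le>n div 2. zc n lam k * kern (n - 2 * k) x y)"

lemma kern_polys_lt: "kern N x \<in> polys_lt (Suc N)"
  unfolding kern_def[abs_def]
proof (intro polys_lt_sum polys_lt_cmul)
  fix c assume "c \<in> {..N div 2}"
  then have e: "Suc (N - 2 * c) + 2 * c = Suc N" by auto
  show "(\<lambda>y. (1 - (norm y)\<^sup>2) ^ c * gk \<nu> (N - 2 * c) x y) \<in> polys_lt (Suc N)"
    using cutoff_power_polys_lt[OF hom_polys_lt[OF hom_gk[where M="N - 2 * c" and \<nu>=\<nu> and x=x] lessI], of c] unfolding e .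
qed

lemma ker_polys_lt: "ker n x \<in> polys_lt (Suc n)"
  unfolding ker_def[abs_def]
  by (intro polys_lt_sum polys_lt_cmul) (rule polys_lt_mono[OF _ kern_polys_lt], simp)

lemma ip_add_right:
  "continuous_on UNIV f \<Longrightarrow> continuous_on UNIV g \<Longrightarrow> continuous_on UNIV h \<Longrightarrow> ip h (\<lambda>x. f x + g x) = ip h f + ip h g"
  using ip_add_left[of f g h] by (simp add: ip_commute)

lemma ip_cmul_right: "ip h (\<lambda>x. c * f x) = c * ip h f"
  using ip_cmul_left[of c f h] by (simp add: ip_commute)

lemma S0_nz: "S 0 (\<lambda>x. 1) \<noteq> 0"
  using b0_S by auto

lemma hom_mult_same: "hom m p \<Longrightarrow> hom m q \<Longrightarrow> hom (2 * m) (\<lambda>x. p x * q x)"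
  using hom_mult[of m p m q] by (simp add: mult_2)

lemma ip_harm:
  assumes Y: "hom m Y" and Y': "hom m Y'"
  shows "ip (\<lambda>x. (1 - (norm x)\<^sup>2) ^ c * norm x ^ (2 * a) * Y x) (\<lambda>x. norm x ^ (2 * l) * Y' x)
    = S (2 * m) (\<lambda>x. Y x * Y' x) / S 0 (\<lambda>x. 1) * beta_moment (lp + 1) (\<mu> + 1 / 2) (m + (a + l)) c"
proof -
  have "ip (\<lambda>x. (1 - (norm x)\<^sup>2) ^ c * norm x ^ (2 * a) * Y x) (\<lambda>x. norm x ^ (2 * l) * Y' x) =
    b0 * (LINT x:cball 0 1|lborel. (Y x * Y' x) * norm x ^ (2 * (a + l)) * (1 - (norm x)\<^sup>2) ^ c * w x)"
    by (simp add: ball_inner_def power_add distrib_left mult_ac)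
  then show ?thesis unfolding b0_ball_integral[OF hom_mult_same[OF Y Y']] .
qed

lemma ip_harm_orthogonal:
  assumes Y: "harm m Y" and Y': "harm m' Y'" and ne: "m \<noteq> m'"
  shows "ip (\<lambda>x. (1 - (norm x)\<^sup>2) ^ c * norm x ^ (2 * a) * Y x) (\<lambda>x. norm x ^ (2 * l) * Y' x) = 0"
proof -
  have "ip (\<lambda>x. (1 - (norm x)\<^sup>2) ^ c * norm x ^ (2 * a) * Y x) (\<lambda>x. norm x ^ (2 * l) * Y' x) =
    b0 * (LINT x:cball 0 1|lborel. (Y x * Y' x) * norm x ^ (2 * (a + l)) * (1 - (norm x)\<^sup>2) ^ c * w x)"
    by (simp add: ball_inner_def power_add distrib_left mult_ac)
  also have "\<dots> = 0"
    using ball_integral[OF hom_mult[OF harm_hom[OF Y] harm_hom[OF Y']], of "a + l" c] S_harm_orthogonal[OF assms]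
    by (simp add: has_bochner_integral_iff set_lebesgue_integral_def)
  finally show ?thesis .
qed

text \<open>\<open>funk_hecke_gk\<close> evaluates each c, with index \<open>lp\<close> because of
  the means over u and v, and the integral over the ball supplies the Beta moment. Terms with c > i
  vanish, since their degree N - 2c is below m.\<close>

lemma kern_harm:
  assumes Y: "harm m Y"
  shows "ip (kern (m + 2 * i) x) (\<lambda>y. norm y ^ (2 * j) * Y y) =
    (\<Sum>c\<le>i. real ((m + 2 * i) choose (2 * c)) * sym_moment \<mu> c * fhc lp (m + 2 * (i - c)) m
      * beta_moment (lp + 1) (\<mu> + 1 / 2) (m + (i - c) + j) c
      * ((1 - (norm x)\<^sup>2) ^ c * norm x ^ (2 * (i - c)) * Y x))"
    (is "_ = (\<Sum>c\<le>i. ?t c)")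
proof -
  define N where "N = m + 2 * i"
  define \<omega> where "\<omega> = S 0 (\<lambda>x. 1)"
  have cY: "continuous_on UNIV (\<lambda>y. norm y ^ (2 * j) * Y y)"
    by (intro continuous_intros hom_continuous[OF harm_hom[OF Y]])
  have cc: "continuous_on UNIV (\<lambda>y. (1 - (norm y)\<^sup>2) ^ c * gk \<nu> (N - 2 * c) x y)" for c
    by (intro continuous_intros hom_continuous[OF hom_gk])
  have val: "ip (\<lambda>y. (1 - (norm y)\<^sup>2) ^ c * gk \<nu> (N - 2 * c) x y) (\<lambda>y. norm y ^ (2 * j) * Y y)
     = S (N - 2 * c + m) (\<lambda>y. gk \<nu> (N - 2 * c) x y * Y y) / 2
       * Beta (real (N - 2 * c + m) / 2 + lp + 1 + real j) (\<mu> + 1 / 2 + real c) * b0" for c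
  proof -
    have "ip (\<lambda>y. (1 - (norm y)\<^sup>2) ^ c * gk \<nu> (N - 2 * c) x y) (\<lambda>y. norm y ^ (2 * j) * Y y)
      = b0 * (LINT y:cball 0 1|lborel. (gk \<nu> (N - 2 * c) x y * Y y) * norm y ^ (2 * j) * (1 - (norm y)\<^sup>2) ^ c * w y)"
      by (simp add: ball_inner_def mult_ac)
    then show ?thesis
      using ball_integral[OF hom_mult[OF hom_gk[where M="N - 2 * c" and \<nu>=\<nu> and x=x] harm_hom[OF Y]], of j c]
      by (simp add: has_bochner_integral_iff set_lebesgue_integral_def)
  qed
  have "ip (kern N x) (\<lambda>y. norm y ^ (2 * j) * Y y) =
     (\<Sum>c\<le>N div 2. (real (N choose (2 * c)) * sym_moment \<mu> c * (1 - (norm x)\<^sup>2) ^ c)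
       * ip (\<lambda>y. (1 - (norm y)\<^sup>2) ^ c * gk \<nu> (N - 2 * c) x y) (\<lambda>y. norm y ^ (2 * j) * Y y))"
    unfolding kern_def[abs_def]
    by (subst ip_sum_left) (auto intro!: continuous_on_mult cc cY simp: ip_cmul_left)
  also have "\<dots> = (\<Sum>c\<le>i. (real (N choose (2 * c)) * sym_moment \<mu> c * (1 - (norm x)\<^sup>2) ^ c)
       * ip (\<lambda>y. (1 - (norm y)\<^sup>2) ^ c * gk \<nu> (N - 2 * c) x y) (\<lambda>y. norm y ^ (2 * j) * Y y))"
  proof (rule sum.mono_neutral_right)
    show "\<forall>c\<in>{..N div 2} - {..i}. real (N choose (2 * c)) * sym_moment \<mu> c * (1 - (norm x)\<^sup>2) ^ c
       * ip (\<lambda>y. (1 - (norm y)\<^sup>2) ^ c * gk \<nu> (N - 2 * c) x y) (\<lambda>y. norm y ^ (2 * j) * Y y) = 0"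
    proof
      fix c assume "c \<in> {..N div 2} - {..i}"
      then have "N - 2 * c < m" by (auto simp: N_def)
      then have "fhc (lk + \<nu>) (N - 2 * c) m = 0" by (simp add: fhc_def)
      then show "real (N choose (2 * c)) * sym_moment \<mu> c * (1 - (norm x)\<^sup>2) ^ c
       * ip (\<lambda>y. (1 - (norm y)\<^sup>2) ^ c * gk \<nu> (N - 2 * c) x y) (\<lambda>y. norm y ^ (2 * j) * Y y) = 0"
        unfolding val funk_hecke_gk[OF nu Y] by simp
    qed
  qed (auto simp: N_def)
  also have "\<dots> = (\<Sum>c\<le>i. ?t c)"
  proof (intro sum.cong refl)
    fix c assume c: "c \<in> {..i}"
    then have Nc: "N - 2 * c = m + 2 * (i - c)" by (auto simp: N_def)
    have "m + 2 * (i - c) + m = 2 * (m + (i - c))" by simp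
    then have h: "hom (2 * (m + (i - c))) (\<lambda>y. gk \<nu> (N - 2 * c) x y * Y y)"
      using hom_mult[OF hom_gk[where M="N - 2 * c" and \<nu>=\<nu> and x=x] harm_hom[OF Y]] unfolding Nc by simp
    have fh: "S (2 * (m + (i - c))) (\<lambda>y. gk \<nu> (N - 2 * c) x y * Y y)
        = \<omega> * fhc lp (m + 2 * (i - c)) m * norm x ^ (2 * (i - c)) * Y x"
      using funk_hecke_gk[OF nu Y, of "N - 2 * c" x] \<open>m + 2 * (i - c) + m = _\<close>
      unfolding Nc lp_def \<omega>_def by simp
    have "ip (\<lambda>y. (1 - (norm y)\<^sup>2) ^ c * gk \<nu> (N - 2 * c) x y) (\<lambda>y. norm y ^ (2 * j) * Y y)
      = b0 * (LINT y:cball 0 1|lborel. (gk \<nu> (N - 2 * c) x y * Y y) * norm y ^ (2 * j) * (1 - (norm y)\<^sup>2) ^ c * w y)"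
      by (simp add: ball_inner_def mult_ac)
    also have "\<dots> = fhc lp (m + 2 * (i - c)) m * norm x ^ (2 * (i - c)) * Y x
        * beta_moment (lp + 1) (\<mu> + 1 / 2) (m + (i - c) + j) c"
      unfolding b0_ball_integral[OF h] fh using S0_nz by (simp add: \<omega>_def)
    finally show "(real (N choose (2 * c)) * sym_moment \<mu> c * (1 - (norm x)\<^sup>2) ^ c)
       * ip (\<lambda>y. (1 - (norm y)\<^sup>2) ^ c * gk \<nu> (N - 2 * c) x y) (\<lambda>y. norm y ^ (2 * j) * Y y) = ?t c"
      by (simp add: N_def)
  qed
  finally show ?thesis by (simp add: N_def)
qed

lemma kern_harm_zero:
  assumes Y: "harm m Y" and z: "\<not> (m \<le> N \<and> even (N - m))"
  shows "ip (kern N x) (\<lambda>y. norm y ^ (2 * j) * Y y) = 0"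
proof -
  have cY: "continuous_on UNIV (\<lambda>y. norm y ^ (2 * j) * Y y)"
    by (intro continuous_intros hom_continuous[OF harm_hom[OF Y]])
  have cc: "continuous_on UNIV (\<lambda>y. (1 - (norm y)\<^sup>2) ^ c * gk \<nu> (N - 2 * c) x y)" for c
    by (intro continuous_intros hom_continuous[OF hom_gk])
  have "ip (\<lambda>y. (1 - (norm y)\<^sup>2) ^ c * gk \<nu> (N - 2 * c) x y) (\<lambda>y. norm y ^ (2 * j) * Y y) = 0"
    if c: "c \<le> N div 2" for c
  proof -
    have "ip (\<lambda>y. (1 - (norm y)\<^sup>2) ^ c * gk \<nu> (N - 2 * c) x y) (\<lambda>y. norm y ^ (2 * j) * Y y)
      = b0 * (LINT y:cball 0 1|lborel. (gk \<nu> (N - 2 * c) x y * Y y) * norm y ^ (2 * j) * (1 - (norm y)\<^sup>2) ^ c * w y)"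
      by (simp add: ball_inner_def mult_ac)
    moreover have "fhc (lk + \<nu>) (N - 2 * c) m = 0" using z c by (auto simp: fhc_def)
    then have "S (N - 2 * c + m) (\<lambda>y. gk \<nu> (N - 2 * c) x y * Y y) = 0"
      using funk_hecke_gk[OF nu Y] by simp
    ultimately show ?thesis
      using ball_integral[OF hom_mult[OF hom_gk[where M="N - 2 * c" and \<nu>=\<nu> and x=x] harm_hom[OF Y]], of j c]
      by (simp add: has_bochner_integral_iff set_lebesgue_integral_def)
  qed
  then show ?thesis unfolding kern_def[abs_def]
    by (subst ip_sum_left) (auto intro!: continuous_on_mult cc cY simp: ip_cmul_left)
qed

text \<open>Duplication of (2c)! cancels the Pochhammer symbol at 1/2, and those at \<mu> + 1/2 and
  lp + 1 cancel between the moments. The index \<open>lam\<close> enters because the Beta parameters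
  lp + 1 and \<mu> + 1/2 add up to lam + 1. Binomial weights are left, so the sum over c becomes
  \<open>bin_mean\<close>.\<close>

lemma kern_coefficient:
  assumes c: "c \<le> i"
  shows "real ((m + 2 * i) choose (2 * c)) * sym_moment \<mu> c * fhc lp (m + 2 * (i - c)) m
      * beta_moment (lp + 1) (\<mu> + 1 / 2) (m + (i - c) + j) c =
    fact (m + 2 * i) / (2 ^ (m + 2 * i) * fact i * pochhammer (lam + 1) (m + i + j))
     * (real (i choose (i - c)) * pochhammer (lp + real m + 1 + real (i - c)) j)"
proof -
  define e where "e = i - c"
  have N: "m + 2 * i = m + 2 * e + 2 * c" and ie: "i = e + c" using c by (auto simp: e_def)
  have pos: "pochhammer (1 / 2 :: real) c > 0" "pochhammer (\<mu> + 1 / 2) c > 0" "pochhammer (lp + 1) (m + e) > 0"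
    "pochhammer (lam + 1) (m + i + j) > 0"
    using mu lp_pos lam_pos by (auto intro!: pochhammer_pos)
  have bin: "real ((m + 2 * i) choose (2 * c)) = fact (m + 2 * i) / (fact (2 * c) * fact (m + 2 * e))"
    using N by (subst binomial_fact) auto
  have bin2: "real (i choose e) = fact i / (fact e * fact c)"
    using ie by (subst binomial_fact) auto
  have pw: "(2::real) ^ (m + 2 * i) = 2 ^ (m + 2 * e) * 4 ^ c"
    unfolding N by (simp add: power_add power_mult)
  have pp: "pochhammer (lp + 1) (m + e + j) = pochhammer (lp + 1) (m + e) * pochhammer (lp + real m + 1 + real e) j"
  proof -
    have "lp + 1 + real (m + e) = lp + real m + 1 + real e" by simp
    then show ?thesis by (simp only: pochhammer_product')
  qed
  have arg: "lp + 1 + (\<mu> + 1 / 2) = lam + 1" "m + e + j + c = m + i + j" using ie by (simp_all add: lam_def)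
  show ?thesis
    unfolding e_def[symmetric] bin bin2 beta_moment_def sym_moment_def fhc_add arg fact_double_half pp pw
    using pos by (simp add: field_simps)
qed

lemma kern_harm_bin_mean:
  assumes Y: "harm m Y"
  shows "ip (kern (m + 2 * i) x) (\<lambda>y. norm y ^ (2 * j) * Y y) =
     fact (m + 2 * i) / (2 ^ (m + 2 * i) * fact i * pochhammer (lam + 1) (m + i + j))
      * bin_mean i j (lp + real m + 1) ((norm x)\<^sup>2) * Y x"
proof -
  define C where "C = fact (m + 2 * i) / (2 ^ (m + 2 * i) * fact i * pochhammer (lam + 1) (m + i + j))"
  define X where "X = (norm x)\<^sup>2"
  have "ip (kern (m + 2 * i) x) (\<lambda>y. norm y ^ (2 * j) * Y y) =
    (\<Sum>c\<le>i. C * (real (i choose (i - c)) * pochhammer (lp + real m + 1 + real (i - c)) j) * ((1 - X) ^ c * X ^ (i - c) * Y x))"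
    unfolding kern_harm[OF Y] C_def X_def
    by (intro sum.cong refl) (simp only: atMost_iff kern_coefficient, simp add: power_mult)
  also have "\<dots> = (\<Sum>e\<le>i. C * (real (i choose e) * pochhammer (lp + real m + 1 + real e) j) * ((1 - X) ^ (i - e) * X ^ e * Y x))"
    by (rule sum.reindex_bij_witness[where i="\<lambda>e. i - e" and j="\<lambda>c. i - c"]) auto
  also have "\<dots> = C * bin_mean i j (lp + real m + 1) X * Y x"
    unfolding bin_mean_def sum_distrib_left sum_distrib_right by (intro sum.cong) auto
  finally show ?thesis by (simp add: C_def X_def)
qed

text \<open>The dependence on |x|^2 is \<open>bin_mean\<close>, whose coefficient at the power j
  gives \<open>fhc lam N (m + 2 * j)\<close>. This involves m and j only through the degree m + 2j,
  which is what lets the statement pass to all homogeneous polynomials of that degree.\<close>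

lemma kern_harm_leading:
  assumes Y: "harm m Y"
  shows "(\<lambda>x. ip (kern N x) (\<lambda>y. norm y ^ (2 * j) * Y y) - fhc lam N (m + 2 * j) * (norm x ^ (2 * j) * Y x)) \<in> polys_lt (m + 2 * j)"
proof (cases "m \<le> N \<and> even (N - m)")
  case True
  then obtain i where N: "N = m + 2 * i" by (metis dvdE le_add_diff_inverse)
  define C where "C = fact (m + 2 * i) / (2 ^ (m + 2 * i) * fact i * pochhammer (lam + 1) (m + i + j))"
  obtain a where a: "\<And>X. bin_mean i j (lp + real m + 1) X = (\<Sum>l<j. a l * X ^ l) + (if j \<le> i then fact i / fact (i - j) else 0) * X ^ j"
    using bin_mean_polynomial by blast
  \<comment> \<open>The factor i!/(i-j)! turns i! in the denominator of \<open>C\<close> into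
    (i-j)!, which is the form of \<open>fhc_add\<close> in degree m + 2j.\<close>
  have lead: "C * (if j \<le> i then fact i / fact (i - j) else 0) = fhc lam N (m + 2 * j)"
  proof (cases "j \<le> i")
    case True
    then obtain k where "i = j + k" using le_Suc_ex by blast
    then have k: "m + 2 * i = (m + 2 * j) + 2 * k" "m + i + j = (m + 2 * j) + k" "i - j = k" by auto
    have "C * (fact i / fact (i - j)) = fhc lam N (m + 2 * j)"
      unfolding C_def N k fhc_add by simp
    then show ?thesis using True by simp
  next
    case False
    then show ?thesis using N by (simp add: fhc_def)
  qed
  have eq: "ip (kern N x) (\<lambda>y. norm y ^ (2 * j) * Y y) - fhc lam N (m + 2 * j) * (norm x ^ (2 * j) * Y x)
     = (\<Sum>l<j. (C * a l) * (norm x ^ (2 * l) * Y x))" for x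
    unfolding N kern_harm_bin_mean[OF Y] C_def[symmetric] a lead[unfolded N, symmetric] power_mult[of "norm x" 2]
    by (simp add: sum_distrib_left sum_distrib_right algebra_simps)
  have "(\<lambda>x. \<Sum>l<j. (C * a l) * (norm x ^ (2 * l) * Y x)) \<in> polys_lt (m + 2 * j)"
    by (intro polys_lt_sum polys_lt_cmul hom_polys_lt[OF hom_norm_power_mult[OF harm_hom[OF Y]]]) auto
  then show ?thesis unfolding eq .
next
  case False
  then have "fhc lam N (m + 2 * j) = 0" by (auto simp: fhc_def)
  then show ?thesis using kern_harm_zero[OF Y False] by (simp add: polys_lt_zero)
qed

lemma fischer_hom: "fischer n p \<Longrightarrow> hom n p"
  by (induction rule: fischer.induct) (auto intro: hom_norm_power_mult harm_hom hom.add)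

lemma kern_continuous: "continuous_on UNIV (kern N x)"
  using polys_lt_continuous[OF kern_polys_lt] .

lemma ker_continuous: "continuous_on UNIV (ker n x)"
  using polys_lt_continuous[OF ker_polys_lt] .

lemma kern_leading:
  assumes "hom n p"
  shows "(\<lambda>x. ip (kern N x) p - fhc lam N n * p x) \<in> polys_lt n"
  using hom_fischer[OF assms]
proof (induction rule: fischer.induct)
  case (harm m Y j)
  then show ?case by (rule kern_harm_leading)
next
  case (add n p q)
  have "continuous_on UNIV p" "continuous_on UNIV q" using add.hyps fischer_hom hom_continuous by blast+
  then have "ip (kern N x) (\<lambda>x. p x + q x) = ip (kern N x) p + ip (kern N x) q" for x
    using kern_continuous by (rule ip_add_right)
  then show ?case using polys_lt_add[OF add.IH] by (simp add: algebra_simps)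
qed

section \<open>The integral operator with kernel \<open>ker n\<close>\<close>

definition T :: "nat \<Rightarrow> (real ^ 'n \<Rightarrow> real) \<Rightarrow> real ^ 'n \<Rightarrow> real" where
  "T n q x = ip (ker n x) q"

lemma T_eq: "continuous_on UNIV q \<Longrightarrow> T n q x = (\<Sum>k\<le>n div 2. zc n lam k * ip (kern (n - 2 * k) x) q)"
  unfolding T_def ker_def[abs_def]
  by (subst ip_sum_left) (auto intro!: continuous_on_mult kern_continuous simp: ip_cmul_left)

text \<open>In degree n' the leading scalar is the combination of the numbers
  \<open>fhc lam (n - 2 * k) n'\<close> with the coefficients of Z_n, which \<open>zc_fhc\<close>
  evaluates.\<close>

lemma T_leading_hom:
  assumes p: "hom n' p"
  shows "(\<lambda>x. T n p x - (if n = n' then 1 else 0) * p x) \<in> polys_lt n'"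
proof -
  have "T n p x - (if n = n' then 1 else 0) * p x =
     (\<Sum>k\<le>n div 2. zc n lam k * (ip (kern (n - 2 * k) x) p - fhc lam (n - 2 * k) n' * p x))" for x
    unfolding T_eq[OF hom_continuous[OF p]] zc_fhc[OF lam_pos, symmetric]
    by (simp add: sum_distrib_right sum_subtractf[symmetric] right_diff_distrib mult.assoc)
  then show ?thesis by (simp only:) (intro polys_lt_sum polys_lt_cmul kern_leading[OF p])
qed

lemma T_add: "continuous_on UNIV f \<Longrightarrow> continuous_on UNIV g \<Longrightarrow> T n (\<lambda>x. f x + g x) x = T n f x + T n g x"
  unfolding T_def by (intro ip_add_right ker_continuous)

lemma T_zero: "T n (\<lambda>x. 0) x = 0"
  unfolding T_def using ip_cmul_right[of _ 0 "\<lambda>x. 0"] by simp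

lemma T_polys_lt: "q \<in> polys_lt k \<Longrightarrow> T n q \<in> polys_lt k"
proof (induction k arbitrary: q)
  case 0
  then have "q = (\<lambda>x. 0)" by (rule polys_lt_0)
  then show ?case using T_zero polys_lt_zero by (simp add: T_zero[abs_def])
next
  case (Suc k)
  from Suc.prems obtain r p where r: "r \<in> polys_lt k" and p: "hom k p" and q: "q = (\<lambda>x. r x + p x)"
    by (rule polys_lt_SucE)
  have "T n q x = T n r x + ((T n p x - (if n = k then 1 else 0) * p x) + (if n = k then 1 else 0) * p x)" for x
    unfolding q using T_add[OF polys_lt_continuous[OF r] hom_continuous[OF p]] by simp
  moreover have "(\<lambda>x. T n r x + ((T n p x - (if n = k then 1 else 0) * p x) + (if n = k then 1 else 0) * p x)) \<in> polys_lt (Suc k)"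
    using Suc.IH[OF r] T_leading_hom[OF p, of n] hom_polys_lt[OF p, of "Suc k"]
    by (intro polys_lt_add polys_lt_cmul) (auto intro: polys_lt_mono[of k "Suc k"])
  ultimately show ?case by presburger
qed

lemma T_leading:
  assumes "q \<in> polys_lt (Suc k)"
  shows "(\<lambda>x. T n q x - (if n = k then 1 else 0) * q x) \<in> polys_lt k"
proof -
  from assms obtain r p where r: "r \<in> polys_lt k" and p: "hom k p" and q: "q = (\<lambda>x. r x + p x)"
    by (rule polys_lt_SucE)
  have "T n q x - (if n = k then 1 else 0) * q x
     = (T n r x - (if n = k then 1 else 0) * r x) + (T n p x - (if n = k then 1 else 0) * p x)" for x
    unfolding q using T_add[OF polys_lt_continuous[OF r] hom_continuous[OF p]] by (simp add: algebra_simps)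
  then show ?thesis
    by (simp only:) (intro polys_lt_add polys_lt_diff polys_lt_cmul T_polys_lt T_leading_hom r p)
qed

text \<open>Symmetry is established for the bilinear form, not pointwise for \<open>kern\<close>, so
  no symmetry of \<open>vk\<close> in x and y has to be shown. For equal degrees of the harmonics
  the Beta moments for j and for l enter as a product; for different degrees both sides are 0 by
  orthogonality.\<close>

lemma kern_symmetric_harm:
  assumes Y: "harm m Y" and Y': "harm m' Y'"
  shows "ip (\<lambda>x. ip (kern N x) (\<lambda>y. norm y ^ (2 * j) * Y y)) (\<lambda>x. norm x ^ (2 * l) * Y' x)
    = ip (\<lambda>x. ip (kern N x) (\<lambda>y. norm y ^ (2 * l) * Y' y)) (\<lambda>x. norm x ^ (2 * j) * Y x)"
proof -
  define g where "g m i c = real ((m + 2 * i) choose (2 * c)) * sym_moment \<mu> c * fhc lp (m + 2 * (i - c)) m" for m i c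
  define bm where "bm = beta_moment (lp + 1) (\<mu> + 1 / 2)"
  have expand: "ip (\<lambda>x. ip (kern (m + 2 * i) x) (\<lambda>y. norm y ^ (2 * j) * Y y)) (\<lambda>x. norm x ^ (2 * l) * Y' x)
    = (\<Sum>c\<le>i. g m i c * bm (m + (i - c) + j) c
       * ip (\<lambda>x. (1 - (norm x)\<^sup>2) ^ c * norm x ^ (2 * (i - c)) * Y x) (\<lambda>x. norm x ^ (2 * l) * Y' x))"
    if Y: "harm m Y" and Y': "harm m' Y'" for m m' Y Y' i j l
    unfolding kern_harm[OF Y] g_def[symmetric] bm_def[symmetric]
    by (subst ip_sum_left)
       (auto intro!: continuous_intros hom_continuous[OF harm_hom[OF Y]] hom_continuous[OF harm_hom[OF Y']] simp: ip_cmul_left)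
  show ?thesis
  proof (cases "m = m'")
    case True
    show ?thesis
    proof (cases "m \<le> N \<and> even (N - m)")
      case True
      then obtain i where N: "N = m + 2 * i" by (metis dvdE le_add_diff_inverse)
      have "ip (\<lambda>x. ip (kern N x) (\<lambda>y. norm y ^ (2 * j) * Y y)) (\<lambda>x. norm x ^ (2 * l) * Y' x)
         = (\<Sum>c\<le>i. g m i c * bm (m + (i - c) + j) c * bm (m + (i - c) + l) c * (S (2 * m) (\<lambda>x. Y x * Y' x) / S 0 (\<lambda>x. 1)))"
        if Y: "harm m Y" and Y': "harm m Y'" for Y Y' j l
        unfolding N expand[OF Y Y'] ip_harm[OF harm_hom[OF Y] harm_hom[OF Y']] bm_def
        by (simp add: add.assoc mult_ac)
      from this[OF Y Y'[folded \<open>m = m'\<close>]] this[OF Y'[folded \<open>m = m'\<close>] Y]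
      show ?thesis by (simp add: mult.commute mult.left_commute)
    next
      case False
      then show ?thesis
        using kern_harm_zero[OF Y False] kern_harm_zero[OF Y', of N] \<open>m = m'\<close> by (simp add: ip_zero_left)
    qed
  next
    case False
    have z: "ip (\<lambda>x. ip (kern N x) (\<lambda>y. norm y ^ (2 * j) * Y y)) (\<lambda>x. norm x ^ (2 * l) * Y' x) = 0"
      if Y: "harm m Y" and Y': "harm m' Y'" and ne: "m \<noteq> m'" for m m' Y Y' j l
    proof (cases "m \<le> N \<and> even (N - m)")
      case True
      then obtain i where N: "N = m + 2 * i" by (metis dvdE le_add_diff_inverse)
      show ?thesis unfolding N expand[OF Y Y'] ip_harm_orthogonal[OF Y Y' ne] by simp
    next
      case False
      then show ?thesis using kern_harm_zero[OF Y False] by (simp add: ip_zero_left)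
    qed
    show ?thesis using z[OF Y Y' False] z[OF Y' Y] False by simp
  qed
qed

lemma kern_ip_continuous:
  assumes "hom n p" shows "continuous_on UNIV (\<lambda>x. ip (kern N x) p)"
proof -
  have "continuous_on UNIV (\<lambda>x. (ip (kern N x) p - fhc lam N n * p x) + fhc lam N n * p x)"
    by (intro continuous_on_add continuous_on_mult_left polys_lt_continuous[OF kern_leading[OF assms]]
        hom_continuous[OF assms])
  then show ?thesis by simp
qed

lemma kern_symmetric:
  assumes p: "hom n p" and q: "hom n' q"
  shows "ip (\<lambda>x. ip (kern N x) p) q = ip (\<lambda>x. ip (kern N x) q) p"
proof -
  have 1: "ip (\<lambda>x. ip (kern N x) (\<lambda>y. norm y ^ (2 * j) * Y y)) q = ip (\<lambda>x. ip (kern N x) q) (\<lambda>y. norm y ^ (2 * j) * Y y)"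
    if Y: "harm m Y" for m Y j
    using hom_fischer[OF q]
  proof (induction rule: fischer.induct)
    case (harm m' Y' l)
    show ?case by (rule kern_symmetric_harm[OF Y harm])
  next
    case (add n p q)
    note h = fischer_hom[OF add.hyps(1)] fischer_hom[OF add.hyps(2)]
    note hY = hom_norm_power_mult[OF harm_hom[OF Y]]
    show ?case
      unfolding ip_add_right[OF hom_continuous[OF h(1)] hom_continuous[OF h(2)] kern_continuous]
        ip_add_right[OF hom_continuous[OF h(1)] hom_continuous[OF h(2)] kern_ip_continuous[OF hY]]
        ip_add_left[OF kern_ip_continuous[OF h(1)] kern_ip_continuous[OF h(2)] hom_continuous[OF hY]]
        add.IH ..
  qed
  show ?thesis
    using hom_fischer[OF p]
  proof (induction rule: fischer.induct)
    case (harm m Y j)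
    then show ?case by (rule 1)
  next
    case (add n p r)
    note h = fischer_hom[OF add.hyps(1)] fischer_hom[OF add.hyps(2)]
    show ?case
      unfolding ip_add_right[OF hom_continuous[OF h(1)] hom_continuous[OF h(2)] kern_continuous]
        ip_add_right[OF hom_continuous[OF h(1)] hom_continuous[OF h(2)] kern_ip_continuous[OF q]]
        ip_add_left[OF kern_ip_continuous[OF h(1)] kern_ip_continuous[OF h(2)] hom_continuous[OF q]]
        add.IH ..
  qed
qed

lemma T_symmetric_hom:
  assumes p: "hom a p" and q: "hom b q"
  shows "ip (T n p) q = ip p (T n q)"
proof -
  have e: "ip (T n p) q = (\<Sum>k\<le>n div 2. zc n lam k * ip (\<lambda>x. ip (kern (n - 2 * k) x) p) q)"
    if p: "hom a p" and q: "hom b q" for a b p q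
    unfolding T_eq[OF hom_continuous[OF p], abs_def]
    by (subst ip_sum_left)
       (auto intro!: continuous_on_mult kern_ip_continuous[OF p] hom_continuous[OF q] simp: ip_cmul_left)
  show ?thesis
    unfolding ip_commute[of p] e[OF p q] e[OF q p] kern_symmetric[OF p q] ..
qed

lemma T_symmetric:
  assumes "p \<in> polys_lt a" "q \<in> polys_lt b"
  shows "ip (T n p) q = ip p (T n q)"
  using assms
proof (induction a arbitrary: p)
  case 0
  then have "p = (\<lambda>x. 0)" using polys_lt_0 by blast
  then show ?case by (simp add: T_zero[abs_def] ip_zero_left)
next
  case (Suc a)
  from Suc.prems(1) obtain r s where r: "r \<in> polys_lt a" and s: "hom a s" and p: "p = (\<lambda>x. r x + s x)"
    by (rule polys_lt_SucE)
  have hs: "ip (T n s) q = ip s (T n q)"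
    using Suc.prems(2)
  proof (induction b arbitrary: q)
    case 0
    then have "q = (\<lambda>x. 0)" using polys_lt_0 by blast
    then show ?case by (simp add: T_zero[abs_def] ip_commute[of _ "\<lambda>x. 0"] ip_zero_left)
  next
    case (Suc b)
    from Suc.prems(1) obtain r' s' where r': "r' \<in> polys_lt b" and s': "hom b s'" and q: "q = (\<lambda>x. r' x + s' x)"
      by (rule polys_lt_SucE)
    have Ts: "continuous_on UNIV (T n s)"
      using polys_lt_continuous[OF T_polys_lt[OF hom_polys_lt[OF s lessI]]] .
    have Tq: "T n q = (\<lambda>x. T n r' x + T n s' x)"
      unfolding q by (intro ext T_add polys_lt_continuous[OF r'] hom_continuous[OF s'])
    have c': "continuous_on UNIV (T n r')" "continuous_on UNIV (T n s')"
      using polys_lt_continuous[OF T_polys_lt[OF r']] polys_lt_continuous[OF T_polys_lt[OF hom_polys_lt[OF s' lessI]]] .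
    have "ip (T n s) q = ip (T n s) r' + ip (T n s) s'"
      unfolding q by (intro ip_add_right polys_lt_continuous[OF r'] hom_continuous[OF s'] Ts)
    also have "\<dots> = ip s (T n r') + ip s (T n s')" using Suc.IH[OF r'] T_symmetric_hom[OF s s'] by simp
    also have "\<dots> = ip s (T n q)" unfolding Tq by (intro ip_add_right[symmetric] c' hom_continuous[OF s])
    finally show ?case .
  qed
  have cq: "continuous_on UNIV q" "continuous_on UNIV (T n q)"
    using polys_lt_continuous[OF Suc.prems(2)] polys_lt_continuous[OF T_polys_lt[OF Suc.prems(2)]] .
  have c: "continuous_on UNIV (T n r)" "continuous_on UNIV (T n s)"
    using polys_lt_continuous[OF T_polys_lt[OF r]] polys_lt_continuous[OF T_polys_lt[OF hom_polys_lt[OF s lessI]]] .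
  have Tp: "T n p = (\<lambda>x. T n r x + T n s x)"
    unfolding p by (intro ext T_add polys_lt_continuous[OF r] hom_continuous[OF s])
  have "ip (T n p) q = ip (T n r) q + ip (T n s) q" unfolding Tp by (intro ip_add_left c cq)
  also have "\<dots> = ip r (T n q) + ip s (T n q)" using Suc.IH[OF r Suc.prems(2)] hs by simp
  also have "\<dots> = ip p (T n q)"
    unfolding p by (intro ip_add_left[symmetric] polys_lt_continuous[OF r] hom_continuous[OF s] cq)
  finally show ?case .
qed

text \<open>A symmetric operator that lowers degrees is nilpotent, hence zero.\<close>

lemma T_lower_zero: "q \<in> polys_lt k \<Longrightarrow> k \<le> n \<Longrightarrow> T n q = (\<lambda>x. 0)"
proof (induction k arbitrary: q)
  case 0
  then have "q = (\<lambda>x. 0)" using polys_lt_0 by blast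
  then show ?case by (simp add: T_zero[abs_def])
next
  case (Suc k)
  have "T n q \<in> polys_lt k" using T_leading[OF Suc.prems(1), of n] Suc.prems(2) by simp
  then have "T n (T n q) = (\<lambda>x. 0)" using Suc by simp
  then have "ip (T n q) (T n q) = 0"
    using T_symmetric[OF Suc.prems(1) T_polys_lt[OF Suc.prems(1), of n], of n]
    by (simp add: ip_commute[of _ "\<lambda>x. 0"] ip_zero_left)
  then show ?case by (rule ip_positive(2)[OF T_polys_lt[OF Suc.prems(1)]])
qed

section \<open>Reproduction of the orthogonal polynomials\<close>

lemma orth_polys_iff:
  "q \<in> orth_polys Rp \<kappa> \<mu> \<nu> n \<longleftrightarrow> q \<in> polys_lt (Suc n) \<and> (\<forall>p\<in>polys_lt n. ip q p = 0)"
proof -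
  have orth: "(\<forall>m<n. \<forall>p\<in>polys_le m. ip q p = 0) \<longleftrightarrow> (\<forall>p\<in>polys_lt n. ip q p = 0)"
  proof
    assume a: "\<forall>m<n. \<forall>p\<in>polys_le m. ip q p = 0"
    show "\<forall>p\<in>polys_lt n. ip q p = 0"
    proof
      fix p :: "real ^ 'n \<Rightarrow> real" assume p: "p \<in> polys_lt n"
      show "ip q p = 0"
      proof (cases n)
        case 0
        then have "p = (\<lambda>x. 0)" using p polys_lt_0 by blast
        then show ?thesis by (simp add: ip_commute[of _ "\<lambda>x. 0"] ip_zero_left)
      next
        case (Suc m)
        then have "\<forall>p\<in>polys_le m. ip q p = 0" using a by blast
        then show ?thesis using p Suc by (simp add: polys_le_eq_polys_lt)
      qed
    qed
  next
    assume a: "\<forall>p\<in>polys_lt n. ip q p = 0"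
    show "\<forall>m<n. \<forall>p\<in>polys_le m. ip q p = 0"
    proof (intro allI impI ballI)
      fix m and p :: "real ^ 'n \<Rightarrow> real" assume "m < n" "p \<in> polys_le m"
      then have "p \<in> polys_lt n" using polys_lt_mono[of "Suc m" n p] by (simp add: polys_le_eq_polys_lt)
      then show "ip q p = 0" using a by blast
    qed
  qed
  show ?thesis
  proof
    assume "q \<in> orth_polys Rp \<kappa> \<mu> \<nu> n"
    then show "q \<in> polys_lt (Suc n) \<and> (\<forall>p\<in>polys_lt n. ip q p = 0)"
      unfolding orth_polys_def polys_of_degree_def using orth polys_lt_zero[of "Suc n"]
      by (auto simp: polys_le_eq_polys_lt)
  next
    assume a: "q \<in> polys_lt (Suc n) \<and> (\<forall>p\<in>polys_lt n. ip q p = 0)"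
    \<comment> \<open>Of degree below n, \<open>q\<close> is orthogonal to itself and hence 0; this
      accounts for the exact degree in \<open>polys_of_degree\<close>.\<close>
    have "q = (\<lambda>x. 0)" if "m < n" "q \<in> polys_le m" for m
    proof -
      have q: "q \<in> polys_lt n" using that polys_lt_mono[of "Suc m" n q] by (simp add: polys_le_eq_polys_lt)
      then have "ip q q = 0" using a by blast
      then show ?thesis using ip_positive(2)[OF q] by blast
    qed
    then show "q \<in> orth_polys Rp \<kappa> \<mu> \<nu> n"
      unfolding orth_polys_def polys_of_degree_def using a orth by (auto simp: polys_le_eq_polys_lt)
  qed
qed

text \<open>The difference d = T q - q has degree below n. Moving \<open>T n\<close> to the other
  factor makes \<open>ip (T n q) d\<close> vanish by \<open>T_lower_zero\<close>, and
  \<open>ip q d\<close> is 0 by orthogonality, so d is orthogonal to itself.\<close>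

lemma T_orth_polys:
  assumes q: "q \<in> orth_polys Rp \<kappa> \<mu> \<nu> n" shows "T n q = q"
proof -
  have q1: "q \<in> polys_lt (Suc n)" and q2: "\<And>p. p \<in> polys_lt n \<Longrightarrow> ip q p = 0"
    using q by (auto simp: orth_polys_iff)
  define d where "d = (\<lambda>x. T n q x - q x)"
  have d: "d \<in> polys_lt n" using T_leading[OF q1, of n] by (simp add: d_def)
  have "ip d d = ip (T n q) d - ip q d"
    unfolding d_def
    using ip_diff_left[OF polys_lt_continuous[OF T_polys_lt[OF q1]] polys_lt_continuous[OF q1] polys_lt_continuous[OF d]]
    by (simp add: d_def)
  also have "ip (T n q) d = ip q (T n d)" by (rule T_symmetric[OF q1 d])
  also have "T n d = (\<lambda>x. 0)" by (rule T_lower_zero[OF d order_refl])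
  finally have "ip d d = 0" using q2[OF d] by (simp add: ip_commute[of _ "\<lambda>x. 0"] ip_zero_left)
  then have "d = (\<lambda>x. 0)" by (rule ip_positive(2)[OF d])
  then show ?thesis by (metis d_def eq_iff_diff_eq_0 ext)
qed

lemma ker_orth_polys: "ker n x \<in> orth_polys Rp \<kappa> \<mu> \<nu> n"
  unfolding orth_polys_iff
proof (intro conjI ballI ker_polys_lt)
  fix p :: "real ^ 'n \<Rightarrow> real" assume "p \<in> polys_lt n"
  then have "T n p x = 0" using T_lower_zero[of p n n] by simp
  then show "ip (ker n x) p = 0" by (simp add: T_def)
qed

text \<open>For fixed x the kernel lies in the space itself. Pairing its expansion with a basis
  element q gives \<open>T n q x\<close>, which is \<open>q x\<close>, as the coefficient of
  q.\<close>

theorem ker_orthonormal_basis: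
  assumes B: "orthonormal_basis ip (orth_polys Rp \<kappa> \<mu> \<nu> n) B"
  shows "(\<Sum>q\<in>B. q x * q y) = ker n x y"
proof -
  have fin: "finite B" and BU: "B \<subseteq> orth_polys Rp \<kappa> \<mu> \<nu> n"
    and on: "\<And>p q. p \<in> B \<Longrightarrow> q \<in> B \<Longrightarrow> ip p q = (if p = q then 1 else 0)"
    and sp: "\<And>p. p \<in> orth_polys Rp \<kappa> \<mu> \<nu> n \<Longrightarrow> \<exists>c. p = (\<lambda>x. \<Sum>q\<in>B. c q * q x)"
    using B unfolding orthonormal_basis_def by blast+
  obtain c where c: "ker n x = (\<lambda>y. \<Sum>q\<in>B. c q * q y)" using sp[OF ker_orth_polys] by blast
  have cont: "continuous_on UNIV q" if "q \<in> B" for q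
    using that BU orth_polys_iff polys_lt_continuous by blast
  have "c q = q x" if q: "q \<in> B" for q
  proof -
    have "q x = T n q x" using T_orth_polys BU q by (metis subsetD)
    also have "\<dots> = (\<Sum>p\<in>B. c p * ip p q)"
      unfolding T_def c using cont q
      by (subst ip_sum_left) (auto intro!: continuous_on_mult simp: ip_cmul_left)
    also have "\<dots> = (\<Sum>p\<in>B. if p = q then c p else 0)" using on q by (intro sum.cong) auto
    also have "\<dots> = c q" using fin q by simp
    finally show ?thesis by simp
  qed
  then show ?thesis unfolding c by (intro sum.cong) auto
qed

end

section \<open>Moments of the integrals in the formula\<close>

text \<open>For \<open>a = 0\<close> these are the moments of the limiting measure.\<close>

definition gmom :: "real \<Rightarrow> nat \<Rightarrow> real" where
  "gmom a q = (if even q then sym_moment a (q div 2) else 0)"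

lemma gmom_0: "gmom 0 q = (1 + (-1) ^ q) / 2"
proof -
  have "pochhammer (1 / 2 :: real) c > 0" for c by (rule pochhammer_pos) simp
  then show ?thesis by (auto simp: gmom_def sym_moment_def less_le)
qed

lemma gmom_even: "gmom a (2 * c) = sym_moment a c" by (simp add: gmom_def)

lemma cball_real: "cball (0::real) 1 = {-1..1}"
  by (auto simp: dist_real_def)

text \<open>The one-dimensional case of \<open>radial_Beta\<close> with F = 1 and K = 1: the unit
  ball is [-1,1], of length 2.\<close>

lemma even_power_moment:
  assumes a: "a > 0"
  shows "has_bochner_integral lborel (\<lambda>t. indicator {-1..1} t * (t ^ (2 * c) * (1 - t\<^sup>2) powr (a - 1)))
      (Beta (1 / 2) a * sym_moment a c)"
proof -
  have "(LINT x:cball (0::real) 1|lborel. (1::real)) = 2"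
    by (simp add: cball_real set_lebesgue_integral_def)
  moreover have "set_integrable lborel (cball 0 1) (\<lambda>x::real. 1::real)"
    by (rule set_integrable_ball_bounded[where B=1]) auto
  ultimately have "has_bochner_integral lborel
      (\<lambda>t::real. indicator (cball 0 1) t * (1 * (norm t powr (2 * real c) * (1 - (norm t)\<^sup>2) powr (a - 1))))
      (1 / 2 * 2 * Beta (1 / 2 + real c) (a - 1 + 1))"
    using radial_Beta[of "\<lambda>x::real. 1" 1 "real c" "a - 1"] a by simp
  moreover have "Beta (1 / 2 + real c) a = Beta (1 / 2) a * sym_moment a c"
    using Beta_shift[of "1 / 2" a c 0] a by (simp add: sym_moment_def add.commute)
  ultimately have "has_bochner_integral lborel
      (\<lambda>t. indicator {-1..1} t * (\<bar>t\<bar> powr (2 * real c) * (1 - t\<^sup>2) powr (a - 1)))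
      (Beta (1 / 2) a * sym_moment a c)"
    by (simp add: cball_real)
  then show ?thesis
  proof (rule has_bochner_integral_cong_AE[THEN iffD1, rotated -1])
    \<comment> \<open>For c = 0 the integrands differ at t = 0, since 0 powr 0 = 0 while 0 ^ 0 =
      1.\<close>
    show "AE t in lborel. indicator {-1..1} t * (\<bar>t\<bar> powr (2 * real c) * (1 - t\<^sup>2) powr (a - 1)) =
      indicator {-1..1} t * (t ^ (2 * c) * (1 - t\<^sup>2) powr (a - 1))"
      using AE_lborel_singleton[of "0::real"]
    proof eventually_elim
      fix t :: real assume "t \<noteq> 0"
      then have "\<bar>t\<bar> powr (2 * real c) = t ^ (2 * c)"
        using powr_realpow[of "\<bar>t\<bar>" "2 * c"] by (simp add: power_even_abs)
      then show "indicator {-1..1} t * (\<bar>t\<bar> powr (2 * real c) * (1 - t\<^sup>2) powr (a - 1)) =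
        indicator {-1..1} t * (t ^ (2 * c) * (1 - t\<^sup>2) powr (a - 1))" by simp
    qed
  qed measurable
qed

text \<open>Odd moments vanish under the change of sign of t; integrability follows from |t| \<le> 1
  and the zeroth moment.\<close>

lemma power_moment:
  assumes a: "a > 0"
  shows "set_integrable lborel {-1..1} (\<lambda>t. t ^ q * (1 - t\<^sup>2) powr (a - 1))"
    and "(LINT t:{-1..1}|lborel. t ^ q * (1 - t\<^sup>2) powr (a - 1)) = Beta (1 / 2) a * gmom a q"
proof -
  define f where "f = (\<lambda>t::real. indicator {-1..1} t * (t ^ q * (1 - t\<^sup>2) powr (a - 1)))"
  have i0: "integrable lborel (\<lambda>t. indicator {-1..1} t * (t ^ (2 * 0) * (1 - t\<^sup>2) powr (a - 1)))"
    using even_power_moment[OF a] by (blast intro: has_bochner_integral_iff[THEN iffD1, THEN conjunct1])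
  have fi: "integrable lborel f"
    unfolding f_def
  proof (rule Bochner_Integration.integrable_bound[OF i0])
    show "AE t in lborel. norm (indicator {-1..1} t * (t ^ q * (1 - t\<^sup>2) powr (a - 1)))
      \<le> norm (indicator {-1..1} t * (t ^ (2 * 0) * (1 - t\<^sup>2) powr (a - 1)))"
      by (intro always_eventually) (auto simp: indicator_def abs_mult power_abs intro!: mult_left_le_one_le power_le_one)
  qed measurable
  then show "set_integrable lborel {-1..1} (\<lambda>t. t ^ q * (1 - t\<^sup>2) powr (a - 1))"
    by (simp add: set_integrable_def f_def)
  have "(LINT t|lborel. f t) = Beta (1 / 2) a * gmom a q"
  proof (cases "even q")
    case True
    then obtain c where "q = 2 * c" by auto
    then show ?thesis using even_power_moment[OF a, of c] by (simp add: f_def gmom_even has_bochner_integral_iff)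
  next
    case False
    have [measurable]: "f \<in> borel_measurable borel" unfolding f_def by measurable
    have "(LINT t|lborel. f (- t)) = (LINT t|lborel. f t)"
      by (rule integral_isometry) (auto intro!: linearI)
    moreover have "f (- t) = - f t" for t using False by (auto simp: f_def indicator_def)
    ultimately show ?thesis using False by (simp add: gmom_def)
  qed
  then show "(LINT t:{-1..1}|lborel. t ^ q * (1 - t\<^sup>2) powr (a - 1)) = Beta (1 / 2) a * gmom a q"
    by (simp add: set_lebesgue_integral_def f_def)
qed

lemma beta_power_moment:
  assumes a: "a > 0" and b: "b > 0"
  shows "set_integrable lborel {0..1} (\<lambda>u. u ^ p * (1 - u) ^ k * (u powr (a - 1) * (1 - u) powr (b - 1)))"
    and "(LINT u:{0..1}|lborel. u ^ p * (1 - u) ^ k * (u powr (a - 1) * (1 - u) powr (b - 1)))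
       = Beta a b * beta_moment a b p k"
proof -
  have e: "indicator {0..1} u * (u ^ p * (1 - u) ^ k * (u powr (a - 1) * (1 - u) powr (b - 1)))
      = indicator {0..1} u * (u powr (a + real p - 1) * (1 - u) powr (b + real k - 1))" for u :: real
  proof (cases "0 < u \<and> u < 1")
    case True
    then show ?thesis by (simp add: powr_realpow[symmetric] powr_add[symmetric] algebra_simps)
  qed (auto simp: indicator_def)
  have "has_bochner_integral lborel (\<lambda>u. indicator {0..1} u * (u powr (a + real p - 1) * (1 - u) powr (b + real k - 1)))
      (Beta (a + real p) (b + real k))"
    using a b Beta_pos[of "a + real p" "b + real k"]
    by (intro has_bochner_integral_nn_integral nn_integral_Beta) (auto intro!: always_eventually)
  then have "has_bochner_integral lborel (\<lambda>u. indicator {0..1} u * (u ^ p * (1 - u) ^ k * (u powr (a - 1) * (1 - u) powr (b - 1))))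
      (Beta a b * beta_moment a b p k)"
    unfolding e beta_moment_Beta[OF a b] .
  then show "set_integrable lborel {0..1} (\<lambda>u. u ^ p * (1 - u) ^ k * (u powr (a - 1) * (1 - u) powr (b - 1)))"
    "(LINT u:{0..1}|lborel. u ^ p * (1 - u) ^ k * (u powr (a - 1) * (1 - u) powr (b - 1)))
       = Beta a b * beta_moment a b p k"
    by (simp_all add: has_bochner_integral_iff set_integrable_def set_lebesgue_integral_def)
qed

lemma set_integral_sum_scaled:
  fixes f :: "'i \<Rightarrow> 'a \<Rightarrow> real"
  assumes "\<And>i. i \<in> I \<Longrightarrow> set_integrable M A (f i)"
  shows "(LINT x:A|M. (\<Sum>i\<in>I. c i * f i x)) = (\<Sum>i\<in>I. c i * (LINT x:A|M. f i x))"
proof -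
  have "(LINT x:A|M. (\<Sum>i\<in>I. c i * f i x)) = (LINT x|M. (\<Sum>i\<in>I. c i * (indicator A x *\<^sub>R f i x)))"
    by (simp add: set_lebesgue_integral_def sum_distrib_left mult.left_commute)
  also have "\<dots> = (\<Sum>i\<in>I. (LINT x|M. c i * (indicator A x *\<^sub>R f i x)))"
    using assms by (intro Bochner_Integration.integral_sum integrable_mult_right) (simp add: set_integrable_def)
  finally show ?thesis by (simp add: set_lebesgue_integral_def)
qed

section \<open>The limit of the normalized measures\<close>

lemma c_const_Beta:
  assumes "a > 0" shows "c_const a * Beta (1 / 2) a = 1"
proof -
  have "Gamma a > 0" "Gamma (a + 1 / 2) > 0" using assms by (auto intro: Gamma_real_pos)
  then show ?thesis by (simp add: c_const_def Beta_def Gamma_one_half_real add.commute[of "1 / 2" a])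
qed

lemma c_const_nonneg: "a > 0 \<Longrightarrow> c_const a \<ge> 0"
  using Gamma_real_pos[of a] Gamma_real_pos[of "a + 1 / 2"] by (simp add: c_const_def)

lemma gmom_tendsto: "((\<lambda>a. gmom a q) \<longlongrightarrow> gmom 0 q) (at_right 0)"
proof (cases "even q")
  case True
  have "pochhammer (1 / 2 :: real) c > 0" for c by (rule pochhammer_pos) simp
  then have nz: "pochhammer (0 + 1 / 2 :: real) (q div 2) \<noteq> 0" by (simp add: less_le)
  have "((\<lambda>a. pochhammer (a + 1 / 2) c) \<longlongrightarrow> pochhammer (0 + 1 / 2 :: real) c) (at_right 0)" for c
    unfolding pochhammer_prod by (intro tendsto_intros)
  then have "((\<lambda>a. sym_moment a (q div 2)) \<longlongrightarrow> sym_moment 0 (q div 2)) (at_right 0)"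
    unfolding sym_moment_def using nz by (intro tendsto_divide tendsto_const) auto
  then show ?thesis using True by (simp add: gmom_def)
qed (simp add: gmom_def)

lemma set_integrable_mult_continuous:
  fixes f :: "real \<Rightarrow> real"
  assumes f: "continuous_on {-1..1} f" and a: "a > 0"
  shows "set_integrable lborel {-1..1} (\<lambda>t. f t * (1 - t\<^sup>2) powr (a - 1))"
proof -
  have "bounded (f ` {-1..1})" by (intro compact_imp_bounded compact_continuous_image f) auto
  then obtain B where B: "\<forall>t\<in>{-1..1}. \<bar>f t\<bar> \<le> B" by (auto simp: bounded_iff)
  have m: "(\<lambda>t. indicator {-1..1} t * f t) \<in> borel_measurable borel"
    using borel_measurable_continuous_on_indicator[OF _ f] by simp
  have i: "integrable lborel (\<lambda>t. B * (indicator {-1..1} t *\<^sub>R (t ^ 0 * (1 - t\<^sup>2) powr (a - 1))))"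
    using power_moment(1)[OF a, of 0] by (intro integrable_mult_right) (simp add: set_integrable_def)
  show ?thesis unfolding set_integrable_def
  proof (rule Bochner_Integration.integrable_bound[OF i])
    have "(\<lambda>t. (indicator {-1..1} t * f t) * (1 - t\<^sup>2) powr (a - 1)) \<in> borel_measurable borel"
      using m by measurable
    then show "(\<lambda>t. indicator {-1..1} t *\<^sub>R (f t * (1 - t\<^sup>2) powr (a - 1))) \<in> borel_measurable lborel"
      by (simp add: mult.assoc)
    show "AE t in lborel. norm (indicator {-1..1} t *\<^sub>R (f t * (1 - t\<^sup>2) powr (a - 1)))
      \<le> norm (B * (indicator {-1..1} t *\<^sub>R (t ^ 0 * (1 - t\<^sup>2) powr (a - 1))))"
      using B by (intro always_eventually)
        (auto simp: indicator_def abs_mult intro!: mult_right_mono intro: order_trans[OF _ abs_ge_self])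
  qed
qed

text \<open>For polynomials the mean is a combination of the moments \<open>gmom a i\<close>, which
  are continuous at a = 0. Continuous \<open>f\<close> are approximated uniformly by polynomials; as
  the normalized measures have mass 1, the error is controlled for all a at once.\<close>

theorem limit_measure:
  fixes f :: "real \<Rightarrow> real"
  assumes f: "continuous_on {-1..1} f"
  shows "((\<lambda>a. c_const a * (LINT t:{-1..1}|lborel. f t * (1 - t\<^sup>2) powr (a - 1)))
           \<longlongrightarrow> (f 1 + f (-1)) / 2) (at_right 0)"
proof -
  define E where "E a g = c_const a * (LINT t:{-1..1}|lborel. g t * (1 - t\<^sup>2) powr (a - 1))" for a and g :: "real \<Rightarrow> real"
  have poly: "((\<lambda>a. E a g) \<longlongrightarrow> (g 1 + g (-1)) / 2) (at_right 0)" if g: "real_polynomial_function g" for g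
  proof -
    obtain b n where b: "g = (\<lambda>t. \<Sum>i\<le>n. b i * t ^ i)" using real_polynomial_function_imp_sum[OF g] by blast
    have "E a g = (\<Sum>i\<le>n. b i * gmom a i)" if a: "a > 0" for a
    proof -
      have "(LINT t:{-1..1}|lborel. g t * (1 - t\<^sup>2) powr (a - 1))
        = (LINT t:{-1..1}|lborel. (\<Sum>i\<le>n. b i * (t ^ i * (1 - t\<^sup>2) powr (a - 1))))"
        by (simp add: b sum_distrib_right mult.assoc)
      also have "\<dots> = (\<Sum>i\<le>n. b i * (Beta (1 / 2) a * gmom a i))"
        by (simp only: set_integral_sum_scaled power_moment[OF a])
      also have "\<dots> = Beta (1 / 2) a * (\<Sum>i\<le>n. b i * gmom a i)"
        by (simp add: sum_distrib_left mult.left_commute)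
      finally have "E a g = (c_const a * Beta (1 / 2) a) * (\<Sum>i\<le>n. b i * gmom a i)"
        by (simp only: E_def mult.assoc)
      then show ?thesis using c_const_Beta[OF a] by simp
    qed
    then have "\<forall>\<^sub>F a in at_right 0. (\<Sum>i\<le>n. b i * gmom a i) = E a g"
      by (auto simp: eventually_at_right_field intro: exI[of _ 1])
    moreover have "((\<lambda>a. \<Sum>i\<le>n. b i * gmom a i) \<longlongrightarrow> (\<Sum>i\<le>n. b i * gmom 0 i)) (at_right 0)"
      by (intro tendsto_intros gmom_tendsto)
    moreover have "(\<Sum>i\<le>n. b i * gmom 0 i) = (g 1 + g (-1)) / 2"
      unfolding b gmom_0 by (simp add: sum.distrib[symmetric] sum_divide_distrib algebra_simps)
    ultimately show ?thesis by (simp add: Lim_transform_eventually)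
  qed
  have "((\<lambda>a. E a f) \<longlongrightarrow> (f 1 + f (-1)) / 2) (at_right 0)"
  proof (rule tendstoI)
    fix e :: real assume e: "e > 0"
    obtain g where g: "real_polynomial_function g" and fg: "\<And>t. t \<in> {-1..1} \<Longrightarrow> \<bar>f t - g t\<bar> < e / 3"
      using Stone_Weierstrass_real_polynomial_function[OF _ f, of "e / 3"] e by auto
    have gc: "continuous_on {-1..1} g" using g continuous_on_polymonial_function real_polynomial_function_eq by blast
    have near: "\<bar>E a f - E a g\<bar> \<le> e / 3" if a: "a > 0" for a
    proof -
      note fi = set_integrable_mult_continuous[OF f a] and gi = set_integrable_mult_continuous[OF gc a]
      have fg_diff: "(LINT t:{-1..1}|lborel. f t * (1 - t\<^sup>2) powr (a - 1)) - (LINT t:{-1..1}|lborel. g t * (1 - t\<^sup>2) powr (a - 1))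
        = (LINT t:{-1..1}|lborel. f t * (1 - t\<^sup>2) powr (a - 1) - g t * (1 - t\<^sup>2) powr (a - 1))"
        using set_integral_diff(2)[OF fi gi] by simp
      have "\<bar>LINT t:{-1..1}|lborel. f t * (1 - t\<^sup>2) powr (a - 1) - g t * (1 - t\<^sup>2) powr (a - 1)\<bar>
          \<le> (LINT t|lborel. e / 3 * (indicator {-1..1} t *\<^sub>R (t ^ 0 * (1 - t\<^sup>2) powr (a - 1))))"
        unfolding set_lebesgue_integral_def
      proof (rule order_trans[OF integral_abs_bound integral_mono])
        show "integrable lborel (\<lambda>t. \<bar>indicator {-1..1} t *\<^sub>R (f t * (1 - t\<^sup>2) powr (a - 1) - g t * (1 - t\<^sup>2) powr (a - 1))\<bar>)"
          using set_integral_diff(1)[OF fi gi] by (intro integrable_abs) (simp add: set_integrable_def)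
        show "integrable lborel (\<lambda>t. e / 3 * (indicator {-1..1} t *\<^sub>R (t ^ 0 * (1 - t\<^sup>2) powr (a - 1))))"
          using power_moment(1)[OF a, of 0] by (intro integrable_mult_right) (simp add: set_integrable_def)
        fix t :: real
        show "\<bar>indicator {-1..1} t *\<^sub>R (f t * (1 - t\<^sup>2) powr (a - 1) - g t * (1 - t\<^sup>2) powr (a - 1))\<bar>
           \<le> e / 3 * (indicator {-1..1} t *\<^sub>R (t ^ 0 * (1 - t\<^sup>2) powr (a - 1)))"
        proof (cases "t \<in> {-1..1}")
          case True
          have "\<bar>f t - g t\<bar> * (1 - t\<^sup>2) powr (a - 1) \<le> e / 3 * (1 - t\<^sup>2) powr (a - 1)"
            using fg[OF True] by (intro mult_right_mono) auto
          then show ?thesis using True by (simp add: left_diff_distrib[symmetric] abs_mult)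
        qed simp
      qed
      also have "\<dots> = e / 3 * (Beta (1 / 2) a * gmom a 0)"
        by (simp only: integral_mult_right_zero power_moment(2)[OF a, of 0, unfolded set_lebesgue_integral_def])
      finally have "\<bar>(LINT t:{-1..1}|lborel. f t * (1 - t\<^sup>2) powr (a - 1)) - (LINT t:{-1..1}|lborel. g t * (1 - t\<^sup>2) powr (a - 1))\<bar>
          \<le> e / 3 * Beta (1 / 2) a" unfolding fg_diff by (simp add: gmom_def sym_moment_def)
      then have "c_const a * \<bar>(LINT t:{-1..1}|lborel. f t * (1 - t\<^sup>2) powr (a - 1)) - (LINT t:{-1..1}|lborel. g t * (1 - t\<^sup>2) powr (a - 1))\<bar>
          \<le> c_const a * (e / 3 * Beta (1 / 2) a)" using c_const_nonneg[OF a] by (rule mult_left_mono)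
      also have "\<dots> = e / 3 * (c_const a * Beta (1 / 2) a)" by simp
      also have "\<dots> = e / 3" unfolding c_const_Beta[OF a] by simp
      finally show ?thesis
        using c_const_nonneg[OF a] by (simp add: E_def right_diff_distrib[symmetric] abs_mult)
    qed
    have "\<forall>\<^sub>F a in at_right 0. \<bar>E a g - (g 1 + g (-1)) / 2\<bar> < e / 3"
      using tendstoD[OF poly[OF g], of "e / 3"] e by (simp add: dist_real_def)
    moreover have "\<forall>\<^sub>F a in at_right (0::real). a > 0" by (simp add: eventually_at_right_less)
    ultimately show "\<forall>\<^sub>F a in at_right 0. dist (E a f) ((f 1 + f (-1)) / 2) < e"
    proof eventually_elim
      fix a assume 1: "\<bar>E a g - (g 1 + g (-1)) / 2\<bar> < e / 3" and a: "(a::real) > 0"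
      show "dist (E a f) ((f 1 + f (-1)) / 2) < e"
      proof -
        have "\<bar>f 1 - g 1\<bar> < e / 3" "\<bar>f (-1) - g (-1)\<bar> < e / 3" using fg[of 1] fg[of "-1"] by auto
        then show ?thesis using near[OF a] 1 unfolding dist_real_def abs_less_iff abs_le_iff
          by - (elim conjE, intro conjI; simp add: field_simps)
      qed
    qed
  qed
  then show ?thesis by (simp add: E_def)
qed

section \<open>Reduction of the integrals to moments of monomials\<close>

lemma sum_even_terms:
  fixes f :: "nat \<Rightarrow> real"
  assumes "\<And>q. odd q \<Longrightarrow> f q = 0"
  shows "(\<Sum>q\<le>N. f q) = (\<Sum>c\<le>N div 2. f (2 * c))"
proof -
  have "(\<Sum>c\<le>N div 2. f (2 * c)) = sum f ((\<lambda>c. 2 * c) ` {..N div 2})"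
    by (subst sum.reindex) (auto simp: inj_on_def)
  also have "\<dots> = (\<Sum>q\<le>N. f q)"
  proof (rule sum.mono_neutral_left)
    show "\<forall>q\<in>{..N} - (\<lambda>c. 2 * c) ` {..N div 2}. f q = 0"
    proof
      fix q assume q: "q \<in> {..N} - (\<lambda>c. 2 * c) ` {..N div 2}"
      have "odd q"
      proof
        assume "even q"
        then obtain c where "q = 2 * c" by auto
        then show False using q by auto
      qed
      then show "f q = 0" by (rule assms)
    qed
  qed auto
  finally show ?thesis ..
qed

context dunkl_setting
begin

text \<open>In \<zeta> the variables u and v occur as u v and 1 - u, hence one exponent
  \<open>p\<close> serves both u and v.\<close>

definition tri_mono :: "nat \<Rightarrow> nat \<Rightarrow> nat \<Rightarrow> real \<Rightarrow> real \<Rightarrow> real \<Rightarrow> real" where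
  "tri_mono p k q u v t = u ^ p * (1 - u) ^ k * v ^ p * t ^ q"

lemma u_moment:
  assumes "\<nu> > 0"
  shows "set_integrable lborel {0..1} (\<lambda>u. u ^ p * (1 - u) ^ k * (u powr (\<nu> - 1) * (1 - u) powr (gam + (real CARD('n) - 2) / 2)))"
    and "(LINT u:{0..1}|lborel. u ^ p * (1 - u) ^ k * (u powr (\<nu> - 1) * (1 - u) powr (gam + (real CARD('n) - 2) / 2)))
       = Beta \<nu> (lk + 1) * beta_moment \<nu> (lk + 1) p k"
proof -
  have "gam + (real CARD('n) - 2) / 2 = lk + 1 - 1" by (simp add: lk_def)
  moreover have "lk + 1 > 0" using lk_nonneg by simp
  ultimately show "set_integrable lborel {0..1} (\<lambda>u. u ^ p * (1 - u) ^ k * (u powr (\<nu> - 1) * (1 - u) powr (gam + (real CARD('n) - 2) / 2)))"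
    "(LINT u:{0..1}|lborel. u ^ p * (1 - u) ^ k * (u powr (\<nu> - 1) * (1 - u) powr (gam + (real CARD('n) - 2) / 2)))
       = Beta \<nu> (lk + 1) * beta_moment \<nu> (lk + 1) p k"
    using beta_power_moment[OF assms, of "lk + 1" p k] by (simp_all only:)
qed

lemma v_moment:
  assumes "\<nu> > 0"
  shows "set_integrable lborel {-1..1} (\<lambda>v. v ^ p * (1 - v\<^sup>2) powr (\<nu> - 1 / 2))"
    and "(LINT v:{-1..1}|lborel. v ^ p * (1 - v\<^sup>2) powr (\<nu> - 1 / 2)) = Beta (1 / 2) (\<nu> + 1 / 2) * gmom (\<nu> + 1 / 2) p"
proof -
  have "\<nu> - 1 / 2 = \<nu> + 1 / 2 - 1" "\<nu> + 1 / 2 > 0" using assms by simp_all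
  then show "set_integrable lborel {-1..1} (\<lambda>v. v ^ p * (1 - v\<^sup>2) powr (\<nu> - 1 / 2))"
    "(LINT v:{-1..1}|lborel. v ^ p * (1 - v\<^sup>2) powr (\<nu> - 1 / 2)) = Beta (1 / 2) (\<nu> + 1 / 2) * gmom (\<nu> + 1 / 2) p"
    using power_moment[of "\<nu> + 1 / 2" p] by (simp_all only:)
qed

text \<open>Common to \<open>triple_integral\<close> and \<open>limit_integral\<close>, which differ
  only in the treatment of t.\<close>

lemma uv_integral:
  assumes nu: "\<nu> > 0"
  shows "(LINT v:{-1..1}|lborel. (LINT u:{0..1}|lborel.
       (\<Sum>i\<in>I. c i * (u ^ p i * (1 - u) ^ k i * v ^ p i)) * (u powr (\<nu> - 1) * (1 - u) powr (gam + (real CARD('n) - 2) / 2)))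
       * (1 - v\<^sup>2) powr (\<nu> - 1 / 2))
    = Beta \<nu> (lk + 1) * Beta (1 / 2) (\<nu> + 1 / 2)
      * (\<Sum>i\<in>I. c i * (beta_moment \<nu> (lk + 1) (p i) (k i) * gmom (\<nu> + 1 / 2) (p i)))"
proof -
  have 1: "(LINT u:{0..1}|lborel.
       (\<Sum>i\<in>I. c i * (u ^ p i * (1 - u) ^ k i * v ^ p i)) * (u powr (\<nu> - 1) * (1 - u) powr (gam + (real CARD('n) - 2) / 2)))
     = (\<Sum>i\<in>I. (c i * v ^ p i) * (Beta \<nu> (lk + 1) * beta_moment \<nu> (lk + 1) (p i) (k i)))" for v
  proof -
    have "(\<lambda>u. (\<Sum>i\<in>I. c i * (u ^ p i * (1 - u) ^ k i * v ^ p i)) * (u powr (\<nu> - 1) * (1 - u) powr (gam + (real CARD('n) - 2) / 2)))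
      = (\<lambda>u. \<Sum>i\<in>I. (c i * v ^ p i) * (u ^ p i * (1 - u) ^ k i * (u powr (\<nu> - 1) * (1 - u) powr (gam + (real CARD('n) - 2) / 2))))"
      unfolding sum_distrib_right by (intro ext sum.cong refl) (simp only: mult_ac)
    then show ?thesis
      using set_integral_sum_scaled[of I lborel "{0..1}"
          "\<lambda>i u. u ^ p i * (1 - u) ^ k i * (u powr (\<nu> - 1) * (1 - u) powr (gam + (real CARD('n) - 2) / 2))"
          "\<lambda>i. c i * v ^ p i"] u_moment[OF nu] by (simp only:)
  qed
  have 2: "(\<lambda>v. (\<Sum>i\<in>I. (c i * v ^ p i) * (Beta \<nu> (lk + 1) * beta_moment \<nu> (lk + 1) (p i) (k i))) * (1 - v\<^sup>2) powr (\<nu> - 1 / 2))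
     = (\<lambda>v. \<Sum>i\<in>I. (c i * (Beta \<nu> (lk + 1) * beta_moment \<nu> (lk + 1) (p i) (k i))) * (v ^ p i * (1 - v\<^sup>2) powr (\<nu> - 1 / 2)))"
    unfolding sum_distrib_right by (intro ext sum.cong refl) (simp only: mult_ac)
  show ?thesis
    unfolding 1 2
    using set_integral_sum_scaled[of I lborel "{-1..1}" "\<lambda>i v. v ^ p i * (1 - v\<^sup>2) powr (\<nu> - 1 / 2)"
        "\<lambda>i. c i * (Beta \<nu> (lk + 1) * beta_moment \<nu> (lk + 1) (p i) (k i))"] v_moment[OF nu]
    by (simp add: sum_distrib_left mult_ac)
qed

lemma triple_integral_monomials:
  assumes mu: "\<mu> > 0" and nu: "\<nu> > 0"
  shows "triple_integral Rp \<kappa> \<mu> \<nu> (\<lambda>u v t. \<Sum>i\<in>I. c i * tri_mono (p i) (k i) (q i) u v t)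
    = Beta (1 / 2) \<mu> * (Beta \<nu> (lk + 1) * Beta (1 / 2) (\<nu> + 1 / 2))
      * (\<Sum>i\<in>I. c i * (beta_moment \<nu> (lk + 1) (p i) (k i) * gmom (\<nu> + 1 / 2) (p i) * gmom \<mu> (q i)))"
proof -
  have "(LINT t:{-1..1}|lborel. (\<Sum>i\<in>I. c i * tri_mono (p i) (k i) (q i) u v t) * (1 - t\<^sup>2) powr (\<mu> - 1))
     = (\<Sum>i\<in>I. (c i * (Beta (1 / 2) \<mu> * gmom \<mu> (q i))) * (u ^ p i * (1 - u) ^ k i * v ^ p i))" for u v
  proof -
    have "(\<lambda>t. (\<Sum>i\<in>I. c i * tri_mono (p i) (k i) (q i) u v t) * (1 - t\<^sup>2) powr (\<mu> - 1))
      = (\<lambda>t. \<Sum>i\<in>I. (c i * (u ^ p i * (1 - u) ^ k i * v ^ p i)) * (t ^ q i * (1 - t\<^sup>2) powr (\<mu> - 1)))"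
      unfolding sum_distrib_right tri_mono_def by (intro ext sum.cong refl) (simp only: mult_ac)
    then show ?thesis
      using set_integral_sum_scaled[of I lborel "{-1..1}" "\<lambda>i t. t ^ q i * (1 - t\<^sup>2) powr (\<mu> - 1)"
          "\<lambda>i. c i * (u ^ p i * (1 - u) ^ k i * v ^ p i)"] power_moment[OF mu]
      by (simp add: mult_ac)
  qed
  then show ?thesis
    unfolding triple_integral_def by (simp only: uv_integral[OF nu]) (simp add: sum_distrib_left mult_ac)
qed

lemma limit_integral_monomials:
  assumes nu: "\<nu> > 0"
  shows "limit_integral Rp \<kappa> \<nu> (\<lambda>u v t. \<Sum>i\<in>I. c i * tri_mono (p i) (k i) (q i) u v t)
    = Beta \<nu> (lk + 1) * Beta (1 / 2) (\<nu> + 1 / 2)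
      * (\<Sum>i\<in>I. c i * (beta_moment \<nu> (lk + 1) (p i) (k i) * gmom (\<nu> + 1 / 2) (p i) * gmom 0 (q i)))"
proof -
  have "((\<Sum>i\<in>I. c i * tri_mono (p i) (k i) (q i) u v 1) + (\<Sum>i\<in>I. c i * tri_mono (p i) (k i) (q i) u v (-1))) / 2
     = (\<Sum>i\<in>I. (c i * gmom 0 (q i)) * (u ^ p i * (1 - u) ^ k i * v ^ p i))" for u v
    unfolding sum.distrib[symmetric] sum_divide_distrib tri_mono_def gmom_0
    by (intro sum.cong refl) (simp add: field_simps)
  then show ?thesis
    unfolding limit_integral_def by (simp only: uv_integral[OF nu]) (simp add: mult_ac)
qed

lemma tri_mono_0: "tri_mono 0 0 0 u v t = 1"
  by (simp add: tri_mono_def)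

lemma moments_0: "beta_moment a b 0 0 = 1" "gmom a 0 = 1"
  by (simp_all add: beta_moment_def gmom_def sym_moment_def)

text \<open>The integral of 1 is the product of the three Beta constants that every monomial
  carries, so \<open>a_const\<close> leaves the bare moments.\<close>

lemma triple_integral_normalized:
  assumes mu: "\<mu> > 0" and nu: "\<nu> > 0"
  shows "a_const Rp \<kappa> \<mu> \<nu> * triple_integral Rp \<kappa> \<mu> \<nu> (\<lambda>u v t. \<Sum>i\<in>I. c i * tri_mono (p i) (k i) (q i) u v t)
    = (\<Sum>i\<in>I. c i * (beta_moment \<nu> (lk + 1) (p i) (k i) * gmom (\<nu> + 1 / 2) (p i) * gmom \<mu> (q i)))"
proof -
  have "triple_integral Rp \<kappa> \<mu> \<nu> (\<lambda>u v t. 1) = Beta (1 / 2) \<mu> * (Beta \<nu> (lk + 1) * Beta (1 / 2) (\<nu> + 1 / 2))"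
    using triple_integral_monomials[OF mu nu, where I="{()}" and c="\<lambda>_. 1" and p="\<lambda>_. 0" and k="\<lambda>_. 0" and q="\<lambda>_. 0"]
    by (simp add: tri_mono_0 moments_0)
  moreover have "Beta (1 / 2) \<mu> > 0" "Beta \<nu> (lk + 1) > 0" "Beta (1 / 2) (\<nu> + 1 / 2) > 0"
    using mu nu lk_nonneg by (auto intro!: Beta_pos)
  ultimately show ?thesis by (simp add: a_const_def triple_integral_monomials[OF mu nu])
qed

lemma limit_integral_normalized:
  assumes nu: "\<nu> > 0"
  shows "a_const_limit Rp \<kappa> \<nu> * limit_integral Rp \<kappa> \<nu> (\<lambda>u v t. \<Sum>i\<in>I. c i * tri_mono (p i) (k i) (q i) u v t)
    = (\<Sum>i\<in>I. c i * (beta_moment \<nu> (lk + 1) (p i) (k i) * gmom (\<nu> + 1 / 2) (p i) * gmom 0 (q i)))"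
proof -
  have "limit_integral Rp \<kappa> \<nu> (\<lambda>u v t. 1) = Beta \<nu> (lk + 1) * Beta (1 / 2) (\<nu> + 1 / 2)"
    using limit_integral_monomials[OF nu, where I="{()}" and c="\<lambda>_. 1" and p="\<lambda>_. 0" and k="\<lambda>_. 0" and q="\<lambda>_. 0"]
    by (simp add: tri_mono_0 moments_0)
  moreover have "Beta \<nu> (lk + 1) > 0" "Beta (1 / 2) (\<nu> + 1 / 2) > 0"
    using nu lk_nonneg by (auto intro!: Beta_pos)
  ultimately show ?thesis by (simp add: a_const_limit_def limit_integral_monomials[OF nu])
qed

text \<open>After binomial expansion \<open>V\<close> meets only powers of <z,y>, evaluated at x'.
  The matching power of |x| moves the point from x' to x by homogeneity, so x' disappears; this
  includes x = 0, where x' is arbitrary.\<close>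

lemma V_zeta_power:
  assumes x: "x = norm x *\<^sub>R x'"
  shows "V (\<lambda>z. zeta z (norm x) y u v t ^ N) x' =
    (\<Sum>q\<le>N. \<Sum>p\<le>N - q. (real (N choose q) * real ((N - q) choose p)
       * (sqrt (1 - (norm x)\<^sup>2) * sqrt (1 - (norm y)\<^sup>2)) ^ q * (norm x * norm y) ^ p * vk (N - q - p) x y)
       * tri_mono p (N - q - p) q u v t)"
proof -
  define s where "s = sqrt (1 - (norm x)\<^sup>2) * sqrt (1 - (norm y)\<^sup>2)"
  define a where "a = norm x * norm y"
  have expand: "zeta z (norm x) y u v t ^ N = (\<Sum>q\<le>N. \<Sum>p\<le>N - q. (real (N choose q) * real ((N - q) choose p)
      * (s * t) ^ q * (a * u * v) ^ p * (norm x * (1 - u)) ^ (N - q - p)) * (z \<bullet> y) ^ (N - q - p))" for z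
  proof -
    have "zeta z (norm x) y u v t = s * t + (a * u * v + norm x * (1 - u) * (z \<bullet> y))"
      by (simp add: zeta_def s_def a_def algebra_simps)
    then have "zeta z (norm x) y u v t ^ N = (\<Sum>q\<le>N. real (N choose q) * (s * t) ^ q
        * (\<Sum>p\<le>N - q. real ((N - q) choose p) * (a * u * v) ^ p * (norm x * (1 - u) * (z \<bullet> y)) ^ (N - q - p)))"
      by (simp only: binomial_ring)
    then show ?thesis by (simp add: sum_distrib_left power_mult_distrib mult_ac)
  qed
  have poly: "real_polynomial_function (\<lambda>z. b * (z \<bullet> y) ^ k)" for b k
    using hom_real_polynomial[OF hom_cmul[OF hom_inner_power]] .
  have "V (\<lambda>z. zeta z (norm x) y u v t ^ N) x' = (\<Sum>q\<le>N. \<Sum>p\<le>N - q. (real (N choose q) * real ((N - q) choose p)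
      * (s * t) ^ q * (a * u * v) ^ p * (norm x * (1 - u)) ^ (N - q - p)) * vk (N - q - p) x' y)"
    unfolding expand
    by (subst V_sum_real_polynomial, intro real_polynomial_function_sum poly finite_atMost,
        intro sum.cong refl, subst V_sum_real_polynomial, intro poly,
        intro sum.cong refl, subst V_scaled[OF hom_inner_power], simp only: vk_def mult.commute)
  also have "\<dots> = (\<Sum>q\<le>N. \<Sum>p\<le>N - q. (real (N choose q) * real ((N - q) choose p)
       * s ^ q * a ^ p * vk (N - q - p) x y) * tri_mono p (N - q - p) q u v t)"
  proof (intro sum.cong refl)
    fix q p
    have "vk (N - q - p) x y = norm x ^ (N - q - p) * vk (N - q - p) x' y"
      using hom_scale[OF vk_hom_left[of "N - q - p" y], of "norm x" x'] x by simp
    then show "(real (N choose q) * real ((N - q) choose p)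
        * (s * t) ^ q * (a * u * v) ^ p * (norm x * (1 - u)) ^ (N - q - p)) * vk (N - q - p) x' y
      = (real (N choose q) * real ((N - q) choose p)
       * s ^ q * a ^ p * vk (N - q - p) x y) * tri_mono p (N - q - p) q u v t"
      by (simp add: tri_mono_def power_mult_distrib mult_ac)
  qed
  finally show ?thesis by (simp add: s_def a_def)
qed

end

context dunkl_ball
begin

text \<open>The odd moments in t and v vanish. Hence the square roots and the product |x||y| occur
  to even powers only, which removes the roots and gives the polynomial form of
  \<open>kern\<close>.\<close>

lemma kern_moments:
  assumes "norm x \<le> 1" "norm y \<le> 1"
  shows "(\<Sum>q\<le>N. \<Sum>p\<le>N - q. (real (N choose q) * real ((N - q) choose p)
       * (sqrt (1 - (norm x)\<^sup>2) * sqrt (1 - (norm y)\<^sup>2)) ^ q * (norm x * norm y) ^ p * vk (N - q - p) x y)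
       * (beta_moment \<nu> (lk + 1) p (N - q - p) * gmom (\<nu> + 1 / 2) p * gmom \<mu> q)) = kern N x y"
proof -
  define s where "s = sqrt (1 - (norm x)\<^sup>2) * sqrt (1 - (norm y)\<^sup>2)"
  have s2: "s ^ (2 * c) = (1 - (norm x)\<^sup>2) ^ c * (1 - (norm y)\<^sup>2) ^ c" for c
  proof -
    have "s\<^sup>2 = (1 - (norm x)\<^sup>2) * (1 - (norm y)\<^sup>2)"
      using assms by (simp add: s_def power_mult_distrib power_le_one)
    then show ?thesis by (simp add: power_mult power_mult_distrib)
  qed
  have inner: "(\<Sum>p\<le>M. (real (M choose p) * (norm x * norm y) ^ p * vk (M - p) x y)
      * (beta_moment \<nu> (lk + 1) p (M - p) * gmom (\<nu> + 1 / 2) p)) = gk \<nu> M x y" for M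
  proof -
    have "(\<Sum>p\<le>M. (real (M choose p) * (norm x * norm y) ^ p * vk (M - p) x y)
      * (beta_moment \<nu> (lk + 1) p (M - p) * gmom (\<nu> + 1 / 2) p)) =
      (\<Sum>b\<le>M div 2. (real (M choose (2 * b)) * (norm x * norm y) ^ (2 * b) * vk (M - 2 * b) x y)
      * (beta_moment \<nu> (lk + 1) (2 * b) (M - 2 * b) * gmom (\<nu> + 1 / 2) (2 * b)))"
      by (rule sum_even_terms) (simp add: gmom_def)
    also have "\<dots> = gk \<nu> M x y"
      unfolding gk_def gmom_even power_mult_distrib by (intro sum.cong refl) (simp only: mult_ac)
    finally show ?thesis .
  qed
  have "(\<Sum>q\<le>N. \<Sum>p\<le>N - q. (real (N choose q) * real ((N - q) choose p) * s ^ q * (norm x * norm y) ^ p * vk (N - q - p) x y)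
       * (beta_moment \<nu> (lk + 1) p (N - q - p) * gmom (\<nu> + 1 / 2) p * gmom \<mu> q))
     = (\<Sum>q\<le>N. (real (N choose q) * s ^ q * gmom \<mu> q) * gk \<nu> (N - q) x y)"
    unfolding inner[symmetric] sum_distrib_left by (intro sum.cong refl) (simp only: mult_ac)
  also have "\<dots> = (\<Sum>c\<le>N div 2. (real (N choose (2 * c)) * s ^ (2 * c) * gmom \<mu> (2 * c)) * gk \<nu> (N - 2 * c) x y)"
    by (rule sum_even_terms) (simp add: gmom_def)
  also have "\<dots> = kern N x y"
    unfolding kern_def s2 gmom_even by (intro sum.cong refl) (simp only: mult_ac)
  finally show ?thesis by (simp add: s_def)
qed

text \<open>Indices of the monomials in \<open>u, v, t\<close> of \<open>V[Z\<^sub>n(\<zeta>)]\<close>: the power \<open>n - 2k\<close> of \<open>\<zeta>\<close>,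
  then the exponents \<open>q\<close> of \<open>t\<close> and \<open>p\<close> of \<open>uv\<close>.\<close>

definition mono_index :: "nat \<Rightarrow> (nat \<times> nat \<times> nat) set" where
  "mono_index n = (SIGMA k:{..n div 2}. SIGMA q:{..n - 2 * k}. {..n - 2 * k - q})"

definition mono_coeff :: "nat \<Rightarrow> real ^ 'n \<Rightarrow> real ^ 'n \<Rightarrow> nat \<times> nat \<times> nat \<Rightarrow> real" where
  "mono_coeff n x y = (\<lambda>(k, q, p). zc n lam k * (real ((n - 2 * k) choose q) * real ((n - 2 * k - q) choose p)
       * (sqrt (1 - (norm x)\<^sup>2) * sqrt (1 - (norm y)\<^sup>2)) ^ q * (norm x * norm y) ^ p * vk (n - 2 * k - q - p) x y))"

lemma sum_mono_index:
  "(\<Sum>i\<in>mono_index n. g i) = (\<Sum>k\<le>n div 2. \<Sum>q\<le>n - 2 * k. \<Sum>p\<le>n - 2 * k - q. g (k, q, p))"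
proof -
  have "(\<Sum>i\<in>mono_index n. g i) = (\<Sum>k\<le>n div 2. \<Sum>j\<in>(SIGMA q:{..n - 2 * k}. {..n - 2 * k - q}). g (k, j))"
    unfolding mono_index_def by (subst sum.Sigma) (auto intro!: finite_SigmaI simp: case_prod_unfold)
  also have "\<dots> = (\<Sum>k\<le>n div 2. \<Sum>q\<le>n - 2 * k. \<Sum>p\<le>n - 2 * k - q. g (k, q, p))"
    by (intro sum.cong refl, subst sum.Sigma) (auto simp: case_prod_unfold)
  finally show ?thesis .
qed

lemma V_Z_poly:
  assumes x: "x = norm x *\<^sub>R x'"
  shows "V (\<lambda>z. Z_poly n lam (zeta z (norm x) y u v t)) x' =
    (\<Sum>i\<in>mono_index n. mono_coeff n x y i * tri_mono (snd (snd i)) (n - 2 * fst i - fst (snd i) - snd (snd i)) (fst (snd i)) u v t)"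
proof -
  have pz: "real_polynomial_function (\<lambda>z. zeta z (norm x) y u v t)"
    unfolding zeta_def
    by (intro real_polynomial_function.intros(2-4) real_polynomial_function.intros(1) bounded_linear_inner_left)
  then have poly: "real_polynomial_function (\<lambda>z. zeta z (norm x) y u v t ^ k)" for k
    by (rule real_polynomial_function_power)
  have "V (\<lambda>z. Z_poly n lam (zeta z (norm x) y u v t)) x' =
     (\<Sum>k\<le>n div 2. zc n lam k * V (\<lambda>z. zeta z (norm x) y u v t ^ (n - 2 * k)) x')"
    unfolding Z_poly_eq
    by (subst V_sum_real_polynomial) (auto intro!: poly real_polynomial_function.intros(2-4) simp: V_cmul_poly[OF poly])
  also have "\<dots> = (\<Sum>i\<in>mono_index n. mono_coeff n x y i * tri_mono (snd (snd i)) (n - 2 * fst i - fst (snd i) - snd (snd i)) (fst (snd i)) u v t)"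
    unfolding sum_mono_index V_zeta_power[OF x] mono_coeff_def
    by (simp add: sum_distrib_left mult.assoc)
  finally show ?thesis .
qed

lemma ker_moments:
  assumes "norm x \<le> 1" "norm y \<le> 1"
  shows "(\<Sum>i\<in>mono_index n. mono_coeff n x y i * (beta_moment \<nu> (lk + 1) (snd (snd i)) (n - 2 * fst i - fst (snd i) - snd (snd i))
      * gmom (\<nu> + 1 / 2) (snd (snd i)) * gmom \<mu> (fst (snd i)))) = ker n x y"
  unfolding sum_mono_index ker_def kern_moments[OF assms, symmetric] mono_coeff_def
  by (simp add: sum_distrib_left mult.assoc)

section \<open>Orthonormal bases exist\<close>

text \<open>Gram--Schmidt, by induction on a finite set of generators.\<close>

lemma orthonormal_basis_exists:
  assumes "finite F"
    and "(\<lambda>x. 0) \<in> U" "\<And>p q. p \<in> U \<Longrightarrow> q \<in> U \<Longrightarrow> (\<lambda>x. p x + q x) \<in> U"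
    and "\<And>p c. p \<in> U \<Longrightarrow> (\<lambda>x. c * p x) \<in> U" "U \<subseteq> polys_lt n"
    and "\<And>p. p \<in> U \<Longrightarrow> \<exists>c. p = (\<lambda>x. \<Sum>f\<in>F. c f * f x)"
  shows "\<exists>B. orthonormal_basis ip U B"
  using assms
proof (induction F arbitrary: U rule: finite_induct)
  case empty
  then have "\<forall>p\<in>U. p = (\<lambda>x. 0)" by fastforce
  then show ?case by (intro exI[of _ "{}"]) (simp add: orthonormal_basis_def)
next
  case (insert f F)
  \<comment> \<open>The members of \<open>U\<close> that do without \<open>f\<close>. The induction
    hypothesis applies to them, and their codimension in \<open>U\<close> is at most one.\<close>
  define U' where "U' = {p \<in> U. \<exists>c. p = (\<lambda>x. \<Sum>f\<in>F. c f * f x)}"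
  have "\<exists>B. orthonormal_basis ip U' B"
  proof (rule insert.IH)
    show "(\<lambda>x. 0) \<in> U'" using insert.prems(1) by (auto simp: U'_def intro: exI[of _ "\<lambda>_. 0"])
    show "(\<lambda>x. p x + q x) \<in> U'" if pq: "p \<in> U'" "q \<in> U'" for p q
    proof -
      obtain c where "p = (\<lambda>x. \<Sum>f\<in>F. c f * f x)" using pq(1) unfolding U'_def by blast
      moreover obtain d where "q = (\<lambda>x. \<Sum>f\<in>F. d f * f x)" using pq(2) unfolding U'_def by blast
      ultimately have "(\<lambda>x. p x + q x) = (\<lambda>x. \<Sum>f\<in>F. (c f + d f) * f x)"
        by (simp add: distrib_right sum.distrib)
      moreover have "(\<lambda>x. p x + q x) \<in> U" using pq insert.prems(2) unfolding U'_def by blast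
      ultimately show ?thesis unfolding U'_def by (intro CollectI conjI exI[of _ "\<lambda>f. c f + d f"])
    qed
    show "(\<lambda>x. b * p x) \<in> U'" if pU: "p \<in> U'" for p b
    proof -
      obtain c where "p = (\<lambda>x. \<Sum>f\<in>F. c f * f x)" using pU unfolding U'_def by blast
      then have "(\<lambda>x. b * p x) = (\<lambda>x. \<Sum>f\<in>F. (b * c f) * f x)"
        by (simp add: sum_distrib_left mult.assoc)
      moreover have "(\<lambda>x. b * p x) \<in> U" using pU insert.prems(3) unfolding U'_def by blast
      ultimately show ?thesis unfolding U'_def by (intro CollectI conjI exI[of _ "\<lambda>f. b * c f"])
    qed
    show "U' \<subseteq> polys_lt n" using insert.prems(4) by (auto simp: U'_def)
  qed (auto simp: U'_def)
  then obtain B where B: "orthonormal_basis ip U' B" by blast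
  have finB: "finite B" and BU: "B \<subseteq> U'"
    and on: "\<And>p q. p \<in> B \<Longrightarrow> q \<in> B \<Longrightarrow> ip p q = (if p = q then 1 else 0)"
    and sp: "\<And>p. p \<in> U' \<Longrightarrow> \<exists>c. p = (\<lambda>x. \<Sum>q\<in>B. c q * q x)"
    using B unfolding orthonormal_basis_def by blast+
  show ?case
  proof (cases "U' = U")
    case True
    then show ?thesis using B by blast
  next
    case False
    then obtain u where u: "u \<in> U" "u \<notin> U'" by (auto simp: U'_def)
    obtain cu where cu: "u = (\<lambda>x. \<Sum>g\<in>insert f F. cu g * g x)" using insert.prems(5)[OF u(1)] by blast
    have cuf: "cu f \<noteq> 0"
    proof
      assume "cu f = 0"
      then have "u = (\<lambda>x. \<Sum>g\<in>F. cu g * g x)" using cu insert.hyps by simp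
      then show False using u by (auto simp: U'_def)
    qed
    have U_sum: "(\<lambda>x. \<Sum>a\<in>A. h a x) \<in> U" if "\<And>a. a \<in> A \<Longrightarrow> h a \<in> U" for A :: "(real ^ 'n \<Rightarrow> real) set" and h
      using that by (induction A rule: infinite_finite_induct) (auto intro: insert.prems)
    have contU: "continuous_on UNIV p" if "p \<in> U" for p
      using insert.prems(4) that polys_lt_continuous by blast
    have BU2: "\<And>q. q \<in> B \<Longrightarrow> q \<in> U" using BU by (auto simp: U'_def)
    define u' where "u' = (\<lambda>x. u x - (\<Sum>q\<in>B. ip u q * q x))"
    have "(\<lambda>x. u x + (-1) * (\<Sum>q\<in>B. ip u q * q x)) \<in> U"
      using BU2 by (intro insert.prems(2,3) u(1) U_sum)
    then have u'U: "u' \<in> U" by (simp add: u'_def)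
    have u'_orth: "ip u' q = 0" if q: "q \<in> B" for q
    proof -
      have "ip u' q = ip u q - ip (\<lambda>x. \<Sum>r\<in>B. ip u r * r x) q"
        unfolding u'_def using BU2 contU u(1) q
        by (intro ip_diff_left continuous_on_sum continuous_on_mult_left) auto
      also have "ip (\<lambda>x. \<Sum>r\<in>B. ip u r * r x) q = (\<Sum>r\<in>B. ip u r * ip r q)"
        unfolding ip_cmul_left[symmetric] using BU2 contU q
        by (intro ip_sum_left continuous_on_mult_left) auto
      also have "(\<Sum>r\<in>B. ip u r * ip r q) = (\<Sum>r\<in>B. if r = q then ip u r else 0)"
        using on q by (intro sum.cong) auto
      finally show ?thesis using finB q by simp
    qed
    have u'0: "u' \<noteq> (\<lambda>x. 0)"
    proof
      assume "u' = (\<lambda>x. 0)"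
      then have e: "u = (\<lambda>x. \<Sum>q\<in>B. ip u q * q x)" by (auto simp: u'_def fun_eq_iff)
      have "\<forall>q\<in>B. \<exists>c. q = (\<lambda>x. \<Sum>f\<in>F. c f * f x)" using BU by (auto simp: U'_def)
      then obtain cc where cc: "\<And>q. q \<in> B \<Longrightarrow> q = (\<lambda>x. \<Sum>f\<in>F. cc q f * f x)" by metis
      have "u x = (\<Sum>f\<in>F. (\<Sum>q\<in>B. ip u q * cc q f) * f x)" for x
      proof -
        have "u x = (\<Sum>q\<in>B. ip u q * q x)" using e by metis
        also have "\<dots> = (\<Sum>q\<in>B. \<Sum>f\<in>F. ip u q * cc q f * f x)"
        proof (intro sum.cong refl)
          fix q assume "q \<in> B"
          then have "q x = (\<Sum>f\<in>F. cc q f * f x)" using cc by metis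
          then show "ip u q * q x = (\<Sum>f\<in>F. ip u q * cc q f * f x)"
            by (simp add: sum_distrib_left mult.assoc)
        qed
        also have "\<dots> = (\<Sum>f\<in>F. (\<Sum>q\<in>B. ip u q * cc q f) * f x)"
          by (subst sum.swap) (simp add: sum_distrib_right)
        finally show ?thesis .
      qed
      then have "u = (\<lambda>x. \<Sum>f\<in>F. (\<Sum>q\<in>B. ip u q * cc q f) * f x)" by (rule ext)
      then have "u \<in> U'" unfolding U'_def
        by (intro CollectI conjI u(1) exI[of _ "\<lambda>f. \<Sum>q\<in>B. ip u q * cc q f"])
      then show False using u(2) by simp
    qed
    have u'p: "u' \<in> polys_lt n" using u'U insert.prems(4) by blast
    define s where "s = sqrt (ip u' u')"
    have s: "s > 0" using ip_positive[OF u'p] u'0 by (auto simp: s_def less_le)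
    have s2: "s * s = ip u' u'" using ip_positive(1)[OF u'p] by (simp add: s_def)
    define e where "e = (\<lambda>x. inverse s * u' x)"
    have eU: "e \<in> U" unfolding e_def by (rule insert.prems(3)[OF u'U])
    have ee: "ip e e = 1" unfolding e_def ip_cmul_left ip_cmul_right s2[symmetric] using s by (simp add: field_simps)
    have eo: "ip e q = 0" "ip q e = 0" if "q \<in> B" for q
    proof -
      show "ip e q = 0" unfolding e_def ip_cmul_left u'_orth[OF that] by simp
      then show "ip q e = 0" by (simp add: ip_commute)
    qed
    have eB: "e \<notin> B" using ee eo by fastforce
    have "orthonormal_basis ip U (insert e B)"
      unfolding orthonormal_basis_def
    proof (intro conjI ballI)
      show "finite (insert e B)" using finB by simp
      show "insert e B \<subseteq> U" using eU BU2 by blast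
      show "ip p q = (if p = q then 1 else 0)" if "p \<in> insert e B" "q \<in> insert e B" for p q
        using that on ee eo eB by auto
      fix p assume p: "p \<in> U"
      obtain cp where cp: "p = (\<lambda>x. \<Sum>g\<in>insert f F. cp g * g x)" using insert.prems(5)[OF p] by blast
      \<comment> \<open>Cancels the coefficient of \<open>f\<close> in p - k u, which places this
        difference in \<open>U'\<close>.\<close>
      define k where "k = cp f / cu f"
      have mem: "(\<lambda>x. p x + (- k) * u x) \<in> U'"
      proof -
        have "p x + (- k) * u x = (\<Sum>g\<in>F. (cp g - k * cu g) * g x)" for x
        proof -
          have "p x = cp f * f x + (\<Sum>g\<in>F. cp g * g x)" "u x = cu f * f x + (\<Sum>g\<in>F. cu g * g x)"
            using insert.hyps by (simp_all add: cp cu)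
          moreover have "k * cu f = cp f" using cuf by (simp add: k_def)
          ultimately show ?thesis
            by (simp add: left_diff_distrib sum_subtractf sum_negf sum_distrib_left distrib_left mult.assoc[symmetric])
        qed
        then have "(\<lambda>x. p x + (- k) * u x) = (\<lambda>x. \<Sum>g\<in>F. (cp g - k * cu g) * g x)" by (rule ext)
        then show ?thesis unfolding U'_def
          by (intro CollectI conjI exI[of _ "\<lambda>g. cp g - k * cu g"]) (intro insert.prems(2,3) p u(1))
      qed
      obtain d where d0: "(\<lambda>x. p x + (- k) * u x) = (\<lambda>x. \<Sum>q\<in>B. d q * q x)" using sp[OF mem] by blast
      have d: "p x + (- k) * u x = (\<Sum>q\<in>B. d q * q x)" for x using fun_cong[OF d0, of x] .
      \<comment> \<open>Read off from p = k u + (sum of d q * q) and u = s e + (projection of u on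
        the span of \<open>B\<close>).\<close>
      define c where "c q = (if q = e then k * s else d q + k * ip u q)" for q
      have "p x = (\<Sum>q\<in>insert e B. c q * q x)" for x
      proof -
        have "(\<Sum>q\<in>B. c q * q x) = (\<Sum>q\<in>B. d q * q x) + k * (\<Sum>q\<in>B. ip u q * q x)"
          unfolding sum_distrib_left sum.distrib[symmetric]
          using eB by (intro sum.cong) (auto simp: c_def algebra_simps)
        moreover have "u x = u' x + (\<Sum>q\<in>B. ip u q * q x)" by (simp add: u'_def)
        moreover have "s * e x = u' x" using s by (simp add: e_def)
        moreover have "(\<Sum>q\<in>insert e B. c q * q x) = k * (s * e x) + (\<Sum>q\<in>B. c q * q x)"
          using finB eB by (simp add: c_def)
        ultimately show ?thesis using d[of x] by (simp add: distrib_left)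
      qed
      then show "\<exists>c. p = (\<lambda>x. \<Sum>q\<in>insert e B. c q * q x)" by blast
    qed
    then show ?thesis by blast
  qed
qed

text \<open>The kernel is a definite description quantified over all orthonormal bases. If there
  were none, every K would satisfy it, so the existence of a basis is what gives uniqueness;
  \<open>ker_orthonormal_basis\<close> shows that all bases yield the same kernel.\<close>

lemma reproducing_kernel_eq: "reproducing_kernel Rp \<kappa> \<mu> \<nu> n = ker n"
proof -
  let ?U = "orth_polys Rp \<kappa> \<mu> \<nu> n"
  define F :: "(real ^ 'n \<Rightarrow> real) set" where "F = monomial_fun ` {\<alpha>. sum \<alpha> UNIV \<le> n}"
  have cont: "continuous_on UNIV p" if "p \<in> ?U" for p
    using that orth_polys_iff polys_lt_continuous by blast
  have contlt: "continuous_on UNIV p" if "p \<in> polys_lt n" for p :: "real ^ 'n \<Rightarrow> real"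
    using that polys_lt_continuous by blast
  have "\<exists>B. orthonormal_basis ip ?U B"
  proof (rule orthonormal_basis_exists[of F _ "Suc n"])
    show "finite F" unfolding F_def by (intro finite_imageI finite_multiindex)
    show "(\<lambda>x. 0) \<in> ?U" by (simp add: orth_polys_iff polys_lt_zero ip_zero_left)
    show "(\<lambda>x. p x + q x) \<in> ?U" if "p \<in> ?U" "q \<in> ?U" for p q
      using that ip_add_left[OF cont[OF that(1)] cont[OF that(2)] contlt]
      by (simp add: orth_polys_iff polys_lt_add)
    show "(\<lambda>x. c * p x) \<in> ?U" if "p \<in> ?U" for p c
      using that by (simp add: orth_polys_iff polys_lt_cmul ip_cmul_left)
    show "?U \<subseteq> polys_lt (Suc n)" by (auto simp: orth_polys_iff)
    fix p assume "p \<in> ?U"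
    then have "p \<in> polys_le n" by (simp add: orth_polys_iff polys_le_eq_polys_lt)
    then obtain c where c: "p = (\<lambda>x. \<Sum>\<alpha> | sum \<alpha> UNIV \<le> n. c \<alpha> * monomial_fun \<alpha> x)"
      unfolding polys_le_def by auto
    have "p x = (\<Sum>f\<in>F. (\<Sum>\<alpha> | sum \<alpha> UNIV \<le> n \<and> monomial_fun \<alpha> = f. c \<alpha>) * f x)" for x
    proof -
      have "p x = (\<Sum>f\<in>F. \<Sum>\<alpha>\<in>{\<alpha> \<in> {\<alpha>. sum \<alpha> UNIV \<le> n}. monomial_fun \<alpha> = f}. c \<alpha> * monomial_fun \<alpha> x)"
        unfolding c F_def by (rule sum.image_gen[OF finite_multiindex])
      also have "\<dots> = (\<Sum>f\<in>F. (\<Sum>\<alpha> | sum \<alpha> UNIV \<le> n \<and> monomial_fun \<alpha> = f. c \<alpha>) * f x)"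
        unfolding sum_distrib_right by (intro sum.cong) auto
      finally show ?thesis .
    qed
    then have "p = (\<lambda>x. \<Sum>f\<in>F. (\<Sum>\<alpha> | sum \<alpha> UNIV \<le> n \<and> monomial_fun \<alpha> = f. c \<alpha>) * f x)" by (rule ext)
    then show "\<exists>c. p = (\<lambda>x. \<Sum>f\<in>F. c f * f x)"
      by (intro exI[of _ "\<lambda>f. \<Sum>\<alpha> | sum \<alpha> UNIV \<le> n \<and> monomial_fun \<alpha> = f. c \<alpha>"])
  qed
  then obtain B where B: "orthonormal_basis ip ?U B" by blast
  show ?thesis
    unfolding reproducing_kernel_def
  proof (rule the_equality)
    show "\<forall>B. orthonormal_basis ip ?U B \<longrightarrow> ker n = (\<lambda>x y. \<Sum>q\<in>B. q x * q y)"
      using ker_orthonormal_basis by (auto simp: fun_eq_iff)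
    fix K assume "\<forall>B. orthonormal_basis ip ?U B \<longrightarrow> K = (\<lambda>x y. \<Sum>q\<in>B. q x * q y)"
    then have "K = (\<lambda>x y. \<Sum>q\<in>B. q x * q y)" using B by blast
    then show "K = ker n" using ker_orthonormal_basis[OF B] by (simp add: fun_eq_iff)
  qed
qed

end

section \<open>Both integral formulas evaluated to \<open>ker n\<close>, and the limit of the
  measures\<close>

theorem theorem3p1:
  fixes G :: "(real ^ 'n \<Rightarrow> real ^ 'n) set"
    and Rp :: "(real ^ 'n) set"
    and \<kappa> :: "real ^ 'n \<Rightarrow> real"
    and V :: "(real ^ 'n \<Rightarrow> real) \<Rightarrow> (real ^ 'n \<Rightarrow> real)"
    and \<nu> :: real
  assumes dim: "CARD('n) \<ge> 2"
    and roots: "positive_root_system G Rp"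
    and mult: "multiplicity_function G Rp \<kappa>"
    and V: "intertwining_operator Rp \<kappa> V"
    and nu: "\<nu> > 0"
  shows
    "(\<forall>\<mu> > 0. \<forall>n. \<forall>x\<in>cball 0 1. \<forall>y\<in>cball 0 1. \<forall>x'. norm x' = 1 \<and> x = norm x *\<^sub>R x' \<longrightarrow>
        reproducing_kernel Rp \<kappa> \<mu> \<nu> n x y =
          a_const Rp \<kappa> \<mu> \<nu> * triple_integral Rp \<kappa> \<mu> \<nu>
            (\<lambda>u v t. V (\<lambda>z. Z_poly n (lambda_const Rp \<kappa> \<mu> \<nu>) (zeta z (norm x) y u v t)) x'))
   \<and> (\<forall>n. \<forall>x\<in>cball 0 1. \<forall>y\<in>cball 0 1. \<forall>x'. norm x' = 1 \<and> x = norm x *\<^sub>R x' \<longrightarrow>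
        reproducing_kernel Rp \<kappa> 0 \<nu> n x y =
          a_const_limit Rp \<kappa> \<nu> * limit_integral Rp \<kappa> \<nu>
            (\<lambda>u v t. V (\<lambda>z. Z_poly n (lambda_const Rp \<kappa> 0 \<nu>) (zeta z (norm x) y u v t)) x'))
   \<and> (\<forall>f :: real \<Rightarrow> real. continuous_on {-1..1} f \<longrightarrow>
        ((\<lambda>a. c_const a * (LINT t:{-1..1}|lborel. f t * (1 - t\<^sup>2) powr (a - 1)))
           \<longlongrightarrow> (f 1 + f (-1)) / 2) (at_right 0))"
proof (intro conjI allI impI ballI)
  interpret S: dunkl_setting G Rp \<kappa> V
    using dim roots mult V by unfold_locales
  fix \<mu> :: real and n and x y x' :: "real ^ 'n"
  assume mu: "\<mu> > 0" and xy: "x \<in> cball 0 1" "y \<in> cball 0 1" and x': "norm x' = 1 \<and> x = norm x *\<^sub>R x'"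
  interpret ball: dunkl_ball G Rp \<kappa> V \<mu> \<nu>
    using mu nu by unfold_locales auto
  have xy': "norm x \<le> 1" "norm y \<le> 1" using xy by auto
  show "reproducing_kernel Rp \<kappa> \<mu> \<nu> n x y =
      a_const Rp \<kappa> \<mu> \<nu> * triple_integral Rp \<kappa> \<mu> \<nu>
        (\<lambda>u v t. V (\<lambda>z. Z_poly n (lambda_const Rp \<kappa> \<mu> \<nu>) (zeta z (norm x) y u v t)) x')"
    unfolding ball.lam_eq ball.V_Z_poly[OF conjunct2[OF x']] S.triple_integral_normalized[OF mu nu]
      ball.ker_moments[OF xy'] ball.reproducing_kernel_eq ..
next
  interpret S: dunkl_setting G Rp \<kappa> V
    using dim roots mult V by unfold_locales
  fix n and x y x' :: "real ^ 'n"
  assume xy: "x \<in> cball 0 1" "y \<in> cball 0 1" and x': "norm x' = 1 \<and> x = norm x *\<^sub>R x'"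
  interpret ball: dunkl_ball G Rp \<kappa> V 0 \<nu>
    using nu by unfold_locales auto
  have xy': "norm x \<le> 1" "norm y \<le> 1" using xy by auto
  show "reproducing_kernel Rp \<kappa> 0 \<nu> n x y =
      a_const_limit Rp \<kappa> \<nu> * limit_integral Rp \<kappa> \<nu>
        (\<lambda>u v t. V (\<lambda>z. Z_poly n (lambda_const Rp \<kappa> 0 \<nu>) (zeta z (norm x) y u v t)) x')"
    unfolding ball.lam_eq ball.V_Z_poly[OF conjunct2[OF x']] S.limit_integral_normalized[OF nu]
      ball.ker_moments[OF xy'] ball.reproducing_kernel_eq ..
qed (rule limit_measure)

end
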